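(* Let $M$ be a smooth $n$-dimensional manifold, $\Phi\to M$ a smooth fibre bundle, $k\ge1$, and let $\mathcal{L}=L\,d^nx$ be a $k$-th order Lagrangian density, i.e. a $\Lambda^nM$-valued function on $\mathcal{Q}^I:=J^k\Phi$. Let $\mathcal{P}^I\cong V^*\mathcal{Q}^I\otimes_{\mathcal{Q}^I}\Lambda^nM$ be the infinitesimal phase bundle with canonical forms $\theta^I$ and $\omega^I=\delta\theta^I$, and let $\mathcal{D}\subset\mathcal{P}^I$ be the graph of $\delta\mathcal{L}$. Then, for each $x\in M$, $\mathcal{D}_x$ is a Lagrangian submanifold of $\mathcal{P}^I_x$, and the Euler--Lagrange equations determined by $\mathcal{L}$ are equivalent to the generating formula $$\delta\mathcal{L}=\theta^I|_{\mathcal{D}}$$ for $\mathcal{D}$, regarded as a PDE on sections of the phase bundle $\mathcal{P}$. That is, a local section $f$ of $\Phi$ satisfies $$\sum_{l=0}^{k}(-1)^l\,\partial_{\mu_1}\cdots\partial_{\mu_l}\frac{\partial L}{\partial\varphi_{\mu_1\dots\mu_l}}=0$$ if and only if, in a neighbourhood of each point of its domain, there is a local section $\sigma$ of $\mathcal{P}\to M$ projecting onto the section $j^{k-1}f$ of $\mathcal{Q}=J^{k-1}\Phi$ such that the class of $j^1\sigma$ in $\mathcal{P}^I$ takes values in $\mathcal{D}$.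
   Context: $\Lambda^iM:=\bigwedge^iT^*M$, pulled back where indicated; $VB$ is the vertical tangent bundle of a bundle $B\to M$, $V^*B$ its dual, $\delta$ the exterior derivative along each fibre $B_x$ (factors in $\Lambda^iM$ treated as constants). Coordinates on $\Phi$: $(x^\mu,\varphi)$, field index suppressed. $\mathcal{Q}:=J^{k-1}\Phi$. The phase bundle is $\mathcal{P}:=V^*\mathcal{Q}\otimes_{\mathcal{Q}}\Lambda^{n-1}M$ with points $p=\sum_{l=0}^{k-1}p^{\mu_1\dots\mu_l\lambda}\,\delta\varphi_{\mu_1\dots\mu_l}\otimes(\partial_\lambda\lrcorner\, d^nx)$, where $p^{\mu_1\dots\mu_l\lambda}$ is symmetric in $\mu_1,\dots,\mu_l$ only. $\widetilde{\mathcal{P}}^I$ is the restriction of $J^1\mathcal{P}\to J^1\mathcal{Q}$ to $J^k\Phi\subset J^1(J^{k-1}\Phi)$ (the holonomic constraints $\varphi_{\mu_1\dots\mu_l,\lambda}=\varphi_{\mu_1\dots\mu_l\lambda}$), and $\mathcal{P}^I$ is the quotient of $\widetilde{\mathcal{P}}^I$ by the degeneracy leaves of the restriction $\widetilde\omega^I$ to $\widetilde{\mathcal P}^I$ of $\sum_{l=0}^{k-1}(\delta p^{\mu_1\dots\mu_l\lambda}{}_{,\lambda}\wedge\delta\varphi_{\mu_1\dots\mu_l}+\delta p^{\mu_1\dots\mu_l\lambda}\wedge\delta\varphi_{\mu_1\dots\mu_l,\lambda})\otimes d^nx$. If $\sigma$ projects onto $j^{k-1}f$, then $j^1\sigma$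 takes values in $\widetilde{\mathcal{P}}^I$, so it has a class in $\mathcal{P}^I$. Coordinates on $\mathcal{P}^I$ are those of $J^k\Phi$ together with the totally symmetric currents $$j=p^\lambda{}_{,\lambda},\qquad j^{\mu_1\dots\mu_l}=p^{(\mu_1\dots\mu_l)}+p^{\mu_1\dots\mu_l\lambda}{}_{,\lambda}\ (1\le l\le k-1),\qquad j^{\mu_1\dots\mu_k}=p^{(\mu_1\dots\mu_k)},$$ with $(\ )$ denoting total symmetrisation, and $$\theta^I=\sum_{l=0}^kj^{\mu_1\dots\mu_l}\,\delta\varphi_{\mu_1\dots\mu_l}\otimes d^nx,\qquad \omega^I=\delta\theta^I .$$ The identification $\mathcal{P}^I\cong V^*\mathcal{Q}^I\otimes_{\mathcal{Q}^I}\Lambda^nM$ sends the point with currents $j^{\mu_1\dots\mu_l}$ to the covector $\sum_lj^{\mu_1\dots\mu_l}\delta\varphi_{\mu_1\dots\mu_l}\otimes d^nx$. Partial derivatives with respect to symmetric jet coordinates are the totally symmetric coefficients with $\delta L=\sum_{l=0}^k\frac{\partial L}{\partial\varphi_{\mu_1\dots\mu_l}}\delta\varphi_{\mu_1\dots\mu_l}$ (sum over all index values). In $\delta\mathcal{L}=\theta^I|_{\mathcal{D}}$, $\mathcal{L}$ is pulled back to $\mathcal{D}$ and $\theta^I|_{\mathcal D}$ is the pullback of $\theta^I$. Lagrangian means maximal isotropic for $\omega^I_x$ (after choosing any volume element at $x$). *)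

theory Defs
  imports "HOL-Analysis.Analysis" "HOL-Combinatorics.Multiset_Permutations"
begin

section \<open>Smooth functions on coordinate spaces\<close>

text \<open>The number of jet coordinates depends on the order of the jet, so every coordinate space
  is taken to be \<open>\<real>\<^sup>I\<close> for a finite index set \<open>I\<close>, realised as the functions vanishing outside \<open>I\<close>
  with the product topology.\<close>

definition coord_space :: "'i set \<Rightarrow> ('i \<Rightarrow> real) set" where
  "coord_space I = {y. \<forall>i. i \<notin> I \<longrightarrow> y i = 0}"

definition pd :: "'i \<Rightarrow> (('i \<Rightarrow> real) \<Rightarrow> real) \<Rightarrow> ('i \<Rightarrow> real) \<Rightarrow> real" where
  "pd i f y = deriv (\<lambda>t. f (y(i := t))) (y i)"

primrec Cr :: "nat \<Rightarrow> 'i set \<Rightarrow> ('i \<Rightarrow> real) set \<Rightarrow> (('i \<Rightarrow> real) \<Rightarrow> real) \<Rightarrow> bool" where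
  "Cr 0 I U f \<longleftrightarrow> continuous_on U f"
| "Cr (Suc r) I U f \<longleftrightarrow> continuous_on U f \<and>
     (\<forall>i\<in>I. (\<forall>y\<in>U. (\<lambda>t. f (y(i := t))) field_differentiable at (y i)) \<and> Cr r I U (pd i f))"

text \<open>Intended for \<open>U\<close> open in \<open>coord_space I\<close>.\<close>

definition smooth_fun :: "'i set \<Rightarrow> ('i \<Rightarrow> real) set \<Rightarrow> (('i \<Rightarrow> real) \<Rightarrow> real) \<Rightarrow> bool" where
  "smooth_fun I U f \<longleftrightarrow> (\<forall>r. Cr r I U f)"

definition smooth_real :: "real set \<Rightarrow> (real \<Rightarrow> real) \<Rightarrow> bool" where
  "smooth_real T g \<longleftrightarrow> (\<forall>r. \<forall>t\<in>T. (deriv ^^ r) g field_differentiable at t)"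

definition pds :: "'i list \<Rightarrow> (('i \<Rightarrow> real) \<Rightarrow> real) \<Rightarrow> ('i \<Rightarrow> real) \<Rightarrow> real" where
  "pds \<mu>s f = foldr pd \<mu>s f"

text \<open>Partial derivatives of smooth functions commute, so the chosen ordering is irrelevant.\<close>

definition pdm :: "'i multiset \<Rightarrow> (('i \<Rightarrow> real) \<Rightarrow> real) \<Rightarrow> ('i \<Rightarrow> real) \<Rightarrow> real" where
  "pdm I f = pds (SOME \<mu>s. mset \<mu>s = I) f"

definition diffeo :: "'i set \<Rightarrow> ('i \<Rightarrow> real) set \<Rightarrow> ('i \<Rightarrow> real) set
    \<Rightarrow> (('i \<Rightarrow> real) \<Rightarrow> 'i \<Rightarrow> real) \<Rightarrow> bool" where
  "diffeo I U V h \<longleftrightarrow> bij_betw h U V \<and> (\<forall>i. smooth_fun I U (\<lambda>y. h y i)) \<and>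
     (\<forall>i. smooth_fun I V (\<lambda>y. inv_into U h y i))"

text \<open>Embedded submanifolds, by slice charts, of an open subset \<open>Amb\<close> of \<open>\<real>\<^sup>I\<close>.\<close>

definition embedded_submanifold ::
    "'i set \<Rightarrow> ('i \<Rightarrow> real) set \<Rightarrow> ('i \<Rightarrow> real) set \<Rightarrow> bool" where
  "embedded_submanifold I Amb S \<longleftrightarrow> S \<subseteq> Amb \<and>
     (\<forall>s\<in>S. \<exists>U V h J. s \<in> U \<and> U \<subseteq> Amb \<and> J \<subseteq> I \<and>
        openin (top_of_set (coord_space I)) U \<and> openin (top_of_set (coord_space I)) V \<and>
        diffeo I U V h \<and> h ` (S \<inter> U) = {y \<in> V. \<forall>i\<in>I - J. y i = 0})"

section \<open>Manifolds and fibre bundles\<close>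

type_synonym ('a, 'i) chart = "'a set \<times> ('a \<Rightarrow> 'i \<Rightarrow> real)"

definition compatible :: "('a, 'i::finite) chart \<Rightarrow> ('a, 'i) chart \<Rightarrow> bool" where
  "compatible C D \<longleftrightarrow>
     open (snd C ` (fst C \<inter> fst D)) \<and>
     (\<forall>i. smooth_fun UNIV (snd C ` (fst C \<inter> fst D)) (\<lambda>y. snd D (inv_into (fst C) (snd C) y) i))"

definition is_chart :: "'a set \<Rightarrow> ('a, 'i::finite) chart \<Rightarrow> bool" where
  "is_chart M C \<longleftrightarrow> fst C \<subseteq> M \<and> inj_on (snd C) (fst C) \<and> open (snd C ` fst C)"

definition atlas :: "'a set \<Rightarrow> ('a, 'i::finite) chart set \<Rightarrow> bool" where
  "atlas M A \<longleftrightarrow> (\<forall>C\<in>A. is_chart M C) \<and> (\<Union>C\<in>A. fst C) = M \<and> (\<forall>C\<in>A. \<forall>D\<in>A. compatible C D)"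

definition charts :: "'a set \<Rightarrow> ('a, 'i::finite) chart set \<Rightarrow> ('a, 'i) chart set" where
  "charts M A = {C. is_chart M C \<and> (\<forall>D\<in>A. compatible C D \<and> compatible D C)}"

definition manifold_topology :: "'a set \<Rightarrow> ('a, 'i::finite) chart set \<Rightarrow> 'a topology" where
  "manifold_topology M A = topology (\<lambda>W. W \<subseteq> M \<and> (\<forall>C\<in>A. open (snd C ` (fst C \<inter> W))))"

lemma openin_manifold_topology:
  assumes "atlas M A"
  shows "openin (manifold_topology M A) W \<longleftrightarrow> W \<subseteq> M \<and> (\<forall>C\<in>A. open (snd C ` (fst C \<inter> W)))"
proof -
  have "istopology (\<lambda>W. W \<subseteq> M \<and> (\<forall>C\<in>A. open (snd C ` (fst C \<inter> W))))"
    unfolding istopology_def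
  proof (intro conjI allI impI ballI)
    fix S T C
    assume S: "S \<subseteq> M \<and> (\<forall>C\<in>A. open (snd C ` (fst C \<inter> S)))"
      and T: "T \<subseteq> M \<and> (\<forall>C\<in>A. open (snd C ` (fst C \<inter> T)))"
    show "S \<inter> T \<subseteq> M" using S by auto
    assume C: "C \<in> A"
    have inj: "inj_on (snd C) (fst C)"
      using assms C by (auto simp: atlas_def is_chart_def)
    have "snd C ` (fst C \<inter> (S \<inter> T)) = snd C ` (fst C \<inter> S) \<inter> snd C ` (fst C \<inter> T)"
      using inj by (auto simp: inj_on_def)
    with S T C show "open (snd C ` (fst C \<inter> (S \<inter> T)))" by auto
  next
    fix K C
    assume K: "\<forall>W\<in>K. W \<subseteq> M \<and> (\<forall>C\<in>A. open (snd C ` (fst C \<inter> W)))"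
    show "\<Union>K \<subseteq> M" using K by auto
    assume C: "C \<in> A"
    have "snd C ` (fst C \<inter> \<Union>K) = (\<Union>W\<in>K. snd C ` (fst C \<inter> W))" by auto
    with K C show "open (snd C ` (fst C \<inter> \<Union>K))" by auto
  qed
  then show ?thesis
    unfolding manifold_topology_def by (simp add: topology_inverse')
qed

definition smooth_manifold :: "'a set \<Rightarrow> ('a, 'i::finite) chart set \<Rightarrow> bool" where
  "smooth_manifold M A \<longleftrightarrow> atlas M A \<and> Hausdorff_space (manifold_topology M A) \<and>
     second_countable (manifold_topology M A)"

text \<open>Openness of the coordinate domains makes the map continuous.\<close>

definition smooth_map :: "'a set \<Rightarrow> ('a, 'i::finite) chart set \<Rightarrow> ('b, 'j::finite) chart set
    \<Rightarrow> ('a \<Rightarrow> 'b) \<Rightarrow> bool" where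
  "smooth_map N A A' f \<longleftrightarrow> (\<forall>C\<in>A. \<forall>D\<in>A'.
     let W = snd C ` {x \<in> N \<inter> fst C. f x \<in> fst D} in
       open W \<and> (\<forall>j. smooth_fun UNIV W (\<lambda>y. snd D (f (inv_into (fst C) (snd C) y)) j)))"

definition prod_atlas :: "('a, 'i::finite) chart set \<Rightarrow> ('b, 'j::finite) chart set
    \<Rightarrow> ('a \<times> 'b, 'i + 'j) chart set" where
  "prod_atlas A A' =
     {(fst C \<times> fst D, \<lambda>(x, y). case_sum (snd C x) (snd D y)) | C D. C \<in> A \<and> D \<in> A'}"

record ('x, 'e, 'n, 'm) fbundle =
  bspace :: "'x set"
  batlas :: "('x, 'n) chart set"
  tspace :: "'e set"
  tatlas :: "('e, 'n + 'm) chart set"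
  proj :: "'e \<Rightarrow> 'x"

definition smooth_fibre_bundle ::
    "('x, 'e, 'n::finite, 'm::finite) fbundle \<Rightarrow> 'f set \<Rightarrow> ('f, 'm) chart set \<Rightarrow> bool" where
  "smooth_fibre_bundle B F AF \<longleftrightarrow>
     smooth_manifold (bspace B) (batlas B) \<and> smooth_manifold (tspace B) (tatlas B) \<and>
     smooth_manifold F AF \<and> proj B ` tspace B = bspace B \<and>
     (\<forall>x\<in>bspace B. \<exists>U \<tau>. x \<in> U \<and> openin (manifold_topology (bspace B) (batlas B)) U \<and>
       (let E = {e \<in> tspace B. proj B e \<in> U}; h = (\<lambda>e. (proj B e, \<tau> e)) in
          bij_betw h E (U \<times> F) \<and>
          smooth_map E (tatlas B) (prod_atlas (batlas B) AF) h \<and>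
          smooth_map (U \<times> F) (prod_atlas (batlas B) AF) (tatlas B) (inv_into E h)))"

text \<open>Adapted charts \<open>(x\<^sup>\<mu>, \<phi>\<^sup>a)\<close>: a chart of the base together with fibre coordinates.\<close>

record ('x, 'e, 'n, 'm) fchart =
  bdom :: "'x set"
  bcoord :: "'x \<Rightarrow> 'n \<Rightarrow> real"
  fdom :: "'e set"
  fcoord :: "'e \<Rightarrow> 'm \<Rightarrow> real"

definition adapted ::
    "('x, 'e, 'n::finite, 'm::finite) fbundle \<Rightarrow> ('x, 'e, 'n, 'm) fchart \<Rightarrow> bool" where
  "adapted B C \<longleftrightarrow>
     (bdom C, bcoord C) \<in> charts (bspace B) (batlas B) \<and> proj B ` fdom C \<subseteq> bdom C \<and>
     (fdom C, \<lambda>e. case_sum (bcoord C (proj B e)) (fcoord C e)) \<in> charts (tspace B) (tatlas B)"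

definition around ::
    "('x, 'e, 'n::finite, 'm::finite) fbundle \<Rightarrow> ('x, 'e, 'n, 'm) fchart \<Rightarrow> 'e \<Rightarrow> bool" where
  "around B C e \<longleftrightarrow> adapted B C \<and> e \<in> fdom C"

definition bpt :: "('x, 'e, 'n, 'm) fchart \<Rightarrow> ('n \<Rightarrow> real) \<Rightarrow> 'x" where
  "bpt C = inv_into (bdom C) (bcoord C)"

definition local_section ::
    "('x, 'e, 'n::finite, 'm::finite) fbundle \<Rightarrow> 'x set \<Rightarrow> ('x \<Rightarrow> 'e) \<Rightarrow> bool" where
  "local_section B N f \<longleftrightarrow> openin (manifold_topology (bspace B) (batlas B)) N \<and>
     (\<forall>x\<in>N. f x \<in> tspace B \<and> proj B (f x) = x) \<and> smooth_map N (batlas B) (tatlas B) f"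

section \<open>Bundles over the total space, given by coordinates in all adapted charts\<close>

text \<open>A point of any of the bundles over \<open>\<Phi>\<close> below (\<open>J\<^sup>k\<Phi>\<close>, the phase bundle, its first jets, ...)
  is encoded as the underlying point \<open>e\<close> of \<open>\<Phi>\<close> together with the family of its coordinates (apart
  from \<open>x\<^sup>\<mu>\<close>) in all adapted charts around \<open>e\<close>; the family is set to zero at all other charts.\<close>

type_synonym ('x, 'e, 'n, 'm, 'i) pt = "'e \<times> (('x, 'e, 'n, 'm) fchart \<Rightarrow> 'i \<Rightarrow> real)"
type_synonym ('x, 'e, 'n, 'm, 'i) vec = "('x, 'e, 'n, 'm) fchart \<Rightarrow> 'i \<Rightarrow> real"

definition left :: "('x, 'e, 'n, 'm, 'i + 'j) pt \<Rightarrow> ('x, 'e, 'n, 'm, 'i) pt" where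
  "left z = (fst z, \<lambda>C i. snd z C (Inl i))"

definition fibre :: "('x, 'e, 'n, 'm) fbundle \<Rightarrow> ('x, 'e, 'n, 'm, 'i) pt set \<Rightarrow> 'x
    \<Rightarrow> ('x, 'e, 'n, 'm, 'i) pt set" where
  "fibre B S x = {z \<in> S. proj B (fst z) = x}"

definition smooth_section :: "('x, 'e, 'n::finite, 'm::finite) fbundle
    \<Rightarrow> ('x, 'e, 'n, 'm, 'i) pt set \<Rightarrow> 'x set \<Rightarrow> ('x \<Rightarrow> ('x, 'e, 'n, 'm, 'i) pt) \<Rightarrow> bool" where
  "smooth_section B S N s \<longleftrightarrow> local_section B N (fst \<circ> s) \<and> (\<forall>x\<in>N. s x \<in> S) \<and>
     (\<forall>C i. adapted B C \<longrightarrow>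
        smooth_fun UNIV (bcoord C ` {x \<in> N. fst (s x) \<in> fdom C}) (\<lambda>y. snd (s (bpt C y)) C i))"

definition jet1 :: "('x, 'e, 'n::finite, 'm::finite) fbundle
    \<Rightarrow> ('x \<Rightarrow> ('x, 'e, 'n, 'm, 'i) pt) \<Rightarrow> 'x \<Rightarrow> ('x, 'e, 'n, 'm, 'i + 'i \<times> 'n) pt" where
  "jet1 B s x = (fst (s x), \<lambda>C.
     if around B C (fst (s x))
     then case_sum (snd (s x) C) (\<lambda>(i, \<rho>). pd \<rho> (\<lambda>y. snd (s (bpt C y)) C i) (bcoord C x))
     else (\<lambda>_. 0))"

definition vertical_curve :: "('x, 'e, 'n::finite, 'm::finite) fbundle
    \<Rightarrow> ('x, 'e, 'n, 'm, 'i) pt set \<Rightarrow> 'x \<Rightarrow> real set \<Rightarrow> (real \<Rightarrow> ('x, 'e, 'n, 'm, 'i) pt) \<Rightarrow> bool" where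
  "vertical_curve B S x T \<gamma> \<longleftrightarrow> (\<forall>t\<in>T. \<gamma> t \<in> fibre B S x) \<and>
     (\<forall>C. adapted B C \<longrightarrow> open {t \<in> T. fst (\<gamma> t) \<in> fdom C} \<and>
        (\<forall>i. smooth_real {t \<in> T. fst (\<gamma> t) \<in> fdom C} (\<lambda>t. snd (\<gamma> t) C i)))"

definition velocity :: "('x, 'e, 'n::finite, 'm::finite) fbundle
    \<Rightarrow> (real \<Rightarrow> ('x, 'e, 'n, 'm, 'i) pt) \<Rightarrow> real \<Rightarrow> ('x, 'e, 'n, 'm, 'i) vec" where
  "velocity B \<gamma> t = (\<lambda>C i. if around B C (fst (\<gamma> t)) then deriv (\<lambda>s. snd (\<gamma> s) C i) t else 0)"

text \<open>The tangent space at \<open>z\<close> of the fibre of \<open>S\<close> through \<open>z\<close>.\<close>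

definition vertical_tangent :: "('x, 'e, 'n::finite, 'm::finite) fbundle
    \<Rightarrow> ('x, 'e, 'n, 'm, 'i) pt set \<Rightarrow> ('x, 'e, 'n, 'm, 'i) pt \<Rightarrow> ('x, 'e, 'n, 'm, 'i) vec set" where
  "vertical_tangent B S z = {velocity B \<gamma> 0 | \<gamma> \<epsilon>.
     \<epsilon> > 0 \<and> vertical_curve B S (proj B (fst z)) {-\<epsilon><..<\<epsilon>} \<gamma> \<and> \<gamma> 0 = z}"

text \<open>\<open>jac C C' x \<kappa> \<nu> = \<partial>x'\<^sup>\<kappa>/\<partial>x\<^sup>\<nu>\<close>, with \<open>x\<close> the base coordinates of \<open>C\<close> and \<open>x'\<close> those of \<open>C'\<close>.\<close>

definition jac :: "('x, 'e, 'n, 'm) fchart \<Rightarrow> ('x, 'e, 'n, 'm) fchart \<Rightarrow> 'x \<Rightarrow> 'n \<Rightarrow> 'n \<Rightarrow> real" where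
  "jac C C' x \<kappa> \<nu> = pd \<nu> (\<lambda>y. bcoord C' (bpt C y) \<kappa>) (bcoord C x)"

definition jdet ::
    "('x, 'e, 'n::finite, 'm) fchart \<Rightarrow> ('x, 'e, 'n, 'm) fchart \<Rightarrow> 'x \<Rightarrow> real" where
  "jdet C C' x = det (\<chi> \<kappa> \<nu>. jac C C' x \<kappa> \<nu>)"

text \<open>Elements \<open>b d\<^sup>nx\<close> of \<open>\<Lambda>\<^sup>n M\<close>, and \<open>b\<^sup>\<lambda> (\<partial>\<^sub>\<lambda> \<lrcorner> d\<^sup>nx)\<close> of \<open>\<Lambda>\<^sup>n\<^sup>-\<^sup>1 M\<close>, pulled back to \<open>e\<close>, are given by
  their components in all adapted charts around \<open>e\<close>.\<close>

definition top_form :: "('x, 'e, 'n::finite, 'm::finite) fbundle \<Rightarrow> 'e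
    \<Rightarrow> (('x, 'e, 'n, 'm) fchart \<Rightarrow> real) \<Rightarrow> bool" where
  "top_form B e b \<longleftrightarrow> (\<forall>C C'. around B C e \<and> around B C' e \<longrightarrow>
     b C = jdet C C' (proj B e) * b C')"

definition cotop_form :: "('x, 'e, 'n::finite, 'm::finite) fbundle \<Rightarrow> 'e
    \<Rightarrow> (('x, 'e, 'n, 'm) fchart \<Rightarrow> 'n \<Rightarrow> real) \<Rightarrow> bool" where
  "cotop_form B e b \<longleftrightarrow> (\<forall>C C' \<rho>. around B C e \<and> around B C' e \<longrightarrow>
     b C \<rho> = jdet C C' (proj B e) * (\<Sum>\<kappa>\<in>UNIV. jac C' C (proj B e) \<rho> \<kappa> * b C' \<kappa>))"

section \<open>Jets and Lagrangian densities\<close>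

text \<open>The coordinate \<open>\<phi>\<^sup>a\<^bsub>\<mu>\<^sub>1\<dots>\<mu>\<^sub>l\<^esub>\<close>, symmetric in its lower indices, is indexed by
  \<open>({#\<mu>\<^sub>1, \<dots>, \<mu>\<^sub>l#}, a)\<close>.  Sums over all index values are sums over lists.\<close>

type_synonym ('n, 'm) jidx = "'n multiset \<times> 'm"

definition jidx :: "nat \<Rightarrow> ('n, 'm) jidx set" where
  "jidx k = {(I, a). size I \<le> k}"

definition jet :: "('x, 'e, 'n::finite, 'm::finite) fbundle \<Rightarrow> nat \<Rightarrow> ('x \<Rightarrow> 'e) \<Rightarrow> 'x
    \<Rightarrow> ('x, 'e, 'n, 'm, ('n, 'm) jidx) pt" where
  "jet B k f x = (f x, \<lambda>C (I, a).
     if around B C (f x) \<and> size I \<le> k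
     then pdm I (\<lambda>y. fcoord C (f (bpt C y)) a) (bcoord C x) else 0)"

definition Jet :: "('x, 'e, 'n::finite, 'm::finite) fbundle \<Rightarrow> nat
    \<Rightarrow> ('x, 'e, 'n, 'm, ('n, 'm) jidx) pt set" where
  "Jet B k = {jet B k f x | f x N. local_section B N f \<and> x \<in> N}"

definition contract :: "nat \<Rightarrow> (('n::finite, 'm::finite) jidx \<Rightarrow> real) \<Rightarrow> (('n, 'm) jidx \<Rightarrow> real) \<Rightarrow> real" where
  "contract k j v = (\<Sum>l\<le>k. \<Sum>\<mu>s | length \<mu>s = l. \<Sum>a\<in>UNIV. j (mset \<mu>s, a) * v (mset \<mu>s, a))"

definition jcoord :: "('x, 'e, 'n, 'm) fbundle \<Rightarrow> ('x, 'e, 'n, 'm) fchart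
    \<Rightarrow> ('x, 'e, 'n, 'm, 'i) pt \<Rightarrow> 'n + 'i \<Rightarrow> real" where
  "jcoord B C z = case_sum (bcoord C (proj B (fst z))) (snd z C)"

type_synonym ('x, 'e, 'n, 'm) density =
  "('x, 'e, 'n, 'm, ('n, 'm) jidx) pt \<Rightarrow> ('x, 'e, 'n, 'm) fchart \<Rightarrow> real"

text \<open>The function \<open>L(x\<^sup>\<mu>, \<phi>, \<phi>\<^sub>\<mu>, \<dots>)\<close> in the chart \<open>C\<close>.\<close>

definition lagr_fun :: "('x, 'e, 'n::finite, 'm::finite) fbundle \<Rightarrow> nat \<Rightarrow> ('x, 'e, 'n, 'm) density
    \<Rightarrow> ('x, 'e, 'n, 'm) fchart \<Rightarrow> ('n + ('n, 'm) jidx \<Rightarrow> real) \<Rightarrow> real" where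
  "lagr_fun B k L C y = L (inv_into {z \<in> Jet B k. fst z \<in> fdom C} (jcoord B C) y) C"

definition lagrangian_density :: "('x, 'e, 'n::finite, 'm::finite) fbundle \<Rightarrow> nat
    \<Rightarrow> ('x, 'e, 'n, 'm) density \<Rightarrow> bool" where
  "lagrangian_density B k L \<longleftrightarrow> (\<forall>z\<in>Jet B k. top_form B (fst z) (L z)) \<and>
     (\<forall>C. adapted B C \<longrightarrow> smooth_fun (range Inl \<union> Inr ` jidx k)
        (jcoord B C ` {z \<in> Jet B k. fst z \<in> fdom C}) (lagr_fun B k L C))"

definition fibre_deriv :: "('x, 'e, 'n::finite, 'm::finite) fbundle \<Rightarrow> nat \<Rightarrow> ('x, 'e, 'n, 'm) density
    \<Rightarrow> ('x, 'e, 'n, 'm, ('n, 'm) jidx) pt \<Rightarrow> ('x, 'e, 'n, 'm, ('n, 'm) jidx) vec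
    \<Rightarrow> ('x, 'e, 'n, 'm) fchart \<Rightarrow> real" where
  "fibre_deriv B k L z v C = (\<Sum>i\<in>jidx k. pd (Inr i) (lagr_fun B k L C) (jcoord B C z) * v C i)"

text \<open>The symmetric coefficients in \<open>\<delta>L = \<Sum>\<^sub>l \<partial>L/\<partial>\<phi>\<^bsub>\<mu>\<^sub>1\<dots>\<mu>\<^sub>l\<^esub> \<delta>\<phi>\<^bsub>\<mu>\<^sub>1\<dots>\<mu>\<^sub>l\<^esub>\<close>: the sum is over all index
  values, so the derivative along the independent coordinate is divided by the number of
  orderings of the multi-index.\<close>

definition dL_dphi :: "('x, 'e, 'n::finite, 'm::finite) fbundle \<Rightarrow> nat \<Rightarrow> ('x, 'e, 'n, 'm) density
    \<Rightarrow> ('x, 'e, 'n, 'm) fchart \<Rightarrow> ('x, 'e, 'n, 'm, ('n, 'm) jidx) pt \<Rightarrow> ('n, 'm) jidx \<Rightarrow> real" where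
  "dL_dphi B k L C z = (\<lambda>(I, a). pd (Inr (I, a)) (lagr_fun B k L C) (jcoord B C z)
     / real (card (permutations_of_multiset I)))"

definition euler_lagrange :: "('x, 'e, 'n::finite, 'm::finite) fbundle \<Rightarrow> nat
    \<Rightarrow> ('x, 'e, 'n, 'm) density \<Rightarrow> 'x set \<Rightarrow> ('x \<Rightarrow> 'e) \<Rightarrow> bool" where
  "euler_lagrange B k L N f \<longleftrightarrow> (\<forall>x\<in>N. \<forall>C a. around B C (f x) \<longrightarrow>
     (\<Sum>l\<le>k. (- 1) ^ l * (\<Sum>\<mu>s | length \<mu>s = l.
        pds \<mu>s (\<lambda>y. dL_dphi B k L C (jet B k f (bpt C y)) (mset \<mu>s, a)) (bcoord C x))) = 0)"

section \<open>The phase bundle and the infinitesimal phase bundle\<close>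

text \<open>Coordinates of the phase bundle: \<open>Inl (I, a)\<close> for those of the \<open>(k-1)\<close>-jet, and
  \<open>Inr ({#\<mu>\<^sub>1, \<dots>, \<mu>\<^sub>l#}, \<lambda>, a)\<close> for \<open>p\<^bsup>\<mu>\<^sub>1\<dots>\<mu>\<^sub>l\<lambda>\<^esup>\<close>.  Its first jets have in addition \<open>Inr (i, \<kappa>)\<close> for
  the derivative of the coordinate \<open>i\<close> along \<open>x\<^sup>\<kappa>\<close>.\<close>

type_synonym ('n, 'm) pidx = "('n, 'm) jidx + 'n multiset \<times> 'n \<times> 'm"
type_synonym ('n, 'm) p1idx = "('n, 'm) pidx + ('n, 'm) pidx \<times> 'n"
type_synonym ('n, 'm) iidx = "('n, 'm) jidx + ('n, 'm) jidx"

text \<open>The value of the momentum on a vertical vector \<open>v\<close>, an element of \<open>\<Lambda>\<^sup>n\<^sup>-\<^sup>1 M\<close>.\<close>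

definition momentum_value :: "nat \<Rightarrow> ('x, 'e, 'n::finite, 'm::finite, ('n, 'm) pidx) pt
    \<Rightarrow> ('x, 'e, 'n, 'm, ('n, 'm) jidx) vec \<Rightarrow> ('x, 'e, 'n, 'm) fchart \<Rightarrow> 'n \<Rightarrow> real" where
  "momentum_value k z v C \<rho> = (\<Sum>l<k. \<Sum>\<mu>s | length \<mu>s = l. \<Sum>a\<in>UNIV.
     snd z C (Inr (mset \<mu>s, \<rho>, a)) * v C (mset \<mu>s, a))"

definition Phase :: "('x, 'e, 'n::finite, 'm::finite) fbundle \<Rightarrow> nat
    \<Rightarrow> ('x, 'e, 'n, 'm, ('n, 'm) pidx) pt set" where
  "Phase B k = {z. left z \<in> Jet B (k - 1) \<and>
     (\<forall>C i. \<not> around B C (fst z) \<longrightarrow> snd z C i = 0) \<and>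
     (\<forall>C I \<rho> a. size I \<ge> k \<longrightarrow> snd z C (Inr (I, \<rho>, a)) = 0) \<and>
     (\<forall>v\<in>vertical_tangent B (Jet B (k - 1)) (left z).
        cotop_form B (fst z) (momentum_value k z v))}"

definition J1Phase :: "('x, 'e, 'n::finite, 'm::finite) fbundle \<Rightarrow> nat
    \<Rightarrow> ('x, 'e, 'n, 'm, ('n, 'm) p1idx) pt set" where
  "J1Phase B k = {jet1 B \<sigma> x | \<sigma> x N. smooth_section B (Phase B k) N \<sigma> \<and> x \<in> N}"

text \<open>The projection from first jets of sections of the phase bundle to those of \<open>J\<^sup>k\<^sup>-\<^sup>1\<Phi>\<close>.\<close>

definition projJ1 :: "('x, 'e, 'n, 'm, ('n, 'm) p1idx) pt
    \<Rightarrow> ('x, 'e, 'n, 'm, ('n, 'm) jidx + ('n, 'm) jidx \<times> 'n) pt" where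
  "projJ1 w = (fst w, \<lambda>C. case_sum (\<lambda>i. snd w C (Inl (Inl i))) (\<lambda>(i, \<rho>). snd w C (Inr (Inl i, \<rho>))))"

text \<open>The graph of the inclusion of \<open>J\<^sup>k\<Phi>\<close> into \<open>J\<^sup>1(J\<^sup>k\<^sup>-\<^sup>1\<Phi>)\<close>.\<close>

definition holonomic :: "('x, 'e, 'n::finite, 'm::finite) fbundle \<Rightarrow> nat
    \<Rightarrow> ('x, 'e, 'n, 'm, ('n, 'm) jidx) pt
    \<Rightarrow> ('x, 'e, 'n, 'm, ('n, 'm) jidx + ('n, 'm) jidx \<times> 'n) pt \<Rightarrow> bool" where
  "holonomic B k z w \<longleftrightarrow> (\<exists>f N x. local_section B N f \<and> x \<in> N \<and>
     z = jet B k f x \<and> w = jet1 B (jet B (k - 1) f) x)"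

definition HolPhase :: "('x, 'e, 'n::finite, 'm::finite) fbundle \<Rightarrow> nat
    \<Rightarrow> ('x, 'e, 'n, 'm, ('n, 'm) p1idx) pt set" where
  "HolPhase B k = {w \<in> J1Phase B k. \<exists>z. holonomic B k z (projJ1 w)}"

definition kjet :: "('x, 'e, 'n::finite, 'm::finite) fbundle \<Rightarrow> nat
    \<Rightarrow> ('x, 'e, 'n, 'm, ('n, 'm) p1idx) pt \<Rightarrow> ('x, 'e, 'n, 'm, ('n, 'm) jidx) pt" where
  "kjet B k w = (THE z. holonomic B k z (projJ1 w))"

text \<open>The restricted form evaluated on vertical vectors \<open>X, Y\<close>, as coefficient of \<open>d\<^sup>nx\<close> in \<open>C\<close>.\<close>

definition omega_tilde :: "nat \<Rightarrow> ('x, 'e, 'n::finite, 'm::finite, ('n, 'm) p1idx) vec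
    \<Rightarrow> ('x, 'e, 'n, 'm, ('n, 'm) p1idx) vec \<Rightarrow> ('x, 'e, 'n, 'm) fchart \<Rightarrow> real" where
  "omega_tilde k X Y C = (\<Sum>l<k. \<Sum>\<mu>s | length \<mu>s = l. \<Sum>a\<in>UNIV. \<Sum>\<rho>\<in>UNIV.
     let dp = Inr (Inr (mset \<mu>s, \<rho>, a), \<rho>); phi = Inl (Inl (mset \<mu>s, a));
         p = Inl (Inr (mset \<mu>s, \<rho>, a)); dphi = Inr (Inl (mset \<mu>s, a), \<rho>)
     in X C dp * Y C phi - Y C dp * X C phi + (X C p * Y C dphi - Y C p * X C dphi))"

definition degeneracy :: "('x, 'e, 'n::finite, 'm::finite) fbundle \<Rightarrow> nat
    \<Rightarrow> ('x, 'e, 'n, 'm, ('n, 'm) p1idx) pt \<Rightarrow> ('x, 'e, 'n, 'm, ('n, 'm) p1idx) vec set" where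
  "degeneracy B k w = {X \<in> vertical_tangent B (HolPhase B k) w.
     \<forall>Y\<in>vertical_tangent B (HolPhase B k) w. \<forall>C. around B C (fst w) \<longrightarrow> omega_tilde k X Y C = 0}"

text \<open>Two points lie on the same degeneracy leaf iff they are joined by a curve, within one fibre,
  that is tangent to the degeneracy distribution.\<close>

definition same_leaf :: "('x, 'e, 'n::finite, 'm::finite) fbundle \<Rightarrow> nat
    \<Rightarrow> (('x, 'e, 'n, 'm, ('n, 'm) p1idx) pt \<times> ('x, 'e, 'n, 'm, ('n, 'm) p1idx) pt) set" where
  "same_leaf B k = {(w, w'). w \<in> HolPhase B k \<and> w' \<in> HolPhase B k \<and>
     (\<exists>\<gamma> \<epsilon>. \<epsilon> > 0 \<and> vertical_curve B (HolPhase B k) (proj B (fst w)) {-\<epsilon><..<1+\<epsilon>} \<gamma> \<and>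
        \<gamma> 0 = w \<and> \<gamma> 1 = w' \<and> (\<forall>t\<in>{0..1}. velocity B \<gamma> t \<in> degeneracy B k (\<gamma> t)))}"

definition InfPhase :: "('x, 'e, 'n::finite, 'm::finite) fbundle \<Rightarrow> nat
    \<Rightarrow> ('x, 'e, 'n, 'm, ('n, 'm) p1idx) pt set set" where
  "InfPhase B k = HolPhase B k // same_leaf B k"

text \<open>The total symmetrisation \<open>p\<^bsup>(\<mu>\<^sub>1\<dots>\<mu>\<^sub>l)\<^esup>\<close>, \<open>l \<ge> 1\<close>, as the average over all orderings.\<close>

definition symmetrised :: "('n multiset \<times> 'n \<times> 'm \<Rightarrow> real) \<Rightarrow> ('n, 'm) jidx \<Rightarrow> real" where
  "symmetrised p = (\<lambda>(I, a).
     (\<Sum>\<mu>s\<in>permutations_of_multiset I. p (mset (butlast \<mu>s), last \<mu>s, a))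
       / real (card (permutations_of_multiset I)))"

definition current :: "nat \<Rightarrow> ('x, 'e, 'n::finite, 'm, ('n, 'm) p1idx) pt
    \<Rightarrow> ('x, 'e, 'n, 'm) fchart \<Rightarrow> ('n, 'm) jidx \<Rightarrow> real" where
  "current k w C = (\<lambda>(I, a). if size I \<le> k then
     (if size I \<ge> 1 then symmetrised (\<lambda>i. snd w C (Inl (Inr i))) (I, a) else 0) +
     (if size I < k then \<Sum>\<rho>\<in>UNIV. snd w C (Inr (Inr (I, \<rho>, a), \<rho>)) else 0)
     else 0)"

text \<open>The coordinates of a point of the infinitesimal phase bundle, with \<open>Inl\<close> for those of the
  \<open>k\<close>-jet and \<open>Inr\<close> for the currents; they do not depend on the representative.\<close>

definition inf_coords :: "('x, 'e, 'n::finite, 'm::finite) fbundle \<Rightarrow> nat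
    \<Rightarrow> ('x, 'e, 'n, 'm, ('n, 'm) p1idx) pt set \<Rightarrow> ('x, 'e, 'n, 'm, ('n, 'm) iidx) pt" where
  "inf_coords B k c = (let w = (SOME w. w \<in> c) in (fst w, \<lambda>C.
     if around B C (fst w) then case_sum (snd (kjet B k w) C) (current k w C) else (\<lambda>_. 0)))"

definition theta :: "nat \<Rightarrow> (('n::finite, 'm::finite) iidx \<Rightarrow> real) \<Rightarrow> (('n, 'm) iidx \<Rightarrow> real) \<Rightarrow> real" where
  "theta k y X = contract k (\<lambda>i. y (Inr i)) (\<lambda>i. X (Inl i))"

text \<open>Exterior derivative of a 1-form \<open>\<theta>\<close> in coordinates: \<open>X(\<theta>(Y)) - Y(\<theta>(X))\<close> for the vector
  fields with constant coefficients \<open>X, Y\<close>.\<close>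

definition ext_deriv :: "(('i \<Rightarrow> real) \<Rightarrow> ('i \<Rightarrow> real) \<Rightarrow> real)
    \<Rightarrow> ('i \<Rightarrow> real) \<Rightarrow> ('i \<Rightarrow> real) \<Rightarrow> ('i \<Rightarrow> real) \<Rightarrow> real" where
  "ext_deriv \<theta> y X Y = deriv (\<lambda>t. \<theta> (\<lambda>i. y i + t * X i) Y) 0 - deriv (\<lambda>t. \<theta> (\<lambda>i. y i + t * Y i) X) 0"

definition omega :: "nat \<Rightarrow> (('n::finite, 'm::finite) iidx \<Rightarrow> real) \<Rightarrow> (('n, 'm) iidx \<Rightarrow> real)
    \<Rightarrow> (('n, 'm) iidx \<Rightarrow> real) \<Rightarrow> real" where
  "omega k = ext_deriv (theta k)"

section \<open>The graph of \<open>\<delta>L\<close> and Lagrangian submanifolds\<close>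

text \<open>The identification of a point having currents \<open>j\<close> with the covector \<open>\<Sum>\<^sub>l j\<^bsup>\<mu>\<^sub>1\<dots>\<mu>\<^sub>l\<^esup> \<delta>\<phi>\<^bsub>\<mu>\<^sub>1\<dots>\<mu>\<^sub>l\<^esub> \<otimes> d\<^sup>nx\<close>
  turns equality with \<open>\<delta>L\<close> at the underlying \<open>k\<close>-jet into the following.\<close>

definition delta_graph :: "('x, 'e, 'n::finite, 'm::finite) fbundle \<Rightarrow> nat
    \<Rightarrow> ('x, 'e, 'n, 'm) density \<Rightarrow> ('x, 'e, 'n, 'm, ('n, 'm) p1idx) pt set set" where
  "delta_graph B k L = {c \<in> InfPhase B k. let z = inf_coords B k c in
     \<forall>v\<in>vertical_tangent B (Jet B k) (left z). \<forall>C. around B C (fst z) \<longrightarrow>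
       contract k (\<lambda>i. snd z C (Inr i)) (v C) = fibre_deriv B k L (left z) v C}"

definition isotropic :: "('x, 'e, 'n::finite, 'm::finite) fbundle \<Rightarrow> nat
    \<Rightarrow> ('x, 'e, 'n, 'm, ('n, 'm) iidx) pt \<Rightarrow> ('x, 'e, 'n, 'm, ('n, 'm) iidx) vec set \<Rightarrow> bool" where
  "isotropic B k z W \<longleftrightarrow> (\<lambda>_ _. 0) \<in> W \<and>
     (\<forall>X\<in>W. \<forall>Y\<in>W. \<forall>s t. (\<lambda>C i. s * X C i + t * Y C i) \<in> W) \<and>
     (\<forall>X\<in>W. \<forall>Y\<in>W. \<forall>C. around B C (fst z) \<longrightarrow> omega k (snd z C) (X C) (Y C) = 0)"

definition maximal_isotropic :: "('x, 'e, 'n::finite, 'm::finite) fbundle \<Rightarrow> nat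
    \<Rightarrow> ('x, 'e, 'n, 'm, ('n, 'm) iidx) vec set \<Rightarrow> ('x, 'e, 'n, 'm, ('n, 'm) iidx) pt
    \<Rightarrow> ('x, 'e, 'n, 'm, ('n, 'm) iidx) vec set \<Rightarrow> bool" where
  "maximal_isotropic B k V z W \<longleftrightarrow> W \<subseteq> V \<and> isotropic B k z W \<and>
     (\<forall>W'. W \<subseteq> W' \<and> W' \<subseteq> V \<and> isotropic B k z W' \<longrightarrow> W' = W)"

text \<open>\<open>D\<^sub>x\<close> is a Lagrangian submanifold of \<open>P\<^sub>x\<close>, for sets \<open>D \<subseteq> P\<close> of points given by coordinates.\<close>

definition lagrangian_submanifold_at :: "('x, 'e, 'n::finite, 'm::finite) fbundle \<Rightarrow> nat
    \<Rightarrow> ('x, 'e, 'n, 'm, ('n, 'm) iidx) pt set \<Rightarrow> ('x, 'e, 'n, 'm, ('n, 'm) iidx) pt set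
    \<Rightarrow> 'x \<Rightarrow> bool" where
  "lagrangian_submanifold_at B k P D x \<longleftrightarrow>
     (\<forall>C. adapted B C \<longrightarrow> embedded_submanifold (jidx k <+> jidx k)
        {snd z C | z. z \<in> fibre B P x \<and> fst z \<in> fdom C}
        {snd z C | z. z \<in> fibre B D x \<and> fst z \<in> fdom C}) \<and>
     (\<forall>z\<in>fibre B D x. maximal_isotropic B k (vertical_tangent B P z) z (vertical_tangent B D z))"

text \<open>\<open>\<delta>L = \<theta>|\<^sub>D\<close>: the fibrewise differential of \<open>L\<close> pulled back to \<open>D\<close> agrees with \<open>\<theta>\<close> on the
  velocity of every vertical curve in \<open>D\<close>.\<close>

definition generating_formula :: "('x, 'e, 'n::finite, 'm::finite) fbundle \<Rightarrow> nat
    \<Rightarrow> ('x, 'e, 'n, 'm) density \<Rightarrow> ('x, 'e, 'n, 'm, ('n, 'm) iidx) pt set \<Rightarrow> bool" where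
  "generating_formula B k L D \<longleftrightarrow>
     (\<forall>x \<gamma> \<epsilon> C. \<epsilon> > 0 \<and> vertical_curve B D x {-\<epsilon><..<\<epsilon>} \<gamma> \<and> around B C (fst (\<gamma> 0)) \<longrightarrow>
        ((\<lambda>t. L (left (\<gamma> t)) C) has_real_derivative
           theta k (snd (\<gamma> 0) C) (velocity B \<gamma> 0 C)) (at 0))"

end

(* A vertical vector field v on J^(k-1) pairs with a section of the phase bundle to a form of degree
   n-1, whose total divergence is the pairing of the currents with the prolongation of v.  Since the
   divergence does not depend on the chart (Piola's identity), the currents together with the k-jet
   are coordinates of a bundle over J^k, and testing the presymplectic form on suitable tangent
   vectors shows that they are constant along the degeneracy leaves.  In these coordinates the graph
   of dL is {j = dL/dphi}: it is Lagrangian by the symmetry of second derivatives, and the generating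
   formula is the chain rule.  The Euler-Lagrange operator annihilates every family of currents,
   because the symmetrised part at order l+1 cancels against the divergence part at order l.
   Conversely, totally symmetric momenta with prescribed currents are found by descending recursion
   on the order, and the one remaining condition, at order 0, is the Euler-Lagrange equation. *)
theory Submission
  imports Defs
begin

text \<open>No bundle here gets an atlas of its own. The locale \<open>coord_bundle\<close> isolates
  what the geometry uses: a point is determined by its coordinates in one adapted chart, all
  coordinates beyond those of the underlying point of \<open>tspace B\<close> are free, and
  coordinates in a second chart are smooth functions of those in the first. First jets inherit this
  interface, and \<open>transfer\<close> carries it along a smooth lift of coordinates with a smooth
  left inverse. Jets of order k + 1 thereby come from first jets of k-jets, and the infinitesimal
  phase bundle from first jets of the phase bundle, so that neither the higher-order chain rule nor
  the transformation law of the currents is ever written out. The obstacle for currents is that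
  \<open>transfer\<close> requires a lift chosen in one chart to have the right currents in every
  other. Comparing divergences settles this once a vertical vector at a k-jet is extended to a field
  along a (k-1)-jet section whose derivatives reproduce it, which Taylor polynomials do. The factors
  \<open>orderings\<close> come from contractions that sum over index lists while the independent
  coordinates are multisets.\<close>

abbreviation open_in :: "'i set \<Rightarrow> ('i \<Rightarrow> real) set \<Rightarrow> bool" where
  "open_in I U \<equiv> openin (top_of_set (coord_space I)) U"

section \<open>Topology of coordinate spaces\<close>

lemma open_in_iff:
  assumes "finite I"
  shows "open_in I U \<longleftrightarrow> U \<subseteq> coord_space I \<and>
    (\<forall>y\<in>U. \<exists>e>0. \<forall>z\<in>coord_space I. (\<forall>i\<in>I. \<bar>z i - y i\<bar> < e) \<longrightarrow> z \<in> U)"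
proof
  assume U: "open_in I U"
  then obtain T where T: "open T" "U = coord_space I \<inter> T" by (auto simp: openin_open)
  show "U \<subseteq> coord_space I \<and>
    (\<forall>y\<in>U. \<exists>e>0. \<forall>z\<in>coord_space I. (\<forall>i\<in>I. \<bar>z i - y i\<bar> < e) \<longrightarrow> z \<in> U)"
  proof (intro conjI ballI)
    show "U \<subseteq> coord_space I" using T by auto
    fix y assume y: "y \<in> U"
    have "openin (product_topology (\<lambda>i. euclidean) UNIV) T"
      using T(1) by (simp add: open_fun_def)
    from product_topology_open_contains_basis[OF this, of y] y T
    obtain X where X: "y \<in> PiE UNIV X" "\<And>i. open (X i)" "PiE UNIV X \<subseteq> T"
      by auto
    have "\<exists>e>0. \<forall>t. \<bar>t - y i\<bar> < e \<longrightarrow> t \<in> X i" for i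
    proof -
      have "y i \<in> X i" using X(1) by auto
      with X(2)[of i] show ?thesis
        unfolding open_dist by (metis dist_real_def)
    qed
    then obtain d where d: "\<And>i. d i > 0" "\<And>i t. \<bar>t - y i\<bar> < d i \<Longrightarrow> t \<in> X i" by metis
    \<comment> \<open>Outside \<open>I\<close> both points vanish and hence agree, so only the
      finitely many radii \<open>d i\<close> with \<open>i\<close> in \<open>I\<close> count. The 1
      keeps the minimum defined for empty \<open>I\<close>.\<close>
    define e where "e = Min (insert 1 (d ` I))"
    have e: "e > 0" unfolding e_def using assms d(1) by (subst Min_gr_iff) auto
    have ed: "e \<le> d i" if "i \<in> I" for i
      unfolding e_def using assms that by (intro Min_le) auto
    show "\<exists>e>0. \<forall>z\<in>coord_space I. (\<forall>i\<in>I. \<bar>z i - y i\<bar> < e) \<longrightarrow> z \<in> U"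
    proof (intro exI[of _ e] conjI ballI impI)
      fix z assume z: "z \<in> coord_space I" "\<forall>i\<in>I. \<bar>z i - y i\<bar> < e"
      have "z i \<in> X i" for i
      proof (cases "i \<in> I")
        case True
        then show ?thesis using z(2) ed[OF True] by (intro d(2)) force
      next
        case False
        then have "z i = y i" using z(1) y T(2) by (auto simp: coord_space_def)
        then show ?thesis using X(1) by auto
      qed
      then have "z \<in> T" using X(3) by auto
      then show "z \<in> U" using z T by auto
    qed (rule e)
  qed
next
  assume U: "U \<subseteq> coord_space I \<and>
    (\<forall>y\<in>U. \<exists>e>0. \<forall>z\<in>coord_space I. (\<forall>i\<in>I. \<bar>z i - y i\<bar> < e) \<longrightarrow> z \<in> U)"
  show "open_in I U"
  proof (subst openin_subopen, intro ballI)
    fix y assume y: "y \<in> U"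
    then obtain e where e: "e > 0" "\<forall>z\<in>coord_space I. (\<forall>i\<in>I. \<bar>z i - y i\<bar> < e) \<longrightarrow> z \<in> U"
      using U by blast
    define T where "T = (\<Inter>i\<in>I. {z :: _ \<Rightarrow> real. \<bar>z i - y i\<bar> < e})"
    have "open T" unfolding T_def using assms
      by (intro open_INT ballI open_Collect_less continuous_intros
          continuous_on_product_then_coordinatewise) auto
    then have "open_in I (coord_space I \<inter> T)" by (simp add: openin_open_Int)
    moreover have "y \<in> coord_space I \<inter> T" "coord_space I \<inter> T \<subseteq> U"
      using U y e by (auto simp: T_def)
    ultimately show "\<exists>T. open_in I T \<and> y \<in> T \<and> T \<subseteq> U" by blast
  qed
qed

lemma open_in_subset: "open_in I U \<Longrightarrow> U \<subseteq> coord_space I"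
  by (metis openin_subset topspace_euclidean_subtopology)

lemma coord_space_UNIV [simp]: "coord_space UNIV = UNIV"
  by (auto simp: coord_space_def)

lemma open_in_UNIV [simp]: "open_in UNIV U \<longleftrightarrow> open U"
  by simp

lemma open_in_eventually:
  assumes "finite I" "open_in I U" "y \<in> U" "\<And>i. i \<in> I \<Longrightarrow> ((\<lambda>s. c s i) \<longlongrightarrow> y i) F"
    "\<forall>\<^sub>F s in F. c s \<in> coord_space I"
  shows "\<forall>\<^sub>F s in F. c s \<in> U"
proof -
  obtain e where e: "e > 0" "\<forall>z\<in>coord_space I. (\<forall>i\<in>I. \<bar>z i - y i\<bar> < e) \<longrightarrow> z \<in> U"
    using assms(1-3) open_in_iff by metis
  have "\<forall>\<^sub>F s in F. \<forall>i\<in>I. \<bar>c s i - y i\<bar> < e"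
    using assms(1,4) e(1) by (intro eventually_ball_finite) (auto simp: tendsto_iff dist_real_def)
  with assms(5) show ?thesis
    by eventually_elim (use e in auto)
qed

lemma upd_coord_space: "y \<in> coord_space I \<Longrightarrow> i \<in> I \<Longrightarrow> y(i := t) \<in> coord_space I"
  by (auto simp: coord_space_def)

lemma open_in_upd:
  assumes "finite I" "open_in I U" "y \<in> U" "i \<in> I"
  shows "\<forall>\<^sub>F t in nhds (y i). y(i := t) \<in> U"
proof (rule open_in_eventually[OF assms(1-3)])
  show "((\<lambda>t. (y(i := t)) j) \<longlongrightarrow> y j) (nhds (y i))" for j
    using filterlim_ident[of "nhds (y i)"] by (cases "j = i") simp_all
  show "\<forall>\<^sub>F t in nhds (y i). y(i := t) \<in> coord_space I"
    using upd_coord_space[OF subsetD[OF open_in_subset[OF assms(2)] assms(3)] assms(4)]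
    by (intro always_eventually allI)
qed

subsection \<open>Differentiation rules\<close>

lemma pd_cong:
  assumes "finite I" "open_in I U" "y \<in> U" "i \<in> I" "\<And>z. z \<in> U \<Longrightarrow> f z = g z"
  shows "pd i f y = pd i g y"
  unfolding pd_def
proof (rule deriv_cong_ev)
  show "\<forall>\<^sub>F t in nhds (y i). f (y(i := t)) = g (y(i := t))"
    using open_in_upd[OF assms(1-4)] by eventually_elim (rule assms(5))
qed simp

lemma field_differentiable_cong_ev:
  fixes f g :: "real \<Rightarrow> real"
  assumes "\<forall>\<^sub>F t in nhds x. f t = g t" "f field_differentiable at x"
  shows "g field_differentiable at x"
  using assms(2) DERIV_cong_ev[OF refl assms(1) refl] unfolding field_differentiable_def by blast

lemma fd_cong:
  assumes "finite I" "open_in I U" "y \<in> U" "i \<in> I" "\<And>z. z \<in> U \<Longrightarrow> f z = g z"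
    "(\<lambda>t. f (y(i := t))) field_differentiable at (y i)"
  shows "(\<lambda>t. g (y(i := t))) field_differentiable at (y i)"
proof -
  have "\<forall>\<^sub>F t in nhds (y i). f (y(i := t)) = g (y(i := t))"
    using open_in_upd[OF assms(1-4)] by eventually_elim (rule assms(5))
  then show ?thesis using assms(6) by (rule field_differentiable_cong_ev)
qed

lemma Cr_Suc_fd:
  "Cr (Suc r) I U f \<Longrightarrow> i \<in> I \<Longrightarrow> y \<in> U \<Longrightarrow> (\<lambda>t. f (y(i := t))) field_differentiable at (y i)"
  unfolding Cr.simps by blast

lemma Cr_cong:
  assumes "finite I" "open_in I U" "\<And>y. y \<in> U \<Longrightarrow> f y = g y" "Cr r I U f"
  shows "Cr r I U g"
  using assms(3,4)
proof (induction r arbitrary: f g)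
  case 0
  then show ?case using continuous_on_cong[of U U f g] by simp
next
  case (Suc r)
  have "continuous_on U g" using Suc continuous_on_cong[of U U f g] by simp
  moreover have "Cr r I U (pd i g)" if "i \<in> I" for i
  proof (rule Suc.IH)
    show "Cr r I U (pd i f)" using Suc.prems that by simp
    show "pd i f y = pd i g y" if "y \<in> U" for y
      by (rule pd_cong[OF assms(1,2) that \<open>i \<in> I\<close>]) (rule Suc.prems)
  qed
  moreover have "(\<lambda>t. g (y(i := t))) field_differentiable at (y i)" if "i \<in> I" "y \<in> U" for i y
    by (rule fd_cong[OF assms(1,2) that(2,1) Suc.prems(1) Cr_Suc_fd[OF Suc.prems(2) that]])
  ultimately show ?case by simp
qed

lemma Cr_subset: "Cr r I U f \<Longrightarrow> U' \<subseteq> U \<Longrightarrow> Cr r I U' f"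
  by (induction r arbitrary: f) (auto intro: continuous_on_subset)

lemma Cr_Suc_imp: "Cr (Suc r) I U f \<Longrightarrow> Cr r I U f"
proof (induction r arbitrary: f)
  case (Suc r)
  have "Cr (Suc r) I U (pd i f)" if "i \<in> I" for i
    using Suc.prems that by (subst (asm) Cr.simps(2)) blast
  then have "\<forall>i\<in>I. Cr r I U (pd i f)"
    using Suc.IH by blast
  then show ?case using Suc.prems by simp
qed simp

lemma Cr_mono: "Cr r I U f \<Longrightarrow> r' \<le> r \<Longrightarrow> Cr r' I U f"
  by (induction r) (auto simp del: Cr.simps simp: le_Suc_eq dest: Cr_Suc_imp)

lemma Cr_continuous: "Cr r I U f \<Longrightarrow> continuous_on U f"
  by (cases r) auto

lemma continuous_on_open_in_local:
  assumes "open_in I U" "\<And>y. y \<in> U \<Longrightarrow> \<exists>W. open_in I W \<and> y \<in> W \<and> W \<subseteq> U \<and> continuous_on W f"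
  shows "continuous_on U f"
  unfolding continuous_on_def
proof
  fix y assume y: "y \<in> U"
  then obtain W where W: "open_in I W" "y \<in> W" "W \<subseteq> U" "continuous_on W f" using assms by blast
  obtain T where T: "open T" "W = coord_space I \<inter> T" using W(1) by (auto simp: openin_open)
  have "at y within U = at y within W"
    using W T open_in_subset[OF assms(1)] by (intro at_within_nhd[of _ T]) auto
  then show "(f \<longlongrightarrow> f y) (at y within U)"
    using W by (simp add: continuous_on_def)
qed

text \<open>Continuity and one-variable derivatives are both conditions near a point. Coordinate
  expressions assembled from several charts are controlled only near each point, and this patches
  the local statements together.\<close>

lemma Cr_local:
  assumes "open_in I U" "\<And>y. y \<in> U \<Longrightarrow> \<exists>W. open_in I W \<and> y \<in> W \<and> W \<subseteq> U \<and> Cr r I W f"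
  shows "Cr r I U f"
  using assms(2)
proof (induction r arbitrary: f)
  case 0
  then show ?case by (auto intro!: continuous_on_open_in_local[OF assms(1)])
next
  case (Suc r)
  have "continuous_on U f"
    using Suc.prems by (intro continuous_on_open_in_local[OF assms(1)]) (meson Cr_continuous)
  moreover have "(\<lambda>t. f (y(i := t))) field_differentiable at (y i)" if "i \<in> I" "y \<in> U" for i y
    using Suc.prems[OF that(2)] that(1) by auto
  moreover have "Cr r I U (pd i f)" if "i \<in> I" for i
    using Suc.prems that by (intro Suc.IH) (metis Cr.simps(2))
  ultimately show ?case by simp
qed

lemma Cr_const: "Cr r I U (\<lambda>_. c)"
proof (induction r arbitrary: c)
  case (Suc r)
  have "pd i (\<lambda>_. c) = (\<lambda>_. 0)" for i :: 'a by (auto simp: pd_def fun_eq_iff)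
  then show ?case using Suc by auto
qed auto

lemma pd_coord: "pd i (\<lambda>y. y j) = (\<lambda>_. if i = j then 1 else 0)"
  by (auto simp: pd_def fun_eq_iff)

lemma Cr_coord: "Cr r I U (\<lambda>y. y j)"
proof (cases r)
  case 0 then show ?thesis by (auto intro: continuous_on_product_then_coordinatewise continuous_on_id)
next
  case (Suc r')
  have "(\<lambda>t. if j = i then t else y j) field_differentiable at (y i)" for i y
    by (cases "j = i") auto
  then show ?thesis using Suc
    by (auto simp: pd_coord Cr_const fun_upd_def intro: continuous_on_product_then_coordinatewise continuous_on_id)
qed

lemma Cr_SucD:
  assumes "Cr (Suc r) I U f" "y \<in> U" "i \<in> I"
  shows "((\<lambda>t. f (y(i := t))) has_real_derivative pd i f y) (at (y i))"
  using assms unfolding pd_def by (auto simp: DERIV_deriv_iff_field_differentiable)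

lemma pd_add:
  assumes "Cr (Suc r) I U f" "Cr (Suc r') I U g" "y \<in> U" "i \<in> I"
  shows "pd i (\<lambda>y. f y + g y) y = pd i f y + pd i g y"
  unfolding pd_def[of _ "\<lambda>y. f y + g y"]
  by (rule DERIV_imp_deriv[OF DERIV_add[OF Cr_SucD[OF assms(1,3,4)] Cr_SucD[OF assms(2,3,4)]]])

lemma pd_mult:
  assumes "Cr (Suc r) I U f" "Cr (Suc r') I U g" "y \<in> U" "i \<in> I"
  shows "pd i (\<lambda>y. f y * g y) y = f y * pd i g y + pd i f y * g y"
proof -
  have "((\<lambda>t. f (y(i := t)) * g (y(i := t))) has_real_derivative
      (pd i f y * g (y(i := y i)) + pd i g y * f (y(i := y i)))) (at (y i))"
    by (rule DERIV_mult[OF Cr_SucD[OF assms(1,3,4)] Cr_SucD[OF assms(2,3,4)]])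
  then show ?thesis
    unfolding pd_def[of _ "\<lambda>y. f y * g y"] by (simp add: DERIV_imp_deriv algebra_simps)
qed

lemma Cr_add:
  assumes "finite I" "open_in I U" "Cr r I U f" "Cr r I U g"
  shows "Cr r I U (\<lambda>y. f y + g y)"
  using assms(3,4)
proof (induction r arbitrary: f g)
  case 0 then show ?case by (auto intro: continuous_intros)
next
  case (Suc r)
  have "Cr r I U (pd i (\<lambda>y. f y + g y))" if "i \<in> I" for i
  proof (rule Cr_cong[OF assms(1,2)])
    show "Cr r I U (\<lambda>y. pd i f y + pd i g y)" using Suc that by auto
  qed (use Suc.prems that pd_add in metis)
  then show ?case using Suc.prems by (auto intro!: continuous_intros field_differentiable_add)
qed

lemma Cr_mult:
  assumes "finite I" "open_in I U" "Cr r I U f" "Cr r I U g"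
  shows "Cr r I U (\<lambda>y. f y * g y)"
  using assms(3,4)
proof (induction r arbitrary: f g)
  case 0 then show ?case by (auto intro: continuous_intros)
next
  case (Suc r)
  have "Cr r I U (pd i (\<lambda>y. f y * g y))" if "i \<in> I" for i
  proof (rule Cr_cong[OF assms(1,2)])
    show "Cr r I U (\<lambda>y. f y * pd i g y + pd i f y * g y)"
      using Suc that Cr_Suc_imp[of r I U] by (intro Cr_add[OF assms(1,2)] Suc.IH) auto
  qed (use Suc.prems that pd_mult in metis)
  then show ?case using Suc.prems by (auto intro!: continuous_intros field_differentiable_mult)
qed

lemma Cr_sum:
  assumes "finite I" "open_in I U" "\<And>j. j \<in> J \<Longrightarrow> Cr r I U (f j)"
  shows "Cr r I U (\<lambda>y. \<Sum>j\<in>J. f j y)"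
  using assms(3) by (induction J rule: infinite_finite_induct) (auto intro: Cr_const Cr_add[OF assms(1,2)])

subsection \<open>The chain rule\<close>

text \<open>Continuous partial derivatives force total differentiability: the coordinates of
  \<open>z\<close> are reset to those of \<open>y\<close> one at a time, and the mean value
  inequality controls each reset. Measuring the error by the sum of the coordinate differences suits
  an arbitrary finite index set.\<close>

lemma first_order_approx:
  assumes J: "finite J" and V: "open_in J V" and f: "Cr (Suc 0) J V f" and y: "y \<in> V" and e: "e > 0"
  shows "\<exists>d>0. \<forall>z\<in>coord_space J. (\<forall>j\<in>J. \<bar>z j - y j\<bar> < d) \<longrightarrow>
    \<bar>f z - f y - (\<Sum>j\<in>J. pd j f y * (z j - y j))\<bar> \<le> e * (\<Sum>j\<in>J. \<bar>z j - y j\<bar>)"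
proof -
  \<comment> \<open>The region where every partial derivative is within \<open>e\<close> of its
    value at \<open>y\<close>. The case distinction is there because an empty intersection would not
    stay inside \<open>V\<close>.\<close>
  define V' where "V' = (if J = {} then V else (\<Inter>j\<in>J. {z\<in>V. \<bar>pd j f z - pd j f y\<bar> < e}))"
  have "open_in J {z\<in>V. \<bar>pd j f z - pd j f y\<bar> < e}" if "j \<in> J" for j
  proof -
    have "continuous_on V (pd j f)" using f that by simp
    then have "openin (top_of_set V) (V \<inter> (pd j f) -` ball (pd j f y) e)"
      by (rule continuous_openin_preimage_gen) simp
    moreover have "V \<inter> (pd j f) -` ball (pd j f y) e = {z\<in>V. \<bar>pd j f z - pd j f y\<bar> < e}"
      by (auto simp: dist_real_def abs_minus_commute)
    ultimately show ?thesis using V openin_trans by metis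
  qed
  then have "open_in J V'" unfolding V'_def using V J by auto
  moreover have "y \<in> V'" using y e by (auto simp: V'_def)
  ultimately obtain d where d: "d > 0" "\<forall>z\<in>coord_space J. (\<forall>j\<in>J. \<bar>z j - y j\<bar> < d) \<longrightarrow> z \<in> V'"
    using open_in_iff[OF J, of V'] by blast
  have V'V: "V' \<subseteq> V" by (auto simp: V'_def)
  have pdV': "\<bar>pd j f z - pd j f y\<bar> \<le> e" if "z \<in> V'" "j \<in> J" for z j
    using that unfolding V'_def by (cases "J = {}") (auto intro: less_imp_le)
  have y0: "y \<in> coord_space J" using y open_in_subset[OF V] by auto
  \<comment> \<open>Induction on the set of coordinates in which \<open>z\<close> may differ from
    \<open>y\<close>; \<open>z\<close> is generalised because the hypothesis is applied to
    \<open>z\<close> with one coordinate reset.\<close>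
  have claim: "\<bar>f z - f y - (\<Sum>j\<in>J'. pd j f y * (z j - y j))\<bar> \<le> e * (\<Sum>j\<in>J'. \<bar>z j - y j\<bar>)"
    if "finite J'" "J' \<subseteq> J" "\<forall>j. j \<notin> J' \<longrightarrow> z j = y j" "\<forall>j\<in>J. \<bar>z j - y j\<bar> < d" for J' z
    using that
  proof (induction J' arbitrary: z rule: finite_induct)
    case empty
    then have "z = y" by auto
    then show ?case by simp
  next
    case (insert j J')
    have j: "j \<in> J" using insert by auto
    define z' where "z' = z(j := y j)"
    have zc: "z \<in> coord_space J"
      unfolding coord_space_def
    proof (intro CollectI allI impI)
      fix i assume i: "i \<notin> J"
      then have "z i = y i" using insert.prems insert.hyps by blast
      then show "z i = 0" using i y0 by (simp add: coord_space_def)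
    qed
    have IH: "\<bar>f z' - f y - (\<Sum>j\<in>J'. pd j f y * (z' j - y j))\<bar> \<le> e * (\<Sum>j\<in>J'. \<bar>z' j - y j\<bar>)"
      using insert d by (intro insert.IH) (auto simp: z'_def)
    have s1: "(\<Sum>i\<in>J'. pd i f y * (z' i - y i)) = (\<Sum>i\<in>J'. pd i f y * (z i - y i))"
      using insert by (intro sum.cong) (auto simp: z'_def)
    have s2: "(\<Sum>i\<in>J'. \<bar>z' i - y i\<bar>) = (\<Sum>i\<in>J'. \<bar>z i - y i\<bar>)"
      using insert by (intro sum.cong) (auto simp: z'_def)
    \<comment> \<open>Removing the linear part makes the derivative of \<open>h\<close> the
      deviation of \<open>pd j f\<close> from its value at \<open>y\<close>, which is at most
      \<open>e\<close>.\<close>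
    define h where "h = (\<lambda>t. f (z(j := t)) - pd j f y * t)"
    have inV: "z(j := t) \<in> V'" if "t \<in> closed_segment (y j) (z j)" for t
    proof -
      have "\<bar>t - y j\<bar> \<le> \<bar>z j - y j\<bar>" using that segment_bound(1) by fastforce
      then have "\<bar>t - y j\<bar> < d" using insert j by fastforce
      moreover have "z(j := t) \<in> coord_space J" using zc j by (rule upd_coord_space)
      ultimately show ?thesis using d(2) insert by auto
    qed
    have "norm (h (z j) - h (y j)) \<le> e * norm (z j - y j)"
    proof (rule field_differentiable_bound[of "closed_segment (y j) (z j)" h
          "\<lambda>t. pd j f (z(j := t)) - pd j f y"])
      fix t assume t: "t \<in> closed_segment (y j) (z j)"
      have "((\<lambda>s. f ((z(j := t))(j := s))) has_real_derivative pd j f (z(j := t))) (at ((z(j := t)) j))"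
        using inV[OF t] V'V j by (intro Cr_SucD[OF f]) auto
      then have D: "((\<lambda>s. f (z(j := s))) has_real_derivative pd j f (z(j := t))) (at t)" by simp
      have "(h has_real_derivative pd j f (z(j := t)) - pd j f y) (at t)"
        unfolding h_def by (auto intro!: derivative_eq_intros D)
      then show "(h has_real_derivative pd j f (z(j := t)) - pd j f y)
          (at t within closed_segment (y j) (z j))"
        by (rule has_field_derivative_at_within)
      show "norm (pd j f (z(j := t)) - pd j f y) \<le> e" using pdV'[OF inV[OF t] j] by simp
    qed auto
    then have "\<bar>f z - f z' - pd j f y * (z j - y j)\<bar> \<le> e * \<bar>z j - y j\<bar>"
      by (simp add: h_def z'_def algebra_simps)
    then show ?case using IH insert.hyps
      by (simp add: s1 s2 distrib_left)
  qed
  show ?thesis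
  proof (intro exI[of _ d] conjI ballI impI)
    fix z assume z: "z \<in> coord_space J" "\<forall>j\<in>J. \<bar>z j - y j\<bar> < d"
    then show "\<bar>f z - f y - (\<Sum>j\<in>J. pd j f y * (z j - y j))\<bar> \<le> e * (\<Sum>j\<in>J. \<bar>z j - y j\<bar>)"
      using y0 J by (intro claim) (auto simp: coord_space_def)
  qed (rule d(1))
qed

text \<open>Formulated for curves, since a partial derivative moves a single variable and vertical
  curves are needed as well. \<open>gc\<close> confines the curve to the coordinate space only near
  \<open>t\<close>, which is all that a derivative sees.\<close>

lemma chain_rule:
  assumes J: "finite J" and V: "open_in J V" and f: "Cr (Suc 0) J V f" and gt: "g t \<in> V"
    and g: "\<And>j. j \<in> J \<Longrightarrow> ((\<lambda>s. g s j) has_real_derivative d j) (at t)"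
    and gc: "\<forall>\<^sub>F s in nhds t. g s \<in> coord_space J"
  shows "((\<lambda>s. f (g s)) has_real_derivative (\<Sum>j\<in>J. pd j f (g t) * d j)) (at t)"
proof -
  define R where "R = (\<lambda>s. f (g s) - f (g t) - (\<Sum>j\<in>J. pd j f (g t) * (g s j - g t j)))"
  have "((\<lambda>s. (R s - R t) / (s - t)) \<longlongrightarrow> 0) (at t)"
    unfolding tendsto_iff
  proof (intro allI impI)
    fix e :: real assume e: "e > 0"
    \<comment> \<open>The total size of the difference quotients tends to \<open>S - 1\<close>, so
      it is below \<open>S\<close> near \<open>t\<close>; the tolerance \<open>e / S / 2\<close>
      then yields a remainder smaller than \<open>e\<close> relative to
      \<open>\<bar>s - t\<bar>\<close>.\<close>
    define S where "S = (\<Sum>j\<in>J. \<bar>d j\<bar>) + 1"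
    have S: "S > 0" unfolding S_def by (simp add: sum_nonneg add_nonneg_pos)
    obtain \<delta> where \<delta>: "\<delta> > 0" "\<forall>z\<in>coord_space J. (\<forall>j\<in>J. \<bar>z j - g t j\<bar> < \<delta>) \<longrightarrow>
      \<bar>f z - f (g t) - (\<Sum>j\<in>J. pd j f (g t) * (z j - g t j))\<bar> \<le> e / S / 2 * (\<Sum>j\<in>J. \<bar>z j - g t j\<bar>)"
      using first_order_approx[OF J V f gt, of "e / S / 2"] e S by auto
    have lim: "((\<lambda>s. g s j) \<longlongrightarrow> g t j) (at t)" if "j \<in> J" for j
      using DERIV_isCont[OF g[OF that]] by (simp add: isCont_def)
    have ev1: "\<forall>\<^sub>F s in at t. \<forall>j\<in>J. \<bar>g s j - g t j\<bar> < \<delta>"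
      using J lim \<delta>(1) by (intro eventually_ball_finite) (auto simp: tendsto_iff dist_real_def)
    have "((\<lambda>s. \<Sum>j\<in>J. \<bar>(g s j - g t j) / (s - t)\<bar>) \<longlongrightarrow> (\<Sum>j\<in>J. \<bar>d j\<bar>)) (at t)"
      using g by (intro tendsto_sum tendsto_rabs) (auto simp: has_field_derivative_iff)
    then have ev2: "\<forall>\<^sub>F s in at t. (\<Sum>j\<in>J. \<bar>(g s j - g t j) / (s - t)\<bar>) < S"
      by (rule order_tendstoD) (simp add: S_def)
    have ev3: "\<forall>\<^sub>F s in at t. g s \<in> coord_space J" using gc by (simp add: eventually_nhds_conv_at)
    have ev4: "\<forall>\<^sub>F s in at t. s \<noteq> t" by (simp add: eventually_at_filter)
    show "\<forall>\<^sub>F s in at t. dist ((R s - R t) / (s - t)) 0 < e"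
      using ev1 ev2 ev3 ev4
    proof eventually_elim
      case (elim s)
      have "\<bar>R s\<bar> \<le> e / S / 2 * (\<Sum>j\<in>J. \<bar>g s j - g t j\<bar>)" using elim \<delta> by (auto simp: R_def)
      also have "(\<Sum>j\<in>J. \<bar>g s j - g t j\<bar>) = (\<Sum>j\<in>J. \<bar>(g s j - g t j) / (s - t)\<bar>) * \<bar>s - t\<bar>"
        using elim(4) by (simp add: sum_distrib_right abs_mult)
      also have "e / S / 2 * ((\<Sum>j\<in>J. \<bar>(g s j - g t j) / (s - t)\<bar>) * \<bar>s - t\<bar>) \<le> e / S / 2 * (S * \<bar>s - t\<bar>)"
        using elim(2) e S by (intro mult_left_mono mult_right_mono) auto
      also have "\<dots> < e * \<bar>s - t\<bar>" using e S elim(4) by simp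
      finally have "\<bar>R s\<bar> < e * \<bar>s - t\<bar>" .
      moreover have "R t = 0" by (simp add: R_def)
      ultimately show ?case using elim(4) by (simp add: dist_real_def divide_simps)
    qed
  qed
  then have R: "(R has_real_derivative 0) (at t)" by (simp add: has_field_derivative_iff)
  have "((\<lambda>s. R s + f (g t) + (\<Sum>j\<in>J. pd j f (g t) * (g s j - g t j))) has_real_derivative
      (\<Sum>j\<in>J. pd j f (g t) * d j)) (at t)"
    by (rule derivative_eq_intros R g refl | assumption)+ (simp add: mult.commute)
  then show ?thesis by (simp add: R_def)
qed

lemma has_derivative_along:
  assumes "finite J" "open_in J V" "Cr (Suc 0) J V f" "\<And>y. y \<in> U \<Longrightarrow> g y \<in> V"
    "finite I" "open_in I U" "y \<in> U" "i \<in> I"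
    "\<And>j. j \<in> J \<Longrightarrow> (\<lambda>t. g (y(i := t)) j) field_differentiable at (y i)"
  shows "((\<lambda>t. f (g (y(i := t)))) has_real_derivative
    (\<Sum>j\<in>J. pd j f (g y) * pd i (\<lambda>y. g y j) y)) (at (y i))"
proof -
  have "((\<lambda>t. f (g (y(i := t)))) has_real_derivative
    (\<Sum>j\<in>J. pd j f (g (y(i := y i))) * pd i (\<lambda>y. g y j) y)) (at (y i))"
  proof (rule chain_rule[OF assms(1-3)])
    show "((\<lambda>s. g (y(i := s)) j) has_real_derivative pd i (\<lambda>y. g y j) y) (at (y i))" if "j \<in> J" for j
      unfolding pd_def using assms(9)[OF that] by (simp add: DERIV_deriv_iff_field_differentiable)
    show "\<forall>\<^sub>F s in nhds (y i). g (y(i := s)) \<in> coord_space J"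
      using open_in_upd[OF assms(5-8)]
      by eventually_elim (use assms(2,4) open_in_subset in blast)
  qed (use assms in auto)
  then show ?thesis by simp
qed

lemma pd_compose:
  assumes "finite J" "open_in J V" "Cr (Suc 0) J V f" "\<And>y. y \<in> U \<Longrightarrow> g y \<in> V"
    "finite I" "open_in I U" "y \<in> U" "i \<in> I" "\<And>j. j \<in> J \<Longrightarrow> Cr (Suc 0) I U (\<lambda>y. g y j)"
  shows "pd i (\<lambda>y. f (g y)) y = (\<Sum>j\<in>J. pd j f (g y) * pd i (\<lambda>y. g y j) y)"
proof -
  have "(\<lambda>t. g (y(i := t)) j) field_differentiable at (y i)" if "j \<in> J" for j
    by (rule Cr_Suc_fd[OF assms(9)[OF that] assms(8,7)])
  note * = has_derivative_along[OF assms(1-8) this]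
  show ?thesis
    unfolding pd_def[of _ "\<lambda>y. f (g y)"] by (rule DERIV_imp_deriv[OF *])
qed

lemma Cr_compose:
  assumes "finite J" "open_in J V" "Cr r J V f" "\<And>y. y \<in> U \<Longrightarrow> g y \<in> V"
    "finite I" "open_in I U" "\<And>j. j \<in> J \<Longrightarrow> Cr r I U (\<lambda>y. g y j)"
  shows "Cr r I U (\<lambda>y. f (g y))"
  using assms(3,7)
proof (induction r arbitrary: f)
  case 0
  \<comment> \<open>Coordinates outside \<open>J\<close> vanish on \<open>V\<close>, so continuity
    of the whole map follows from that of the coordinates in \<open>J\<close>.\<close>
  have gc: "continuous_on U g"
  proof (rule continuous_on_coordinatewise_then_product)
    fix j show "continuous_on U (\<lambda>y. g y j)"
    proof (cases "j \<in> J")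
      case False
      then have "g y j = 0" if "y \<in> U" for y
        using assms(4)[OF that] open_in_subset[OF assms(2)] by (auto simp: coord_space_def)
      then show ?thesis using continuous_on_cong[of U U "\<lambda>y. g y j" "\<lambda>_. 0"] by simp
    qed (use 0 in auto)
  qed
  have "continuous_on V f" using 0 by simp
  then show ?case using continuous_on_compose2[of V f U g] gc assms(4) by (simp add: image_subset_iff)
next
  case (Suc r)
  have f1: "Cr (Suc 0) J V f" using Suc.prems(1) by (rule Cr_mono) simp
  have g1: "Cr (Suc 0) I U (\<lambda>y. g y j)" if "j \<in> J" for j using Suc.prems(2)[OF that] by (rule Cr_mono) simp
  have gr: "Cr r I U (\<lambda>y. g y j)" if "j \<in> J" for j using Suc.prems(2)[OF that] by (rule Cr_mono) simp
  have "continuous_on U (\<lambda>y. f (g y))"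
  proof -
    have "Cr r I U (\<lambda>y. f (g y))"
      by (rule Suc.IH[OF Cr_Suc_imp[OF Suc.prems(1)] gr])
    then show ?thesis by (rule Cr_continuous)
  qed
  moreover have "Cr r I U (pd i (\<lambda>y. f (g y)))" if "i \<in> I" for i
  proof (rule Cr_cong[OF assms(5,6)])
    show "Cr r I U (\<lambda>y. \<Sum>j\<in>J. pd j f (g y) * pd i (\<lambda>y. g y j) y)"
    proof (intro Cr_sum[OF assms(5,6)] Cr_mult[OF assms(5,6)])
      fix j assume j: "j \<in> J"
      have "Cr r J V (pd j f)" using Suc.prems(1) j by simp
      then show "Cr r I U (\<lambda>y. pd j f (g y))" by (rule Suc.IH[OF _ gr])
      show "Cr r I U (pd i (\<lambda>y. g y j))" using Suc.prems(2)[OF j] that by simp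
    qed
    show "(\<Sum>j\<in>J. pd j f (g y) * pd i (\<lambda>y. g y j) y) = pd i (\<lambda>y. f (g y)) y" if "y \<in> U" for y
      by (rule pd_compose[symmetric, OF assms(1,2) f1 assms(4-6) that \<open>i \<in> I\<close> g1])
  qed
  moreover have "(\<lambda>t. f (g (y(i := t)))) field_differentiable at (y i)" if "i \<in> I" "y \<in> U" for i y
  proof -
    have "(\<lambda>t. g (y(i := t)) j) field_differentiable at (y i)" if "j \<in> J" for j
      by (rule Cr_Suc_fd[OF g1[OF that] \<open>i \<in> I\<close> \<open>y \<in> U\<close>])
    note * = has_derivative_along[OF assms(1,2) f1 assms(4-6) that(2,1) this]
    show ?thesis
      unfolding field_differentiable_def by (rule exI, rule *)
  qed
  ultimately show ?case unfolding Cr.simps by (intro conjI ballI)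
qed

subsection \<open>Smooth functions\<close>

lemma smooth_Cr: "smooth_fun I U f \<Longrightarrow> Cr r I U f"
  by (simp add: smooth_fun_def)

lemma smooth_cong:
  "finite I \<Longrightarrow> open_in I U \<Longrightarrow> smooth_fun I U f \<Longrightarrow> (\<And>y. y \<in> U \<Longrightarrow> f y = g y) \<Longrightarrow> smooth_fun I U g"
  unfolding smooth_fun_def by (metis Cr_cong)

lemma smooth_subset: "smooth_fun I U f \<Longrightarrow> U' \<subseteq> U \<Longrightarrow> smooth_fun I U' f"
  unfolding smooth_fun_def by (metis Cr_subset)

lemma smooth_local:
  assumes "open_in I U" "\<And>y. y \<in> U \<Longrightarrow> \<exists>W. open_in I W \<and> y \<in> W \<and> W \<subseteq> U \<and> smooth_fun I W f"
  shows "smooth_fun I U f"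
  unfolding smooth_fun_def
proof
  fix r show "Cr r I U f" using assms(2) unfolding smooth_fun_def by (intro Cr_local[OF assms(1)]) blast
qed

lemma smooth_const: "smooth_fun I U (\<lambda>_. c)"
  by (simp add: smooth_fun_def Cr_const)

lemma smooth_coord: "smooth_fun I U (\<lambda>y. y j)"
  by (simp add: smooth_fun_def Cr_coord)

lemma smooth_add:
  "finite I \<Longrightarrow> open_in I U \<Longrightarrow> smooth_fun I U f \<Longrightarrow> smooth_fun I U g \<Longrightarrow> smooth_fun I U (\<lambda>y. f y + g y)"
  by (simp add: smooth_fun_def Cr_add)

lemma smooth_mult:
  "finite I \<Longrightarrow> open_in I U \<Longrightarrow> smooth_fun I U f \<Longrightarrow> smooth_fun I U g \<Longrightarrow> smooth_fun I U (\<lambda>y. f y * g y)"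
  by (simp add: smooth_fun_def Cr_mult)

lemma smooth_diff:
  assumes "finite I" "open_in I U" "smooth_fun I U f" "smooth_fun I U g"
  shows "smooth_fun I U (\<lambda>y. f y - g y)"
  using smooth_add[OF assms(1-3) smooth_mult[OF assms(1,2) smooth_const[of I U "-1"] assms(4)]] by simp

lemma smooth_sum:
  "finite I \<Longrightarrow> open_in I U \<Longrightarrow> (\<And>j. j \<in> J \<Longrightarrow> smooth_fun I U (f j)) \<Longrightarrow> smooth_fun I U (\<lambda>y. \<Sum>j\<in>J. f j y)"
  by (simp add: smooth_fun_def Cr_sum)

lemma smooth_prod:
  "finite I \<Longrightarrow> open_in I U \<Longrightarrow> (\<And>j. j \<in> J \<Longrightarrow> smooth_fun I U (f j)) \<Longrightarrow> smooth_fun I U (\<lambda>y. \<Prod>j\<in>J. f j y)"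
  by (induction J rule: infinite_finite_induct) (auto intro: smooth_const smooth_mult)

lemma smooth_power:
  "finite I \<Longrightarrow> open_in I U \<Longrightarrow> smooth_fun I U f \<Longrightarrow> smooth_fun I U (\<lambda>y. f y ^ n)"
  by (induction n) (auto intro: smooth_const smooth_mult)

lemma smooth_cmult:
  assumes "finite I" "open_in I U" "smooth_fun I U f"
  shows "smooth_fun I U (\<lambda>y. c * f y)"
  using smooth_mult[OF assms(1,2) smooth_const assms(3)] .

lemma smooth_divide:
  assumes "finite I" "open_in I U" "smooth_fun I U f"
  shows "smooth_fun I U (\<lambda>y. f y / c)"
  using smooth_mult[OF assms(1-3) smooth_const, of "1/c"] by simp

lemma smooth_if:
  "(P \<Longrightarrow> smooth_fun I U f) \<Longrightarrow> (\<not> P \<Longrightarrow> smooth_fun I U g) \<Longrightarrow> smooth_fun I U (\<lambda>y. if P then f y else g y)"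
  by (cases P) auto

lemma smooth_pd: "smooth_fun I U f \<Longrightarrow> i \<in> I \<Longrightarrow> smooth_fun I U (pd i f)"
  unfolding smooth_fun_def by (metis Cr.simps(2))

lemma smooth_continuous: "smooth_fun I U f \<Longrightarrow> continuous_on U f"
  unfolding smooth_fun_def using Cr_continuous by blast

lemma smooth_compose:
  assumes "finite J" "open_in J V" "smooth_fun J V f" "\<And>y. y \<in> U \<Longrightarrow> g y \<in> V"
    "finite I" "open_in I U" "\<And>j. j \<in> J \<Longrightarrow> smooth_fun I U (\<lambda>y. g y j)"
  shows "smooth_fun I U (\<lambda>y. f (g y))"
  unfolding smooth_fun_def
  by (intro allI Cr_compose[OF assms(1,2) smooth_Cr[OF assms(3)] assms(4,5,6)] smooth_Cr[OF assms(7)])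

lemma smooth_pd_compose:
  assumes "finite J" "open_in J V" "smooth_fun J V f" "\<And>y. y \<in> U \<Longrightarrow> g y \<in> V"
    "finite I" "open_in I U" "y \<in> U" "i \<in> I" "\<And>j. j \<in> J \<Longrightarrow> smooth_fun I U (\<lambda>y. g y j)"
  shows "pd i (\<lambda>y. f (g y)) y = (\<Sum>j\<in>J. pd j f (g y) * pd i (\<lambda>y. g y j) y)"
  by (rule pd_compose[OF assms(1,2) smooth_Cr[OF assms(3)] assms(4-8) smooth_Cr[OF assms(9)]])

lemma smooth_has_pd:
  assumes "smooth_fun I U f" "y \<in> U" "i \<in> I"
  shows "((\<lambda>t. f (y(i := t))) has_real_derivative pd i f y) (at (y i))"
  using Cr_SucD[OF smooth_Cr[OF assms(1)] assms(2,3)] .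

lemma smooth_pd_add:
  assumes "smooth_fun I U f" "smooth_fun I U g" "y \<in> U" "i \<in> I"
  shows "pd i (\<lambda>y. f y + g y) y = pd i f y + pd i g y"
  by (rule pd_add[OF smooth_Cr[OF assms(1)] smooth_Cr[OF assms(2)] assms(3,4)])

lemma smooth_pd_mult:
  assumes "smooth_fun I U f" "smooth_fun I U g" "y \<in> U" "i \<in> I"
  shows "pd i (\<lambda>y. f y * g y) y = f y * pd i g y + pd i f y * g y"
  by (rule pd_mult[OF smooth_Cr[OF assms(1)] smooth_Cr[OF assms(2)] assms(3,4)])

lemma pd_const: "pd i (\<lambda>_. c) = (\<lambda>_. 0)"
  by (auto simp: pd_def fun_eq_iff)

lemma smooth_pd_cmult:
  assumes "smooth_fun I U f" "y \<in> U" "i \<in> I"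
  shows "pd i (\<lambda>y. c * f y) y = c * pd i f y"
  using smooth_pd_mult[OF smooth_const assms] by (simp add: pd_const)

lemma smooth_pd_sum:
  assumes "finite I" "open_in I U" "\<And>j. j \<in> J \<Longrightarrow> smooth_fun I U (f j)" "y \<in> U" "i \<in> I"
  shows "pd i (\<lambda>y. \<Sum>j\<in>J. f j y) y = (\<Sum>j\<in>J. pd i (f j) y)"
  using assms(3)
proof (induction J rule: infinite_finite_induct)
  case (insert j J)
  then show ?case
    using smooth_pd_add[of I U "f j" "\<lambda>y. \<Sum>j\<in>J. f j y" y i] smooth_sum[OF assms(1,2), of J f] assms(4,5)
    by simp
qed (auto simp: pd_const)

subsection \<open>Symmetry of second derivatives\<close>

text \<open>The mean value theorem is applied to the second difference over a square of side
  \<open>h\<close>, once in direction \<open>i\<close> and once in direction \<open>j\<close>. The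
  left-hand side does not change when \<open>i\<close> and \<open>j\<close> are exchanged.\<close>

lemma mixed_increment:
  assumes f: "smooth_fun I U f" and ij: "i \<in> I" "j \<in> I" "i \<noteq> j" and h: "h > 0"
    and box: "\<And>s t. s \<in> {y i..y i + h} \<Longrightarrow> t \<in> {y j..y j + h} \<Longrightarrow> y(i := s, j := t) \<in> U"
  shows "\<exists>s\<in>{y i..y i + h}. \<exists>t\<in>{y j..y j + h}.
    f (y(i := y i + h, j := y j + h)) - f (y(i := y i + h)) - f (y(j := y j + h)) + f y
      = h * h * pd j (pd i f) (y(i := s, j := t))"
proof -
  have Di: "((\<lambda>s. f (y(i := s, j := t))) has_real_derivative pd i f (y(i := s, j := t))) (at s)"
    if "s \<in> {y i..y i + h}" "t \<in> {y j..y j + h}" for s t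
  proof -
    have "((\<lambda>s'. f ((y(i := s, j := t))(i := s'))) has_real_derivative pd i f (y(i := s, j := t)))
      (at ((y(i := s, j := t)) i))"
      using ij that by (intro smooth_has_pd[OF f] box) auto
    then show ?thesis using ij by (simp add: fun_upd_twist)
  qed
  have Dj: "((\<lambda>t. pd i f (y(i := s, j := t))) has_real_derivative pd j (pd i f) (y(i := s, j := t))) (at t)"
    if "s \<in> {y i..y i + h}" "t \<in> {y j..y j + h}" for s t
  proof -
    have "((\<lambda>t'. pd i f ((y(i := s, j := t))(j := t'))) has_real_derivative pd j (pd i f) (y(i := s, j := t)))
      (at ((y(i := s, j := t)) j))"
      using ij that by (intro smooth_has_pd[OF smooth_pd[OF f]] box) auto
    then show ?thesis using ij by simp
  qed
  define G where "G = (\<lambda>s. f (y(i := s, j := y j + h)) - f (y(i := s, j := y j)))"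
  have "\<exists>s. y i < s \<and> s < y i + h \<and> G (y i + h) - G (y i) = (y i + h - y i) *
      (pd i f (y(i := s, j := y j + h)) - pd i f (y(i := s, j := y j)))"
    unfolding G_def using h by (intro MVT2 DERIV_diff Di) auto
  then obtain s where s: "y i < s" "s < y i + h" "G (y i + h) - G (y i) = h *
      (pd i f (y(i := s, j := y j + h)) - pd i f (y(i := s, j := y j)))" by auto
  have "\<exists>t. y j < t \<and> t < y j + h \<and> pd i f (y(i := s, j := y j + h)) - pd i f (y(i := s, j := y j))
      = (y j + h - y j) * pd j (pd i f) (y(i := s, j := t))"
    using h s by (intro MVT2 Dj) auto
  then obtain t where t: "y j < t" "t < y j + h" "pd i f (y(i := s, j := y j + h)) - pd i f (y(i := s, j := y j))
      = h * pd j (pd i f) (y(i := s, j := t))" by auto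
  have "G (y i + h) - G (y i) =
      f (y(i := y i + h, j := y j + h)) - f (y(i := y i + h)) - f (y(j := y j + h)) + f y"
    using ij by (auto simp: G_def fun_upd_idem)
  then show ?thesis using s t by (intro bexI[of _ s] bexI[of _ t]) auto
qed

text \<open>On a small square the same second difference equals \<open>h * h\<close> times either
  mixed derivative, each taken at some point of the square. By continuity both values lie within
  \<open>e\<close> of those at \<open>y\<close>, which is too close if these differ by twice
  \<open>e\<close>.\<close>

lemma pd_commute:
  assumes I: "finite I" "open_in I U" and f: "smooth_fun I U f" and y: "y \<in> U" and ij: "i \<in> I" "j \<in> I"
  shows "pd i (pd j f) y = pd j (pd i f) y"
proof (rule ccontr)
  assume ne: "pd i (pd j f) y \<noteq> pd j (pd i f) y"
  then have nij: "i \<noteq> j" by auto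
  define e where "e = \<bar>pd i (pd j f) y - pd j (pd i f) y\<bar> / 2"
  have e: "e > 0" using ne by (simp add: e_def)
  have op: "open_in I {z\<in>U. \<bar>g z - g y\<bar> < e}" if "continuous_on U g" for g :: "('a \<Rightarrow> real) \<Rightarrow> real"
  proof -
    have "openin (top_of_set U) (U \<inter> g -` ball (g y) e)"
      using that by (rule continuous_openin_preimage_gen) simp
    moreover have "U \<inter> g -` ball (g y) e = {z\<in>U. \<bar>g z - g y\<bar> < e}"
      by (auto simp: dist_real_def abs_minus_commute)
    ultimately show ?thesis using I(2) openin_trans by metis
  qed
  define V where "V = {z\<in>U. \<bar>pd i (pd j f) z - pd i (pd j f) y\<bar> < e} \<inter>
    {z\<in>U. \<bar>pd j (pd i f) z - pd j (pd i f) y\<bar> < e}"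
  have "open_in I V" unfolding V_def
    by (intro openin_Int op smooth_continuous[of I] smooth_pd f ij)
  moreover have "y \<in> V" using y e by (auto simp: V_def)
  ultimately obtain d where d: "d > 0" "\<forall>z\<in>coord_space I. (\<forall>k\<in>I. \<bar>z k - y k\<bar> < d) \<longrightarrow> z \<in> V"
    using open_in_iff[OF I(1), of V] by blast
  define h where "h = d / 2"
  have h: "h > 0" using d by (simp add: h_def)
  have box: "y(i := s, j := t) \<in> V" if "s \<in> {y i..y i + h}" "t \<in> {y j..y j + h}" for s t
  proof -
    have "y(i := s, j := t) \<in> coord_space I"
      by (rule upd_coord_space[OF upd_coord_space[OF subsetD[OF open_in_subset[OF I(2)] y] ij(1)] ij(2)])
    then show ?thesis using that d h by (auto simp: h_def)
  qed
  have boxU: "y(i := s, j := t) \<in> U" if "s \<in> {y i..y i + h}" "t \<in> {y j..y j + h}" for s t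
    using box[OF that] by (auto simp: V_def)
  obtain s t where st: "s\<in>{y i..y i + h}" "t\<in>{y j..y j + h}"
    "f (y(i := y i + h, j := y j + h)) - f (y(i := y i + h)) - f (y(j := y j + h)) + f y
      = h * h * pd j (pd i f) (y(i := s, j := t))"
    using mixed_increment[OF f ij nij h boxU] by blast
  obtain t' s' where st': "t'\<in>{y j..y j + h}" "s'\<in>{y i..y i + h}"
    "f (y(j := y j + h, i := y i + h)) - f (y(j := y j + h)) - f (y(i := y i + h)) + f y
      = h * h * pd i (pd j f) (y(j := t', i := s'))"
  proof -
    have "y(j := t, i := s) \<in> U" if "t \<in> {y j..y j + h}" "s \<in> {y i..y i + h}" for s t
      using boxU[OF that(2,1)] by (simp add: fun_upd_twist[OF nij[symmetric]])
    from mixed_increment[OF f ij(2,1) nij[symmetric] h this] show thesis using that by blast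
  qed
  have "h * h * pd i (pd j f) (y(i := s', j := t')) = h * h * pd j (pd i f) (y(i := s, j := t))"
    using st(3) st'(3) unfolding fun_upd_twist[OF nij[symmetric]] by linarith
  then have "pd i (pd j f) (y(i := s', j := t')) = pd j (pd i f) (y(i := s, j := t))" using h by simp
  moreover have "\<bar>pd i (pd j f) (y(i := s', j := t')) - pd i (pd j f) y\<bar> < e"
    using box[OF st'(2,1)] by (auto simp: V_def)
  moreover have "\<bar>pd j (pd i f) (y(i := s, j := t)) - pd j (pd i f) y\<bar> < e"
    using box[OF st(1,2)] by (auto simp: V_def)
  ultimately have "\<bar>pd i (pd j f) y - pd j (pd i f) y\<bar> < e + e" by linarith
  then show False by (simp add: e_def)
qed

lemma pds_Nil [simp]: "pds [] f = f" and pds_Cons [simp]: "pds (i # \<mu>s) f = pd i (pds \<mu>s f)"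
  by (auto simp: pds_def)

lemma pds_append: "pds (\<mu>s @ \<nu>s) f = pds \<mu>s (pds \<nu>s f)"
  by (induction \<mu>s) auto

lemma smooth_pds: "smooth_fun I U f \<Longrightarrow> set \<mu>s \<subseteq> I \<Longrightarrow> smooth_fun I U (pds \<mu>s f)"
  by (induction \<mu>s) (auto intro: smooth_pd)

lemma pds_cong:
  assumes "finite I" "open_in I U" "set \<mu>s \<subseteq> I" "\<And>z. z \<in> U \<Longrightarrow> f z = g z" "y \<in> U"
  shows "pds \<mu>s f y = pds \<mu>s g y"
  using assms(3,5)
proof (induction \<mu>s arbitrary: y)
  case (Cons i \<mu>s)
  then have i: "i \<in> I" "set \<mu>s \<subseteq> I" by auto
  show ?case unfolding pds_Cons
    by (rule pd_cong[OF assms(1,2) Cons.prems(2) i(1) Cons.IH[OF i(2)]])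
qed (use assms in simp)

lemma pds_move:
  assumes "finite I" "open_in I U" "smooth_fun I U f" "i \<in> I" "set \<mu>s \<subseteq> I" "set \<nu>s \<subseteq> I" "y \<in> U"
  shows "pds (\<mu>s @ i # \<nu>s) f y = pds (i # \<mu>s @ \<nu>s) f y"
  using assms(5,7)
proof (induction \<mu>s arbitrary: y)
  case (Cons j \<mu>s)
  have j: "j \<in> I" "set \<mu>s \<subseteq> I" using Cons.prems by auto
  have "pds ((j # \<mu>s) @ i # \<nu>s) f y = pd j (pds (\<mu>s @ i # \<nu>s) f) y" by simp
  also have "\<dots> = pd j (pds (i # \<mu>s @ \<nu>s) f) y"
    by (rule pd_cong[OF assms(1,2) Cons.prems(2) j(1) Cons.IH[OF j(2)]])
  also have "\<dots> = pd i (pd j (pds (\<mu>s @ \<nu>s) f)) y"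
    unfolding pds_Cons using j assms(6)
    by (intro pd_commute[OF assms(1,2)] smooth_pds assms(3) Cons.prems assms(4)) auto
  finally show ?case by simp
qed simp

lemma pds_perm:
  assumes "finite I" "open_in I U" "smooth_fun I U f" "mset \<mu>s = mset \<nu>s" "set \<mu>s \<subseteq> I" "y \<in> U"
  shows "pds \<mu>s f y = pds \<nu>s f y"
  using assms(4-6)
proof (induction \<mu>s arbitrary: \<nu>s y)
  case (Cons i \<mu>s)
  have "i \<in> set \<nu>s" using mset_eq_setD[OF Cons.prems(1)] by auto
  then obtain as bs where \<nu>: "\<nu>s = as @ i # bs" by (meson split_list)
  have i: "i \<in> I" "set \<mu>s \<subseteq> I" using Cons.prems by auto
  have sub: "set as \<subseteq> I" "set bs \<subseteq> I"
    using mset_eq_setD[OF Cons.prems(1)] Cons.prems(2) \<nu> by auto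
  have m: "mset \<mu>s = mset (as @ bs)" using Cons.prems(1) \<nu> by simp
  have "pds (i # \<mu>s) f y = pds (i # as @ bs) f y"
    unfolding pds_Cons by (rule pd_cong[OF assms(1,2) Cons.prems(3) i(1) Cons.IH[OF m i(2)]])
  also have "\<dots> = pds \<nu>s f y"
    unfolding \<nu> by (rule pds_move[OF assms(1-3) i(1) sub Cons.prems(3), symmetric])
  finally show ?case .
qed simp

text \<open>Removes the arbitrary choice of an ordering hidden in \<open>pdm\<close>.\<close>

lemma pdm_eq:
  assumes "finite I" "open_in I U" "smooth_fun I U f" "set \<mu>s \<subseteq> I" "y \<in> U"
  shows "pdm (mset \<mu>s) f y = pds \<mu>s f y"
proof -
  have "mset (SOME \<nu>s. mset \<nu>s = mset \<mu>s) = mset \<mu>s" by (rule someI) simp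
  then show ?thesis
    unfolding pdm_def using assms
    by (intro pds_perm[OF assms(1-3)]) (auto dest: mset_eq_setD)
qed

lemma pdm_cong:
  assumes "finite I" "open_in I U" "set_mset M \<subseteq> I" "\<And>z. z \<in> U \<Longrightarrow> f z = g z" "y \<in> U"
  shows "pdm M f y = pdm M g y"
proof -
  have "mset (SOME \<nu>s. mset \<nu>s = M) = M" by (rule someI_ex) (rule ex_mset)
  then show ?thesis unfolding pdm_def
    using assms by (intro pds_cong[OF assms(1,2)]) (auto simp flip: set_mset_mset)
qed

lemma smooth_pdm:
  assumes "smooth_fun I U f" "set_mset M \<subseteq> I"
  shows "smooth_fun I U (pdm M f)"
proof -
  have "mset (SOME \<nu>s. mset \<nu>s = M) = M" by (rule someI_ex) (rule ex_mset)
  then show ?thesis unfolding pdm_def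
    using assms by (intro smooth_pds) (auto simp flip: set_mset_mset)
qed

lemma pdm_empty [simp]: "pdm {#} f = f"
  by (simp add: pdm_def)

lemma pdm_add_mset:
  assumes "finite I" "open_in I U" "smooth_fun I U f" "i \<in> I" "set_mset M \<subseteq> I" "y \<in> U"
  shows "pdm (add_mset i M) f y = pd i (pdm M f) y"
proof -
  obtain \<mu>s where M: "M = mset \<mu>s" by (metis ex_mset)
  have s: "set \<mu>s \<subseteq> I" "set (i # \<mu>s) \<subseteq> I" using assms M by auto
  have "pdm (add_mset i M) f y = pds (i # \<mu>s) f y"
    using pdm_eq[OF assms(1-3) s(2) assms(6)] by (simp add: M)
  also have "\<dots> = pd i (pdm M f) y"
    unfolding pds_Cons M
    by (rule pd_cong[OF assms(1,2,6,4) pdm_eq[OF assms(1-3) s(1), symmetric]])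
  finally show ?thesis .
qed

subsection \<open>Smooth functions of one real variable\<close>

lemma smooth_real_cong:
  assumes "open T" "\<And>t. t \<in> T \<Longrightarrow> g t = h t" "smooth_real T g"
  shows "smooth_real T h"
proof -
  have ev: "(deriv ^^ r) g t = (deriv ^^ r) h t" if "t \<in> T" for r t
    using that
  proof (induction r arbitrary: t)
    case (Suc r)
    have "\<forall>\<^sub>F x in nhds t. (deriv ^^ r) g x = (deriv ^^ r) h x"
      using eventually_nhds_in_open[OF assms(1) Suc.prems] by eventually_elim (rule Suc.IH)
    then show ?case by (simp add: deriv_cong_ev)
  qed (use assms in auto)
  show ?thesis unfolding smooth_real_def
  proof (intro allI ballI)
    fix r t assume t: "t \<in> T"
    have "\<forall>\<^sub>F x in nhds t. (deriv ^^ r) g x = (deriv ^^ r) h x"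
      using eventually_nhds_in_open[OF assms(1) t] by eventually_elim (rule ev)
    moreover have "(deriv ^^ r) g field_differentiable at t" using assms(3) t by (auto simp: smooth_real_def)
    ultimately show "(deriv ^^ r) h field_differentiable at t"
      by (rule field_differentiable_cong_ev)
  qed
qed

lemma smooth_real_subset: "smooth_real T g \<Longrightarrow> T' \<subseteq> T \<Longrightarrow> smooth_real T' g"
  by (auto simp: smooth_real_def)

lemma smooth_real_DERIV: "smooth_real T g \<Longrightarrow> t \<in> T \<Longrightarrow> (g has_real_derivative deriv g t) (at t)"
  unfolding smooth_real_def by (metis DERIV_deriv_iff_field_differentiable funpow_0)

lemma line_DERIV:
  assumes "finite I" "open_in I U" "smooth_fun I U f" "a \<in> coord_space I" "b \<in> coord_space I"
    "(\<lambda>i. a i + t * b i) \<in> U"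
  shows "((\<lambda>t. f (\<lambda>i. a i + t * b i)) has_real_derivative
    (\<Sum>i\<in>I. pd i f (\<lambda>i. a i + t * b i) * b i)) (at t)"
proof (rule chain_rule[OF assms(1,2) smooth_Cr[OF assms(3)]])
  show "(\<lambda>i. a i + t * b i) \<in> U" by fact
  show "((\<lambda>s. a j + s * b j) has_real_derivative b j) (at t)" for j
    by (auto intro!: derivative_eq_intros)
  show "\<forall>\<^sub>F s in nhds t. (\<lambda>i. a i + s * b i) \<in> coord_space I"
    using assms(4,5) by (intro always_eventually) (auto simp: coord_space_def)
qed

text \<open>The vertical curves built later to realise tangent vectors are images of straight lines
  under smooth maps. The derivative along a line is again the restriction of a smooth function, the
  directional derivative \<open>f'\<close>, and this drives the induction on the order.\<close>

lemma smooth_real_line: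
  assumes "finite I" "open_in I U" "smooth_fun I U f" "a \<in> coord_space I" "b \<in> coord_space I"
  shows "open {t. (\<lambda>i. a i + t * b i) \<in> U}" "smooth_real {t. (\<lambda>i. a i + t * b i) \<in> U} (\<lambda>t. f (\<lambda>i. a i + t * b i))"
proof -
  let ?T = "{t. (\<lambda>i. a i + t * b i) \<in> U}"
  show op: "open ?T"
  proof (subst open_subopen, intro ballI)
    fix t assume t: "t \<in> ?T"
    have "\<forall>\<^sub>F s in nhds t. (\<lambda>i. a i + s * b i) \<in> U"
    proof (rule open_in_eventually[OF assms(1,2)])
      show "(\<lambda>i. a i + t * b i) \<in> U" using t by simp
      show "((\<lambda>s. a i + s * b i) \<longlongrightarrow> a i + t * b i) (nhds t)" for i
        by (intro tendsto_intros filterlim_ident)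
      show "\<forall>\<^sub>F s in nhds t. (\<lambda>i. a i + s * b i) \<in> coord_space I"
        using assms(4,5) by (intro always_eventually) (auto simp: coord_space_def)
    qed
    then show "\<exists>T. open T \<and> t \<in> T \<and> T \<subseteq> ?T" unfolding eventually_nhds by auto
  qed
  have "\<forall>t\<in>?T. (deriv ^^ r) (\<lambda>t. f (\<lambda>i. a i + t * b i)) field_differentiable at t" for r
    using assms(3)
  proof (induction r arbitrary: f)
    case 0
    show ?case
    proof
      fix t assume "t \<in> ?T"
      then have "(\<lambda>i. a i + t * b i) \<in> U" by simp
      from line_DERIV[OF assms(1,2) 0 assms(4,5) this]
      show "(deriv ^^ 0) (\<lambda>t. f (\<lambda>i. a i + t * b i)) field_differentiable at t"
        by (auto simp: field_differentiable_def)
    qed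
  next
    case (Suc r)
    define g where "g = (\<lambda>t. f (\<lambda>i. a i + t * b i))"
    define f' where "f' = (\<lambda>y. \<Sum>i\<in>I. pd i f y * b i)"
    have "smooth_fun I U f'"
      unfolding f'_def using Suc.prems
      by (intro smooth_sum[OF assms(1,2)] smooth_mult[OF assms(1,2)] smooth_const smooth_pd)
    note IH = Suc.IH[OF this]
    have eq0: "deriv g t = f' (\<lambda>i. a i + t * b i)" if "t \<in> ?T" for t
    proof -
      from that have "(\<lambda>i. a i + t * b i) \<in> U" by simp
      then show ?thesis
        unfolding g_def f'_def by (rule DERIV_imp_deriv[OF line_DERIV[OF assms(1,2) Suc.prems assms(4,5)]])
    qed
    have eq: "(deriv ^^ n) (deriv g) t = (deriv ^^ n) (\<lambda>t. f' (\<lambda>i. a i + t * b i)) t" if "t \<in> ?T" for n t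
      using that
    proof (induction n arbitrary: t)
      case (Suc n)
      have "\<forall>\<^sub>F x in nhds t. (deriv ^^ n) (deriv g) x = (deriv ^^ n) (\<lambda>t. f' (\<lambda>i. a i + t * b i)) x"
        using eventually_nhds_in_open[OF op Suc.prems] by eventually_elim (rule Suc.IH)
      then show ?case by (simp add: deriv_cong_ev)
    qed (use eq0 in auto)
    show ?case
    proof
      fix t assume t: "t \<in> ?T"
      have "\<forall>\<^sub>F x in nhds t. (deriv ^^ r) (\<lambda>t. f' (\<lambda>i. a i + t * b i)) x = (deriv ^^ r) (deriv g) x"
        using eventually_nhds_in_open[OF op t] by eventually_elim (rule eq[symmetric])
      moreover have "(deriv ^^ r) (\<lambda>t. f' (\<lambda>i. a i + t * b i)) field_differentiable at t"
        using IH t by (rule bspec)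
      ultimately have "(deriv ^^ r) (deriv g) field_differentiable at t"
        by (rule field_differentiable_cong_ev)
      then show "(deriv ^^ Suc r) (\<lambda>t. f (\<lambda>i. a i + t * b i)) field_differentiable at t"
        unfolding g_def by (simp add: funpow_swap1)
    qed
  qed
  then show "smooth_real ?T (\<lambda>t. f (\<lambda>i. a i + t * b i))" by (auto simp: smooth_real_def)
qed

section \<open>Charts\<close>

lemma open_preimage_smooth:
  assumes "open A" "\<And>j. smooth_fun UNIV A (\<lambda>y. g y j)" "open V"
  shows "open {y\<in>A. g y \<in> V}"
proof -
  have "continuous_on A g"
    by (intro continuous_on_coordinatewise_then_product smooth_continuous[OF assms(2)])
  then have "open (A \<inter> g -` V)" using assms by (intro continuous_open_preimage)
  moreover have "A \<inter> g -` V = {y\<in>A. g y \<in> V}" by auto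
  ultimately show ?thesis by simp
qed

lemma smooth_compose_UNIV:
  fixes f :: "('j::finite \<Rightarrow> real) \<Rightarrow> real" and g :: "('i::finite \<Rightarrow> real) \<Rightarrow> 'j \<Rightarrow> real"
  assumes "open V" "smooth_fun UNIV V f" "\<And>y. y \<in> U \<Longrightarrow> g y \<in> V" "open U"
    "\<And>j. smooth_fun UNIV U (\<lambda>y. g y j)"
  shows "smooth_fun UNIV U (\<lambda>y. f (g y))"
  by (rule smooth_compose[where J = UNIV and V = V]) (use assms in simp_all)

lemma atlas_chart:
  assumes "atlas M A" "C \<in> A"
  shows "C \<in> charts M A" "fst C \<subseteq> M" "inj_on (snd C) (fst C)" "open (snd C ` fst C)"
  using assms by (auto simp: atlas_def charts_def is_chart_def)

lemma chartsD:
  assumes "C \<in> charts M A"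
  shows "fst C \<subseteq> M" "inj_on (snd C) (fst C)" "open (snd C ` fst C)"
    "D \<in> A \<Longrightarrow> compatible C D" "D \<in> A \<Longrightarrow> compatible D C"
  using assms by (auto simp: charts_def is_chart_def)

lemma atlas_cover:
  assumes "atlas M A" "x \<in> M"
  obtains C where "C \<in> A" "x \<in> fst C"
  using assms unfolding atlas_def by blast

lemma smooth_mapD:
  assumes "smooth_map N A A' f" "C \<in> A" "D \<in> A'"
  shows "open (snd C ` {x \<in> N \<inter> fst C. f x \<in> fst D})"
    "smooth_fun UNIV (snd C ` {x \<in> N \<inter> fst C. f x \<in> fst D})
       (\<lambda>y. snd D (f (inv_into (fst C) (snd C) y)) j)"
  using assms by (auto simp: smooth_map_def Let_def)

text \<open>\<open>smooth_map\<close> speaks only of the charts in the atlases. An arbitrary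
  compatible pair \<open>X\<close>, \<open>Y\<close> is reached by factoring through atlas charts
  \<open>D\<close> around \<open>x0\<close> and \<open>D'\<close> around \<open>f x0\<close>;
  \<open>W\<close> is the open set on which the whole composite is defined.\<close>

lemma smooth_map_charts_local:
  fixes A :: "('a, 'i::finite) chart set" and A' :: "('b, 'j::finite) chart set"
  assumes A: "atlas M A" and A': "atlas M' A'" and f: "smooth_map N A A' f"
    and N: "N \<subseteq> M" "f ` N \<subseteq> M'" and X: "X \<in> charts M A" and Y: "Y \<in> charts M' A'"
    and y0: "y0 \<in> snd X ` {x \<in> N \<inter> fst X. f x \<in> fst Y}"
  shows "\<exists>W. open W \<and> y0 \<in> W \<and> W \<subseteq> snd X ` {x \<in> N \<inter> fst X. f x \<in> fst Y} \<and>
    (\<forall>j. smooth_fun UNIV W (\<lambda>y. snd Y (f (inv_into (fst X) (snd X) y)) j))"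
proof -
  obtain x0 where x0: "x0 \<in> N" "x0 \<in> fst X" "f x0 \<in> fst Y" "y0 = snd X x0" using y0 by auto
  obtain D where D: "D \<in> A" "x0 \<in> fst D" using atlas_cover[OF A, of x0] x0 N by auto
  obtain D' where D': "D' \<in> A'" "f x0 \<in> fst D'"
  proof -
    have "f x0 \<in> M'" using x0 N by auto
    then show thesis using atlas_cover[OF A'] that by blast
  qed
  note inj = chartsD(2)[OF X] atlas_chart(3)[OF A D(1)] atlas_chart(3)[OF A' D'(1)]
  note cXD = chartsD(4)[OF X D(1), unfolded compatible_def]
  note cDY = chartsD(5)[OF Y D'(1), unfolded compatible_def]
  define A1 where "A1 = snd X ` (fst X \<inter> fst D)"
  define XD where "XD = (\<lambda>y. snd D (inv_into (fst X) (snd X) y))"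
  define W1 where "W1 = snd D ` {x \<in> N \<inter> fst D. f x \<in> fst D'}"
  define g where "g = (\<lambda>y. snd D' (f (inv_into (fst D) (snd D) y)))"
  define A2 where "A2 = snd D' ` (fst D' \<inter> fst Y)"
  define DY where "DY = (\<lambda>y. snd Y (inv_into (fst D') (snd D') y))"
  have A1: "open A1" "\<And>j. smooth_fun UNIV A1 (\<lambda>y. XD y j)"
    using cXD by (auto simp: A1_def XD_def)
  have A2: "open A2" "\<And>j. smooth_fun UNIV A2 (\<lambda>y. DY y j)"
    using cDY by (auto simp: A2_def DY_def)
  have W1: "open W1" "\<And>j. smooth_fun UNIV W1 (\<lambda>y. g y j)"
    using smooth_mapD[OF f D(1) D'(1)] by (simp_all add: W1_def g_def)
  define U where "U = {y\<in>A1. XD y \<in> W1}"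
  have U: "open U" unfolding U_def by (rule open_preimage_smooth[OF A1 W1(1)])
  have sU: "smooth_fun UNIV U (\<lambda>y. g (XD y) j)" for j
    by (rule smooth_compose_UNIV[OF W1(1) W1(2) _ U smooth_subset[OF A1(2)]]) (auto simp: U_def)
  define W where "W = {y\<in>U. g (XD y) \<in> A2}"
  have W: "open W" unfolding W_def by (rule open_preimage_smooth[OF U sU A2(1)])
  have sW: "smooth_fun UNIV W (\<lambda>y. DY (g (XD y)) j)" for j
    by (rule smooth_compose_UNIV[OF A2(1) A2(2) _ W smooth_subset[OF sU]]) (auto simp: W_def)
  have inW: "\<exists>x. x \<in> N \<and> x \<in> fst X \<and> f x \<in> fst Y \<and> y = snd X x \<and> DY (g (XD y)) = snd Y (f x)"
    if y: "y \<in> W" for y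
  proof -
    obtain x where x: "x \<in> fst X" "x \<in> fst D" "y = snd X x" using y by (auto simp: W_def U_def A1_def)
    have XDy: "XD y = snd D x" using x inj by (simp add: XD_def)
    have "snd D x \<in> W1" using y XDy by (auto simp: W_def U_def)
    then obtain x' where x': "x' \<in> N" "x' \<in> fst D" "f x' \<in> fst D'" "snd D x = snd D x'"
      by (auto simp: W1_def)
    then have "x = x'" using x inj by (auto dest: inj_onD)
    then have xN: "x \<in> N" "f x \<in> fst D'" using x' by auto
    have g: "g (XD y) = snd D' (f x)" using XDy x inj by (simp add: g_def)
    have "snd D' (f x) \<in> A2" using y g by (auto simp: W_def)
    then obtain z where z: "z \<in> fst D'" "z \<in> fst Y" "snd D' (f x) = snd D' z" by (auto simp: A2_def)
    then have "f x = z" using xN inj by (auto dest: inj_onD)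
    then have "f x \<in> fst Y" "DY (g (XD y)) = snd Y (f x)" using z xN inj g by (simp_all add: DY_def)
    then show ?thesis using x xN by blast
  qed
  have "y0 \<in> W"
  proof -
    have "XD y0 = snd D x0" "y0 \<in> A1" using x0 D inj by (auto simp: XD_def A1_def)
    moreover have "snd D x0 \<in> W1" using x0 D D' by (auto simp: W1_def)
    moreover have "g (snd D x0) = snd D' (f x0)" using D inj by (simp add: g_def)
    moreover have "snd D' (f x0) \<in> A2" using x0 D' by (auto simp: A2_def)
    ultimately show ?thesis by (simp add: W_def U_def)
  qed
  moreover have "W \<subseteq> snd X ` {x \<in> N \<inter> fst X. f x \<in> fst Y}" using inW by blast
  moreover have "smooth_fun UNIV W (\<lambda>y. snd Y (f (inv_into (fst X) (snd X) y)) j)" for j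
  proof (rule smooth_cong[OF _ _ sW])
    fix y assume "y \<in> W"
    from inW[OF this] obtain x where x: "x \<in> fst X" "y = snd X x" "DY (g (XD y)) = snd Y (f x)" by blast
    then show "DY (g (XD y)) j = snd Y (f (inv_into (fst X) (snd X) y)) j"
      using inj by simp
  qed (use W in auto)
  ultimately show ?thesis using W by blast
qed

lemma smooth_map_charts:
  fixes A :: "('a, 'i::finite) chart set" and A' :: "('b, 'j::finite) chart set"
  assumes "atlas M A" "atlas M' A'" "smooth_map N A A' f"
    "N \<subseteq> M" "f ` N \<subseteq> M'" "X \<in> charts M A" "Y \<in> charts M' A'"
  shows "open (snd X ` {x \<in> N \<inter> fst X. f x \<in> fst Y})" (is "open ?W")
    "smooth_fun UNIV (snd X ` {x \<in> N \<inter> fst X. f x \<in> fst Y})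
       (\<lambda>y. snd Y (f (inv_into (fst X) (snd X) y)) j)"
proof -
  note loc = smooth_map_charts_local[OF assms]
  show op: "open ?W" by (subst open_subopen) (use loc in blast)
  show "smooth_fun UNIV ?W (\<lambda>y. snd Y (f (inv_into (fst X) (snd X) y)) j)"
  proof (rule smooth_local)
    fix y assume "y \<in> ?W"
    from loc[OF this] obtain W where "open W" "y \<in> W" "W \<subseteq> ?W"
      "\<forall>j. smooth_fun UNIV W (\<lambda>y. snd Y (f (inv_into (fst X) (snd X) y)) j)" by auto
    then show "\<exists>W. open_in UNIV W \<and> y \<in> W \<and> W \<subseteq> ?W \<and>
        smooth_fun UNIV W (\<lambda>y. snd Y (f (inv_into (fst X) (snd X) y)) j)"
      by (intro exI[of _ W] conjI) simp_all
  qed (use op in simp)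
qed

lemma smooth_map_id:
  fixes A :: "('a, 'i::finite) chart set"
  assumes A: "atlas M A" and N: "openin (manifold_topology M A) N"
  shows "smooth_map N A A (\<lambda>x. x)"
  unfolding smooth_map_def Let_def
proof (intro ballI conjI allI)
  fix C D j assume C: "C \<in> A" and D: "D \<in> A"
  have c: "compatible C D" using A C D by (simp add: atlas_def)
  have eq: "snd C ` {x \<in> N \<inter> fst C. x \<in> fst D} = snd C ` (fst C \<inter> N) \<inter> snd C ` (fst C \<inter> fst D)"
    using atlas_chart(3)[OF A C] by (auto simp: inj_on_def)
  show "open (snd C ` {x \<in> N \<inter> fst C. x \<in> fst D})"
    unfolding eq using N C c by (auto simp: openin_manifold_topology[OF A] compatible_def)
  show "smooth_fun UNIV (snd C ` {x \<in> N \<inter> fst C. x \<in> fst D})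
      (\<lambda>y. snd D (inv_into (fst C) (snd C) y) j)"
    by (rule smooth_subset[of _ "snd C ` (fst C \<inter> fst D)"]) (use c in \<open>auto simp: compatible_def\<close>)
qed

lemma openin_manifold_topology_space:
  assumes "atlas M A"
  shows "openin (manifold_topology M A) M"
  unfolding openin_manifold_topology[OF assms]
proof (intro conjI ballI)
  fix C assume "C \<in> A"
  then have "fst C \<inter> M = fst C" "open (snd C ` fst C)"
    using atlas_chart(2,4)[OF assms, of C] by auto
  then show "open (snd C ` (fst C \<inter> M))" by simp
qed simp

text \<open>Charts are compatible with the atlas by definition; they are compatible with each other
  because the identity is a smooth map and \<open>smooth_map_charts\<close> applies to it.\<close>

lemma charts_compatible:
  fixes A :: "('a, 'i::finite) chart set"
  assumes A: "atlas M A" and X: "X \<in> charts M A" and Y: "Y \<in> charts M A"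
  shows "compatible X Y"
proof -
  have eq: "{x \<in> M \<inter> fst X. x \<in> fst Y} = fst X \<inter> fst Y" using chartsD(1)[OF X] by auto
  note * = smooth_map_charts[OF A A smooth_map_id[OF A openin_manifold_topology_space[OF A]] _ _ X Y]
  show ?thesis using * unfolding compatible_def eq by auto
qed

section \<open>Adapted charts\<close>

definition tcoord :: "('x, 'e, 'n, 'm) fbundle \<Rightarrow> ('x, 'e, 'n, 'm) fchart \<Rightarrow> 'e \<Rightarrow> 'n + 'm \<Rightarrow> real" where
  "tcoord B C e = case_sum (bcoord C (proj B e)) (fcoord C e)"

definition tpt :: "('x, 'e, 'n, 'm) fbundle \<Rightarrow> ('x, 'e, 'n, 'm) fchart \<Rightarrow> ('n + 'm \<Rightarrow> real) \<Rightarrow> 'e" where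
  "tpt B C = inv_into (fdom C) (tcoord B C)"

text \<open>From local triviality only the existence of adapted charts around every point is
  retained, together with the two atlases.\<close>

locale fibred =
  fixes B :: "('x, 'e, 'n::finite, 'm::finite) fbundle"
  assumes base_atlas: "atlas (bspace B) (batlas B)"
    and total_atlas: "atlas (tspace B) (tatlas B)"
    and chart_ex: "e \<in> tspace B \<Longrightarrow> \<exists>C. around B C e"
begin

lemma bchart: "adapted B C \<Longrightarrow> (bdom C, bcoord C) \<in> charts (bspace B) (batlas B)"
  and tchart: "adapted B C \<Longrightarrow> (fdom C, tcoord B C) \<in> charts (tspace B) (tatlas B)"
  by (auto simp: adapted_def tcoord_def[abs_def])

lemma fdom_proj: "adapted B C \<Longrightarrow> e \<in> fdom C \<Longrightarrow> proj B e \<in> bdom C"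
  by (auto simp: adapted_def)

lemma bdom_subset: "adapted B C \<Longrightarrow> bdom C \<subseteq> bspace B"
  using chartsD(1)[OF bchart] by simp

lemma fdom_subset: "adapted B C \<Longrightarrow> fdom C \<subseteq> tspace B"
  using chartsD(1)[OF tchart] by simp

lemma bpt_bcoord: "adapted B C \<Longrightarrow> x \<in> bdom C \<Longrightarrow> bpt C (bcoord C x) = x"
  using chartsD(2)[OF bchart] by (simp add: bpt_def)

lemma tpt_tcoord: "adapted B C \<Longrightarrow> e \<in> fdom C \<Longrightarrow> tpt B C (tcoord B C e) = e"
  using chartsD(2)[OF tchart] by (simp add: tpt_def)

lemma tcoord_inj: "adapted B C \<Longrightarrow> e \<in> fdom C \<Longrightarrow> e' \<in> fdom C \<Longrightarrow> tcoord B C e = tcoord B C e' \<Longrightarrow> e = e'"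
  by (metis tpt_tcoord)

lemma bcoord_inj: "adapted B C \<Longrightarrow> x \<in> bdom C \<Longrightarrow> x' \<in> bdom C \<Longrightarrow> bcoord C x = bcoord C x' \<Longrightarrow> x = x'"
  by (metis bpt_bcoord)

lemma bcoord_bpt: "y \<in> bcoord C ` bdom C \<Longrightarrow> bcoord C (bpt C y) = y"
  by (simp add: bpt_def f_inv_into_f)

lemma base_trans:
  assumes "adapted B C" "adapted B C'"
  shows "open (bcoord C ` (bdom C \<inter> bdom C'))"
    "smooth_fun UNIV (bcoord C ` (bdom C \<inter> bdom C')) (\<lambda>y. bcoord C' (bpt C y) \<kappa>)"
  using charts_compatible[OF base_atlas bchart[OF assms(1)] bchart[OF assms(2)]]
  by (auto simp: compatible_def bpt_def)

lemma total_trans: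
  assumes "adapted B C" "adapted B C'"
  shows "open (tcoord B C ` (fdom C \<inter> fdom C'))"
    "smooth_fun UNIV (tcoord B C ` (fdom C \<inter> fdom C')) (\<lambda>y. tcoord B C' (tpt B C y) j)"
  using charts_compatible[OF total_atlas tchart[OF assms(1)] tchart[OF assms(2)]]
  by (auto simp: compatible_def tpt_def)

lemma open_base_subset: "openin (manifold_topology (bspace B) (batlas B)) N \<Longrightarrow> N \<subseteq> bspace B"
  by (simp add: openin_manifold_topology[OF base_atlas])

lemma sectionD:
  assumes "local_section B N f"
  shows "N \<subseteq> bspace B" "openin (manifold_topology (bspace B) (batlas B)) N"
    "x \<in> N \<Longrightarrow> f x \<in> tspace B" "x \<in> N \<Longrightarrow> proj B (f x) = x" "smooth_map N (batlas B) (tatlas B) f"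
  using assms open_base_subset by (auto simp: local_section_def)

lemma section_bdom: "local_section B N f \<Longrightarrow> adapted B C \<Longrightarrow> x \<in> N \<Longrightarrow> f x \<in> fdom C \<Longrightarrow> x \<in> bdom C"
  using fdom_proj sectionD(4) by metis

lemma section_chart:
  assumes f: "local_section B N f" and C: "adapted B C"
  shows "open (bcoord C ` {x \<in> N. f x \<in> fdom C})"
    "smooth_fun UNIV (bcoord C ` {x \<in> N. f x \<in> fdom C}) (\<lambda>y. fcoord C (f (bpt C y)) a)"
proof -
  have eq: "{x \<in> N \<inter> bdom C. f x \<in> fdom C} = {x \<in> N. f x \<in> fdom C}"
    using section_bdom[OF f C] by auto
  have im: "f ` N \<subseteq> tspace B" using sectionD(3)[OF f] by auto
  note * = smooth_map_charts[OF base_atlas total_atlas sectionD(5)[OF f] sectionD(1)[OF f] im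
      bchart[OF C] tchart[OF C], unfolded fst_conv snd_conv eq]
  show "open (bcoord C ` {x \<in> N. f x \<in> fdom C})" using *(1) .
  show "smooth_fun UNIV (bcoord C ` {x \<in> N. f x \<in> fdom C}) (\<lambda>y. fcoord C (f (bpt C y)) a)"
    using *(2)[of "Inr a"] by (simp add: tcoord_def bpt_def)
qed

lemma section_preimage_open:
  assumes f: "local_section B N f" and C: "adapted B C"
  shows "openin (manifold_topology (bspace B) (batlas B)) {x \<in> N. f x \<in> fdom C}"
  unfolding openin_manifold_topology[OF base_atlas]
proof (intro conjI ballI)
  show "{x \<in> N. f x \<in> fdom C} \<subseteq> bspace B" using sectionD(1)[OF f] by auto
  fix D assume D: "D \<in> batlas B"
  have im: "f ` N \<subseteq> tspace B" using sectionD(3)[OF f] by auto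
  have "{x \<in> N \<inter> fst D. f x \<in> fdom C} = fst D \<inter> {x \<in> N. f x \<in> fdom C}" by auto
  then show "open (snd D ` (fst D \<inter> {x \<in> N. f x \<in> fdom C}))"
    using smooth_map_charts(1)[OF base_atlas total_atlas sectionD(5)[OF f] sectionD(1)[OF f] im
      atlas_chart(1)[OF base_atlas D] tchart[OF C]] by simp
qed

lemma local_section_subset:
  assumes f: "local_section B N f" and N': "openin (manifold_topology (bspace B) (batlas B)) N'" "N' \<subseteq> N"
  shows "local_section B N' f"
  unfolding local_section_def smooth_map_def Let_def
proof (intro conjI ballI allI)
  fix D D' j assume D: "D \<in> batlas B" and D': "D' \<in> tatlas B"
  note * = smooth_mapD[OF sectionD(5)[OF f] D D']
  have eq: "snd D ` {x \<in> N' \<inter> fst D. f x \<in> fst D'} =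
      snd D ` (fst D \<inter> N') \<inter> snd D ` {x \<in> N \<inter> fst D. f x \<in> fst D'}"
    using atlas_chart(3)[OF base_atlas D] N'(2) by (fastforce simp: inj_on_def)
  show "open (snd D ` {x \<in> N' \<inter> fst D. f x \<in> fst D'})"
    unfolding eq using * N'(1) D by (auto simp: openin_manifold_topology[OF base_atlas])
  show "smooth_fun UNIV (snd D ` {x \<in> N' \<inter> fst D. f x \<in> fst D'})
      (\<lambda>y. snd D' (f (inv_into (fst D) (snd D) y)) j)"
    by (rule smooth_subset[OF *(2)]) (use N'(2) in auto)
qed (use sectionD[OF f] N' in auto)

text \<open>Fibre coordinates as smooth functions of base coordinates define a section while the
  graph stays in the image of the chart. The work lies in checking openness and smoothness against
  every pair of atlas charts, since \<open>C\<close> need not belong to the atlas.\<close>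

lemma section_intro:
  assumes C: "adapted B C" and W: "open W" and s: "\<And>a. smooth_fun UNIV W (\<lambda>y. s y a)"
    and sC: "\<And>y. y \<in> W \<Longrightarrow> case_sum y (s y) \<in> tcoord B C ` fdom C"
  obtains f where "local_section B (bpt C ` W) f" "W \<subseteq> bcoord C ` bdom C"
    "\<And>x. x \<in> bpt C ` W \<Longrightarrow> bcoord C x \<in> W" "\<And>x. x \<in> bpt C ` W \<Longrightarrow> f x \<in> fdom C"
    "\<And>x a. x \<in> bpt C ` W \<Longrightarrow> fcoord C (f x) a = s (bcoord C x) a"
proof -
  define f where "f = (\<lambda>x. tpt B C (case_sum (bcoord C x) (s (bcoord C x))))"
  define N where "N = bpt C ` W"
  have pt: "\<exists>e\<in>fdom C. tcoord B C e = case_sum y (s y) \<and> bcoord C (proj B e) = y \<and>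
      fcoord C e = s y \<and> proj B e = bpt C y \<and> proj B e \<in> bdom C \<and> f (bpt C y) = e" if y: "y \<in> W" for y
  proof -
    obtain e where e: "e \<in> fdom C" "tcoord B C e = case_sum y (s y)" using sC[OF y] by auto
    have q: "bcoord C (proj B e) = y" "fcoord C e = s y"
      using fun_cong[OF e(2), of "Inl i" for i] fun_cong[OF e(2), of "Inr i" for i]
      by (auto simp: tcoord_def fun_eq_iff)
    have p: "proj B e \<in> bdom C" using e C by (simp add: fdom_proj)
    have b: "proj B e = bpt C y" using bpt_bcoord[OF C p] q by simp
    have "f (bpt C y) = e" using e q b tpt_tcoord[OF C e(1)] by (simp add: f_def)
    then show ?thesis using e q p b by auto
  qed
  have Wb: "W \<subseteq> bcoord C ` bdom C" using pt by force
  have Nx: "x \<in> bdom C \<and> bcoord C x \<in> W \<and> f x \<in> fdom C \<and> proj B (f x) = x \<and>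
      fcoord C (f x) = s (bcoord C x) \<and> tcoord B C (f x) = case_sum (bcoord C x) (s (bcoord C x))"
    if "x \<in> N" for x
  proof -
    obtain y where y: "y \<in> W" "x = bpt C y" using \<open>x \<in> N\<close> by (auto simp: N_def)
    then show ?thesis using pt[OF y(1)] by auto
  qed
  have inN: "x \<in> N" if "x \<in> bdom C" "bcoord C x \<in> W" for x
    using that bpt_bcoord[OF C that(1)] by (auto simp: N_def intro!: image_eqI[of _ _ "bcoord C x"])
  have D_facts: "open (snd D ` (fst D \<inter> N)) \<and> (\<forall>D'\<in>tatlas B. open (snd D ` {x \<in> N \<inter> fst D. f x \<in> fst D'}) \<and>
      (\<forall>j. smooth_fun UNIV (snd D ` {x \<in> N \<inter> fst D. f x \<in> fst D'}) (\<lambda>y. snd D' (f (inv_into (fst D) (snd D) y)) j)))"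
    if D: "D \<in> batlas B" for D
  proof -
    note injD = atlas_chart(3)[OF base_atlas D]
    define A1 where "A1 = snd D ` (fst D \<inter> bdom C)"
    define \<psi> where "\<psi> = (\<lambda>y. bcoord C (inv_into (fst D) (snd D) y))"
    have A1: "open A1" "\<And>j. smooth_fun UNIV A1 (\<lambda>y. \<psi> y j)"
      using chartsD(5)[OF bchart[OF C] D] by (auto simp: compatible_def A1_def \<psi>_def)
    define W1 where "W1 = {y \<in> A1. \<psi> y \<in> W}"
    have W1: "open W1" unfolding W1_def by (rule open_preimage_smooth[OF A1 W])
    have W1_eq: "W1 = snd D ` (fst D \<inter> N)"
    proof (intro equalityI subsetI)
      fix y assume "y \<in> W1"
      then obtain x where x: "x \<in> fst D" "x \<in> bdom C" "y = snd D x" "\<psi> y \<in> W" by (auto simp: W1_def A1_def)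
      then have "bcoord C x \<in> W" using injD by (simp add: \<psi>_def)
      then show "y \<in> snd D ` (fst D \<inter> N)" using x inN by auto
    next
      fix y assume "y \<in> snd D ` (fst D \<inter> N)"
      then obtain x where x: "x \<in> fst D" "x \<in> N" "y = snd D x" by auto
      then show "y \<in> W1" using Nx[OF x(2)] injD by (auto simp: W1_def A1_def \<psi>_def)
    qed
    define cs where "cs = (\<lambda>y. case_sum (\<psi> y) (s (\<psi> y)))"
    have cs: "smooth_fun UNIV W1 (\<lambda>y. cs y q)" for q
    proof (cases q)
      case (Inl i)
      then show ?thesis using smooth_subset[OF A1(2)[of i], of W1] by (auto simp: cs_def W1_def)
    next
      case (Inr a)
      have "smooth_fun UNIV W1 (\<lambda>y. s (\<psi> y) a)"
        by (rule smooth_compose_UNIV[OF W s _ W1 smooth_subset[OF A1(2)]]) (auto simp: W1_def)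
      then show ?thesis by (simp add: cs_def Inr)
    qed
    have "open (snd D ` {x \<in> N \<inter> fst D. f x \<in> fst D'}) \<and>
      (\<forall>j. smooth_fun UNIV (snd D ` {x \<in> N \<inter> fst D. f x \<in> fst D'}) (\<lambda>y. snd D' (f (inv_into (fst D) (snd D) y)) j))"
      if D': "D' \<in> tatlas B" for D'
    proof -
      have c: "compatible (fdom C, tcoord B C) D'" by (rule chartsD(4)[OF tchart[OF C] D'])
      define A2 where "A2 = tcoord B C ` (fdom C \<inter> fst D')"
      have A2: "open A2" "\<And>j. smooth_fun UNIV A2 (\<lambda>y. snd D' (tpt B C y) j)"
        using c by (auto simp: compatible_def A2_def tpt_def)
      define W2 where "W2 = {y \<in> W1. cs y \<in> A2}"
      have W2: "open W2" unfolding W2_def by (rule open_preimage_smooth[OF W1 cs A2(1)])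
      have csx: "cs (snd D x) = tcoord B C (f x)" if "x \<in> N" "x \<in> fst D" for x
        using Nx[OF that(1)] that injD by (simp add: cs_def \<psi>_def)
      have W2_eq: "W2 = snd D ` {x \<in> N \<inter> fst D. f x \<in> fst D'}"
      proof (intro equalityI subsetI)
        fix y assume "y \<in> W2"
        then obtain x where x: "x \<in> fst D" "x \<in> N" "y = snd D x" "cs y \<in> A2" by (auto simp: W2_def W1_eq)
        then obtain e where e: "e \<in> fdom C" "e \<in> fst D'" "tcoord B C (f x) = tcoord B C e"
          using csx by (auto simp: A2_def)
        then have "f x = e" using tcoord_inj[OF C _ e(1)] Nx[OF x(2)] by auto
        then show "y \<in> snd D ` {x \<in> N \<inter> fst D. f x \<in> fst D'}" using x e by auto
      next
        fix y assume "y \<in> snd D ` {x \<in> N \<inter> fst D. f x \<in> fst D'}"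
        then obtain x where x: "x \<in> fst D" "x \<in> N" "y = snd D x" "f x \<in> fst D'" by auto
        then have "f x \<in> fdom C \<inter> fst D'" using Nx[of x] by simp
        then have "tcoord B C (f x) \<in> A2" unfolding A2_def by (rule imageI)
        then have "cs y \<in> A2" using x csx[of x] by simp
        then show "y \<in> W2" using x by (auto simp: W2_def W1_eq)
      qed
      have "smooth_fun UNIV W2 (\<lambda>y. snd D' (f (inv_into (fst D) (snd D) y)) j)" for j
      proof (rule smooth_cong)
        show "smooth_fun UNIV W2 (\<lambda>y. snd D' (tpt B C (cs y)) j)"
          by (rule smooth_compose_UNIV[OF A2(1) A2(2) _ W2 smooth_subset[OF cs]]) (auto simp: W2_def)
        fix y assume "y \<in> W2"
        then obtain x where x: "x \<in> fst D" "x \<in> N" "y = snd D x" by (auto simp: W2_eq)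
        then show "snd D' (tpt B C (cs y)) j = snd D' (f (inv_into (fst D) (snd D) y)) j"
        proof -
          have c: "cs y = tcoord B C (f x)" unfolding x(3) by (rule csx[OF x(2,1)])
          have fx: "f x \<in> fdom C" using Nx[OF x(2)] by blast
          have "tpt B C (cs y) = f x" unfolding c by (rule tpt_tcoord[OF C fx])
          moreover have "inv_into (fst D) (snd D) y = x" unfolding x(3) by (rule inv_into_f_f[OF injD x(1)])
          ultimately show ?thesis by (simp only:)
        qed
      qed (use W2 in auto)
      then show ?thesis using W2 unfolding W2_eq by blast
    qed
    then show ?thesis using W1 unfolding W1_eq by blast
  qed
  have "local_section B N f"
    unfolding local_section_def smooth_map_def Let_def openin_manifold_topology[OF base_atlas]
  proof (intro conjI ballI allI)
    show "N \<subseteq> bspace B" using Nx bdom_subset[OF C] by blast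
    fix x assume "x \<in> N"
    then show "f x \<in> tspace B" "proj B (f x) = x" using Nx fdom_subset[OF C] by blast+
  qed (use D_facts in blast)+
  then show ?thesis using that[of f] Wb Nx unfolding N_def by simp
qed

end

text \<open>The adapted chart is a product of a base chart \<open>D\<close> and a fibre chart
  \<open>G\<close>, pulled back along the trivialisation \<open>h\<close>. Compatibility from it to
  a chart of the total space is smoothness of the inverse of \<open>h\<close>; compatibility in the
  other direction is smoothness of \<open>h\<close>.\<close>

lemma smooth_fibre_bundle_fibred:
  fixes B :: "('x, 'e, 'n::finite, 'm::finite) fbundle" and AF :: "('f, 'm) chart set"
  assumes S: "smooth_fibre_bundle B F AF"
  shows "fibred B"
proof
  show bA: "atlas (bspace B) (batlas B)" and tA: "atlas (tspace B) (tatlas B)"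
    using S by (auto simp: smooth_fibre_bundle_def smooth_manifold_def)
  have FA: "atlas F AF" using S by (auto simp: smooth_fibre_bundle_def smooth_manifold_def)
  have ps: "proj B e \<in> bspace B" if "e \<in> tspace B" for e
    using S that by (auto simp: smooth_fibre_bundle_def)
  show "\<exists>C. around B C e" if e: "e \<in> tspace B" for e
  proof -
    obtain U \<tau> where U: "proj B e \<in> U" "openin (manifold_topology (bspace B) (batlas B)) U"
      and triv: "let E = {e \<in> tspace B. proj B e \<in> U}; h = (\<lambda>e. (proj B e, \<tau> e)) in
          bij_betw h E (U \<times> F) \<and>
          smooth_map E (tatlas B) (prod_atlas (batlas B) AF) h \<and>
          smooth_map (U \<times> F) (prod_atlas (batlas B) AF) (tatlas B) (inv_into E h)"
      using S ps[OF e] unfolding smooth_fibre_bundle_def by blast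
    define E where "E = {e \<in> tspace B. proj B e \<in> U}"
    define h where "h = (\<lambda>e. (proj B e, \<tau> e))"
    have bij: "bij_betw h E (U \<times> F)"
      and h1: "smooth_map E (tatlas B) (prod_atlas (batlas B) AF) h"
      and h2: "smooth_map (U \<times> F) (prod_atlas (batlas B) AF) (tatlas B) (inv_into E h)"
      using triv by (auto simp: E_def h_def Let_def)
    have eE: "e \<in> E" using e U by (simp add: E_def)
    have injh: "inj_on h E" and imh: "h ` E = U \<times> F" using bij by (auto simp: bij_betw_def)
    obtain D where D: "D \<in> batlas B" "proj B e \<in> fst D" using atlas_cover[OF bA ps[OF e]] by auto
    have "\<tau> e \<in> F" using imh eE by (auto simp: h_def)
    then obtain G where G: "G \<in> AF" "\<tau> e \<in> fst G" using atlas_cover[OF FA] by metis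
    note iD = atlas_chart(3)[OF bA D(1)] and iG = atlas_chart(3)[OF FA G(1)]
    define P where "P = (fst D \<times> fst G, \<lambda>(x, y). case_sum (snd D x) (snd G y))"
    have P: "P \<in> prod_atlas (batlas B) AF"
      unfolding prod_atlas_def P_def using D(1) G(1) by blast
    have fP: "fst P = fst D \<times> fst G" and sP: "snd P (x, y) = case_sum (snd D x) (snd G y)" for x y
      by (auto simp: P_def)
    have csum: "case_sum a b = case_sum a' b' \<longleftrightarrow> a = a' \<and> b = b'" for a a' :: "'n \<Rightarrow> real" and b b' :: "'m \<Rightarrow> real"
      by (metis case_sum_o_inj(1) case_sum_o_inj(2))
    have injP: "inj_on (snd P) (fst P)"
      using iD iG by (auto simp: inj_on_def fP sP csum)
    define Q where "Q = {e \<in> E. h e \<in> fst P}"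
    define C where "C = \<lparr>bdom = fst D, bcoord = snd D, fdom = Q, fcoord = \<lambda>e. snd G (\<tau> e)\<rparr>"
    define q where "q = (\<lambda>e. case_sum (snd D (proj B e)) (snd G (\<tau> e)))"
    have q: "q e = snd P (h e)" for e by (simp add: q_def sP h_def)
    have injq: "inj_on q Q"
    proof (rule inj_onI)
      fix a b assume a: "a \<in> Q" "b \<in> Q" "q a = q b"
      then have "h a = h b" using injP by (auto simp: q Q_def dest: inj_onD)
      then show "a = b" using injh a by (auto simp: Q_def dest: inj_onD)
    qed
    \<comment> \<open>The image is a product whose base factor is cut down to the trivialising set
      \<open>U\<close>; openness of \<open>U\<close> in the manifold topology is what makes it
      open.\<close>
    have qQ: "q ` Q = {y. y \<circ> Inl \<in> snd D ` (fst D \<inter> U) \<and> y \<circ> Inr \<in> snd G ` fst G}"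
    proof (intro equalityI subsetI)
      fix y assume "y \<in> q ` Q"
      then obtain e' where e': "e' \<in> Q" "y = q e'" by auto
      have "y \<circ> Inl = snd D (proj B e')" "y \<circ> Inr = snd G (\<tau> e')" by (auto simp: e'(2) q_def)
      then show "y \<in> {y. y \<circ> Inl \<in> snd D ` (fst D \<inter> U) \<and> y \<circ> Inr \<in> snd G ` fst G}"
        using e'(1) by (auto simp: Q_def E_def fP h_def)
    next
      fix y assume "y \<in> {y. y \<circ> Inl \<in> snd D ` (fst D \<inter> U) \<and> y \<circ> Inr \<in> snd G ` fst G}"
      then obtain x z where xz: "x \<in> fst D" "x \<in> U" "y \<circ> Inl = snd D x" "z \<in> fst G" "y \<circ> Inr = snd G z" by auto
      have "z \<in> F" using xz(4) atlas_chart(2)[OF FA G(1)] by auto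
      then obtain e' where e': "e' \<in> E" "h e' = (x, z)" using imh xz by (metis SigmaI imageE)
      have "q e' = case_sum (y \<circ> Inl) (y \<circ> Inr)" using e' xz by (simp add: q sP)
      then have "q e' = y" by (simp add: fun_eq_iff split: sum.split)
      then show "y \<in> q ` Q" using e' xz by (auto simp: Q_def fP)
    qed
    have opq: "open (q ` Q)"
    proof -
      have c1: "continuous_on UNIV (\<lambda>y. y \<circ> Inl :: 'n \<Rightarrow> real)" and c2: "continuous_on UNIV (\<lambda>y. y \<circ> Inr :: 'm \<Rightarrow> real)"
        by (auto intro!: continuous_on_coordinatewise_then_product simp: o_def)
      have "open (snd D ` (fst D \<inter> U))" using U D by (simp add: openin_manifold_topology[OF bA])
      then have "open ((\<lambda>y. y \<circ> Inl) -` (snd D ` (fst D \<inter> U)) \<inter> (\<lambda>y. y \<circ> Inr) -` (snd G ` fst G))"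
        using c1 c2 atlas_chart(4)[OF FA G(1)] by (intro open_Int open_vimage) auto
      moreover have "(\<lambda>y. y \<circ> Inl) -` (snd D ` (fst D \<inter> U)) \<inter> (\<lambda>y. y \<circ> Inr) -` (snd G ` fst G) = q ` Q"
        by (auto simp: qQ)
      ultimately show ?thesis by simp
    qed
    have comp: "compatible (Q, q) T \<and> compatible T (Q, q)" if T: "T \<in> tatlas B" for T
    proof
      have inv: "inv_into E h (h a) = a" if "a \<in> Q" for a using injh that by (auto simp: Q_def)
      have e1: "snd P ` {p \<in> U \<times> F \<inter> fst P. inv_into E h p \<in> fst T} = q ` (Q \<inter> fst T)"
      proof (intro equalityI subsetI)
        fix y assume "y \<in> snd P ` {p \<in> U \<times> F \<inter> fst P. inv_into E h p \<in> fst T}"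
        then obtain p where p: "p \<in> U \<times> F" "p \<in> fst P" "inv_into E h p \<in> fst T" "y = snd P p" by auto
        then obtain a where a: "a \<in> E" "p = h a" using imh by (metis imageE)
        then have "a \<in> Q" using p by (simp add: Q_def)
        then show "y \<in> q ` (Q \<inter> fst T)" using p a inv by (auto simp: q)
      next
        fix y assume "y \<in> q ` (Q \<inter> fst T)"
        then obtain a where a: "a \<in> Q" "a \<in> fst T" "y = snd P (h a)" by (auto simp: q)
        have "h a \<in> U \<times> F" using a imh by (auto simp: Q_def)
        then show "y \<in> snd P ` {p \<in> U \<times> F \<inter> fst P. inv_into E h p \<in> fst T}"
          using a inv by (auto simp: Q_def)
      qed
      note sm = smooth_mapD[OF h2 P T, unfolded e1]
      show "compatible (Q, q) T"
        unfolding compatible_def fst_conv snd_conv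
      proof (intro conjI allI)
        show op: "open (q ` (Q \<inter> fst T))" by (rule sm(1))
        fix j
        show "smooth_fun UNIV (q ` (Q \<inter> fst T)) (\<lambda>y. snd T (inv_into Q q y) j)"
        proof (rule smooth_cong[OF _ _ sm(2)])
          fix y assume "y \<in> q ` (Q \<inter> fst T)"
          then obtain a where a: "a \<in> Q" "y = q a" by auto
          have "h a \<in> fst P" using a by (simp add: Q_def)
          then have "inv_into (fst P) (snd P) y = h a" unfolding a(2) q by (rule inv_into_f_f[OF injP])
          moreover have "inv_into Q q y = a" using a injq by simp
          ultimately show "snd T (inv_into E h (inv_into (fst P) (snd P) y)) j = snd T (inv_into Q q y) j"
            using inv[OF a(1)] by simp
        qed (use op in auto)
      qed
      have e2: "snd T ` {x \<in> E \<inter> fst T. h x \<in> fst P} = snd T ` (fst T \<inter> Q)" by (auto simp: Q_def)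
      note sm' = smooth_mapD[OF h1 T P, unfolded e2]
      show "compatible T (Q, q)"
        unfolding compatible_def fst_conv snd_conv q using sm' by auto
    qed
    have "adapted B C"
      unfolding adapted_def
    proof (intro conjI)
      show "(bdom C, bcoord C) \<in> charts (bspace B) (batlas B)"
        using atlas_chart(1)[OF bA D(1)] by (simp add: C_def)
      show "proj B ` fdom C \<subseteq> bdom C" by (auto simp: C_def Q_def fP h_def)
      have "(Q, q) \<in> charts (tspace B) (tatlas B)"
        using injq opq comp by (auto simp: charts_def is_chart_def Q_def E_def)
      then show "(fdom C, \<lambda>e. case_sum (bcoord C (proj B e)) (fcoord C e)) \<in> charts (tspace B) (tatlas B)"
        by (simp add: C_def q_def)
    qed
    moreover have "e \<in> fdom C" using eE D G by (simp add: C_def Q_def fP h_def)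
    ultimately show ?thesis by (auto simp: around_def)
  qed
qed

section \<open>Bundles with coordinates in all adapted charts\<close>

text \<open>Base coordinates are adjoined to the fibre coordinates because transition functions
  depend on both.\<close>

definition bidx :: "'i set \<Rightarrow> ('n + 'i) set" where
  "bidx K = range Inl \<union> Inr ` K"

lemma finite_bidx: "finite K \<Longrightarrow> finite (bidx K :: ('n::finite + 'i) set)"
  by (simp add: bidx_def)

lemma Inl_bidx [simp]: "Inl n \<in> bidx K" and Inr_bidx [simp]: "Inr i \<in> bidx K \<longleftrightarrow> i \<in> K"
  by (auto simp: bidx_def)

lemma sum_bidx:
  fixes f :: "'n::finite + 'i \<Rightarrow> real"
  assumes "finite K"
  shows "(\<Sum>q\<in>bidx K. f q) = (\<Sum>n\<in>UNIV. f (Inl n)) + (\<Sum>i\<in>K. f (Inr i))"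
proof -
  have "(\<Sum>q\<in>bidx K. f q) = (\<Sum>q\<in>range Inl. f q) + (\<Sum>q\<in>Inr ` K. f q)"
    unfolding bidx_def using assms by (intro sum.union_disjoint) auto
  then show ?thesis by (simp add: sum.reindex o_def)
qed

lemma case_sum_coord_space: "u \<in> coord_space K \<Longrightarrow> case_sum b u \<in> coord_space (bidx K)"
  by (auto simp: coord_space_def split: sum.split)

lemma coord_space_bidx: "y \<in> coord_space (bidx K) \<Longrightarrow> (\<lambda>i. y (Inr i)) \<in> coord_space K"
  by (auto simp: coord_space_def)

lemma open_in_coord_space: "open_in I (coord_space I)"
  by simp

lemma smooth_continuous_on:
  assumes "\<And>j. smooth_fun I V (\<lambda>u. g u j)"
  shows "continuous_on V g"
  by (intro continuous_on_coordinatewise_then_product smooth_continuous[OF assms])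

lemma open_in_preimage:
  assumes "open_in I V" "\<And>j. smooth_fun I V (\<lambda>u. g u j)" "open_in J W" "\<And>u. u \<in> V \<Longrightarrow> g u \<in> coord_space J"
  shows "open_in I {u\<in>V. g u \<in> W}"
proof -
  obtain T where T: "open T" "W = coord_space J \<inter> T" using assms(3) by (auto simp: openin_open)
  have "openin (top_of_set V) (V \<inter> g -` T)"
    by (rule continuous_openin_preimage_gen[OF smooth_continuous_on[OF assms(2)] T(1)])
  moreover have "V \<inter> g -` T = {u\<in>V. g u \<in> W}" using T assms(4) by auto
  ultimately show ?thesis using openin_trans[OF _ assms(1)] by simp
qed

text \<open>Whether a point lies over two chart domains depends only on its underlying point in the
  total space, whose coordinates sit in the slots \<open>Inl n\<close> and
  \<open>Inr (emb a)\<close>. The set is therefore a cylinder over the overlap of two charts of the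
  total space.\<close>

definition overlap :: "('x, 'e, 'n, 'm) fbundle \<Rightarrow> 'i set \<Rightarrow> ('m \<Rightarrow> 'i) \<Rightarrow> ('x, 'e, 'n, 'm) fchart
    \<Rightarrow> ('x, 'e, 'n, 'm) fchart \<Rightarrow> ('n + 'i \<Rightarrow> real) set" where
  "overlap B K emb C C' = {y \<in> coord_space (bidx K).
     case_sum (\<lambda>n. y (Inl n)) (\<lambda>a. y (Inr (emb a))) \<in> tcoord B C ` (fdom C \<inter> fdom C')}"

section \<open>Vertical curves and velocities in arbitrary sets of points\<close>

lemma vertical_curve_subset:
  assumes "vertical_curve B S x T \<gamma>" "open T'" "T' \<subseteq> T"
  shows "vertical_curve B S x T' \<gamma>"
  unfolding vertical_curve_def
proof (intro conjI ballI allI impI)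
  fix C assume C: "adapted B C"
  have "{t\<in>T'. fst (\<gamma> t) \<in> fdom C} = T' \<inter> {t\<in>T. fst (\<gamma> t) \<in> fdom C}" using assms(3) by auto
  then show "open {t\<in>T'. fst (\<gamma> t) \<in> fdom C}"
    using assms C by (auto simp: vertical_curve_def)
  fix i
  show "smooth_real {t \<in> T'. fst (\<gamma> t) \<in> fdom C} (\<lambda>t. snd (\<gamma> t) C i)"
    by (rule smooth_real_subset[of "{t \<in> T. fst (\<gamma> t) \<in> fdom C}"])
      (use assms C in \<open>auto simp: vertical_curve_def\<close>)
qed (use assms in \<open>auto simp: vertical_curve_def\<close>)

lemma vertical_curve_codomain:
  assumes "vertical_curve B S x T \<gamma>" "\<And>t. t \<in> T \<Longrightarrow> \<gamma> t \<in> S'"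
  shows "vertical_curve B S' x T \<gamma>"
  using assms by (auto simp: vertical_curve_def fibre_def)

lemma vertical_tangent_mono:
  assumes "S' \<subseteq> S"
  shows "vertical_tangent B S' z \<subseteq> vertical_tangent B S z"
proof
  fix v assume "v \<in> vertical_tangent B S' z"
  then obtain \<gamma> \<epsilon> where g: "v = velocity B \<gamma> 0" "\<epsilon> > 0"
    "vertical_curve B S' (proj B (fst z)) {-\<epsilon><..<\<epsilon>} \<gamma>" "\<gamma> 0 = z"
    by (auto simp: vertical_tangent_def)
  have "vertical_curve B S (proj B (fst z)) {-\<epsilon><..<\<epsilon>} \<gamma>"
    by (rule vertical_curve_codomain[OF g(3)]) (use g(3) assms in \<open>auto simp: vertical_curve_def fibre_def\<close>)
  then show "v \<in> vertical_tangent B S z" using g by (auto simp: vertical_tangent_def)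
qed

lemma vertical_curve_DERIV:
  assumes "vertical_curve B S x T \<gamma>" "t \<in> T" "around B C (fst (\<gamma> t))"
  shows "((\<lambda>s. snd (\<gamma> s) C i) has_real_derivative velocity B \<gamma> t C i) (at t)"
proof -
  have "smooth_real {t \<in> T. fst (\<gamma> t) \<in> fdom C} (\<lambda>t. snd (\<gamma> t) C i)"
    using assms by (auto simp: vertical_curve_def around_def)
  from smooth_real_DERIV[OF this] show ?thesis
    using assms by (auto simp: velocity_def around_def)
qed

lemma velocity_eqI:
  assumes "\<forall>\<^sub>F s in nhds t. snd (\<gamma> s) C i = g s" "(g has_real_derivative d) (at t)" "around B C (fst (\<gamma> t))"
  shows "velocity B \<gamma> t C i = d"
proof -
  have "velocity B \<gamma> t C i = deriv g t"
    using assms(3) deriv_cong_ev[OF assms(1) refl] by (simp add: velocity_def)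
  then show ?thesis using assms(2) by (simp add: DERIV_imp_deriv)
qed

lemma vertical_curve_open:
  "vertical_curve B S x T \<gamma> \<Longrightarrow> adapted B C \<Longrightarrow> open {t\<in>T. fst (\<gamma> t) \<in> fdom C}"
  by (simp add: vertical_curve_def)

lemma vertical_curve_in:
  "vertical_curve B S x T \<gamma> \<Longrightarrow> t \<in> T \<Longrightarrow> \<gamma> t \<in> S \<and> proj B (fst (\<gamma> t)) = x"
  by (auto simp: vertical_curve_def fibre_def)

text \<open>\<open>jac C' C\<close> is a derivative in the coordinates of \<open>C'\<close>; read in
  the coordinates of \<open>C\<close> it is a composite with the change of coordinates.\<close>

lemma jac_smooth:
  fixes B :: "('x, 'e, 'n::finite, 'm::finite) fbundle"
  assumes "fibred B" "adapted B C" "adapted B C'"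
  shows "smooth_fun UNIV (bcoord C ` (bdom C \<inter> bdom C')) (\<lambda>y. jac C' C (bpt C y) \<rho> \<kappa>)"
proof -
  interpret fibred B by fact
  show ?thesis unfolding jac_def
  proof (rule smooth_compose_UNIV[where V = "bcoord C' ` (bdom C' \<inter> bdom C)"
        and f = "pd \<kappa> (\<lambda>y. bcoord C (bpt C' y) \<rho>)" and g = "\<lambda>y. bcoord C' (bpt C y)"])
    show "open (bcoord C' ` (bdom C' \<inter> bdom C))" "open (bcoord C ` (bdom C \<inter> bdom C'))"
      using base_trans assms by auto
    show "smooth_fun UNIV (bcoord C' ` (bdom C' \<inter> bdom C)) (pd \<kappa> (\<lambda>y. bcoord C (bpt C' y) \<rho>))"
      by (rule smooth_pd[OF base_trans(2)[OF assms(3,2)]]) simp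
    show "bcoord C' (bpt C y) \<in> bcoord C' ` (bdom C' \<inter> bdom C)" if "y \<in> bcoord C ` (bdom C \<inter> bdom C')" for y
      using that bpt_bcoord[OF assms(2)] by auto
    show "smooth_fun UNIV (bcoord C ` (bdom C \<inter> bdom C')) (\<lambda>y. bcoord C' (bpt C y) j)" for j
      by (rule base_trans(2)[OF assms(2,3)])
  qed
qed

lemma (in fibred) overlap_open:
  assumes "adapted B C" "adapted B C'"
  shows "open_in (bidx K) (overlap B K emb C C')"
proof -
  let ?g = "\<lambda>y. case_sum (\<lambda>n. y (Inl n)) (\<lambda>a. y (Inr (emb a))) :: 'n + 'm \<Rightarrow> real"
  have "continuous_on UNIV ?g"
  proof (rule continuous_on_coordinatewise_then_product)
    show "continuous_on UNIV (\<lambda>y. ?g y q)" for q by (cases q) auto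
  qed
  then have "open (?g -` (tcoord B C ` (fdom C \<inter> fdom C')))"
    using total_trans(1)[OF assms] by (simp add: continuous_on_eq_continuous_at open_vimage)
  then have "open_in (bidx K) (coord_space (bidx K) \<inter> ?g -` (tcoord B C ` (fdom C \<inter> fdom C')))"
    by (simp add: openin_open_Int)
  moreover have "coord_space (bidx K) \<inter> ?g -` (tcoord B C ` (fdom C \<inter> fdom C')) = overlap B K emb C C'"
    by (auto simp: overlap_def)
  ultimately show ?thesis by simp
qed

text \<open>\<open>emb\<close> marks the slots that repeat the fibre coordinates of the underlying
  point, \<open>pt_ex\<close> makes all other slots in \<open>K\<close> free, and
  \<open>trans_ex\<close> provides smooth transition functions of base and fibre coordinates
  jointly.\<close>

locale coord_bundle = fibred B
  for B :: "('x, 'e, 'n::finite, 'm::finite) fbundle" +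
  fixes S :: "('x, 'e, 'n, 'm, 'i) pt set" and K :: "'i set" and emb :: "'m \<Rightarrow> 'i"
  assumes finite_K: "finite K"
    and emb_K: "emb a \<in> K"
    and pt_tspace: "z \<in> S \<Longrightarrow> fst z \<in> tspace B"
    and pt_zero: "z \<in> S \<Longrightarrow> \<not> around B C (fst z) \<Longrightarrow> snd z C i = 0"
    and pt_coord: "z \<in> S \<Longrightarrow> around B C (fst z) \<Longrightarrow> snd z C \<in> coord_space K"
    and pt_emb: "z \<in> S \<Longrightarrow> around B C (fst z) \<Longrightarrow> snd z C (emb a) = fcoord C (fst z) a"
    and pt_ex: "around B C e \<Longrightarrow> u \<in> coord_space K \<Longrightarrow> (\<And>a. u (emb a) = fcoord C e a) \<Longrightarrow>
      \<exists>z\<in>S. fst z = e \<and> snd z C = u"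
    and trans_ex: "adapted B C \<Longrightarrow> adapted B C' \<Longrightarrow> \<exists>T. smooth_fun (bidx K) (overlap B K emb C C') T \<and>
      (\<forall>z\<in>S. fst z \<in> fdom C \<longrightarrow> fst z \<in> fdom C' \<longrightarrow> snd z C' i = T (jcoord B C z))"
begin

lemma finite_bK: "finite (bidx K :: ('n + 'i) set)"
  by (rule finite_bidx[OF finite_K])

lemma tcoord_pt:
  assumes "z \<in> S" "around B C (fst z)"
  shows "case_sum (\<lambda>n. jcoord B C z (Inl n)) (\<lambda>a. jcoord B C z (Inr (emb a))) = tcoord B C (fst z)"
  using pt_emb[OF assms] by (auto simp: tcoord_def jcoord_def fun_eq_iff split: sum.split)

lemma jcoord_overlap:
  assumes "z \<in> S" "around B C (fst z)" "around B C' (fst z)"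
  shows "jcoord B C z \<in> overlap B K emb C C'"
  unfolding overlap_def
proof (intro CollectI conjI)
  show "jcoord B C z \<in> coord_space (bidx K)"
    unfolding jcoord_def by (rule case_sum_coord_space[OF pt_coord[OF assms(1,2)]])
  show "case_sum (\<lambda>n. jcoord B C z (Inl n)) (\<lambda>a. jcoord B C z (Inr (emb a))) \<in> tcoord B C ` (fdom C \<inter> fdom C')"
    unfolding tcoord_pt[OF assms(1,2)] using assms by (auto simp: around_def)
qed

lemma overlap_pt:
  assumes y: "y \<in> overlap B K emb C C'" and C: "adapted B C"
  obtains z where "z \<in> S" "fst z \<in> fdom C" "fst z \<in> fdom C'" "jcoord B C z = y" "snd z C = (\<lambda>i. y (Inr i))"
    "bcoord C (proj B (fst z)) = (\<lambda>n. y (Inl n))"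
proof -
  obtain e where e: "e \<in> fdom C" "e \<in> fdom C'"
    "case_sum (\<lambda>n. y (Inl n)) (\<lambda>a. y (Inr (emb a))) = tcoord B C e" and yc: "y \<in> coord_space (bidx K)"
    using y by (auto simp: overlap_def)
  have q: "y (Inl n) = bcoord C (proj B e) n" "y (Inr (emb a)) = fcoord C e a" for n a
    using fun_cong[OF e(3), of "Inl n"] fun_cong[OF e(3), of "Inr a"] by (auto simp: tcoord_def)
  have "\<exists>z\<in>S. fst z = e \<and> snd z C = (\<lambda>i. y (Inr i))"
    by (rule pt_ex) (use q e C coord_space_bidx[OF yc] in \<open>auto simp: around_def\<close>)
  then obtain z where z: "z \<in> S" "fst z = e" "snd z C = (\<lambda>i. y (Inr i))" by blast
  moreover have "jcoord B C z = y" using z q by (auto simp: jcoord_def fun_eq_iff split: sum.split)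
  ultimately show ?thesis using that[of z] e q by auto
qed

definition tr :: "('x, 'e, 'n, 'm) fchart \<Rightarrow> ('x, 'e, 'n, 'm) fchart \<Rightarrow> 'i \<Rightarrow> ('n + 'i \<Rightarrow> real) \<Rightarrow> real" where
  "tr C C' i = (SOME T. smooth_fun (bidx K) (overlap B K emb C C') T \<and>
      (\<forall>z\<in>S. fst z \<in> fdom C \<longrightarrow> fst z \<in> fdom C' \<longrightarrow> snd z C' i = T (jcoord B C z)))"

lemma tr_smooth: "adapted B C \<Longrightarrow> adapted B C' \<Longrightarrow> smooth_fun (bidx K) (overlap B K emb C C') (tr C C' i)"
  and tr_eq: "z \<in> S \<Longrightarrow> around B C (fst z) \<Longrightarrow> around B C' (fst z) \<Longrightarrow> snd z C' i = tr C C' i (jcoord B C z)"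
proof -
  have *: "smooth_fun (bidx K) (overlap B K emb C C') (tr C C' i) \<and>
    (\<forall>z\<in>S. fst z \<in> fdom C \<longrightarrow> fst z \<in> fdom C' \<longrightarrow> snd z C' i = tr C C' i (jcoord B C z))"
    if "adapted B C" "adapted B C'"
    unfolding tr_def by (rule someI_ex[OF trans_ex[OF that]])
  show "adapted B C \<Longrightarrow> adapted B C' \<Longrightarrow> smooth_fun (bidx K) (overlap B K emb C C') (tr C C' i)"
    using * by blast
  show "z \<in> S \<Longrightarrow> around B C (fst z) \<Longrightarrow> around B C' (fst z) \<Longrightarrow> snd z C' i = tr C C' i (jcoord B C z)"
    using * by (auto simp: around_def)
qed

text \<open>Coordinates in one chart determine those in every other chart around the point through
  \<open>tr\<close>, and at the remaining charts the family is zero.\<close>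

lemma pt_eqI:
  assumes "z \<in> S" "z' \<in> S" "fst z = fst z'" "around B C (fst z)" "snd z C = snd z' C"
  shows "z = z'"
proof (rule prod_eqI)
  show "snd z = snd z'"
  proof (intro ext)
    fix C' i
    have j: "jcoord B C z = jcoord B C z'" using assms by (simp add: jcoord_def)
    show "snd z C' i = snd z' C' i"
    proof (cases "around B C' (fst z)")
      case True
      then show ?thesis using tr_eq[OF assms(1,4) True] tr_eq[OF assms(2), of C C'] assms j by simp
    next
      case False
      then show ?thesis using pt_zero assms by metis
    qed
  qed
qed (rule assms)

subsection \<open>Vertical curves and tangent vectors\<close>

text \<open>The curve is the image of a straight line in a parameter space under
  \<open>\<Psi>\<close>, read as fibre coordinates over a fixed base point. The identity as
  \<open>\<Psi>\<close> realises arbitrary tangent vectors; a general \<open>\<Psi>\<close> allows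
  curves confined to the graph of a map. Smoothness in other charts comes from the transition
  functions.\<close>

lemma curve_ex:
  assumes C: "adapted B C" "x \<in> bdom C" and I: "finite I" "open_in I V"
    and \<Psi>: "\<And>i. smooth_fun I V (\<lambda>u. \<Psi> u i)" and ab: "a \<in> coord_space I" "b \<in> coord_space I"
    and \<Psi>C: "\<And>u. u \<in> V \<Longrightarrow> case_sum (bcoord C x) (\<Psi> u) \<in> overlap B K emb C C"
  obtains \<gamma> where "vertical_curve B S x {t. (\<lambda>i. a i + t * b i) \<in> V} \<gamma>"
    "\<And>t. (\<lambda>i. a i + t * b i) \<in> V \<Longrightarrow> fst (\<gamma> t) \<in> fdom C \<and> snd (\<gamma> t) C = \<Psi> (\<lambda>i. a i + t * b i)"
proof -
  let ?l = "\<lambda>t i. a i + t * b i"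
  let ?G = "\<lambda>u. case_sum (bcoord C x) (\<Psi> u)"
  have "\<exists>z. z \<in> S \<and> fst z \<in> fdom C \<and> jcoord B C z = ?G u \<and> snd z C = \<Psi> u \<and> proj B (fst z) = x"
    if u: "u \<in> V" for u
  proof -
    obtain z where z: "z \<in> S" "fst z \<in> fdom C" "jcoord B C z = ?G u"
      "snd z C = (\<lambda>i. ?G u (Inr i))" "bcoord C (proj B (fst z)) = (\<lambda>n. ?G u (Inl n))"
      by (rule overlap_pt[OF \<Psi>C[OF u] C(1)])
    have "proj B (fst z) = x" using z(5) bcoord_inj[OF C(1) fdom_proj[OF C(1) z(2)] C(2)] by simp
    then show ?thesis using z by (intro exI[of _ z]) auto
  qed
  then obtain P where P: "\<And>u. u \<in> V \<Longrightarrow> P u \<in> S \<and> fst (P u) \<in> fdom C \<and> jcoord B C (P u) = ?G u \<and>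
      snd (P u) C = \<Psi> u \<and> proj B (fst (P u)) = x" by metis
  define \<gamma> where "\<gamma> = (\<lambda>t. P (?l t))"
  have "vertical_curve B S x {t. ?l t \<in> V} \<gamma>"
    unfolding vertical_curve_def
  proof (intro conjI ballI allI impI)
    show "\<gamma> t \<in> fibre B S x" if "t \<in> {t. ?l t \<in> V}" for t
      using P that by (auto simp: \<gamma>_def fibre_def)
    fix C' assume C': "adapted B C'"
    define V' where "V' = {u\<in>V. ?G u \<in> overlap B K emb C C'}"
    have Gs: "smooth_fun I V (\<lambda>u. ?G u q)" for q
      by (cases q) (simp_all add: smooth_const \<Psi>)
    have V': "open_in I V'"
      unfolding V'_def
      by (rule open_in_preimage[OF I(2) Gs overlap_open[OF C(1) C']])
        (use \<Psi>C in \<open>auto simp: overlap_def\<close>)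
    have eq: "{t \<in> {t. ?l t \<in> V}. fst (\<gamma> t) \<in> fdom C'} = {t. ?l t \<in> V'}"
    proof (intro equalityI subsetI)
      fix t assume t: "t \<in> {t \<in> {t. ?l t \<in> V}. fst (\<gamma> t) \<in> fdom C'}"
      then have "jcoord B C (\<gamma> t) \<in> overlap B K emb C C'"
        using P[of "?l t"] C C' by (intro jcoord_overlap) (auto simp: \<gamma>_def around_def)
      then show "t \<in> {t. ?l t \<in> V'}" using P[of "?l t"] t by (auto simp: \<gamma>_def V'_def)
    next
      fix t assume t: "t \<in> {t. ?l t \<in> V'}"
      then have tV: "?l t \<in> V" and o: "?G (?l t) \<in> overlap B K emb C C'" by (auto simp: V'_def)
      obtain z where z: "z \<in> S" "fst z \<in> fdom C" "fst z \<in> fdom C'" "jcoord B C z = ?G (?l t)"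
        by (rule overlap_pt[OF o C(1)])
      have "tcoord B C (fst z) = tcoord B C (fst (P (?l t)))"
        using tcoord_pt[OF z(1), of C] tcoord_pt[of "P (?l t)" C] P[OF tV] z C by (simp add: around_def)
      then have "fst z = fst (P (?l t))" using tcoord_inj[OF C(1) z(2)] P[OF tV] by blast
      then show "t \<in> {t \<in> {t. ?l t \<in> V}. fst (\<gamma> t) \<in> fdom C'}" using z tV by (simp add: \<gamma>_def)
    qed
    show "open {t \<in> {t. ?l t \<in> V}. fst (\<gamma> t) \<in> fdom C'}"
      unfolding eq by (rule smooth_real_line(1)[OF I(1) V' smooth_const[of _ _ 0] ab])
    fix i
    have sm: "smooth_fun I V' (\<lambda>u. tr C C' i (?G u))"
      by (rule smooth_compose[OF finite_bK overlap_open[OF C(1) C'] tr_smooth[OF C(1) C'] _ I(1) V'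
          smooth_subset[OF Gs]]) (auto simp: V'_def)
    show "smooth_real {t \<in> {t. ?l t \<in> V}. fst (\<gamma> t) \<in> fdom C'} (\<lambda>t. snd (\<gamma> t) C' i)"
      unfolding eq
    proof (rule smooth_real_cong[OF smooth_real_line(1)[OF I(1) V' smooth_const[of _ _ 0] ab] _
          smooth_real_line(2)[OF I(1) V' sm ab]])
      fix t assume t: "t \<in> {t. ?l t \<in> V'}"
      then have tV: "?l t \<in> V" by (simp add: V'_def)
      have "fst (\<gamma> t) \<in> fdom C'" using t eq by blast
      then show "tr C C' i (?G (?l t)) = snd (\<gamma> t) C' i"
        using tr_eq[of "\<gamma> t" C C' i] P[OF tV] C C' by (simp add: \<gamma>_def around_def)
    qed
  qed
  moreover have "fst (\<gamma> t) \<in> fdom C \<and> snd (\<gamma> t) C = \<Psi> (?l t)" if "?l t \<in> V" for t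
    using P[OF that] by (simp add: \<gamma>_def)
  ultimately show ?thesis by (rule that)
qed

text \<open>In the chart the fibre is an open set of coordinates, so a short straight segment
  through \<open>z\<close> stays inside it whatever its direction.\<close>

lemma tangent_curve:
  assumes z: "z \<in> S" and C: "around B C (fst z)" and w: "w \<in> coord_space K"
  obtains \<gamma> \<epsilon> where "\<epsilon> > 0" "vertical_curve B S (proj B (fst z)) {-\<epsilon><..<\<epsilon>} \<gamma>" "\<gamma> 0 = z"
    "\<And>t. t \<in> {-\<epsilon><..<\<epsilon>} \<Longrightarrow> fst (\<gamma> t) \<in> fdom C \<and> snd (\<gamma> t) C = (\<lambda>i. snd z C i + t * w i)"
    "velocity B \<gamma> 0 C = w"
proof -
  let ?x = "proj B (fst z)"
  have Ca: "adapted B C" "fst z \<in> fdom C" using C by (auto simp: around_def)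
  define V where "V = {u \<in> coord_space K. case_sum (bcoord C ?x) u \<in> overlap B K emb C C}"
  have s: "smooth_fun K (coord_space K) (\<lambda>u. case_sum (bcoord C ?x) u q)" for q
    by (cases q) (simp_all add: smooth_const smooth_coord)
  have V: "open_in K V" unfolding V_def
    by (rule open_in_preimage[OF open_in_coord_space s overlap_open[OF Ca(1) Ca(1)] case_sum_coord_space])
  obtain \<gamma> where \<gamma>: "vertical_curve B S ?x {t. (\<lambda>i. snd z C i + t * w i) \<in> V} \<gamma>"
    "\<And>t. (\<lambda>i. snd z C i + t * w i) \<in> V \<Longrightarrow> fst (\<gamma> t) \<in> fdom C \<and> snd (\<gamma> t) C = (\<lambda>i. snd z C i + t * w i)"
  proof (rule curve_ex[OF Ca(1) fdom_proj[OF Ca] finite_K V smooth_coord pt_coord[OF z C] w])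
    show "case_sum (bcoord C (proj B (fst z))) (\<lambda>i. u i) \<in> overlap B K emb C C" if "u \<in> V" for u
      using that by (simp add: V_def)
  qed blast
  let ?T = "{t. (\<lambda>i. snd z C i + t * w i) \<in> V}"
  have op: "open ?T"
    by (rule smooth_real_line(1)[OF finite_K V smooth_const[of _ _ 0] pt_coord[OF z C] w])
  have "0 \<in> ?T"
    using pt_coord[OF z C] jcoord_overlap[OF z C C] by (simp add: V_def jcoord_def)
  then obtain \<epsilon> where e: "\<epsilon> > 0" "ball 0 \<epsilon> \<subseteq> ?T" using op open_contains_ball by blast
  have sub: "{-\<epsilon><..<\<epsilon>} \<subseteq> ?T" using e(2) by (auto simp: ball_eq_greaterThanLessThan)
  have c: "vertical_curve B S ?x {-\<epsilon><..<\<epsilon>} \<gamma>"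
    by (rule vertical_curve_subset[OF \<gamma>(1) _ sub]) simp
  have eq: "fst (\<gamma> t) \<in> fdom C \<and> snd (\<gamma> t) C = (\<lambda>i. snd z C i + t * w i)" if "t \<in> {-\<epsilon><..<\<epsilon>}" for t
    using that sub \<gamma>(2) by auto
  have 0: "0 \<in> {-\<epsilon><..<\<epsilon>}" using e by simp
  have in0: "\<gamma> 0 \<in> S" "proj B (fst (\<gamma> 0)) = ?x" using vertical_curve_in[OF c 0] by auto
  have "\<gamma> 0 = z"
  proof (rule pt_eqI[OF in0(1) z])
    have g0: "fst (\<gamma> 0) \<in> fdom C" "snd (\<gamma> 0) C = snd z C" using eq[OF 0] by auto
    have ar: "around B C (fst (\<gamma> 0))" using g0 Ca by (simp add: around_def)
    have "jcoord B C (\<gamma> 0) = jcoord B C z" using g0 in0 by (simp add: jcoord_def)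
    then have "tcoord B C (fst (\<gamma> 0)) = tcoord B C (fst z)"
      using tcoord_pt[OF in0(1) ar] tcoord_pt[OF z C] by simp
    then show "fst (\<gamma> 0) = fst z" using tcoord_inj[OF Ca(1) g0(1) Ca(2)] by simp
    show "around B C (fst (\<gamma> 0))" "snd (\<gamma> 0) C = snd z C" using ar g0 by auto
  qed
  moreover have "velocity B \<gamma> 0 C = w"
  proof
    fix i
    have "\<forall>\<^sub>F s in nhds 0. s \<in> {-\<epsilon><..<\<epsilon>}" using e by (intro eventually_nhds_in_open) auto
    then have "\<forall>\<^sub>F s in nhds 0. snd (\<gamma> s) C i = snd z C i + s * w i"
      by eventually_elim (simp add: eq)
    then show "velocity B \<gamma> 0 C i = w i"
      by (rule velocity_eqI) (use C \<open>\<gamma> 0 = z\<close> in \<open>auto intro!: derivative_eq_intros\<close>)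
  qed
  ultimately show ?thesis using that e(1) c eq by blast
qed

text \<open>Base coordinates are constant along a vertical curve, so only the fibre slots
  contribute. The second chart \<open>C'\<close> lets the rule cover transition functions on an
  overlap as well as functions on a single chart, where \<open>C'\<close> is
  \<open>C\<close>.\<close>

lemma curve_chain:
  assumes c: "vertical_curve B S x T \<gamma>" and T: "open T" "t \<in> T"
    and C: "around B C (fst (\<gamma> t))" "around B C' (fst (\<gamma> t))"
    and f: "smooth_fun (bidx K) (overlap B K emb C C') f"
  shows "((\<lambda>s. f (jcoord B C (\<gamma> s))) has_real_derivative
    (\<Sum>j\<in>K. pd (Inr j) f (jcoord B C (\<gamma> t)) * velocity B \<gamma> t C j)) (at t)"
proof -
  have Ca: "adapted B C" "adapted B C'" using C by (auto simp: around_def)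
  have op: "open ({t\<in>T. fst (\<gamma> t) \<in> fdom C} \<inter> {t\<in>T. fst (\<gamma> t) \<in> fdom C'})"
    using vertical_curve_open[OF c] Ca by auto
  have "t \<in> {t\<in>T. fst (\<gamma> t) \<in> fdom C} \<inter> {t\<in>T. fst (\<gamma> t) \<in> fdom C'}"
    using C T by (auto simp: around_def)
  note ev = eventually_nhds_in_open[OF op this]
  have "((\<lambda>s. f (jcoord B C (\<gamma> s))) has_real_derivative
    (\<Sum>q\<in>bidx K. pd q (f) (jcoord B C (\<gamma> t)) * case_sum (\<lambda>_. 0) (velocity B \<gamma> t C) q)) (at t)"
  proof (rule chain_rule[OF finite_bK overlap_open[OF Ca] smooth_Cr[OF f]])
    show "jcoord B C (\<gamma> t) \<in> overlap B K emb C C'"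
      using vertical_curve_in[OF c T(2)] C by (intro jcoord_overlap) auto
    show "\<forall>\<^sub>F s in nhds t. jcoord B C (\<gamma> s) \<in> coord_space (bidx K)"
      using ev
    proof eventually_elim
      case (elim s)
      then have "jcoord B C (\<gamma> s) \<in> overlap B K emb C C'"
        using vertical_curve_in[OF c, of s] Ca by (intro jcoord_overlap) (auto simp: around_def)
      then show ?case by (simp add: overlap_def)
    qed
    fix q
    show "((\<lambda>s. jcoord B C (\<gamma> s) q) has_real_derivative case_sum (\<lambda>_. 0) (velocity B \<gamma> t C) q) (at t)"
    proof (cases q)
      case (Inl n)
      have "\<forall>\<^sub>F s in nhds t. jcoord B C (\<gamma> s) (Inl n) = bcoord C x n"
        using eventually_nhds_in_open[OF T] by eventually_elim (use vertical_curve_in[OF c] in \<open>simp add: jcoord_def\<close>)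
      then have "((\<lambda>s. jcoord B C (\<gamma> s) (Inl n)) has_real_derivative 0) (at t) \<longleftrightarrow>
          ((\<lambda>s. bcoord C x n) has_real_derivative 0) (at t)"
        by (intro DERIV_cong_ev refl)
      then show ?thesis by (simp add: Inl)
    next
      case (Inr j)
      then show ?thesis using vertical_curve_DERIV[OF c T(2) C(1)] by (simp add: jcoord_def)
    qed
  qed
  then show ?thesis by (simp add: sum_bidx[OF finite_K])
qed

lemma velocity_trans:
  assumes c: "vertical_curve B S x T \<gamma>" and T: "open T" "t \<in> T"
    and C: "around B C (fst (\<gamma> t))" "around B C' (fst (\<gamma> t))"
  shows "velocity B \<gamma> t C' i =
    (\<Sum>j\<in>K. pd (Inr j) (tr C C' i) (jcoord B C (\<gamma> t)) * velocity B \<gamma> t C j)"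
proof -
  have Ca: "adapted B C" "adapted B C'" using C by (auto simp: around_def)
  have op: "open ({t\<in>T. fst (\<gamma> t) \<in> fdom C} \<inter> {t\<in>T. fst (\<gamma> t) \<in> fdom C'})"
    using vertical_curve_open[OF c] Ca by auto
  have "t \<in> {t\<in>T. fst (\<gamma> t) \<in> fdom C} \<inter> {t\<in>T. fst (\<gamma> t) \<in> fdom C'}"
    using C T by (auto simp: around_def)
  note ev = eventually_nhds_in_open[OF op this]
  have D: "((\<lambda>s. tr C C' i (jcoord B C (\<gamma> s))) has_real_derivative
    (\<Sum>j\<in>K. pd (Inr j) (tr C C' i) (jcoord B C (\<gamma> t)) * velocity B \<gamma> t C j)) (at t)"
    by (rule curve_chain[OF c T C tr_smooth[OF Ca]])
  have "\<forall>\<^sub>F s in nhds t. snd (\<gamma> s) C' i = tr C C' i (jcoord B C (\<gamma> s))"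
    using ev
  proof eventually_elim
    case (elim s)
    then show ?case using vertical_curve_in[OF c, of s] Ca by (intro tr_eq) (auto simp: around_def)
  qed
  from velocity_eqI[OF this D C(2)] show ?thesis .
qed

lemma tangentE:
  assumes "X \<in> vertical_tangent B S z"
  obtains \<gamma> \<epsilon> where "X = velocity B \<gamma> 0" "\<epsilon> > 0" "vertical_curve B S (proj B (fst z)) {-\<epsilon><..<\<epsilon>} \<gamma>"
    "\<gamma> 0 = z" "z \<in> S"
proof -
  obtain \<gamma> \<epsilon> where g: "X = velocity B \<gamma> 0" "\<epsilon> > 0" "vertical_curve B S (proj B (fst z)) {-\<epsilon><..<\<epsilon>} \<gamma>" "\<gamma> 0 = z"
    using assms by (auto simp: vertical_tangent_def)
  then have "z \<in> S" using vertical_curve_in[OF g(3), of 0] by auto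
  with g that show ?thesis by blast
qed

lemma tangent_trans:
  assumes "X \<in> vertical_tangent B S z" "around B C (fst z)" "around B C' (fst z)"
  shows "X C' i = (\<Sum>j\<in>K. pd (Inr j) (tr C C' i) (jcoord B C z) * X C j)"
proof -
  obtain \<gamma> \<epsilon> where g: "X = velocity B \<gamma> 0" "\<epsilon> > 0" "vertical_curve B S (proj B (fst z)) {-\<epsilon><..<\<epsilon>} \<gamma>"
    "\<gamma> 0 = z" using tangentE[OF assms(1)] by metis
  show ?thesis using velocity_trans[OF g(3), of 0 C C' i] g assms by simp
qed

lemma tangent_zero: "X \<in> vertical_tangent B S z \<Longrightarrow> \<not> around B C (fst z) \<Longrightarrow> X C i = 0"
  by (auto simp: vertical_tangent_def velocity_def)

lemma velocity_coord:
  assumes c: "vertical_curve B S x T \<gamma>" and T: "t \<in> T" and C: "around B C (fst (\<gamma> t))"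
  shows "velocity B \<gamma> t C \<in> coord_space K"
  unfolding coord_space_def
proof (intro CollectI allI impI)
  fix i assume i: "i \<notin> K"
  have Ca: "adapted B C" and tC: "t \<in> {t\<in>T. fst (\<gamma> t) \<in> fdom C}" using C T by (auto simp: around_def)
  have "\<forall>\<^sub>F s in nhds t. snd (\<gamma> s) C i = 0"
    using eventually_nhds_in_open[OF vertical_curve_open[OF c Ca] tC]
  proof eventually_elim
    case (elim s)
    then have "snd (\<gamma> s) C \<in> coord_space K"
      using vertical_curve_in[OF c, of s] Ca by (intro pt_coord) (auto simp: around_def)
    then show ?case using i by (simp add: coord_space_def)
  qed
  then show "velocity B \<gamma> t C i = 0" by (rule velocity_eqI) (use C in auto)
qed

lemma tangent_coord:
  assumes "X \<in> vertical_tangent B S z" "around B C (fst z)"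
  shows "X C \<in> coord_space K"
proof -
  obtain \<gamma> \<epsilon> where g: "X = velocity B \<gamma> 0" "\<epsilon> > 0" "vertical_curve B S (proj B (fst z)) {-\<epsilon><..<\<epsilon>} \<gamma>"
    "\<gamma> 0 = z" using tangentE[OF assms(1)] by metis
  show ?thesis using velocity_coord[OF g(3), of 0 C] g assms by simp
qed

lemma tangent_eqI:
  assumes "X \<in> vertical_tangent B S z" "Y \<in> vertical_tangent B S z" "around B C (fst z)" "X C = Y C"
  shows "X = Y"
proof (intro ext)
  fix C' i
  show "X C' i = Y C' i"
  proof (cases "around B C' (fst z)")
    case True
    then show ?thesis using tangent_trans[OF assms(1,3) True] tangent_trans[OF assms(2,3) True] assms(4) by simp
  next
    case False
    then show ?thesis using tangent_zero assms(1,2) by metis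
  qed
qed

lemma tangent_ex:
  assumes "z \<in> S" "around B C (fst z)" "w \<in> coord_space K"
  shows "\<exists>X\<in>vertical_tangent B S z. X C = w"
proof -
  obtain \<gamma> \<epsilon> where "\<epsilon> > 0" "vertical_curve B S (proj B (fst z)) {-\<epsilon><..<\<epsilon>} \<gamma>" "\<gamma> 0 = z"
    "velocity B \<gamma> 0 C = w"
    using tangent_curve[OF assms] by metis
  then show ?thesis by (intro bexI[of _ "velocity B \<gamma> 0"]) (auto simp: vertical_tangent_def)
qed

text \<open>A tangent vector is a family over all charts, so a sum of velocities is not evidently a
  velocity. The combination is realised in one chart and agrees in the others because the
  transformation law is linear with coefficients depending only on \<open>z\<close>.\<close>

lemma tangent_linear:
  assumes X: "X \<in> vertical_tangent B S z" and Y: "Y \<in> vertical_tangent B S z"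
  shows "(\<lambda>C i. s * X C i + t * Y C i) \<in> vertical_tangent B S z"
proof -
  have z: "z \<in> S" using tangentE[OF X] by metis
  obtain C where C: "around B C (fst z)" using chart_ex[OF pt_tspace[OF z]] by blast
  have "(\<lambda>i. s * X C i + t * Y C i) \<in> coord_space K"
    using tangent_coord[OF X C] tangent_coord[OF Y C] by (auto simp: coord_space_def)
  from tangent_ex[OF z C this] obtain Z where Z: "Z \<in> vertical_tangent B S z" "Z C = (\<lambda>i. s * X C i + t * Y C i)"
    by blast
  have "Z = (\<lambda>C i. s * X C i + t * Y C i)"
  proof (intro ext)
    fix C' i
    show "Z C' i = s * X C' i + t * Y C' i"
    proof (cases "around B C' (fst z)")
      case True
      show ?thesis
        unfolding tangent_trans[OF Z(1) C True] tangent_trans[OF X C True] tangent_trans[OF Y C True] Z(2)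
        by (simp add: sum_distrib_left sum.distrib algebra_simps)
    next
      case False
      then show ?thesis using tangent_zero[OF Z(1)] tangent_zero[OF X] tangent_zero[OF Y] by simp
    qed
  qed
  then show ?thesis using Z by simp
qed

end

section \<open>Affine functions and first jets of sections\<close>

lemma pd_affine:
  fixes y0 :: "'n::finite \<Rightarrow> real"
  shows "pd \<rho> (\<lambda>y. c + (\<Sum>\<sigma>\<in>UNIV. d \<sigma> * (y \<sigma> - y0 \<sigma>))) y = d \<rho>"
proof -
  have eq: "(\<lambda>t. c + (\<Sum>\<sigma>\<in>UNIV. d \<sigma> * ((y(\<rho> := t)) \<sigma> - y0 \<sigma>))) =
      (\<lambda>t. c + (\<Sum>\<sigma>\<in>UNIV - {\<rho>}. d \<sigma> * (y \<sigma> - y0 \<sigma>)) + d \<rho> * (t - y0 \<rho>))"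
  proof
    fix t
    have "(\<Sum>\<sigma>\<in>UNIV. d \<sigma> * ((y(\<rho> := t)) \<sigma> - y0 \<sigma>)) =
        d \<rho> * (t - y0 \<rho>) + (\<Sum>\<sigma>\<in>UNIV - {\<rho>}. d \<sigma> * ((y(\<rho> := t)) \<sigma> - y0 \<sigma>))"
      by (subst sum.remove[of _ \<rho>]) auto
    also have "(\<Sum>\<sigma>\<in>UNIV - {\<rho>}. d \<sigma> * ((y(\<rho> := t)) \<sigma> - y0 \<sigma>)) = (\<Sum>\<sigma>\<in>UNIV - {\<rho>}. d \<sigma> * (y \<sigma> - y0 \<sigma>))"
      by (rule sum.cong) auto
    finally show "c + (\<Sum>\<sigma>\<in>UNIV. d \<sigma> * ((y(\<rho> := t)) \<sigma> - y0 \<sigma>)) =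
      c + (\<Sum>\<sigma>\<in>UNIV - {\<rho>}. d \<sigma> * (y \<sigma> - y0 \<sigma>)) + d \<rho> * (t - y0 \<rho>)" by simp
  qed
  show ?thesis unfolding pd_def eq
    by (rule DERIV_imp_deriv) (auto intro!: derivative_eq_intros)
qed

lemma smooth_affine:
  fixes y0 :: "'n::finite \<Rightarrow> real"
  assumes "open U"
  shows "smooth_fun UNIV U (\<lambda>y. c + (\<Sum>\<sigma>\<in>UNIV. d \<sigma> * (y \<sigma> - y0 \<sigma>)))"
  using assms
  by (intro smooth_add smooth_sum smooth_cmult smooth_diff smooth_const smooth_coord) simp_all

definition J1 :: "('x, 'e, 'n::finite, 'm::finite) fbundle \<Rightarrow> ('x, 'e, 'n, 'm, 'i) pt set
    \<Rightarrow> ('x, 'e, 'n, 'm, 'i + 'i \<times> 'n) pt set" where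
  "J1 B S = {jet1 B s x | s x N. smooth_section B S N s \<and> x \<in> N}"

lemma smooth_sectionD:
  assumes "smooth_section B S N s"
  shows "local_section B N (fst \<circ> s)" "x \<in> N \<Longrightarrow> s x \<in> S"
    "adapted B C \<Longrightarrow> smooth_fun UNIV (bcoord C ` {x \<in> N. fst (s x) \<in> fdom C}) (\<lambda>y. snd (s (bpt C y)) C i)"
  using assms by (auto simp: smooth_section_def)

context coord_bundle begin

subsection \<open>Sections and their first jets\<close>

text \<open>Coordinates in the single chart \<open>C\<close> determine the section; in every other
  chart its coordinates are composites of \<open>u\<close> with transition functions, hence
  smooth.\<close>

lemma section_ex:
  assumes f: "local_section B N f" and C: "adapted B C" and fC: "\<And>x. x \<in> N \<Longrightarrow> f x \<in> fdom C"
    and u: "\<And>i. smooth_fun UNIV (bcoord C ` N) (\<lambda>y. u y i)"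
    and uK: "\<And>x. x \<in> N \<Longrightarrow> u (bcoord C x) \<in> coord_space K"
    and ue: "\<And>x a. x \<in> N \<Longrightarrow> u (bcoord C x) (emb a) = fcoord C (f x) a"
  obtains s where "smooth_section B S N s" "fst \<circ> s = f" "\<And>x. x \<in> N \<Longrightarrow> snd (s x) C = u (bcoord C x)"
proof -
  have ar: "around B C (f x)" if "x \<in> N" for x using C fC[OF that] by (simp add: around_def)
  have "\<exists>z\<in>S. fst z = f x \<and> snd z C = u (bcoord C x)" if "x \<in> N" for x
    by (rule pt_ex[OF ar[OF that] uK[OF that] ue[OF that]])
  then obtain P where P: "\<And>x. x \<in> N \<Longrightarrow> P x \<in> S \<and> fst (P x) = f x \<and> snd (P x) C = u (bcoord C x)" by metis
  define s where "s = (\<lambda>x. (f x, snd (P x)))"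
  have sP: "s x = P x" if "x \<in> N" for x using P[OF that] by (simp add: s_def prod_eq_iff)
  have fs: "fst \<circ> s = f" by (auto simp: s_def)
  have NC: "{x \<in> N. f x \<in> fdom C} = N" using fC by auto
  have oN: "open (bcoord C ` N)" using section_chart(1)[OF f C] NC by simp
  have Nb: "N \<subseteq> bdom C" using section_bdom[OF f C] fC by auto
  have "smooth_section B S N s"
    unfolding smooth_section_def fs
  proof (intro conjI ballI allI impI f)
    show "s x \<in> S" if "x \<in> N" for x using P sP that by simp
    fix C' i assume C': "adapted B C'"
    define W where "W = bcoord C' ` {x \<in> N. fst (s x) \<in> fdom C'}"
    have W_eq: "W = bcoord C' ` {x \<in> N. f x \<in> fdom C'}" by (simp add: W_def s_def)
    have W: "open W" unfolding W_eq by (rule section_chart(1)[OF f C'])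
    have Wx: "\<exists>x. x \<in> N \<and> x \<in> bdom C' \<and> f x \<in> fdom C' \<and> y = bcoord C' x \<and> bpt C' y = x" if y: "y \<in> W" for y
    proof -
      obtain x where x: "x \<in> N" "f x \<in> fdom C'" "y = bcoord C' x" using y by (auto simp: W_eq)
      have "x \<in> bdom C'" by (rule section_bdom[OF f C' x(1,2)])
      then show ?thesis using x bpt_bcoord[OF C'] by auto
    qed
    define \<psi> where "\<psi> = (\<lambda>y. bcoord C (bpt C' y))"
    have \<psi>: "smooth_fun UNIV W (\<lambda>y. \<psi> y j)" for j
      unfolding \<psi>_def by (rule smooth_subset[OF base_trans(2)[OF C' C]]) (use Nb Wx in blast)
    have u\<psi>: "smooth_fun UNIV W (\<lambda>y. u (\<psi> y) j)" for j
      by (rule smooth_compose_UNIV[OF oN u _ W \<psi>]) (use Wx in \<open>auto simp: \<psi>_def\<close>)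
    have eq: "snd (s (bpt C' y)) C' i = tr C C' i (case_sum (\<psi> y) (u (\<psi> y))) \<and>
        case_sum (\<psi> y) (u (\<psi> y)) \<in> overlap B K emb C C'" if y: "y \<in> W" for y
    proof -
      obtain x where x: "x \<in> N" "f x \<in> fdom C'" "bpt C' y = x" using Wx[OF y] by blast
      have a: "around B C (fst (P x))" "around B C' (fst (P x))"
        using P[OF x(1)] ar[OF x(1)] x C' by (auto simp: around_def)
      have "jcoord B C (P x) = case_sum (\<psi> y) (u (\<psi> y))"
        using P[OF x(1)] sectionD(4)[OF f x(1)] x by (simp add: jcoord_def \<psi>_def)
      then show ?thesis
        using tr_eq[OF _ a] jcoord_overlap[OF _ a] P[OF x(1)] x sP by simp
    qed
    have "smooth_fun UNIV W (\<lambda>y. tr C C' i (case_sum (\<psi> y) (u (\<psi> y))))"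
    proof (rule smooth_compose[OF finite_bK overlap_open[OF C C'] tr_smooth[OF C C']])
      show "case_sum (\<psi> y) (u (\<psi> y)) \<in> overlap B K emb C C'" if "y \<in> W" for y using eq[OF that] by blast
      show "smooth_fun UNIV W (\<lambda>y. case_sum (\<psi> y) (u (\<psi> y)) q)" for q
        by (cases q) (simp_all add: \<psi> u\<psi>)
    qed (use W in simp_all)
    then show "smooth_fun UNIV W (\<lambda>y. snd (s (bpt C' y)) C' i)"
      by (rule smooth_cong[rotated 2]) (use W eq in simp_all)
  qed
  moreover have "snd (s x) C = u (bcoord C x)" if "x \<in> N" for x using P sP that by simp
  ultimately show ?thesis using that fs by blast
qed

lemma smooth_section_around:
  assumes s: "smooth_section B S N s" and C: "adapted B C"
  shows "open (bcoord C ` {x \<in> N. fst (s x) \<in> fdom C})"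
    "y \<in> bcoord C ` {x \<in> N. fst (s x) \<in> fdom C} \<Longrightarrow> bpt C y \<in> N \<and> fst (s (bpt C y)) \<in> fdom C \<and>
      bpt C y \<in> bdom C \<and> bcoord C (bpt C y) = y \<and> s (bpt C y) \<in> S \<and> proj B (fst (s (bpt C y))) = bpt C y"
    "x \<in> N \<Longrightarrow> fst (s x) \<in> fdom C \<Longrightarrow> x \<in> bdom C"
proof -
  note f = smooth_sectionD(1)[OF s]
  show "open (bcoord C ` {x \<in> N. fst (s x) \<in> fdom C})" using section_chart(1)[OF f C] by simp
  show *: "x \<in> bdom C" if "x \<in> N" "fst (s x) \<in> fdom C" for x using section_bdom[OF f C] that by simp
  assume "y \<in> bcoord C ` {x \<in> N. fst (s x) \<in> fdom C}"
  then obtain x where x: "x \<in> N" "fst (s x) \<in> fdom C" "y = bcoord C x" by auto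
  have "bpt C y = x" using bpt_bcoord[OF C *[OF x(1,2)]] x by simp
  then show "bpt C y \<in> N \<and> fst (s (bpt C y)) \<in> fdom C \<and> bpt C y \<in> bdom C \<and> bcoord C (bpt C y) = y \<and>
      s (bpt C y) \<in> S \<and> proj B (fst (s (bpt C y))) = bpt C y"
    using x * smooth_sectionD(2)[OF s] sectionD(4)[OF f] by auto
qed

text \<open>Chain rule for the coordinates of \<open>s\<close> in \<open>C'\<close>, written as
  \<open>tr\<close> applied to base and fibre coordinates in \<open>C\<close>, which in turn depend
  on the base coordinates of \<open>C'\<close>. The right-hand side involves \<open>s\<close> only
  through its first jet in \<open>C\<close>, so it is a transition function for first jets.\<close>

lemma jet1_trans:
  assumes s: "smooth_section B S N s" and x: "x \<in> N"
    and ar: "around B C (fst (s x))" "around B C' (fst (s x))"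
  shows "snd (jet1 B s x) C' (Inr (i, \<kappa>)) = (\<Sum>\<rho>\<in>UNIV. jac C' C x \<rho> \<kappa> *
      (pd (Inl \<rho>) (tr C C' i) (jcoord B C (s x)) +
       (\<Sum>j\<in>K. pd (Inr j) (tr C C' i) (jcoord B C (s x)) * snd (jet1 B s x) C (Inr (j, \<rho>)))))"
proof -
  have C: "adapted B C" "adapted B C'" using ar by (auto simp: around_def)
  have sx: "fst (s x) \<in> fdom C" "fst (s x) \<in> fdom C'" using ar by (auto simp: around_def)
  define V where "V = bcoord C ` {x \<in> N. fst (s x) \<in> fdom C}"
  note Vf = smooth_section_around[OF s C(1), folded V_def]
  have xb: "x \<in> bdom C" "x \<in> bdom C'" using smooth_section_around(3)[OF s _ x] C sx by auto
  have bx: "bpt C (bcoord C x) = x" "bpt C' (bcoord C' x) = x" using bpt_bcoord C xb by auto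
  define W0 where "W0 = bcoord C' ` {x \<in> N. fst (s x) \<in> fdom C'}"
  note W0f = smooth_section_around[OF s C(2), folded W0_def]
  define \<psi> where "\<psi> = (\<lambda>y. bcoord C (bpt C' y))"
  define W where "W = {y \<in> W0 \<inter> bcoord C' ` (bdom C' \<inter> bdom C). \<psi> y \<in> V}"
  have W: "open W" unfolding W_def
  proof (rule open_preimage_smooth[OF _ _ Vf(1)])
    show "open (W0 \<inter> bcoord C' ` (bdom C' \<inter> bdom C))"
      using W0f(1) base_trans(1)[OF C(2,1)] by (rule open_Int)
    show "smooth_fun UNIV (W0 \<inter> bcoord C' ` (bdom C' \<inter> bdom C)) (\<lambda>y. \<psi> y j)" for j
      unfolding \<psi>_def by (rule smooth_subset[OF base_trans(2)[OF C(2,1)]]) auto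
  qed
  have \<psi>: "smooth_fun UNIV W (\<lambda>y. \<psi> y j)" for j
    unfolding \<psi>_def by (rule smooth_subset[OF base_trans(2)[OF C(2,1)]]) (auto simp: W_def)
  define U where "U = (\<lambda>j y. snd (s (bpt C y)) C j)"
  have U: "smooth_fun UNIV V (U j)" for j
    unfolding U_def V_def by (rule smooth_sectionD(3)[OF s C(1)])
  have \<psi>V: "\<psi> y \<in> V" if "y \<in> W" for y using that by (simp add: W_def)
  have U\<psi>: "smooth_fun UNIV W (\<lambda>y. U j (\<psi> y))" for j
    by (rule smooth_compose_UNIV[OF Vf(1) U \<psi>V W \<psi>])
  have bW: "bpt C (\<psi> y) = bpt C' y" if "y \<in> W" for y
  proof -
    have "bpt C' y \<in> bdom C" using that bpt_bcoord[OF C(2)] by (auto simp: W_def)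
    then show ?thesis by (simp add: \<psi>_def bpt_bcoord[OF C(1)])
  qed
  define G where "G = (\<lambda>y. case_sum (\<psi> y) (\<lambda>j. U j (\<psi> y)))"
  have GW: "G y = jcoord B C (s (bpt C' y)) \<and> G y \<in> overlap B K emb C C' \<and>
      snd (s (bpt C' y)) C' i = tr C C' i (G y)" if y: "y \<in> W" for y
  proof -
    have yW0: "y \<in> W0" using y by (simp add: W_def)
    note p = W0f(2)[OF yW0] and q = Vf(2)[OF \<psi>V[OF y]]
    have a: "around B C (fst (s (bpt C' y)))" "around B C' (fst (s (bpt C' y)))"
      using p q bW[OF y] C by (auto simp: around_def)
    have G: "G y = jcoord B C (s (bpt C' y))"
      using p bW[OF y] by (simp add: G_def jcoord_def \<psi>_def U_def)
    then show ?thesis using jcoord_overlap[OF _ a] tr_eq[OF _ a] p by simp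
  qed
  have Gs: "smooth_fun UNIV W (\<lambda>y. G y q)" for q
    by (cases q) (simp_all add: G_def \<psi> U\<psi>)
  define y0 where "y0 = bcoord C' x"
  have y0: "y0 \<in> W"
    using x sx xb bx by (auto simp: W_def W0_def V_def y0_def \<psi>_def)
  have \<psi>0: "\<psi> y0 = bcoord C x" using bx by (simp add: \<psi>_def y0_def)
  have G0: "G y0 = jcoord B C (s x)" using GW[OF y0] bx by (simp add: y0_def)
  have oW: "open_in UNIV W" using W by simp
  have "snd (jet1 B s x) C' (Inr (i, \<kappa>)) = pd \<kappa> (\<lambda>y. snd (s (bpt C' y)) C' i) y0"
    using ar by (simp add: jet1_def y0_def)
  also have "\<dots> = pd \<kappa> (\<lambda>y. tr C C' i (G y)) y0"
    by (rule pd_cong[OF finite oW y0 UNIV_I]) (use GW in blast)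
  also have "\<dots> = (\<Sum>q\<in>bidx K. pd q (tr C C' i) (G y0) * pd \<kappa> (\<lambda>y. G y q) y0)"
    by (rule smooth_pd_compose[OF finite_bK overlap_open[OF C] tr_smooth[OF C] _ finite oW y0 UNIV_I Gs])
      (use GW in blast)
  also have "\<dots> = (\<Sum>\<rho>\<in>UNIV. pd (Inl \<rho>) (tr C C' i) (G y0) * pd \<kappa> (\<lambda>y. G y (Inl \<rho>)) y0) +
      (\<Sum>j\<in>K. pd (Inr j) (tr C C' i) (G y0) * pd \<kappa> (\<lambda>y. G y (Inr j)) y0)"
    by (rule sum_bidx[OF finite_K])
  also have "(\<lambda>\<rho>. pd \<kappa> (\<lambda>y. G y (Inl \<rho>)) y0) = (\<lambda>\<rho>. jac C' C x \<rho> \<kappa>)"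
    by (simp add: G_def jac_def \<psi>_def y0_def)
  also have "(\<lambda>j. pd \<kappa> (\<lambda>y. G y (Inr j)) y0) =
      (\<lambda>j. \<Sum>\<rho>\<in>UNIV. snd (jet1 B s x) C (Inr (j, \<rho>)) * jac C' C x \<rho> \<kappa>)"
  proof
    fix j
    have "pd \<kappa> (\<lambda>y. G y (Inr j)) y0 = pd \<kappa> (\<lambda>y. U j (\<psi> y)) y0" by (simp add: G_def)
    also have "\<dots> = (\<Sum>\<rho>\<in>UNIV. pd \<rho> (U j) (\<psi> y0) * pd \<kappa> (\<lambda>y. \<psi> y \<rho>) y0)"
      by (rule smooth_pd_compose[OF finite _ U \<psi>V finite oW y0 UNIV_I \<psi>]) (use Vf(1) in simp)
    also have "\<dots> = (\<Sum>\<rho>\<in>UNIV. snd (jet1 B s x) C (Inr (j, \<rho>)) * jac C' C x \<rho> \<kappa>)"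
      using ar by (simp add: \<psi>0 jet1_def U_def jac_def \<psi>_def y0_def bx)
    finally show "pd \<kappa> (\<lambda>y. G y (Inr j)) y0 = \<dots>" .
  qed
  finally have "snd (jet1 B s x) C' (Inr (i, \<kappa>)) =
      (\<Sum>\<rho>\<in>UNIV. pd (Inl \<rho>) (tr C C' i) (jcoord B C (s x)) * jac C' C x \<rho> \<kappa>) +
      (\<Sum>j\<in>K. pd (Inr j) (tr C C' i) (jcoord B C (s x)) *
        (\<Sum>\<rho>\<in>UNIV. snd (jet1 B s x) C (Inr (j, \<rho>)) * jac C' C x \<rho> \<kappa>))"
    by (simp add: G0)
  also have "(\<Sum>j\<in>K. pd (Inr j) (tr C C' i) (jcoord B C (s x)) *
        (\<Sum>\<rho>\<in>UNIV. snd (jet1 B s x) C (Inr (j, \<rho>)) * jac C' C x \<rho> \<kappa>)) =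
      (\<Sum>\<rho>\<in>UNIV. jac C' C x \<rho> \<kappa> * (\<Sum>j\<in>K. pd (Inr j) (tr C C' i) (jcoord B C (s x)) *
        snd (jet1 B s x) C (Inr (j, \<rho>))))"
    by (simp add: sum_distrib_left mult_ac) (rule sum.swap)
  finally show ?thesis by (simp add: distrib_left sum.distrib mult.commute)
qed

text \<open>Fibre coordinates that are affine in the base coordinates take any prescribed value and
  first derivatives at a point, so all first-jet coordinates are free.\<close>

lemma J1_section:
  assumes C: "adapted B C" and e: "e \<in> fdom C" and u1: "u1 \<in> coord_space (K <+> K \<times> UNIV)"
    and ue: "\<And>a. u1 (Inl (emb a)) = fcoord C e a"
  obtains s N where "smooth_section B S N s" "proj B e \<in> N" "fst (s (proj B e)) = e"
    "snd (jet1 B s (proj B e)) C = u1"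
proof -
  define x where "x = proj B e"
  define y0 where "y0 = bcoord C x"
  have xb: "x \<in> bdom C" unfolding x_def by (rule fdom_proj[OF C e])
  define u where "u = (\<lambda>y i. u1 (Inl i) + (\<Sum>\<sigma>\<in>UNIV. u1 (Inr (i, \<sigma>)) * (y \<sigma> - y0 \<sigma>)))"
  have u0: "u y0 i = u1 (Inl i)" for i by (simp add: u_def)
  have us: "smooth_fun UNIV U (\<lambda>y. u y i)" if "open U" for U i
    unfolding u_def by (rule smooth_affine[OF that])
  have uK: "u y \<in> coord_space K" for y
    unfolding coord_space_def
  proof (intro CollectI allI impI)
    fix i assume "i \<notin> K"
    then have "u1 (Inl i) = 0" "u1 (Inr (i, \<sigma>)) = 0" for \<sigma> using u1 by (auto simp: coord_space_def)
    then show "u y i = 0" by (simp add: u_def)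
  qed
  have g: "smooth_fun UNIV UNIV (\<lambda>y. case_sum y (\<lambda>a. u y (emb a)) q)" for q
    by (cases q) (simp_all add: smooth_coord us)
  define W where "W = {y. case_sum y (\<lambda>a. u y (emb a)) \<in> tcoord B C ` fdom C}"
  have W: "open W"
    unfolding W_def using open_preimage_smooth[OF open_UNIV g chartsD(3)[OF tchart[OF C], unfolded fst_conv snd_conv]] by simp
  have t0: "case_sum y0 (\<lambda>a. u y0 (emb a)) = tcoord B C e"
    using ue u0 by (simp add: tcoord_def y0_def x_def fun_eq_iff split: sum.split)
  have y0: "y0 \<in> W" using t0 e by (auto simp: W_def)
  obtain f where f: "local_section B (bpt C ` W) f" "W \<subseteq> bcoord C ` bdom C"
    "\<And>x. x \<in> bpt C ` W \<Longrightarrow> bcoord C x \<in> W" "\<And>x. x \<in> bpt C ` W \<Longrightarrow> f x \<in> fdom C"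
    "\<And>x a. x \<in> bpt C ` W \<Longrightarrow> fcoord C (f x) a = u (bcoord C x) (emb a)"
  proof (rule section_intro[OF C W, where s = "\<lambda>y a. u y (emb a)"])
    show "smooth_fun UNIV W (\<lambda>y. u y (emb a))" for a by (rule us[OF W])
    show "case_sum y (\<lambda>a. u y (emb a)) \<in> tcoord B C ` fdom C" if "y \<in> W" for y using that by (simp add: W_def)
  qed blast
  define N where "N = bpt C ` W"
  have bW: "bcoord C ` N = W"
    using f(2) bcoord_bpt by (force simp: N_def image_image)
  have xN: "x \<in> N" using y0 bpt_bcoord[OF C xb] by (force simp: N_def y0_def)
  obtain s where s: "smooth_section B S N s" "fst \<circ> s = f" "\<And>x. x \<in> N \<Longrightarrow> snd (s x) C = u (bcoord C x)"
    by (rule section_ex[OF f(1) C f(4), folded N_def, where u = u]) (use us[OF W] bW uK f(5) in \<open>auto simp: N_def\<close>)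
  have fx: "f x = e"
  proof (rule tcoord_inj[OF C f(4) e])
    show xN': "x \<in> bpt C ` W" using xN by (simp add: N_def)
    have "tcoord B C (f x) = case_sum y0 (\<lambda>a. u y0 (emb a))"
      using sectionD(4)[OF f(1) xN'] f(5)[OF xN'] by (simp add: tcoord_def y0_def fun_eq_iff split: sum.split)
    then show "tcoord B C (f x) = tcoord B C e" using t0 by simp
  qed
  have fs: "fst (s y) = f y" for y using s(2) by (metis comp_apply)
  have ar: "around B C (fst (s x))" using C e fx fs by (simp add: around_def)
  have "snd (jet1 B s x) C q = u1 q" for q
  proof (cases q)
    case (Inl i)
    then show ?thesis using s(3)[OF xN] ar u0 by (simp add: jet1_def y0_def)
  next
    case (Inr p)
    obtain i \<rho> where p: "p = (i, \<rho>)" by (cases p)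
    have oW: "open_in UNIV W" using W by simp
    have "pd \<rho> (\<lambda>y. snd (s (bpt C y)) C i) y0 = pd \<rho> (\<lambda>y. u y i) y0"
    proof (rule pd_cong[OF finite oW y0 UNIV_I])
      fix y assume y: "y \<in> W"
      then have "bpt C y \<in> N" by (simp add: N_def)
      then show "snd (s (bpt C y)) C i = u y i" using s(3) bcoord_bpt f(2) y by (metis subsetD)
    qed
    also have "\<dots> = u1 (Inr (i, \<rho>))" unfolding u_def by (rule pd_affine)
    finally show ?thesis using ar by (simp add: jet1_def Inr p y0_def)
  qed
  then show ?thesis using that[OF s(1)] xN fx fs by (simp add: x_def fun_eq_iff)
qed

lemma J1_coord_bundle: "coord_bundle B (J1 B S) (K <+> K \<times> UNIV) (\<lambda>a. Inl (emb a))"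
proof (unfold_locales)
  show "finite (K <+> K \<times> (UNIV :: 'n set))" using finite_K by simp
  show "Inl (emb a) \<in> K <+> K \<times> UNIV" for a using emb_K by auto
  fix z assume "z \<in> J1 B S"
  then obtain s x N where s: "z = jet1 B s x" "smooth_section B S N s" "x \<in> N" by (auto simp: J1_def)
  have sx: "s x \<in> S" by (rule smooth_sectionD(2)[OF s(2,3)])
  have f: "fst z = fst (s x)" by (simp add: s jet1_def)
  show "fst z \<in> tspace B" using pt_tspace[OF sx] f by simp
  show "snd z C i = 0" if "\<not> around B C (fst z)" for C i using that f by (simp add: s jet1_def)
  fix C assume ar: "around B C (fst z)"
  have l: "snd z C (Inl i) = snd (s x) C i" for i using ar f by (simp add: s jet1_def)
  show "snd z C (Inl (emb a)) = fcoord C (fst z) a" for a using pt_emb[OF sx] ar f l by simp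
  have sK: "snd (s x) C \<in> coord_space K" using pt_coord[OF sx] ar f by simp
  show "snd z C \<in> coord_space (K <+> K \<times> UNIV)"
    unfolding coord_space_def
  proof (intro CollectI allI impI)
    fix q assume q: "q \<notin> K <+> K \<times> (UNIV :: 'n set)"
    show "snd z C q = 0"
    proof (cases q)
      case (Inl i)
      then show ?thesis using q sK l by (auto simp: coord_space_def)
    next
      case (Inr p)
      obtain i \<rho> where p: "p = (i, \<rho>)" by (cases p)
      have i: "i \<notin> K" using q Inr p by auto
      have C: "adapted B C" "fst (s x) \<in> fdom C" using ar f by (auto simp: around_def)
      note V = smooth_section_around[OF s(2) C(1)]
      have oV: "open_in UNIV (bcoord C ` {x \<in> N. fst (s x) \<in> fdom C})" using V(1) by simp
      have "pd \<rho> (\<lambda>y. snd (s (bpt C y)) C i) (bcoord C x) = pd \<rho> (\<lambda>_. 0) (bcoord C x)"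
      proof (rule pd_cong[OF finite oV _ UNIV_I])
        show "bcoord C x \<in> bcoord C ` {x \<in> N. fst (s x) \<in> fdom C}" using s C by auto
        fix y assume "y \<in> bcoord C ` {x \<in> N. fst (s x) \<in> fdom C}"
        from V(2)[OF this] have "snd (s (bpt C y)) C \<in> coord_space K"
          using C by (intro pt_coord) (auto simp: around_def)
        then show "snd (s (bpt C y)) C i = 0" using i by (simp add: coord_space_def)
      qed
      then show ?thesis using ar f by (simp add: s jet1_def Inr p pd_const)
    qed
  qed
next
  fix C e u1
  assume ar: "around B C e" and u1: "u1 \<in> coord_space (K <+> K \<times> (UNIV :: 'n set))"
    and ue: "\<And>a. u1 (Inl (emb a)) = fcoord C e a"
  have C: "adapted B C" "e \<in> fdom C" using ar by (auto simp: around_def)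
  obtain s N where s: "smooth_section B S N s" "proj B e \<in> N" "fst (s (proj B e)) = e"
    "snd (jet1 B s (proj B e)) C = u1"
    by (rule J1_section[OF C u1 ue])
  have "jet1 B s (proj B e) \<in> J1 B S" unfolding J1_def using s(1,2) by blast
  moreover have "fst (jet1 B s (proj B e)) = e" using s(3) by (simp add: jet1_def)
  ultimately show "\<exists>z\<in>J1 B S. fst z = e \<and> snd z C = u1" using s(4) by blast
next
  fix C C' :: "('x, 'e, 'n, 'm) fchart" and q :: "'i + 'i \<times> 'n"
  assume C: "adapted B C" "adapted B C'"
  let ?O = "overlap B (K <+> K \<times> (UNIV :: 'n set)) (\<lambda>a. Inl (emb a)) C C'"
  let ?K1 = "K <+> K \<times> (UNIV :: 'n set)"
  have finK1: "finite (bidx ?K1 :: ('n + ('i + 'i \<times> 'n)) set)" using finite_K by (intro finite_bidx) simp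
  \<comment> \<open>Dropping the derivative slots lets the transition functions of \<open>S\<close>
    be reused on the larger coordinate space.\<close>
  define trunc where "trunc = (\<lambda>y :: 'n + ('i + 'i \<times> 'n) \<Rightarrow> real. case_sum (\<lambda>n. y (Inl n)) (\<lambda>i. y (Inr (Inl i))))"
  have trc: "trunc y \<in> coord_space (bidx K)" if y: "y \<in> coord_space (bidx ?K1)" for y
    unfolding coord_space_def
  proof (intro CollectI allI impI)
    fix p :: "'n + 'i" assume p: "p \<notin> bidx K"
    then obtain i where i: "p = Inr i" "i \<notin> K" by (cases p) auto
    then have "Inr (Inl i) \<notin> (bidx ?K1 :: ('n + ('i + 'i \<times> 'n)) set)" by auto
    then show "trunc y p = 0" using y i by (simp add: trunc_def coord_space_def)
  qed
  have O_eq: "?O = {y \<in> coord_space (bidx ?K1). trunc y \<in> overlap B K emb C C'}"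
    using trc by (auto simp: trunc_def overlap_def)
  have trO: "trunc y \<in> overlap B K emb C C'" if "y \<in> ?O" for y
    using that by (simp add: O_eq)
  have trs: "smooth_fun (bidx ?K1) ?O (\<lambda>y. trunc y p)" for p
    by (cases p) (simp_all add: trunc_def smooth_coord)
  have oO: "open_in (bidx ?K1) ?O"
    unfolding O_eq
  proof (rule open_in_preimage[OF open_in_coord_space _ overlap_open[OF C] trc])
    show "smooth_fun (bidx ?K1) (coord_space (bidx ?K1)) (\<lambda>y. trunc y p)" for p
      by (cases p) (simp_all add: trunc_def smooth_coord)
  qed
  have comp: "smooth_fun (bidx ?K1) ?O (\<lambda>y. g (trunc y))" if "smooth_fun (bidx K) (overlap B K emb C C') g" for g
    by (rule smooth_compose[OF finite_bK overlap_open[OF C] that trO finK1 oO trs])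
  have jtr: "trunc (jcoord B C (jet1 B s x)) = jcoord B C (s x)" if "around B C (fst (s x))" for s and x :: 'x
    using that by (simp add: trunc_def jcoord_def jet1_def fun_eq_iff split: sum.split)
  show "\<exists>T. smooth_fun (bidx ?K1) ?O T \<and>
      (\<forall>z\<in>J1 B S. fst z \<in> fdom C \<longrightarrow> fst z \<in> fdom C' \<longrightarrow> snd z C' q = T (jcoord B C z))"
  proof (cases q)
    case (Inl i)
    show ?thesis
    proof (intro exI[of _ "\<lambda>y. tr C C' i (trunc y)"] conjI ballI impI)
      show "smooth_fun (bidx ?K1) ?O (\<lambda>y. tr C C' i (trunc y))" by (rule comp[OF tr_smooth[OF C]])
      fix z assume z: "z \<in> J1 B S" "fst z \<in> fdom C" "fst z \<in> fdom C'"
      then obtain s x N where s: "z = jet1 B s x" "smooth_section B S N s" "x \<in> N" by (auto simp: J1_def)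
      have ar: "around B C (fst (s x))" "around B C' (fst (s x))" using z C by (auto simp: s jet1_def around_def)
      show "snd z C' q = tr C C' i (trunc (jcoord B C z))"
        unfolding s(1) jtr[where s = s and x = x, OF ar(1)] tr_eq[OF smooth_sectionD(2)[OF s(2,3)] ar, symmetric]
        using ar by (simp add: jet1_def Inl)
    qed
  next
    case (Inr p)
    obtain i \<kappa> where p: "p = (i, \<kappa>)" by (cases p)
    \<comment> \<open>The right-hand side of \<open>jet1_trans\<close>, with the data of the section
      replaced by coordinates of its jet.\<close>
    define T where "T = (\<lambda>y. \<Sum>\<rho>\<in>UNIV. jac C' C (bpt C (\<lambda>n. y (Inl n))) \<rho> \<kappa> *
      (pd (Inl \<rho>) (tr C C' i) (trunc y) + (\<Sum>j\<in>K. pd (Inr j) (tr C C' i) (trunc y) * y (Inr (Inr (j, \<rho>))))))"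
    show ?thesis
    proof (intro exI[of _ T] conjI ballI impI)
      have J: "smooth_fun (bidx ?K1) ?O (\<lambda>y. jac C' C (bpt C (\<lambda>n. y (Inl n))) \<rho> \<kappa>)" for \<rho>
      proof (rule smooth_compose[where J = UNIV and V = "bcoord C ` (bdom C \<inter> bdom C')"
            and f = "\<lambda>v. jac C' C (bpt C v) \<rho> \<kappa>" and g = "\<lambda>y n. y (Inl n)"])
        show "smooth_fun UNIV (bcoord C ` (bdom C \<inter> bdom C')) (\<lambda>v. jac C' C (bpt C v) \<rho> \<kappa>)"
          by (rule jac_smooth[OF fibred_axioms C])
        show "(\<lambda>n. y (Inl n)) \<in> bcoord C ` (bdom C \<inter> bdom C')" if y: "y \<in> ?O" for y
        proof -
          obtain e where e: "e \<in> fdom C" "e \<in> fdom C'"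
            "case_sum (\<lambda>n. y (Inl n)) (\<lambda>a. y (Inr (Inl (emb a)))) = tcoord B C e"
            using y by (auto simp: overlap_def)
          have "(\<lambda>n. y (Inl n)) = bcoord C (proj B e)"
            using fun_cong[OF e(3), of "Inl n" for n] by (auto simp: tcoord_def)
          then show ?thesis using e fdom_proj C by auto
        qed
      qed (use base_trans(1)[OF C] finK1 oO in \<open>auto intro: smooth_coord\<close>)
      show "smooth_fun (bidx ?K1) ?O T"
        unfolding T_def
        by (intro smooth_sum[OF finK1 oO] smooth_mult[OF finK1 oO] smooth_add[OF finK1 oO] J
            comp[OF smooth_pd[OF tr_smooth[OF C]]] smooth_coord) auto
      fix z assume z: "z \<in> J1 B S" "fst z \<in> fdom C" "fst z \<in> fdom C'"
      then obtain s x N where s: "z = jet1 B s x" "smooth_section B S N s" "x \<in> N" by (auto simp: J1_def)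
      have ar: "around B C (fst (s x))" "around B C' (fst (s x))" using z C by (auto simp: s jet1_def around_def)
      have pr: "proj B (fst (s x)) = x" using sectionD(4)[OF smooth_sectionD(1)[OF s(2)] s(3)] by simp
      have xb: "x \<in> bdom C" using smooth_section_around(3)[OF s(2) C(1) s(3)] ar by (simp add: around_def)
      have b: "bpt C (\<lambda>n. jcoord B C z (Inl n)) = x"
        using pr bpt_bcoord[OF C(1) xb] by (simp add: s jcoord_def jet1_def)
      have m: "jcoord B C z (Inr (Inr (j, \<rho>))) = snd (jet1 B s x) C (Inr (j, \<rho>))" for j \<rho>
        by (simp add: jcoord_def s)
      show "snd z C' q = T (jcoord B C z)"
        unfolding T_def b m unfolding s(1) jtr[where s = s and x = x, OF ar(1)] Inr p by (rule jet1_trans[OF s(2,3) ar])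
    qed
  qed
qed

text \<open>The new transition function is \<open>P\<close> after the old transition after
  \<open>E\<close>. The point of \<open>lift\<close> is that the lift is chosen in one chart
  \<open>C\<close>, while \<open>P\<close> must recover the coordinates of \<open>z'\<close> from it
  in every chart.\<close>

lemma transfer:
  fixes S' :: "('x, 'e, 'n, 'm, 'j) pt set"
  assumes finK': "finite K'" and embK': "\<And>a. emb' a \<in> K'"
    and pt_t: "\<And>z. z \<in> S' \<Longrightarrow> fst z \<in> tspace B"
    and pt_z: "\<And>z C i. z \<in> S' \<Longrightarrow> \<not> around B C (fst z) \<Longrightarrow> snd z C i = 0"
    and pt_c: "\<And>z C. z \<in> S' \<Longrightarrow> around B C (fst z) \<Longrightarrow> snd z C \<in> coord_space K'"
    and pt_e: "\<And>z C a. z \<in> S' \<Longrightarrow> around B C (fst z) \<Longrightarrow> snd z C (emb' a) = fcoord C (fst z) a"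
    and pt_x: "\<And>C e u. around B C e \<Longrightarrow> u \<in> coord_space K' \<Longrightarrow> (\<And>a. u (emb' a) = fcoord C e a) \<Longrightarrow>
      \<exists>z\<in>S'. fst z = e \<and> snd z C = u"
    and E: "\<And>i. smooth_fun K' (coord_space K') (\<lambda>u. E u i)" "\<And>u. u \<in> coord_space K' \<Longrightarrow> E u \<in> coord_space K"
      "\<And>u a. E u (emb a) = u (emb' a)"
    and P: "\<And>i. smooth_fun K (coord_space K) (\<lambda>v. P v i)"
    and lift: "\<And>z' C. z' \<in> S' \<Longrightarrow> around B C (fst z') \<Longrightarrow>
      \<exists>z\<in>S. fst z = fst z' \<and> snd z C = E (snd z' C) \<and> (\<forall>C'. around B C' (fst z') \<longrightarrow> snd z' C' = P (snd z C'))"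
  shows "coord_bundle B S' K' emb'"
proof (unfold_locales)
  fix C C' :: "('x, 'e, 'n, 'm) fchart" and i :: 'j
  assume C: "adapted B C" "adapted B C'"
  let ?O = "overlap B K' emb' C C'"
  have fin: "finite (bidx K' :: ('n + 'j) set)" by (rule finite_bidx[OF finK'])
  define G where "G = (\<lambda>y. case_sum (\<lambda>n. y (Inl n)) (E (\<lambda>i. y (Inr i))) :: 'n + 'i \<Rightarrow> real)"
  have Gs: "smooth_fun (bidx K') (coord_space (bidx K')) (\<lambda>y. G y q)" for q
  proof (cases q)
    case (Inr j)
    define r where "r = (\<lambda>(y :: 'n + 'j \<Rightarrow> real) i. y (Inr i))"
    have "smooth_fun (bidx K') (coord_space (bidx K')) (\<lambda>y. E (r y) j)"
    proof (rule smooth_compose[OF finK' open_in_coord_space E(1) _ fin open_in_coord_space])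
      show "r y \<in> coord_space K'" if "y \<in> coord_space (bidx K')" for y
        unfolding r_def by (rule coord_space_bidx[OF that])
      show "smooth_fun (bidx K') (coord_space (bidx K')) (\<lambda>y. r y q)" for q
        unfolding r_def by (rule smooth_coord)
    qed
    then show ?thesis by (simp add: G_def Inr r_def)
  qed (simp add: G_def smooth_coord)
  have Gc: "G y \<in> coord_space (bidx K)" if "y \<in> coord_space (bidx K')" for y
    unfolding G_def by (rule case_sum_coord_space[OF E(2)[OF coord_space_bidx[OF that]]])
  have O_eq: "?O = {y \<in> coord_space (bidx K'). G y \<in> overlap B K emb C C'}"
    using Gc by (auto simp: overlap_def G_def E(3))
  have oO: "open_in (bidx K') ?O"
    unfolding O_eq by (rule open_in_preimage[OF open_in_coord_space Gs overlap_open[OF C] Gc])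
  have Oc: "?O \<subseteq> coord_space (bidx K')" by (auto simp: O_eq)
  define H where "H = (\<lambda>y j. tr C C' j (G y))"
  have Hs: "smooth_fun (bidx K') ?O (\<lambda>y. H y j)" for j
    unfolding H_def
    by (rule smooth_compose[OF finite_bK overlap_open[OF C] tr_smooth[OF C] _ fin oO smooth_subset[OF Gs Oc]])
      (simp add: O_eq)
  have Hc: "H y \<in> coord_space K" if "y \<in> ?O" for y
  proof -
    have "G y \<in> overlap B K emb C C'" using that by (simp add: O_eq)
    then obtain z where z: "z \<in> S" "fst z \<in> fdom C" "fst z \<in> fdom C'" "jcoord B C z = G y"
      using overlap_pt[OF _ C(1)] by metis
    have a: "around B C (fst z)" "around B C' (fst z)" using z C by (auto simp: around_def)
    have "H y = snd z C'" unfolding H_def using tr_eq[OF z(1) a] z(4) by auto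
    then show ?thesis using pt_coord[OF z(1) a(2)] by simp
  qed
  show "\<exists>T. smooth_fun (bidx K') ?O T \<and>
      (\<forall>z\<in>S'. fst z \<in> fdom C \<longrightarrow> fst z \<in> fdom C' \<longrightarrow> snd z C' i = T (jcoord B C z))"
  proof (intro exI[of _ "\<lambda>y. P (H y) i"] conjI ballI impI)
    show "smooth_fun (bidx K') ?O (\<lambda>y. P (H y) i)"
      by (rule smooth_compose[OF finite_K open_in_coord_space P Hc fin oO Hs])
    fix z' assume z': "z' \<in> S'" "fst z' \<in> fdom C" "fst z' \<in> fdom C'"
    have a: "around B C (fst z')" "around B C' (fst z')" using z' C by (auto simp: around_def)
    obtain z where z: "z \<in> S" "fst z = fst z'" "snd z C = E (snd z' C)"
      "\<And>C'. around B C' (fst z') \<Longrightarrow> snd z' C' = P (snd z C')" using lift[OF z'(1) a(1)] by blast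
    have "jcoord B C z = G (jcoord B C z')" using z by (simp add: G_def jcoord_def)
    then have "snd z C' = H (jcoord B C z')"
      unfolding H_def using tr_eq[OF z(1), of C C'] a z(2) by auto
    then show "snd z' C' i = P (H (jcoord B C z')) i" using z(4)[OF a(2)] by simp
  qed
qed (fact finK' embK' pt_t pt_z pt_c pt_e pt_x)+

end

section \<open>Multi-indices\<close>

text \<open>The multinomial coefficient of \<open>I\<close>: how often a multi-index occurs in a sum
  over all index values.\<close>

abbreviation orderings :: "'n multiset \<Rightarrow> real" where
  "orderings I \<equiv> real (card (permutations_of_multiset I))"

lemma orderings_pos: "orderings I > 0"
  by (simp add: card_gt_0_iff)

lemma add_mset_last_butlast:
  assumes "mset \<mu>s = I" "\<mu>s \<noteq> []"
  shows "add_mset (last \<mu>s) (mset (butlast \<mu>s)) = I"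
proof -
  have "mset (butlast \<mu>s @ [last \<mu>s]) = I" using assms(1) append_butlast_last_id[OF assms(2)] by metis
  then show ?thesis by simp
qed

lemma finite_lists_length: "finite {\<mu>s :: 'n::finite list. length \<mu>s = l}"
  using finite_lists_length_eq[of "UNIV :: 'n set" l] by simp

lemma mset_lists: "mset ` {\<mu>s :: 'n list. length \<mu>s = l} = {I. size I = l}"
proof (intro equalityI subsetI)
  fix I :: "'n multiset" assume I: "I \<in> {I. size I = l}"
  obtain \<mu>s where "mset \<mu>s = I" using ex_mset by blast
  then show "I \<in> mset ` {\<mu>s. length \<mu>s = l}" using I by auto
qed auto

lemma finite_msets_size: "finite {I :: 'n::finite multiset. size I = l}"
  unfolding mset_lists[symmetric] by (intro finite_imageI finite_lists_length)

lemma jidx_eq: "jidx k = (\<Union>l\<le>k. {I. size I = l}) \<times> UNIV"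
  by (auto simp: jidx_def)

lemma finite_jidx: "finite (jidx k :: ('n::finite, 'm::finite) jidx set)"
  unfolding jidx_eq by (intro finite_cartesian_product finite_UN_I finite_msets_size) auto

lemma jidx_iff [simp]: "(I, a) \<in> jidx k \<longleftrightarrow> size I \<le> k"
  by (simp add: jidx_def)

lemma sum_lists_mset:
  fixes F :: "'n::finite multiset \<Rightarrow> real"
  shows "(\<Sum>\<mu>s | length \<mu>s = l. F (mset \<mu>s)) = (\<Sum>I | size I = l. orderings I * F I)"
proof -
  have "(\<Sum>\<mu>s | length \<mu>s = l. F (mset \<mu>s)) =
      (\<Sum>I\<in>mset ` {\<mu>s. length \<mu>s = l}. \<Sum>\<mu>s\<in>{\<mu>s \<in> {\<mu>s. length \<mu>s = l}. mset \<mu>s = I}. F (mset \<mu>s))"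
    by (rule sum.image_gen[OF finite_lists_length])
  also have "\<dots> = (\<Sum>I | size I = l. orderings I * F I)"
    unfolding mset_lists
  proof (rule sum.cong[OF refl])
    fix I :: "'n multiset" assume "I \<in> {I. size I = l}"
    then have "{\<mu>s \<in> {\<mu>s. length \<mu>s = l}. mset \<mu>s = I} = permutations_of_multiset I"
      by (auto simp: permutations_of_multiset_def)
    then show "(\<Sum>\<mu>s\<in>{\<mu>s \<in> {\<mu>s. length \<mu>s = l}. mset \<mu>s = I}. F (mset \<mu>s)) = orderings I * F I"
      by (simp add: permutations_of_multiset_def)
  qed
  finally show ?thesis .
qed

lemma contract_eq: "contract k j v = (\<Sum>i\<in>jidx k. orderings (fst i) * (j i * v i))"
proof -
  have "(\<Sum>\<mu>s | length \<mu>s = l. \<Sum>a\<in>UNIV. j (mset \<mu>s, a) * v (mset \<mu>s, a)) =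
     (\<Sum>I | size I = l. \<Sum>a\<in>UNIV. orderings I * (j (I, a) * v (I, a)))" for l
    using sum_lists_mset[of "\<lambda>I. \<Sum>a\<in>UNIV. j (I, a) * v (I, a)" l] by (simp add: sum_distrib_left)
  then have "contract k j v = (\<Sum>l\<le>k. \<Sum>I | size I = l. \<Sum>a\<in>UNIV. orderings I * (j (I, a) * v (I, a)))"
    by (simp add: contract_def)
  also have "\<dots> = (\<Sum>I\<in>(\<Union>l\<le>k. {I. size I = l}). \<Sum>a\<in>UNIV. orderings I * (j (I, a) * v (I, a)))"
    by (rule sum.UNION_disjoint[symmetric]) (auto simp: finite_msets_size)
  also have "\<dots> = (\<Sum>i\<in>jidx k. orderings (fst i) * (j i * v i))"
    unfolding jidx_eq by (simp add: sum.cartesian_product case_prod_unfold)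
  finally show ?thesis .
qed

section \<open>Taylor polynomials\<close>

text \<open>The factorials make differentiation remove an index without producing a factor, so that
  the coefficients of \<open>taylor\<close> are exactly its derivatives at
  \<open>x0\<close>.\<close>

definition monomial :: "('n::finite \<Rightarrow> real) \<Rightarrow> 'n multiset \<Rightarrow> ('n \<Rightarrow> real) \<Rightarrow> real" where
  "monomial x0 J y = (\<Prod>i\<in>UNIV. (y i - x0 i) ^ count J i / fact (count J i))"

lemma smooth_monomial: "open U \<Longrightarrow> smooth_fun UNIV U (monomial x0 J)"
  unfolding monomial_def[abs_def]
  by (intro smooth_prod smooth_divide smooth_power smooth_diff smooth_const smooth_coord) simp_all

lemma pd_monomial: "pd i (monomial x0 J) = (if i \<in># J then monomial x0 (J - {#i#}) else (\<lambda>_. 0))"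
proof
  fix y :: "'a \<Rightarrow> real"
  define R where "R = (\<Prod>j\<in>UNIV - {i}. (y j - x0 j) ^ count J j / fact (count J j))"
  have eq: "monomial x0 J (y(i := t)) = (t - x0 i) ^ count J i / fact (count J i) * R" for t
  proof -
    have "(\<Prod>j\<in>UNIV - {i}. ((y(i := t)) j - x0 j) ^ count J j / fact (count J j)) = R"
      unfolding R_def by (rule prod.cong) auto
    then show ?thesis unfolding monomial_def by (subst prod.remove[of _ i]) auto
  qed
  show "pd i (monomial x0 J) y = (if i \<in># J then monomial x0 (J - {#i#}) else (\<lambda>_. 0)) y"
  proof (cases "i \<in># J")
    case True
    then obtain c where c: "count J i = Suc c" by (metis gr0_conv_Suc count_greater_zero_iff)
    have R': "monomial x0 (J - {#i#}) y = (y i - x0 i) ^ c / fact c * R"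
    proof -
      have "(\<Prod>j\<in>UNIV - {i}. (y j - x0 j) ^ count (J - {#i#}) j / fact (count (J - {#i#}) j)) = R"
        unfolding R_def by (rule prod.cong) auto
      then show ?thesis unfolding monomial_def using c by (subst prod.remove[of _ i]) auto
    qed
    have f: "fact (Suc c) = real (Suc c) * fact c" by simp
    have d1: "((\<lambda>t. t - x0 i) has_real_derivative 1) (at (y i))" by (auto intro!: derivative_eq_intros)
    have "((\<lambda>t. (t - x0 i) ^ Suc c) has_real_derivative (real (Suc c) * (y i - x0 i) ^ c)) (at (y i))"
      using DERIV_power_Suc[OF d1, of c] by simp
    then have "((\<lambda>t. (t - x0 i) ^ Suc c / fact (Suc c) * R) has_real_derivative
        (real (Suc c) * (y i - x0 i) ^ c) / fact (Suc c) * R) (at (y i))"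
      by (intro DERIV_cmult_right DERIV_cdivide)
    moreover have "(real (Suc c) * (y i - x0 i) ^ c) / fact (Suc c) = (y i - x0 i) ^ c / fact c"
      unfolding f by (rule mult_divide_mult_cancel_left) simp
    ultimately have "((\<lambda>t. (t - x0 i) ^ Suc c / fact (Suc c) * R) has_real_derivative
        (y i - x0 i) ^ c / fact c * R) (at (y i))" by (simp only:)
    then have "pd i (monomial x0 J) y = (y i - x0 i) ^ c / fact c * R"
      unfolding pd_def eq c by (rule DERIV_imp_deriv)
    then show ?thesis using True R' by simp
  next
    case False
    then have "count J i = 0" by (simp add: not_in_iff)
    then show ?thesis unfolding pd_def eq using False by simp
  qed
qed

lemma add_mset_subseteq: "add_mset i M \<subseteq># J \<longleftrightarrow> M \<subseteq># J \<and> i \<in># J - M"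
proof
  assume "add_mset i M \<subseteq># J"
  then have c: "count (add_mset i M) x \<le> count J x" for x by (simp add: subseteq_mset_def)
  have "count M x \<le> count J x" for x using c[of x] by (auto split: if_splits)
  moreover have "count M i < count J i" using c[of i] by simp
  ultimately show "M \<subseteq># J \<and> i \<in># J - M" by (simp add: subseteq_mset_def in_diff_count)
next
  assume "M \<subseteq># J \<and> i \<in># J - M"
  then have "count M x \<le> count J x" "count M i < count J i" for x
    by (simp_all add: subseteq_mset_def in_diff_count)
  then show "add_mset i M \<subseteq># J" by (simp add: subseteq_mset_def Suc_le_eq)
qed

lemma pds_monomial:
  "pds \<mu>s (monomial x0 J) = (if mset \<mu>s \<subseteq># J then monomial x0 (J - mset \<mu>s) else (\<lambda>_. 0))"
proof (induction \<mu>s)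
  case (Cons i \<mu>s)
  have "J - mset \<mu>s - {#i#} = J - mset (i # \<mu>s)" by simp
  then show ?case
    unfolding pds_Cons Cons.IH mset.simps add_mset_subseteq by (simp add: pd_monomial pd_const)
qed simp

lemma monomial_base: "monomial x0 J x0 = (if J = {#} then 1 else 0)"
proof (cases "J = {#}")
  case False
  then obtain i where "i \<in># J" by blast
  then have "count J i \<noteq> 0" by simp
  then have "(x0 i - x0 i) ^ count J i / fact (count J i) = 0" by simp
  then have "monomial x0 J x0 = 0" unfolding monomial_def by (intro prod_zero) auto
  then show ?thesis using False by simp
qed (simp add: monomial_def)

lemma smooth_lincomb:
  assumes "finite I" "open_in I U" "\<And>j. j \<in> J \<Longrightarrow> smooth_fun I U (f j)"
  shows "smooth_fun I U (\<lambda>y. \<Sum>j\<in>J. c j * f j y)"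
  by (rule smooth_sum[OF assms(1,2) smooth_cmult[OF assms(1,2) assms(3)]])

lemma pds_lincomb:
  assumes I: "finite I" "open_in I U" and f: "\<And>j. j \<in> J \<Longrightarrow> smooth_fun I U (f j)" and "set \<mu>s \<subseteq> I" and "y \<in> U"
  shows "pds \<mu>s (\<lambda>y. \<Sum>j\<in>J. c j * f j y) y = (\<Sum>j\<in>J. c j * pds \<mu>s (f j) y)"
  using assms(4,5)
proof (induction \<mu>s arbitrary: y)
  case (Cons i \<mu>s)
  have i: "i \<in> I" "set \<mu>s \<subseteq> I" using Cons.prems by auto
  have "pds (i # \<mu>s) (\<lambda>y. \<Sum>j\<in>J. c j * f j y) y = pd i (\<lambda>y. \<Sum>j\<in>J. c j * pds \<mu>s (f j) y) y"
    unfolding pds_Cons by (rule pd_cong[OF I Cons.prems(2) i(1) Cons.IH[OF i(2)]])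
  also have "\<dots> = (\<Sum>j\<in>J. pd i (\<lambda>y. c j * pds \<mu>s (f j) y) y)"
    by (rule smooth_pd_sum[OF I smooth_cmult[OF I smooth_pds[OF f i(2)]] Cons.prems(2) i(1)])
  also have "\<dots> = (\<Sum>j\<in>J. c j * pd i (pds \<mu>s (f j)) y)"
    by (rule sum.cong[OF refl smooth_pd_cmult[OF smooth_pds[OF f i(2)] Cons.prems(2) i(1)]])
  finally show ?case by simp
qed simp

definition taylor :: "nat \<Rightarrow> ('n::finite \<Rightarrow> real) \<Rightarrow> ('n multiset \<Rightarrow> real) \<Rightarrow> ('n \<Rightarrow> real) \<Rightarrow> real" where
  "taylor k x0 u y = (\<Sum>J\<in>(\<Union>l\<le>k. {J. size J = l}). u J * monomial x0 J y)"

lemma smooth_taylor: "open U \<Longrightarrow> smooth_fun UNIV U (taylor k x0 u)"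
  unfolding taylor_def[abs_def] by (rule smooth_lincomb) (simp_all add: smooth_monomial)

lemma pdm_taylor:
  assumes "size I \<le> k"
  shows "pdm I (taylor k x0 u) x0 = u I"
proof -
  obtain \<mu>s where I: "I = mset \<mu>s" by (metis ex_mset)
  have "pdm I (taylor k x0 u) x0 = pds \<mu>s (taylor k x0 u) x0"
    unfolding I by (rule pdm_eq[OF finite _ smooth_taylor[OF open_UNIV]]) simp_all
  also have "\<dots> = (\<Sum>J\<in>(\<Union>l\<le>k. {J. size J = l}). u J * pds \<mu>s (monomial x0 J) x0)"
    unfolding taylor_def[abs_def] by (rule pds_lincomb[OF finite _ smooth_monomial[OF open_UNIV]]) simp_all
  also have "\<dots> = (\<Sum>J\<in>(\<Union>l\<le>k. {J. size J = l}). if J = I then u J else 0)"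
  proof (rule sum.cong[OF refl])
    fix J :: "'a multiset"
    have "(I \<subseteq># J \<and> J - I = {#}) \<longleftrightarrow> J = I"
      by (metis Diff_eq_empty_iff_mset subset_mset.antisym subset_mset.order_refl)
    then show "u J * pds \<mu>s (monomial x0 J) x0 = (if J = I then u J else 0)"
      by (auto simp: pds_monomial monomial_base I)
  qed
  also have "\<dots> = u I" using assms by (subst sum.delta) (auto simp: finite_msets_size)
  finally show ?thesis .
qed

section \<open>Jet bundles\<close>

lemma Jet_cases:
  assumes "z \<in> Jet B k"
  obtains f N x where "z = jet B k f x" "local_section B N f" "x \<in> N"
  using assms by (auto simp: Jet_def)

lemma fst_jet [simp]: "fst (jet B k f x) = f x"
  by (simp add: jet_def)

lemma snd_jet: "snd (jet B k f x) C (I, a) = (if around B C (f x) \<and> size I \<le> k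
     then pdm I (\<lambda>y. fcoord C (f (bpt C y)) a) (bcoord C x) else 0)"
  by (simp add: jet_def)

context fibred begin

lemma section_coord:
  assumes f: "local_section B N f" and C: "adapted B C"
  shows "y \<in> bcoord C ` {x \<in> N. f x \<in> fdom C} \<Longrightarrow> bpt C y \<in> N \<and> f (bpt C y) \<in> fdom C \<and>
      bpt C y \<in> bdom C \<and> bcoord C (bpt C y) = y"
    "x \<in> N \<Longrightarrow> f x \<in> fdom C \<Longrightarrow> bpt C (bcoord C x) = x"
proof -
  show *: "bpt C (bcoord C x) = x" if "x \<in> N" "f x \<in> fdom C" for x
    using bpt_bcoord[OF C section_bdom[OF f C that]] .
  assume "y \<in> bcoord C ` {x \<in> N. f x \<in> fdom C}"
  then obtain x where x: "x \<in> N" "f x \<in> fdom C" "y = bcoord C x" by auto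
  then show "bpt C y \<in> N \<and> f (bpt C y) \<in> fdom C \<and> bpt C y \<in> bdom C \<and> bcoord C (bpt C y) = y"
    using *[OF x(1,2)] section_bdom[OF f C x(1,2)] by simp
qed

lemma snd_jet_bpt:
  assumes f: "local_section B N f" and C: "adapted B C" and y: "y \<in> bcoord C ` {x \<in> N. f x \<in> fdom C}"
  shows "snd (jet B k f (bpt C y)) C (I, a) =
    (if size I \<le> k then pdm I (\<lambda>y. fcoord C (f (bpt C y)) a) y else 0)"
  using section_coord(1)[OF f C y] C by (simp add: snd_jet around_def)

lemma jet_smooth_section:
  assumes f: "local_section B N f"
  shows "smooth_section B (Jet B k) N (jet B k f)"
proof -
  have "fst \<circ> jet B k f = f" by (simp add: fun_eq_iff)
  then show ?thesis
    unfolding smooth_section_def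
  proof (intro conjI ballI allI impI)
    show "jet B k f x \<in> Jet B k" if "x \<in> N" for x using that f by (auto simp: Jet_def)
    fix C :: "('x, 'e, 'n, 'm) fchart" and i :: "'n multiset \<times> 'm"
    assume C: "adapted B C"
    obtain I a where i: "i = (I, a)" by (cases i)
    let ?W = "bcoord C ` {x \<in> N. f x \<in> fdom C}"
    note s = section_chart[OF f C]
    have "smooth_fun UNIV ?W (\<lambda>y. if size I \<le> k then pdm I (\<lambda>y. fcoord C (f (bpt C y)) a) y else 0)"
      by (intro smooth_if smooth_pdm s(2) smooth_const) simp
    then have "smooth_fun UNIV ?W (\<lambda>y. snd (jet B k f (bpt C y)) C i)"
      unfolding i
      by (rule smooth_cong[rotated 2]) (use s(1) in \<open>simp_all add: snd_jet_bpt[OF f C]\<close>)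
    then show "smooth_fun UNIV (bcoord C ` {x \<in> N. fst (jet B k f x) \<in> fdom C})
       (\<lambda>y. snd (jet B k f (bpt C y)) C i)" by simp
  qed (use f in simp)
qed

lemma jet1_jet:
  assumes f: "local_section B N f" and x: "x \<in> N" and C: "around B C (f x)"
  shows "snd (jet1 B (jet B k f) x) C (Inl i) = snd (jet B k f x) C i"
    "snd (jet1 B (jet B k f) x) C (Inr ((I, a), \<rho>)) =
      (if size I \<le> k then snd (jet B (Suc k) f x) C (add_mset \<rho> I, a) else 0)"
proof -
  have Ca: "adapted B C" "f x \<in> fdom C" using C by (auto simp: around_def)
  show "snd (jet1 B (jet B k f) x) C (Inl i) = snd (jet B k f x) C i" using C by (simp add: jet1_def)
  let ?W = "bcoord C ` {x \<in> N. f x \<in> fdom C}"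
  let ?F = "\<lambda>y. fcoord C (f (bpt C y)) a"
  note s = section_chart[OF f Ca(1)]
  have oW: "open_in UNIV ?W" using s(1) by simp
  have xW: "bcoord C x \<in> ?W" using x Ca by auto
  have "snd (jet1 B (jet B k f) x) C (Inr ((I, a), \<rho>)) = pd \<rho> (\<lambda>y. snd (jet B k f (bpt C y)) C (I, a)) (bcoord C x)"
    using C by (simp add: jet1_def)
  also have "\<dots> = pd \<rho> (\<lambda>y. if size I \<le> k then pdm I ?F y else 0) (bcoord C x)"
    by (rule pd_cong[OF finite oW xW UNIV_I snd_jet_bpt[OF f Ca(1)]])
  also have "\<dots> = (if size I \<le> k then snd (jet B (Suc k) f x) C (add_mset \<rho> I, a) else 0)"
    using C pdm_add_mset[OF finite oW s(2) UNIV_I _ xW, where M = I] by (simp add: snd_jet pd_const)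
  finally show "snd (jet1 B (jet B k f) x) C (Inr ((I, a), \<rho>)) =
      (if size I \<le> k then snd (jet B (Suc k) f x) C (add_mset \<rho> I, a) else 0)" .
qed

text \<open>\<open>W0\<close> is shrunk to the points where the graph of \<open>s\<close> stays in
  the chart; the condition on \<open>s\<close> at the base point of \<open>e\<close> guarantees that
  this point survives.\<close>

lemma section_germ:
  assumes C: "adapted B C" and e: "e \<in> fdom C"
    and W0: "open W0" "bcoord C (proj B e) \<in> W0"
    and s: "\<And>a. smooth_fun UNIV W0 (\<lambda>y. s y a)" "\<And>a. s (bcoord C (proj B e)) a = fcoord C e a"
  obtains f N where "local_section B N f" "proj B e \<in> N" "f (proj B e) = e" "N \<subseteq> bdom C"
    "\<And>x. x \<in> N \<Longrightarrow> f x \<in> fdom C" "open (bcoord C ` N)" "bcoord C ` N \<subseteq> W0"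
    "\<And>x a. x \<in> N \<Longrightarrow> fcoord C (f x) a = s (bcoord C x) a"
    "\<And>y a. y \<in> bcoord C ` N \<Longrightarrow> fcoord C (f (bpt C y)) a = s y a"
proof -
  let ?y0 = "bcoord C (proj B e)"
  define W where "W = {y \<in> W0. case_sum y (s y) \<in> tcoord B C ` fdom C}"
  have "smooth_fun UNIV W0 (\<lambda>y. case_sum y (s y) q)" for q
    by (cases q) (simp_all add: smooth_coord s)
  then have W: "open W"
    unfolding W_def using chartsD(3)[OF tchart[OF C]] by (intro open_preimage_smooth[OF W0(1)]) simp_all
  have "case_sum ?y0 (s ?y0) = tcoord B C e"
    using s(2) by (simp add: tcoord_def fun_eq_iff split: sum.split)
  then have y0: "?y0 \<in> W" using e W0 by (auto simp: W_def)
  have WW0: "W \<subseteq> W0" by (auto simp: W_def)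
  have sW: "smooth_fun UNIV W (\<lambda>y. s y a)" for a by (rule smooth_subset[OF s(1) WW0])
  obtain f where f: "local_section B (bpt C ` W) f" "W \<subseteq> bcoord C ` bdom C"
    "\<And>x. x \<in> bpt C ` W \<Longrightarrow> bcoord C x \<in> W" "\<And>x. x \<in> bpt C ` W \<Longrightarrow> f x \<in> fdom C"
    "\<And>x a. x \<in> bpt C ` W \<Longrightarrow> fcoord C (f x) a = s (bcoord C x) a"
  proof (rule section_intro[OF C W sW])
    show "case_sum y (s y) \<in> tcoord B C ` fdom C" if "y \<in> W" for y using that by (simp add: W_def)
  qed blast
  let ?N = "bpt C ` W"
  have bW: "bcoord C ` ?N = W" using f(2) bcoord_bpt by (force simp: image_image)
  have xN: "proj B e \<in> ?N" using y0 bpt_bcoord[OF C fdom_proj[OF C e]] by (metis imageI)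
  have "tcoord B C (f (proj B e)) = tcoord B C e"
    using sectionD(4)[OF f(1) xN] f(5)[OF xN] s(2) by (simp add: tcoord_def fun_eq_iff split: sum.split)
  then have fe: "f (proj B e) = e" using tcoord_inj[OF C f(4)[OF xN] e] by simp
  have Nb: "?N \<subseteq> bdom C"
  proof
    fix x assume "x \<in> ?N"
    then show "x \<in> bdom C" by (intro section_bdom[OF f(1) C _ f(4)])
  qed
  have fb: "fcoord C (f (bpt C y)) a = s y a" if y: "y \<in> bcoord C ` ?N" for y a
  proof -
    obtain x where x: "x \<in> ?N" "y = bcoord C x" using y by (rule imageE)
    have "x \<in> bdom C" using x(1) Nb by (rule rev_subsetD)
    then have "bpt C y = x" unfolding x(2) by (rule bpt_bcoord[OF C])
    then show ?thesis using f(5)[OF x(1)] x(2) by (simp only:)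
  qed
  have oN: "open (bcoord C ` ?N)" "bcoord C ` ?N \<subseteq> W0" unfolding bW by (rule W WW0)+
  show ?thesis by (rule that[OF f(1) xN fe Nb f(4) oN f(5) fb])
qed

text \<open>Taylor polynomials realise every jet coordinate vector whose order-zero part matches
  \<open>e\<close>; this is what makes the jet coordinates free.\<close>

lemma polynomial_section:
  assumes C: "adapted B C" and e: "e \<in> fdom C" and u: "\<And>a. u ({#}, a) = fcoord C e a"
  obtains f N where "local_section B N f" "proj B e \<in> N" "f (proj B e) = e" "N \<subseteq> bdom C"
    "\<And>x. x \<in> N \<Longrightarrow> f x \<in> fdom C" "open (bcoord C ` N)"
    "\<And>y a. y \<in> bcoord C ` N \<Longrightarrow> fcoord C (f (bpt C y)) a = taylor k (bcoord C (proj B e)) (\<lambda>J. u (J, a)) y"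
    "\<And>I a. size I \<le> k \<Longrightarrow> snd (jet B k f (proj B e)) C (I, a) = u (I, a)"
proof -
  let ?y0 = "bcoord C (proj B e)"
  have t0: "taylor k ?y0 (\<lambda>J. u (J, a)) ?y0 = fcoord C e a" for a
    using pdm_taylor[of "{#}" k ?y0 "\<lambda>J. u (J, a)"] u by simp
  obtain f N where f: "local_section B N f" "proj B e \<in> N" "f (proj B e) = e" "N \<subseteq> bdom C"
    "\<And>x. x \<in> N \<Longrightarrow> f x \<in> fdom C" "open (bcoord C ` N)"
    "\<And>y a. y \<in> bcoord C ` N \<Longrightarrow> fcoord C (f (bpt C y)) a = taylor k ?y0 (\<lambda>J. u (J, a)) y"
    by (rule section_germ[OF C e open_UNIV UNIV_I smooth_taylor[OF open_UNIV] t0]) blast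
  have "snd (jet B k f (proj B e)) C (I, a) = u (I, a)" if "size I \<le> k" for I a
  proof -
    have oN: "open_in UNIV (bcoord C ` N)" using f(6) by simp
    have "snd (jet B k f (proj B e)) C (I, a) = pdm I (\<lambda>y. fcoord C (f (bpt C y)) a) ?y0"
      using that C e f(3) by (simp add: snd_jet around_def)
    also have "\<dots> = pdm I (taylor k ?y0 (\<lambda>J. u (J, a))) ?y0"
      by (rule pdm_cong[OF finite oN _ f(7)]) (use f(2) in auto)
    also have "\<dots> = u (I, a)" by (rule pdm_taylor[OF that])
    finally show ?thesis .
  qed
  note * = this
  show ?thesis by (rule that[OF f *])
qed

lemma Jet_facts:
  "z \<in> Jet B k \<Longrightarrow> fst z \<in> tspace B"
  "z \<in> Jet B k \<Longrightarrow> \<not> around B C (fst z) \<Longrightarrow> snd z C i = 0"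
  "z \<in> Jet B k \<Longrightarrow> around B C (fst z) \<Longrightarrow> snd z C \<in> coord_space (jidx k)"
  "z \<in> Jet B k \<Longrightarrow> around B C (fst z) \<Longrightarrow> snd z C ({#}, a) = fcoord C (fst z) a"
  "around B C e \<Longrightarrow> u \<in> coord_space (jidx k) \<Longrightarrow> (\<And>a. u ({#}, a) = fcoord C e a) \<Longrightarrow>
      \<exists>z\<in>Jet B k. fst z = e \<and> snd z C = u"
proof -
  show "fst z \<in> tspace B" if z: "z \<in> Jet B k" for z
    by (rule Jet_cases[OF z]) (use sectionD(3) in auto)
  show "snd z C i = 0" if z: "z \<in> Jet B k" and n: "\<not> around B C (fst z)" for z C i
    by (rule Jet_cases[OF z]) (use n in \<open>cases i, auto simp: snd_jet\<close>)
  show "snd z C \<in> coord_space (jidx k)" if z: "z \<in> Jet B k" "around B C (fst z)" for z C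
    by (rule Jet_cases[OF z(1)]) (auto simp: snd_jet coord_space_def)
  show "snd z C ({#}, a) = fcoord C (fst z) a" if z: "z \<in> Jet B k" "around B C (fst z)" for z C a
  proof -
    obtain f N x where f: "z = jet B k f x" "local_section B N f" "x \<in> N" by (rule Jet_cases[OF z(1)])
    have C: "adapted B C" "f x \<in> fdom C" using z(2) f by (auto simp: around_def)
    show ?thesis using z(2) f section_coord(2)[OF f(2) C(1) f(3) C(2)] by (simp add: snd_jet)
  qed
  show "\<exists>z\<in>Jet B k. fst z = e \<and> snd z C = u"
    if ar: "around B C e" and u: "u \<in> coord_space (jidx k)" and ue: "\<And>a. u ({#}, a) = fcoord C e a" for C e u
  proof -
    have C: "adapted B C" "e \<in> fdom C" using ar by (auto simp: around_def)
    obtain f N where f: "local_section B N f" "proj B e \<in> N" "f (proj B e) = e"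
      "\<And>I a. size I \<le> k \<Longrightarrow> snd (jet B k f (proj B e)) C (I, a) = u (I, a)"
      by (rule polynomial_section[OF C ue, where k = k]) blast
    have "snd (jet B k f (proj B e)) C (I, a) = u (I, a)" for I a
      using f(4)[of I a] u by (cases "size I \<le> k") (auto simp: snd_jet coord_space_def)
    then have "snd (jet B k f (proj B e)) C = u" by (auto simp: fun_eq_iff)
    moreover have "jet B k f (proj B e) \<in> Jet B k" using f by (auto simp: Jet_def)
    ultimately show ?thesis using f(3) by (intro bexI[of _ "jet B k f (proj B e)"]) auto
  qed
qed

lemma Jet0_coord_bundle: "coord_bundle B (Jet B 0) (jidx 0) (\<lambda>a. ({#}, a))"
proof (unfold_locales)
  fix C C' :: "('x, 'e, 'n, 'm) fchart" and i :: "'n multiset \<times> 'm"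
  assume C: "adapted B C" "adapted B C'"
  let ?O = "overlap B (jidx 0) (\<lambda>a. ({#}, a)) C C'"
  let ?b = "bidx (jidx 0) :: ('n + 'n multiset \<times> 'm) set"
  have fin: "finite ?b" by (rule finite_bidx[OF finite_jidx])
  define g where "g = (\<lambda>y :: 'n + 'n multiset \<times> 'm \<Rightarrow> real. case_sum (\<lambda>n. y (Inl n)) (\<lambda>a. y (Inr ({#}, a))) :: 'n + 'm \<Rightarrow> real)"
  have gs: "smooth_fun ?b U (\<lambda>y. g y q)" for q U by (cases q) (simp_all add: g_def smooth_coord)
  have O_eq: "?O = {y \<in> coord_space ?b. g y \<in> tcoord B C ` (fdom C \<inter> fdom C')}"
    by (simp add: overlap_def g_def)
  have oO: "open_in ?b ?O"
    unfolding O_eq by (rule open_in_preimage[OF open_in_coord_space gs, where J = UNIV])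
      (use total_trans(1)[OF C] in simp_all)
  obtain I a where i: "i = (I, a)" by (cases i)
  show "\<exists>T. smooth_fun ?b ?O T \<and>
      (\<forall>z\<in>Jet B 0. fst z \<in> fdom C \<longrightarrow> fst z \<in> fdom C' \<longrightarrow> snd z C' i = T (jcoord B C z))"
  proof (cases "I = {#}")
    case True
    show ?thesis
    proof (intro exI[of _ "\<lambda>y. tcoord B C' (tpt B C (g y)) (Inr a)"] conjI ballI impI)
      show "smooth_fun ?b ?O (\<lambda>y. tcoord B C' (tpt B C (g y)) (Inr a))"
        by (rule smooth_compose[OF finite _ total_trans(2)[OF C] _ fin oO gs])
          (use total_trans(1)[OF C] in \<open>simp_all add: O_eq\<close>)
      fix z assume z: "z \<in> Jet B 0" "fst z \<in> fdom C" "fst z \<in> fdom C'"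
      have ar: "around B C (fst z)" "around B C' (fst z)" using z C by (auto simp: around_def)
      have "g (jcoord B C z) = tcoord B C (fst z)"
        using Jet_facts(4)[OF z(1) ar(1)] by (simp add: g_def jcoord_def tcoord_def fun_eq_iff split: sum.split)
      then show "snd z C' i = tcoord B C' (tpt B C (g (jcoord B C z))) (Inr a)"
        using tpt_tcoord[OF C(1) z(2)] Jet_facts(4)[OF z(1) ar(2)] True i by (simp add: tcoord_def)
    qed
  next
    case False
    have "snd z C' i = 0" if z: "z \<in> Jet B 0" "fst z \<in> fdom C'" for z
    proof -
      have "snd z C' \<in> coord_space (jidx 0)" using z C by (intro Jet_facts(3)) (auto simp: around_def)
      moreover have "i \<notin> jidx 0" using False i by simp
      ultimately show ?thesis unfolding coord_space_def by blast
    qed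
    then show ?thesis by (intro exI[of _ "\<lambda>_. 0"]) (auto simp: smooth_const)
  qed
qed (use finite_jidx Jet_facts in auto)

text \<open>Induction on the order through the inclusion of (k+1)-jets into first jets of k-jets.
  \<open>E\<close> fills the slot of the derivative of coordinate \<open>I\<close> along
  \<open>\<rho>\<close> with the coordinate of \<open>add_mset \<rho> I\<close>; \<open>P\<close>
  recovers a top-order coordinate from one such slot, the removed index being an arbitrary
  choice.\<close>

lemma Jet_coord_bundle: "coord_bundle B (Jet B k) (jidx k) (\<lambda>a. ({#}, a))"
proof (induction k)
  case 0
  show ?case by (rule Jet0_coord_bundle)
next
  case (Suc k)
  define E :: "('n multiset \<times> 'm \<Rightarrow> real) \<Rightarrow> 'n multiset \<times> 'm + ('n multiset \<times> 'm) \<times> 'n \<Rightarrow> real"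
    where "E u = case_sum (\<lambda>i. if size (fst i) \<le> k then u i else 0)
      (\<lambda>(i, \<rho>). if size (fst i) \<le> k then u (add_mset \<rho> (fst i), snd i) else 0)" for u
  define P :: "('n multiset \<times> 'm + ('n multiset \<times> 'm) \<times> 'n \<Rightarrow> real) \<Rightarrow> 'n multiset \<times> 'm \<Rightarrow> real"
    where "P v i = (if size (fst i) \<le> k then v (Inl i) else if size (fst i) = Suc k then
      (let r = (SOME r. r \<in># fst i) in v (Inr ((fst i - {#r#}, snd i), r))) else 0)" for v i
  show ?case
  proof (rule coord_bundle.transfer[OF coord_bundle.J1_coord_bundle[OF Suc], where E = E and P = P])
    show "smooth_fun (jidx (Suc k)) (coord_space (jidx (Suc k))) (\<lambda>u. E u q)" for q
      by (cases q) (auto simp: E_def smooth_const smooth_coord intro!: smooth_if split: prod.split)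
    show "E u \<in> coord_space (jidx k <+> jidx k \<times> UNIV)" for u
      unfolding coord_space_def
    proof (intro CollectI allI impI)
      fix q :: "'n multiset \<times> 'm + ('n multiset \<times> 'm) \<times> 'n"
      assume q: "q \<notin> jidx k <+> jidx k \<times> UNIV"
      show "E u q = 0"
      proof (cases q)
        case (Inl i) then show ?thesis using q by (cases i) (auto simp: E_def)
      next
        case (Inr p) then show ?thesis using q by (cases p; cases "fst p") (auto simp: E_def)
      qed
    qed
    show "E u (Inl ({#}, a)) = u ({#}, a)" for u a by (simp add: E_def)
    show "smooth_fun (jidx k <+> jidx k \<times> UNIV) (coord_space (jidx k <+> jidx k \<times> UNIV)) (\<lambda>v. P v i)" for i
      unfolding P_def Let_def by (intro smooth_if smooth_coord smooth_const)
    fix z' C assume z': "z' \<in> Jet B (Suc k)" "around B C (fst z')"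
    obtain f N x where f: "z' = jet B (Suc k) f x" "local_section B N f" "x \<in> N" by (rule Jet_cases[OF z'(1)])
    let ?z = "jet1 B (jet B k f) x"
    have "?z \<in> J1 B (Jet B k)" unfolding J1_def using jet_smooth_section[OF f(2)] f(3) by blast
    moreover have "fst ?z = fst z'" by (simp add: f jet1_def)
    moreover have *: "snd ?z C = E (snd z' C)" if ar: "around B C (f x)" for C
    proof
      fix q show "snd ?z C q = E (snd z' C) q"
      proof (cases q)
        case (Inl i)
        then show ?thesis using jet1_jet(1)[OF f(2,3) ar, of k i] by (cases i) (simp add: E_def f(1) snd_jet)
      next
        case (Inr p)
        obtain I a \<rho> where p: "p = ((I, a), \<rho>)" by (cases p) auto
        show ?thesis using jet1_jet(2)[OF f(2,3) ar, of k I a \<rho>] by (simp add: E_def f(1) Inr p)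
      qed
    qed
    moreover have "snd z' C' = P (snd ?z C')" if ar: "around B C' (fst z')" for C'
    proof
      fix i :: "'n multiset \<times> 'm"
      obtain I a where i: "i = (I, a)" by (cases i)
      have ar': "around B C' (f x)" using ar by (simp add: f)
      have "snd z' C' \<in> coord_space (jidx (Suc k))" by (rule Jet_facts(3)[OF z'(1) ar])
      then have z0: "size I > Suc k \<Longrightarrow> snd z' C' (I, a) = 0" by (simp add: coord_space_def)
      show "snd z' C' i = P (snd ?z C') i"
      proof (cases "size I = Suc k")
        case True
        then have "I \<noteq> {#}" by auto
        then have r: "(SOME r. r \<in># I) \<in># I" by (meson multiset_nonemptyE someI_ex)
        have sz: "size (I - {#SOME r. r \<in># I#}) = k" using True r by (simp add: size_Diff_singleton)
        have "add_mset (SOME r. r \<in># I) (I - {#SOME r. r \<in># I#}) = I" using r by simp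
        then show ?thesis
          unfolding *[OF ar'] using True sz by (simp add: P_def i E_def Let_def)
      next
        case False
        then show ?thesis unfolding *[OF ar'] using z0 by (auto simp: P_def i E_def)
      qed
    qed
    ultimately show "\<exists>z\<in>J1 B (Jet B k). fst z = fst z' \<and> snd z C = E (snd z' C) \<and>
        (\<forall>C'. around B C' (fst z') \<longrightarrow> snd z' C' = P (snd z C'))"
      using z'(2) f(1) by (intro bexI[of _ ?z]) auto
  qed (use finite_jidx Jet_facts in auto)
qed

end

section \<open>Jacobian matrices of chart changes\<close>

context fibred begin

lemma jac_chain:
  assumes C: "adapted B C" "adapted B C'" "adapted B C''" and x: "x \<in> bdom C" "x \<in> bdom C'" "x \<in> bdom C''"
  shows "jac C C'' x \<kappa> \<nu> = (\<Sum>\<mu>\<in>UNIV. jac C' C'' x \<kappa> \<mu> * jac C C' x \<mu> \<nu>)"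
proof -
  define \<psi> where "\<psi> = (\<lambda>y. bcoord C' (bpt C y))"
  define V where "V = bcoord C' ` (bdom C' \<inter> bdom C'')"
  define U where "U = {y \<in> bcoord C ` (bdom C \<inter> bdom C'). \<psi> y \<in> V}"
  have V: "open V" unfolding V_def by (rule base_trans(1)[OF C(2,3)])
  note t = base_trans[OF C(1,2), folded \<psi>_def]
  have \<psi>s: "smooth_fun UNIV (bcoord C ` (bdom C \<inter> bdom C')) (\<lambda>y. \<psi> y j)" for j
    unfolding \<psi>_def by (rule base_trans(2)[OF C(1,2)])
  have U: "open U" unfolding U_def by (rule open_preimage_smooth[OF base_trans(1)[OF C(1,2)] \<psi>s V])
  have oU: "open_in UNIV U" and oV: "open_in UNIV V" using U V by simp_all
  have \<psi>x: "\<psi> (bcoord C x) = bcoord C' x" by (simp add: \<psi>_def bpt_bcoord[OF C(1) x(1)])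
  have y0: "bcoord C x \<in> U" using x \<psi>x by (auto simp: U_def V_def)
  have \<psi>U: "smooth_fun UNIV U (\<lambda>y. \<psi> y j)" for j by (rule smooth_subset[OF \<psi>s]) (auto simp: U_def)
  have \<psi>V: "\<psi> y \<in> V" if "y \<in> U" for y using that by (simp add: U_def)
  have Vs: "smooth_fun UNIV V (\<lambda>y. bcoord C'' (bpt C' y) \<kappa>)" unfolding V_def by (rule base_trans(2)[OF C(2,3)])
  have "jac C C'' x \<kappa> \<nu> = pd \<nu> (\<lambda>y. bcoord C'' (bpt C' (\<psi> y)) \<kappa>) (bcoord C x)"
    unfolding jac_def
  proof (rule pd_cong[OF finite oU y0 UNIV_I])
    fix y assume "y \<in> U"
    then obtain x' where x': "x' \<in> bdom C" "x' \<in> bdom C'" "y = bcoord C x'" by (auto simp: U_def)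
    then show "bcoord C'' (bpt C y) \<kappa> = bcoord C'' (bpt C' (\<psi> y)) \<kappa>"
      by (simp add: \<psi>_def bpt_bcoord[OF C(1)] bpt_bcoord[OF C(2)])
  qed
  also have "\<dots> = (\<Sum>\<mu>\<in>UNIV. pd \<mu> (\<lambda>y. bcoord C'' (bpt C' y) \<kappa>) (\<psi> (bcoord C x)) * pd \<nu> (\<lambda>y. \<psi> y \<mu>) (bcoord C x))"
    by (rule smooth_pd_compose[OF finite oV Vs \<psi>V finite oU y0 UNIV_I \<psi>U])
  finally show ?thesis unfolding \<psi>x unfolding jac_def \<psi>_def .
qed

lemma jac_self:
  assumes C: "adapted B C" and x: "x \<in> bdom C"
  shows "jac C C x \<kappa> \<nu> = (if \<kappa> = \<nu> then 1 else 0)"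
proof -
  have oU: "open_in UNIV (bcoord C ` (bdom C \<inter> bdom C))" using base_trans(1)[OF C C] by simp
  have "jac C C x \<kappa> \<nu> = pd \<nu> (\<lambda>y. y \<kappa>) (bcoord C x)"
    unfolding jac_def by (rule pd_cong[OF finite oU _ UNIV_I]) (use x bcoord_bpt[of _ C] in auto)
  then show ?thesis by (auto simp: pd_coord)
qed

lemma jdet_chain:
  assumes "adapted B C" "adapted B C'" "adapted B C''" "x \<in> bdom C" "x \<in> bdom C'" "x \<in> bdom C''"
  shows "jdet C C'' x = jdet C' C'' x * jdet C C' x"
proof -
  have "(\<chi> \<kappa> \<nu>. jac C C'' x \<kappa> \<nu>) = (\<chi> \<kappa> \<nu>. jac C' C'' x \<kappa> \<nu>) ** (\<chi> \<kappa> \<nu>. jac C C' x \<kappa> \<nu>)"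
    unfolding matrix_matrix_mult_def by (simp add: vec_eq_iff jac_chain[OF assms])
  then show ?thesis unfolding jdet_def by (simp add: det_mul)
qed

lemma jdet_self: "adapted B C \<Longrightarrow> x \<in> bdom C \<Longrightarrow> jdet C C x = 1"
proof -
  assume "adapted B C" "x \<in> bdom C"
  then have "(\<chi> \<kappa> \<nu>. jac C C x \<kappa> \<nu>) = (mat 1 :: real^'n^'n)"
    by (simp add: vec_eq_iff mat_def jac_self)
  then show ?thesis by (simp add: jdet_def)
qed

lemma jac_smooth_same:
  assumes C: "adapted B C" "adapted B C'"
  shows "smooth_fun UNIV (bcoord C ` (bdom C \<inter> bdom C')) (\<lambda>y. jac C C' (bpt C y) \<rho> \<kappa>)"
proof (rule smooth_cong)
  show "smooth_fun UNIV (bcoord C ` (bdom C \<inter> bdom C')) (pd \<kappa> (\<lambda>y. bcoord C' (bpt C y) \<rho>))"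
    by (rule smooth_pd[OF base_trans(2)[OF C]]) simp
  show "pd \<kappa> (\<lambda>y. bcoord C' (bpt C y) \<rho>) y = jac C C' (bpt C y) \<rho> \<kappa>" if "y \<in> bcoord C ` (bdom C \<inter> bdom C')" for y
    using that bcoord_bpt[of y C] by (auto simp: jac_def)
qed (use base_trans(1)[OF C] in auto)

lemma smooth_det:
  fixes A :: "'n \<Rightarrow> 'n \<Rightarrow> ('n \<Rightarrow> real) \<Rightarrow> real"
  assumes "open U" "\<And>i j. smooth_fun UNIV U (A i j)"
  shows "smooth_fun UNIV U (\<lambda>y. det (\<chi> i j. A i j y))"
  unfolding det_def
  using assms by (intro smooth_sum smooth_cmult smooth_prod) simp_all

lemma jdet_smooth:
  assumes C: "adapted B C" "adapted B C'"
  shows "smooth_fun UNIV (bcoord C ` (bdom C \<inter> bdom C')) (\<lambda>y. jdet C' C (bpt C y))"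
    "smooth_fun UNIV (bcoord C ` (bdom C \<inter> bdom C')) (\<lambda>y. jdet C C' (bpt C y))"
  unfolding jdet_def
  by (rule smooth_det[OF base_trans(1)[OF C]], rule jac_smooth[OF fibred_axioms C] jac_smooth_same[OF C])+

text \<open>The coefficients by which the components of an element of \<open>\<Lambda>\<^sup>n\<^sup>-\<^sup>1 M\<close> transform.\<close>

definition cofac :: "('x, 'e, 'n, 'm) fchart \<Rightarrow> ('x, 'e, 'n, 'm) fchart \<Rightarrow> 'x \<Rightarrow> 'n \<Rightarrow> 'n \<Rightarrow> real" where
  "cofac C C' x \<rho> \<kappa> = jdet C C' x * jac C' C x \<rho> \<kappa>"

lemma cotop_form_cofac:
  "cotop_form B e b \<longleftrightarrow> (\<forall>C C' \<rho>. around B C e \<and> around B C' e \<longrightarrow>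
     b C \<rho> = (\<Sum>\<kappa>\<in>UNIV. cofac C C' (proj B e) \<rho> \<kappa> * b C' \<kappa>))"
  by (simp add: cotop_form_def cofac_def sum_distrib_left mult_ac)

lemma around_bdom: "around B C e \<Longrightarrow> adapted B C \<and> e \<in> fdom C \<and> proj B e \<in> bdom C"
  using fdom_proj by (auto simp: around_def)

text \<open>The cocycle property makes it consistent to define the components of an (n-1)-form in
  all charts from those in one reference chart.\<close>

lemma cofac_chain:
  assumes "around B C e" "around B C' e" "around B C'' e"
  shows "cofac C C'' (proj B e) \<rho> \<sigma> = (\<Sum>\<kappa>\<in>UNIV. cofac C C' (proj B e) \<rho> \<kappa> * cofac C' C'' (proj B e) \<kappa> \<sigma>)"
proof -
  note a = assms[THEN around_bdom]
  have "jdet C C'' (proj B e) = jdet C C' (proj B e) * jdet C' C'' (proj B e)"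
    using jdet_chain[of C C' C'' "proj B e"] a by simp
  moreover have "jac C'' C (proj B e) \<rho> \<sigma> = (\<Sum>\<kappa>\<in>UNIV. jac C' C (proj B e) \<rho> \<kappa> * jac C'' C' (proj B e) \<kappa> \<sigma>)"
    using jac_chain[of C'' C' C "proj B e"] a by simp
  ultimately show ?thesis unfolding cofac_def by (simp add: sum_distrib_left mult_ac)
qed

lemma cofac_self:
  assumes "around B C e"
  shows "cofac C C (proj B e) \<rho> \<sigma> = (if \<rho> = \<sigma> then 1 else 0)"
  using around_bdom[OF assms] by (simp add: cofac_def jdet_self jac_self)

lemma cofac_smooth:
  assumes C: "adapted B C" "adapted B C'"
  shows "smooth_fun UNIV (bcoord C ` (bdom C \<inter> bdom C')) (\<lambda>y. cofac C' C (bpt C y) \<rho> \<kappa>)"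
    "smooth_fun UNIV (bcoord C ` (bdom C \<inter> bdom C')) (\<lambda>y. cofac C C' (bpt C y) \<rho> \<kappa>)"
  unfolding cofac_def using base_trans(1)[OF C]
  by (auto intro!: smooth_mult jdet_smooth[OF C] jac_smooth[OF fibred_axioms C] jac_smooth_same[OF C])

lemma overlap_base:
  assumes "adapted B C" "adapted B C'" "y \<in> overlap B K emb C C'"
  shows "(\<lambda>n. y (Inl n)) \<in> bcoord C ` (bdom C \<inter> bdom C')"
proof -
  obtain e where e: "e \<in> fdom C" "e \<in> fdom C'"
    "case_sum (\<lambda>n. y (Inl n)) (\<lambda>a. y (Inr (emb a))) = tcoord B C e"
    using assms(3) by (auto simp: overlap_def)
  have "(\<lambda>n. y (Inl n)) = bcoord C (proj B e)"
    using fun_cong[OF e(3), of "Inl n" for n] by (auto simp: tcoord_def)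
  then show ?thesis using e fdom_proj assms by auto
qed

lemma base_function_smooth:
  fixes emb :: "'m \<Rightarrow> 'i"
  assumes C: "adapted B C" "adapted B C'" and K: "finite K"
    and h: "smooth_fun UNIV (bcoord C ` (bdom C \<inter> bdom C')) h"
  shows "smooth_fun (bidx K) (overlap B K emb C C') (\<lambda>y. h (\<lambda>n. y (Inl n)))"
proof -
  define r where "r = (\<lambda>(y :: 'n + 'i \<Rightarrow> real) n. y (Inl n))"
  have oV: "open_in UNIV (bcoord C ` (bdom C \<inter> bdom C'))" using base_trans(1)[OF C] by simp
  have "smooth_fun (bidx K) (overlap B K emb C C') (\<lambda>y. h (r y))"
  proof (rule smooth_compose[OF finite oV h _ finite_bidx[OF K] overlap_open[OF C]])
    show "r y \<in> bcoord C ` (bdom C \<inter> bdom C')" if "y \<in> overlap B K emb C C'" for y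
      unfolding r_def by (rule overlap_base[OF C that])
    show "smooth_fun (bidx K) (overlap B K emb C C') (\<lambda>y. r y n)" for n unfolding r_def by (rule smooth_coord)
  qed
  then show ?thesis by (simp add: r_def)
qed

end

context coord_bundle begin

text \<open>Rather than identifying \<open>tr C C\<close> as a function, its partial derivatives are
  read off from the transformation law of a unit tangent vector from \<open>C\<close> to
  itself.\<close>

lemma tr_self:
  assumes z: "z \<in> S" and C: "around B C (fst z)" and j: "j \<in> K"
  shows "pd (Inr j) (tr C C i) (jcoord B C z) = (if i = j then 1 else 0)"
proof -
  define w where "w = (\<lambda>i. if i = j then 1 else 0 :: real)"
  have "w \<in> coord_space K" using j by (auto simp: w_def coord_space_def)
  then obtain X where X: "X \<in> vertical_tangent B S z" "X C = w" using tangent_ex[OF z C] by blast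
  have "w i = (\<Sum>k\<in>K. pd (Inr k) (tr C C i) (jcoord B C z) * w k)"
    using tangent_trans[OF X(1) C C, of i] X(2) by simp
  also have "\<dots> = (\<Sum>k\<in>K. if k = j then pd (Inr j) (tr C C i) (jcoord B C z) else 0)"
    by (rule sum.cong) (auto simp: w_def)
  also have "\<dots> = pd (Inr j) (tr C C i) (jcoord B C z)" using finite_K j by simp
  finally show ?thesis by (simp add: w_def)
qed

end

section \<open>The phase bundle\<close>

lemma sum_matrix_assoc:
  fixes a :: "'a \<Rightarrow> real"
  shows "(\<Sum>\<sigma>\<in>A. (\<Sum>\<kappa>\<in>A'. a \<kappa> * b \<kappa> \<sigma>) * M \<sigma>) = (\<Sum>\<kappa>\<in>A'. a \<kappa> * (\<Sum>\<sigma>\<in>A. b \<kappa> \<sigma> * M \<sigma>))"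
  by (simp add: sum_distrib_left sum_distrib_right mult.assoc) (rule sum.swap)

definition pidx :: "nat \<Rightarrow> ('n, 'm) pidx set" where
  "pidx k = jidx (k - 1) <+> {(I, \<rho>, a). size I < k}"

lemma finite_pidx: "finite (pidx k :: ('n::finite, 'm::finite) pidx set)"
proof -
  have "finite ((\<lambda>((I, a), \<rho>). (I, \<rho>, a)) ` ((jidx k :: ('n, 'm) jidx set) \<times> (UNIV :: 'n set)))"
    by (intro finite_imageI finite_cartesian_product finite_jidx) simp
  moreover have "{(I, \<rho>, a). size I < k} \<subseteq> (\<lambda>((I, a), \<rho>). (I, \<rho>, a)) ` ((jidx k :: ('n, 'm) jidx set) \<times> (UNIV :: 'n set))"
  proof (intro subsetI, elim CollectE case_prodE)
    fix x and I :: "'n multiset" and p and \<rho> :: 'n and a :: 'm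
    assume x: "x = (I, p)" "p = (\<rho>, a)" "size I < k"
    then show "x \<in> (\<lambda>((I, a), \<rho>). (I, \<rho>, a)) ` ((jidx k :: ('n, 'm) jidx set) \<times> (UNIV :: 'n set))"
      by (intro image_eqI[of _ _ "((I, a), \<rho>)"]) simp_all
  qed
  ultimately have "finite {(I :: 'n multiset, \<rho> :: 'n, a :: 'm). size I < k}" by (rule rev_finite_subset)
  then show ?thesis unfolding pidx_def by (intro finite_Plus finite_jidx)
qed

lemma pidx_iff [simp]: "Inl i \<in> pidx k \<longleftrightarrow> i \<in> jidx (k - 1)" "Inr (I, \<rho>, a) \<in> pidx k \<longleftrightarrow> size I < k"
  by (auto simp: pidx_def)

lemma momentum_value_eq:
  assumes "k \<ge> 1"
  shows "momentum_value k z v C \<rho> =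
    (\<Sum>i\<in>jidx (k - 1). orderings (fst i) * (snd z C (Inr (fst i, \<rho>, snd i)) * v C i))"
proof -
  have "{..<k} = {..k - 1}" using assms by auto
  then have "momentum_value k z v C \<rho> = contract (k - 1) (\<lambda>i. snd z C (Inr (fst i, \<rho>, snd i))) (v C)"
    by (simp add: momentum_value_def contract_def)
  then show ?thesis by (simp add: contract_eq)
qed

lemma left_left [simp]: "fst (left z) = fst z" "snd (left z) C i = snd z C (Inl i)"
  by (simp_all add: left_def)

lemma jcoord_left: "jcoord B C (left z) = case_sum (\<lambda>n. jcoord B C z (Inl n)) (\<lambda>i. jcoord B C z (Inr (Inl i)))"
  by (auto simp: jcoord_def left_def fun_eq_iff split: sum.split)

lemma PhaseD:
  assumes "z \<in> Phase B k"
  shows "left z \<in> Jet B (k - 1)" "\<not> around B C (fst z) \<Longrightarrow> snd z C i = 0"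
    "size I \<ge> k \<Longrightarrow> snd z C (Inr (I, \<rho>, a)) = 0"
    "v \<in> vertical_tangent B (Jet B (k - 1)) (left z) \<Longrightarrow> cotop_form B (fst z) (momentum_value k z v)"
  using assms by (auto simp: Phase_def)

text \<open>A phase point is constrained only through its values on vertical vectors. Unit vectors
  extract the transformation law of the components, dual to that of vertical vectors and twisted by
  \<open>cofac\<close>; conversely, spreading arbitrary components from one chart by this law gives
  a phase point, by the cocycle property.\<close>

lemma (in fibred) Phase_coord_bundle:
  assumes k: "k \<ge> 1"
  shows "coord_bundle B (Phase B k) (pidx k) (\<lambda>a. Inl ({#}, a))"
proof -
  interpret J: coord_bundle B "Jet B (k - 1)" "jidx (k - 1)" "\<lambda>a. ({#}, a)" by (rule Jet_coord_bundle)
  \<comment> \<open>Evaluation on the vertical vector that is the unit vector at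
    \<open>(I, a)\<close> in \<open>C'\<close>. The division undoes the number of times this
    coordinate is counted in the sum over index lists.\<close>
  have pt_momentum: "snd z C' (Inr (I, \<rho>, a)) = 1 / orderings I * (\<Sum>\<kappa>\<in>UNIV. cofac C' C (proj B (fst z)) \<rho> \<kappa> *
      (\<Sum>i\<in>jidx (k - 1). orderings (fst i) * (snd z C (Inr (fst i, \<kappa>, snd i)) *
         pd (Inr (I, a)) (J.tr C' C i) (jcoord B C' (left z)))))"
    if z: "z \<in> Phase B k" and ar: "around B C (fst z)" "around B C' (fst z)" and I: "size I < k" for z C C' I \<rho> a
  proof -
    define w :: "('n, 'm) jidx \<Rightarrow> real" where "w = (\<lambda>i. if i = (I, a) then 1 else 0)"
    have Ia: "(I, a) \<in> jidx (k - 1)" using I by simp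
    then have "w \<in> coord_space (jidx (k - 1))" by (auto simp: w_def coord_space_def)
    then obtain v where v: "v \<in> vertical_tangent B (Jet B (k - 1)) (left z)" "v C' = w"
      using J.tangent_ex[OF PhaseD(1)[OF z], of C'] ar by auto
    have vC: "v C i = pd (Inr (I, a)) (J.tr C' C i) (jcoord B C' (left z))" for i
    proof -
      have "v C i = (\<Sum>j\<in>jidx (k - 1). pd (Inr j) (J.tr C' C i) (jcoord B C' (left z)) * w j)"
        using J.tangent_trans[OF v(1), of C' C i] ar v(2) by simp
      also have "\<dots> = (\<Sum>j\<in>jidx (k - 1). if j = (I, a) then pd (Inr (I, a)) (J.tr C' C i) (jcoord B C' (left z)) else 0)"
        by (rule sum.cong) (auto simp: w_def)
      also have "\<dots> = pd (Inr (I, a)) (J.tr C' C i) (jcoord B C' (left z))"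
        unfolding sum.delta[OF finite_jidx] using Ia by (simp only: if_True)
      finally show ?thesis .
    qed
    have "momentum_value k z v C' \<rho> = (\<Sum>\<kappa>\<in>UNIV. cofac C' C (proj B (fst z)) \<rho> \<kappa> * momentum_value k z v C \<kappa>)"
      using PhaseD(4)[OF z v(1)] ar unfolding cotop_form_cofac by blast
    moreover have "momentum_value k z v C' \<rho> = orderings I * snd z C' (Inr (I, \<rho>, a))"
    proof -
      have "momentum_value k z v C' \<rho> = (\<Sum>i\<in>jidx (k - 1). if i = (I, a) then orderings I * snd z C' (Inr (I, \<rho>, a)) else 0)"
        unfolding momentum_value_eq[OF k] v(2) by (rule sum.cong) (auto simp: w_def)
      then show ?thesis unfolding sum.delta[OF finite_jidx] using Ia by (simp only: if_True)
    qed
    ultimately show ?thesis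
      using orderings_pos[of I] by (simp add: momentum_value_eq[OF k] vC field_simps)
  qed
  have facts: "fst z \<in> tspace B" "\<not> around B C (fst z) \<Longrightarrow> snd z C i = 0"
    "around B C (fst z) \<Longrightarrow> snd z C \<in> coord_space (pidx k)"
    "around B C (fst z) \<Longrightarrow> snd z C (Inl ({#}, a)) = fcoord C (fst z) a"
    if z: "z \<in> Phase B k" for z C i a
  proof -
    note l = PhaseD(1)[OF z]
    show "fst z \<in> tspace B" using J.pt_tspace[OF l] by simp
    show "\<not> around B C (fst z) \<Longrightarrow> snd z C i = 0" by (rule PhaseD(2)[OF z])
    show "snd z C (Inl ({#}, a)) = fcoord C (fst z) a" if "around B C (fst z)"
      using J.pt_emb[OF l, of C a] that by simp
    show "snd z C \<in> coord_space (pidx k)" if "around B C (fst z)"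
      unfolding coord_space_def
    proof (intro CollectI allI impI)
      fix q :: "('n, 'm) pidx" assume q: "q \<notin> pidx k"
      show "snd z C q = 0"
      proof (cases q)
        case (Inl i)
        have "snd (left z) C \<in> coord_space (jidx (k - 1))" using J.pt_coord[OF l] that by simp
        moreover have "i \<notin> jidx (k - 1)" using q Inl by simp
        ultimately have "snd (left z) C i = 0" unfolding coord_space_def by blast
        then show ?thesis by (simp add: Inl)
      next
        case (Inr p)
        obtain I \<rho> b where p: "p = (I, \<rho>, b)" by (cases p) auto
        then show ?thesis using q Inr PhaseD(3)[OF z, of I C \<rho> b] by simp
      qed
    qed
  qed
  show ?thesis
  proof (unfold_locales)
    fix C0 e and u :: "('n, 'm) pidx \<Rightarrow> real"
    assume ar0: "around B C0 e" and u: "u \<in> coord_space (pidx k)" and ue: "\<And>a. u (Inl ({#}, a)) = fcoord C0 e a"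
    have "(\<lambda>i. u (Inl i)) \<in> coord_space (jidx (k - 1))" using u by (auto simp: coord_space_def)
    then obtain z0 where z0: "z0 \<in> Jet B (k - 1)" "fst z0 = e" "snd z0 C0 = (\<lambda>i. u (Inl i))"
      using J.pt_ex[OF ar0 _ ue] by blast
    \<comment> \<open>The components that \<open>pt_momentum\<close> forces on every chart once
      those in the reference chart \<open>C0\<close> are prescribed by \<open>u\<close>.\<close>
    define q where "q = (\<lambda>C (I, \<rho>, a). if size I < k then 1 / orderings I * (\<Sum>\<kappa>\<in>UNIV. cofac C C0 (proj B e) \<rho> \<kappa> *
      (\<Sum>i\<in>jidx (k - 1). orderings (fst i) * (u (Inr (fst i, \<kappa>, snd i)) *
         pd (Inr (I, a)) (J.tr C C0 i) (jcoord B C z0)))) else 0)"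
    define z where "z = (e, \<lambda>C. if around B C e then case_sum (snd z0 C) (q C) else (\<lambda>_. 0))"
    have lz: "left z = z0"
    proof (rule prod_eqI)
      show "snd (left z) = snd z0"
      proof (intro ext)
        fix C i show "snd (left z) C i = snd z0 C i"
          using J.pt_zero[OF z0(1), of C i] z0(2) by (simp add: z_def)
      qed
    qed (simp add: z_def z0)
    have mom: "momentum_value k z v C \<rho> = (\<Sum>\<kappa>\<in>UNIV. cofac C C0 (proj B e) \<rho> \<kappa> *
        (\<Sum>i\<in>jidx (k - 1). orderings (fst i) * (u (Inr (fst i, \<kappa>, snd i)) * v C0 i)))"
      if v: "v \<in> vertical_tangent B (Jet B (k - 1)) z0" and C: "around B C e" for v C \<rho>
    proof -
      have "momentum_value k z v C \<rho> = (\<Sum>j\<in>jidx (k - 1). (\<Sum>\<kappa>\<in>UNIV. cofac C C0 (proj B e) \<rho> \<kappa> *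
        (\<Sum>i\<in>jidx (k - 1). orderings (fst i) * (u (Inr (fst i, \<kappa>, snd i)) *
         pd (Inr j) (J.tr C C0 i) (jcoord B C z0)))) * v C j)"
        unfolding momentum_value_eq[OF k]
      proof (rule sum.cong[OF refl])
        fix j :: "('n, 'm) jidx" assume j: "j \<in> jidx (k - 1)"
        obtain I a where I: "j = (I, a)" by (cases j)
        have "size I < k" using j k I by auto
        then have "orderings I * snd z C (Inr (I, \<rho>, a)) = (\<Sum>\<kappa>\<in>UNIV. cofac C C0 (proj B e) \<rho> \<kappa> *
          (\<Sum>i\<in>jidx (k - 1). orderings (fst i) * (u (Inr (fst i, \<kappa>, snd i)) *
            pd (Inr j) (J.tr C C0 i) (jcoord B C z0))))"
          using C orderings_pos[of I] by (simp add: z_def q_def I)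
        then show "orderings (fst j) * (snd z C (Inr (fst j, \<rho>, snd j)) * v C j) = (\<Sum>\<kappa>\<in>UNIV. cofac C C0 (proj B e) \<rho> \<kappa> *
          (\<Sum>i\<in>jidx (k - 1). orderings (fst i) * (u (Inr (fst i, \<kappa>, snd i)) *
            pd (Inr j) (J.tr C C0 i) (jcoord B C z0)))) * v C j"
          by (simp add: I mult.assoc[symmetric])
      qed
      also have "\<dots> = (\<Sum>\<kappa>\<in>UNIV. \<Sum>j\<in>jidx (k - 1). \<Sum>i\<in>jidx (k - 1). cofac C C0 (proj B e) \<rho> \<kappa> *
        (orderings (fst i) * (u (Inr (fst i, \<kappa>, snd i)) * (pd (Inr j) (J.tr C C0 i) (jcoord B C z0) * v C j))))"
        by (subst sum.swap) (simp add: sum_distrib_left sum_distrib_right mult_ac)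
      also have "\<dots> = (\<Sum>\<kappa>\<in>UNIV. \<Sum>i\<in>jidx (k - 1). \<Sum>j\<in>jidx (k - 1). cofac C C0 (proj B e) \<rho> \<kappa> *
        (orderings (fst i) * (u (Inr (fst i, \<kappa>, snd i)) * (pd (Inr j) (J.tr C C0 i) (jcoord B C z0) * v C j))))"
        by (rule sum.cong[OF refl sum.swap])
      also have "\<dots> = (\<Sum>\<kappa>\<in>UNIV. cofac C C0 (proj B e) \<rho> \<kappa> *
        (\<Sum>i\<in>jidx (k - 1). orderings (fst i) * (u (Inr (fst i, \<kappa>, snd i)) * v C0 i)))"
        using J.tangent_trans[OF v, of C C0] C ar0 z0(2) by (simp add: sum_distrib_left)
      finally show ?thesis .
    qed
    have "z \<in> Phase B k"
      unfolding Phase_def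
    proof (intro CollectI conjI allI impI ballI)
      show "left z \<in> Jet B (k - 1)" using lz z0 by simp
      show "snd z C i = 0" if "\<not> around B C (fst z)" for C i using that by (simp add: z_def)
      show "snd z C (Inr (I, \<rho>, a)) = 0" if "size I \<ge> k" for C I \<rho> a using that by (simp add: z_def q_def)
      fix v assume v: "v \<in> vertical_tangent B (Jet B (k - 1)) (left z)"
      have pz: "fst z = e" by (simp add: z_def)
      show "cotop_form B (fst z) (momentum_value k z v)"
        unfolding cotop_form_cofac pz
      proof (intro allI impI, elim conjE)
        fix C C' \<rho> assume C: "around B C e" "around B C' e"
        note m = mom[OF v[unfolded lz]]
        show "momentum_value k z v C \<rho> = (\<Sum>\<kappa>\<in>UNIV. cofac C C' (proj B e) \<rho> \<kappa> * momentum_value k z v C' \<kappa>)"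
          unfolding m[OF C(1)] m[OF C(2)] cofac_chain[OF C ar0] by (rule sum_matrix_assoc)
      qed
    qed
    moreover have "snd z C0 = u"
    proof
      fix r show "snd z C0 r = u r"
      proof (cases r)
        case (Inl i) then show ?thesis using ar0 z0 by (simp add: z_def)
      next
        case (Inr p)
        obtain I \<rho> a where p: "p = (I, \<rho>, a)" by (cases p) auto
        show ?thesis
        proof (cases "size I < k")
          case True
          then have Ia: "(I, a) \<in> jidx (k - 1)" by simp
          have "q C0 (I, \<rho>, a) = 1 / orderings I * (\<Sum>\<kappa>\<in>UNIV. if \<rho> = \<kappa> then
              (\<Sum>i\<in>jidx (k - 1). if i = (I, a) then orderings I * u (Inr (I, \<kappa>, a)) else 0) else 0)"
          proof -
            have "(\<Sum>i\<in>jidx (k - 1). orderings (fst i) * (u (Inr (fst i, \<kappa>, snd i)) *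
              pd (Inr (I, a)) (J.tr C0 C0 i) (jcoord B C0 z0))) =
              (\<Sum>i\<in>jidx (k - 1). if i = (I, a) then orderings I * u (Inr (I, \<kappa>, a)) else 0)" for \<kappa>
              using J.tr_self[OF z0(1) _ Ia, of C0] ar0 z0(2) by (intro sum.cong) auto
            then have "q C0 (I, \<rho>, a) = 1 / orderings I * (\<Sum>\<kappa>\<in>UNIV. cofac C0 C0 (proj B e) \<rho> \<kappa> *
                (\<Sum>i\<in>jidx (k - 1). if i = (I, a) then orderings I * u (Inr (I, \<kappa>, a)) else 0))"
              using True by (simp only: q_def prod.case if_True)
            moreover have "cofac C0 C0 (proj B e) \<rho> \<kappa> * c = (if \<rho> = \<kappa> then c else 0)" for \<kappa> c
              by (simp add: cofac_self[OF ar0])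
            ultimately show ?thesis by (simp only:)
          qed
          also have "\<dots> = u (Inr (I, \<rho>, a))"
            unfolding sum.delta[OF finite_jidx] sum.delta'[OF finite] using Ia orderings_pos[of I] by simp
          finally show ?thesis using ar0 by (simp add: z_def Inr p)
        next
          case False
          then have "Inr (I, \<rho>, a) \<notin> pidx k" by simp
          then have "u (Inr (I, \<rho>, a)) = 0" using u by (auto simp: coord_space_def)
          then show ?thesis using False ar0 by (simp add: z_def q_def Inr p)
        qed
      qed
    qed
    ultimately show "\<exists>z\<in>Phase B k. fst z = e \<and> snd z C0 = u" by (intro bexI[of _ z]) (simp_all add: z_def)
  next
    fix C C' :: "('x, 'e, 'n, 'm) fchart" and r :: "('n, 'm) pidx"
    assume C: "adapted B C" "adapted B C'"
    let ?O = "overlap B (pidx k) (\<lambda>a. Inl ({#}, a)) C C'"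
    let ?b = "bidx (pidx k) :: ('n + ('n, 'm) pidx) set"
    have fin: "finite ?b" by (rule finite_bidx[OF finite_pidx])
    have oO: "open_in ?b ?O" by (rule overlap_open[OF C])
    define trunc where "trunc = (\<lambda>y :: 'n + ('n, 'm) pidx \<Rightarrow> real. case_sum (\<lambda>n. y (Inl n)) (\<lambda>i. y (Inr (Inl i))))"
    have trc: "trunc y \<in> coord_space (bidx (jidx (k - 1)))" if y: "y \<in> coord_space ?b" for y
      unfolding coord_space_def
    proof (intro CollectI allI impI)
      fix p :: "'n + ('n, 'm) jidx" assume p: "p \<notin> bidx (jidx (k - 1))"
      then obtain i where i: "p = Inr i" "i \<notin> jidx (k - 1)" by (cases p) auto
      then have "Inr (Inl i) \<notin> ?b" by simp
      then show "trunc y p = 0" using y i by (simp add: trunc_def coord_space_def)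
    qed
    have trO: "trunc y \<in> overlap B (jidx (k - 1)) (\<lambda>a. ({#}, a)) C C'" if "y \<in> ?O" for y
      using that trc[of y] by (simp add: overlap_def trunc_def)
    have trs: "smooth_fun ?b ?O (\<lambda>y. trunc y p)" for p
      by (cases p) (simp_all add: trunc_def smooth_coord)
    have comp: "smooth_fun ?b ?O (\<lambda>y. g (trunc y))"
      if "smooth_fun (bidx (jidx (k - 1))) (overlap B (jidx (k - 1)) (\<lambda>a. ({#}, a)) C C') g" for g
      by (rule smooth_compose[OF J.finite_bK overlap_open[OF C] that trO fin oO trs])
    have tl: "trunc (jcoord B C z) = jcoord B C (left z)" for z
      by (simp add: trunc_def jcoord_left)
    \<comment> \<open>\<open>pt_momentum\<close> differentiates the transition from
      \<open>C'\<close> back to \<open>C\<close> at the coordinates in \<open>C'\<close>.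
      \<open>Q\<close> expresses these coordinates through those in \<open>C\<close>, in which
      smoothness is to be shown.\<close>
    define Q where "Q = (\<lambda>y :: 'n + ('n, 'm) pidx \<Rightarrow> real. case_sum (\<lambda>n. bcoord C' (bpt C (\<lambda>n. y (Inl n))) n) (\<lambda>j. J.tr C C' j (trunc y)))"
    have Qs: "smooth_fun ?b ?O (\<lambda>y. Q y p)" for p
    proof (cases p)
      case (Inl n)
      have "smooth_fun ?b ?O (\<lambda>y. bcoord C' (bpt C (\<lambda>n. y (Inl n))) n)"
        by (rule base_function_smooth[OF C finite_pidx base_trans(2)[OF C]])
      then show ?thesis by (simp add: Q_def Inl)
    next
      case (Inr j)
      have "smooth_fun ?b ?O (\<lambda>y. J.tr C C' j (trunc y))" by (rule comp[OF J.tr_smooth[OF C]])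
      then show ?thesis by (simp add: Q_def Inr)
    qed
    have Q_eq: "Q y = jcoord B C' z0" if z0: "z0 \<in> Jet B (k - 1)" "around B C (fst z0)" "around B C' (fst z0)"
      "trunc y = jcoord B C z0" for y z0
    proof -
      have b: "(\<lambda>n. y (Inl n)) = bcoord C (proj B (fst z0))"
        using fun_cong[OF z0(4), of "Inl n" for n] by (auto simp: trunc_def jcoord_def)
      have "bpt C (\<lambda>n. y (Inl n)) = proj B (fst z0)"
        unfolding b using around_bdom[OF z0(2)] by (simp add: bpt_bcoord)
      moreover have "(\<lambda>j. J.tr C C' j (trunc y)) = snd z0 C'"
        unfolding z0(4) by (rule ext, rule J.tr_eq[OF z0(1-3), symmetric])
      ultimately show ?thesis unfolding Q_def jcoord_def by simp
    qed
    have QO: "Q y \<in> overlap B (jidx (k - 1)) (\<lambda>a. ({#}, a)) C' C" if y: "y \<in> ?O" for y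
    proof -
      obtain z0 where z0: "z0 \<in> Jet B (k - 1)" "fst z0 \<in> fdom C" "fst z0 \<in> fdom C'" "jcoord B C z0 = trunc y"
        by (rule J.overlap_pt[OF trO[OF y] C(1)])
      have ar: "around B C (fst z0)" "around B C' (fst z0)" using z0 C by (auto simp: around_def)
      show ?thesis unfolding Q_eq[OF z0(1) ar z0(4)[symmetric]] by (rule J.jcoord_overlap[OF z0(1) ar(2,1)])
    qed
    have compQ: "smooth_fun ?b ?O (\<lambda>y. g (Q y))"
      if "smooth_fun (bidx (jidx (k - 1))) (overlap B (jidx (k - 1)) (\<lambda>a. ({#}, a)) C' C) g" for g
      by (rule smooth_compose[OF J.finite_bK overlap_open[OF C(2,1)] that QO fin oO Qs])
    show "\<exists>T. smooth_fun ?b ?O T \<and>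
      (\<forall>z\<in>Phase B k. fst z \<in> fdom C \<longrightarrow> fst z \<in> fdom C' \<longrightarrow> snd z C' r = T (jcoord B C z))"
    proof (cases r)
      case (Inl i)
      show ?thesis
      proof (intro exI[of _ "\<lambda>y. J.tr C C' i (trunc y)"] conjI ballI impI)
        show "smooth_fun ?b ?O (\<lambda>y. J.tr C C' i (trunc y))" by (rule comp[OF J.tr_smooth[OF C]])
        fix z assume z: "z \<in> Phase B k" "fst z \<in> fdom C" "fst z \<in> fdom C'"
        then show "snd z C' r = J.tr C C' i (trunc (jcoord B C z))"
          using J.tr_eq[OF PhaseD(1)[OF z(1)], of C C' i] C by (simp add: tl Inl around_def)
      qed
    next
      case (Inr p)
      obtain I \<rho> a where p: "p = (I, \<rho>, a)" by (cases p) auto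
      show ?thesis
      proof (cases "size I < k")
        case True
        then have Ia: "Inr (I, a) \<in> bidx (jidx (k - 1))" by simp
        define T where "T = (\<lambda>y :: 'n + ('n, 'm) pidx \<Rightarrow> real. 1 / orderings I * (\<Sum>\<kappa>\<in>UNIV. cofac C' C (bpt C (\<lambda>n. y (Inl n))) \<rho> \<kappa> *
          (\<Sum>i\<in>jidx (k - 1). orderings (fst i) * (y (Inr (Inr (fst i, \<kappa>, snd i))) *
            pd (Inr (I, a)) (J.tr C' C i) (Q y)))))"
        show ?thesis
        proof (intro exI[of _ T] conjI ballI impI)
          show "smooth_fun ?b ?O T"
            unfolding T_def
            by (intro smooth_cmult[OF fin oO] smooth_sum[OF fin oO] smooth_mult[OF fin oO]
                base_function_smooth[OF C finite_pidx cofac_smooth(1)[OF C]] smooth_coord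
                compQ[OF smooth_pd[OF J.tr_smooth[OF C(2,1)] Ia]])
          fix z assume z: "z \<in> Phase B k" "fst z \<in> fdom C" "fst z \<in> fdom C'"
          have ar: "around B C (fst z)" "around B C' (fst z)" using z C by (auto simp: around_def)
          have b: "bpt C (\<lambda>n. jcoord B C z (Inl n)) = proj B (fst z)"
            using around_bdom[OF ar(1)] by (simp add: jcoord_def bpt_bcoord)
          have q: "Q (jcoord B C z) = jcoord B C' (left z)"
            by (rule Q_eq[OF PhaseD(1)[OF z(1)]]) (use ar tl in simp_all)
          have m: "jcoord B C z (Inr i) = snd z C i" for i by (simp add: jcoord_def)
          show "snd z C' r = T (jcoord B C z)"
            unfolding T_def b q m Inr p by (rule pt_momentum[OF z(1) ar True])
        qed
      next
        case False
        then have "snd z C' r = 0" if "z \<in> Phase B k" for z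
          using PhaseD(3)[OF that, of I C' \<rho> a] by (simp add: Inr p)
        then show ?thesis by (intro exI[of _ "\<lambda>_. 0"]) (auto simp: smooth_const)
      qed
    qed
  qed (use finite_pidx facts in auto)
qed

section \<open>The Piola identity\<close>

lemma sum_mult_unit:
  fixes f :: "'n::finite \<Rightarrow> real"
  shows "(\<Sum>\<mu>\<in>UNIV. f \<mu> * (if \<mu> = \<kappa> then 1 else 0)) = f \<kappa>"
proof -
  have "(\<Sum>\<mu>\<in>UNIV. f \<mu> * (if \<mu> = \<kappa> then 1 else 0)) = (\<Sum>\<mu>\<in>UNIV. if \<mu> = \<kappa> then f \<mu> else 0)"
    by (rule sum.cong) auto
  then show ?thesis by simp
qed

text \<open>A form of Cramer's rule: the new row is a combination of the rows of \<open>A\<close>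
  with coefficients given by the inverse \<open>N\<close>, and by multilinearity every term except
  the multiple of row \<open>m\<close> has a repeated row.\<close>

lemma det_row_replace:
  fixes A N :: "'n::finite \<Rightarrow> 'n \<Rightarrow> real"
  assumes inv: "\<And>\<rho> \<sigma>. (\<Sum>i\<in>UNIV. N \<rho> i * A i \<sigma>) = (if \<rho> = \<sigma> then 1 else 0)"
  shows "det (\<chi> i. if i = m then (\<chi> j. r j) else (\<chi> j. A i j)) = (\<Sum>\<rho>\<in>UNIV. r \<rho> * N \<rho> m) * det (\<chi> i j. A i j)"
proof -
  define c where "c = (\<lambda>i. \<Sum>\<rho>\<in>UNIV. r \<rho> * N \<rho> i)"
  have r: "(\<chi> j. r j) = (\<Sum>i\<in>UNIV. c i *s (\<chi> j. A i j))"
  proof (simp add: vec_eq_iff sum_component, intro allI)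
    fix \<sigma>
    have "(\<Sum>i\<in>UNIV. c i * A i \<sigma>) = (\<Sum>\<rho>\<in>UNIV. r \<rho> * (\<Sum>i\<in>UNIV. N \<rho> i * A i \<sigma>))"
      unfolding c_def by (rule sum_matrix_assoc)
    also have "\<dots> = (\<Sum>\<rho>\<in>UNIV. if \<rho> = \<sigma> then r \<sigma> else 0)"
      unfolding inv by (rule sum.cong) auto
    also have "\<dots> = r \<sigma>" by simp
    finally show "r \<sigma> = (\<Sum>i\<in>UNIV. c i * A i \<sigma>)" by simp
  qed
  have "det (\<chi> i. if i = m then (\<chi> j. r j) else (\<chi> j. A i j)) =
      (\<Sum>k\<in>UNIV. det (\<chi> i. if i = m then c k *s (\<chi> j. A k j) else (\<chi> j. A i j)))"
    unfolding r by (rule det_linear_row_sum) simp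
  also have "\<dots> = (\<Sum>k\<in>UNIV. c k * det (\<chi> i. if i = m then (\<chi> j. A k j) else (\<chi> j. A i j)))"
    by (rule sum.cong[OF refl det_row_mul])
  also have "\<dots> = (\<Sum>k\<in>UNIV. if k = m then c m * det (\<chi> i j. A i j) else 0)"
  proof (rule sum.cong[OF refl])
    fix k
    show "c k * det (\<chi> i. if i = m then (\<chi> j. A k j) else (\<chi> j. A i j)) =
        (if k = m then c m * det (\<chi> i j. A i j) else 0)"
    proof (cases "k = m")
      case True
      have "(\<chi> i. if i = m then (\<chi> j. A k j) else (\<chi> j. A i j)) = (\<chi> i j. A i j)"
        using True by (simp add: vec_eq_iff)
      then show ?thesis using True by simp
    next
      case False
      have "det (\<chi> i. if i = m then (\<chi> j. A k j) else (\<chi> j. A i j)) = 0"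
        using False by (intro det_identical_rows[of m k]) (auto simp: row_def vec_eq_iff)
      then show ?thesis using False by simp
    qed
  qed
  also have "\<dots> = c m * det (\<chi> i j. A i j)" by simp
  finally show ?thesis by (simp add: c_def)
qed

text \<open>Jacobi's formula. The Leibniz expansion differentiates to a sum of determinants with one
  row replaced by its derivative, each evaluated by \<open>det_row_replace\<close>.\<close>

lemma det_has_derivative:
  fixes A :: "'n::finite \<Rightarrow> 'n \<Rightarrow> real \<Rightarrow> real" and N :: "'n \<Rightarrow> 'n \<Rightarrow> real"
  assumes D: "\<And>i j. (A i j has_real_derivative A' i j) (at t)"
    and inv: "\<And>\<rho> \<sigma>. (\<Sum>i\<in>UNIV. N \<rho> i * A i \<sigma> t) = (if \<rho> = \<sigma> then 1 else 0)"
  shows "((\<lambda>t. det (\<chi> i j. A i j t)) has_real_derivative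
    (\<Sum>m\<in>UNIV. \<Sum>\<rho>\<in>UNIV. A' m \<rho> * N \<rho> m) * det (\<chi> i j. A i j t)) (at t)"
proof -
  have "((\<lambda>t. det (\<chi> i j. A i j t)) has_real_derivative
     (\<Sum>p | p permutes UNIV. of_int (sign p) * (\<Sum>m\<in>UNIV. A' m (p m) * (\<Prod>i\<in>UNIV - {m}. A i (p i) t)))) (at t)"
    unfolding det_def vec_lambda_beta
    by (intro DERIV_sum DERIV_cmult has_field_derivative_prod D)
  also have "(\<Sum>p | p permutes UNIV. of_int (sign p) * (\<Sum>m\<in>UNIV. A' m (p m) * (\<Prod>i\<in>UNIV - {m}. A i (p i) t))) =
     (\<Sum>m\<in>UNIV. det (\<chi> i. if i = m then (\<chi> j. A' m j) else (\<chi> j. A i j t)))"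
  proof -
    have "det (\<chi> i. if i = m then (\<chi> j. A' m j) else (\<chi> j. A i j t)) =
        (\<Sum>p | p permutes UNIV. of_int (sign p) * (A' m (p m) * (\<Prod>i\<in>UNIV - {m}. A i (p i) t)))" for m
      unfolding det_def
    proof (rule sum.cong[OF refl])
      fix p
      have "(\<Prod>i\<in>UNIV. (\<chi> i. if i = m then (\<chi> j. A' m j) else (\<chi> j. A i j t)) $ i $ p i) =
          A' m (p m) * (\<Prod>i\<in>UNIV - {m}. (\<chi> i. if i = m then (\<chi> j. A' m j) else (\<chi> j. A i j t)) $ i $ p i)"
        by (subst prod.remove[of _ m]) auto
      also have "(\<Prod>i\<in>UNIV - {m}. (\<chi> i. if i = m then (\<chi> j. A' m j) else (\<chi> j. A i j t)) $ i $ p i) =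
          (\<Prod>i\<in>UNIV - {m}. A i (p i) t)"
        by (rule prod.cong) auto
      finally show "of_int (sign p) * (\<Prod>i\<in>UNIV. (\<chi> i. if i = m then (\<chi> j. A' m j) else (\<chi> j. A i j t)) $ i $ p i) =
        of_int (sign p) * (A' m (p m) * (\<Prod>i\<in>UNIV - {m}. A i (p i) t))" by simp
    qed
    then show ?thesis by (simp add: sum_distrib_left) (rule sum.swap)
  qed
  also have "\<dots> = (\<Sum>m\<in>UNIV. \<Sum>\<rho>\<in>UNIV. A' m \<rho> * N \<rho> m) * det (\<chi> i j. A i j t)"
    unfolding det_row_replace[OF inv] by (simp add: sum_distrib_right)
  finally show ?thesis .
qed

context fibred begin

lemma jac_inverse:
  assumes C: "adapted B C" "adapted B C'" and x: "x \<in> bdom C" "x \<in> bdom C'"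
  shows "(\<Sum>\<mu>\<in>UNIV. jac C' C x \<rho> \<mu> * jac C C' x \<mu> \<sigma>) = (if \<rho> = \<sigma> then 1 else 0)"
  using jac_chain[OF C C(1) x x(1), of \<rho> \<sigma>] jac_self[OF C(1) x(1), of \<rho> \<sigma>] by simp

text \<open>With \<open>J\<close> the Jacobian matrix and \<open>N\<close> its inverse, \<open>\<partial>\<^sub>\<rho> (det J N\<^bsup>\<rho>\<^esup>\<^sub>\<kappa>)\<close> is antisymmetric in two indices
  contracted with second derivatives of the coordinate change.\<close>

lemma piola:
  assumes C: "adapted B C" "adapted B C'" and y0: "y0 \<in> bcoord C ` (bdom C \<inter> bdom C')"
  shows "(\<Sum>\<rho>\<in>UNIV. pd \<rho> (\<lambda>y. cofac C C' (bpt C y) \<rho> \<kappa>) y0) = 0"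
proof -
  define U where "U = bcoord C ` (bdom C \<inter> bdom C')"
  have oU: "open_in UNIV U" unfolding U_def using base_trans(1)[OF C] by simp
  define J where "J = (\<lambda>\<mu> \<rho> y. jac C C' (bpt C y) \<mu> \<rho>)"
  define N where "N = (\<lambda>\<rho> \<mu> y. jac C' C (bpt C y) \<rho> \<mu>)"
  define D where "D = (\<lambda>y. jdet C C' (bpt C y))"
  have y0U: "y0 \<in> U" using y0 by (simp add: U_def)
  have Js: "smooth_fun UNIV U (J \<mu> \<rho>)" for \<mu> \<rho> unfolding J_def U_def by (rule jac_smooth_same[OF C])
  have Ns: "smooth_fun UNIV U (N \<rho> \<mu>)" for \<mu> \<rho> unfolding N_def U_def by (rule jac_smooth[OF fibred_axioms C])
  have Ds: "smooth_fun UNIV U D" unfolding D_def U_def by (rule jdet_smooth(2)[OF C])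
  have bU: "bpt C y \<in> bdom C \<and> bpt C y \<in> bdom C' \<and> bcoord C (bpt C y) = y" if "y \<in> U" for y
    using that bpt_bcoord[OF C(1)] by (auto simp: U_def)
  have NJ: "(\<Sum>\<mu>\<in>UNIV. N \<rho> \<mu> y * J \<mu> \<sigma> y) = (if \<rho> = \<sigma> then 1 else 0)" if "y \<in> U" for y \<rho> \<sigma>
    using jac_inverse[OF C, of "bpt C y"] bU[OF that] by (simp add: N_def J_def)
  have JN: "(\<Sum>\<mu>\<in>UNIV. J \<rho> \<mu> y * N \<mu> \<sigma> y) = (if \<rho> = \<sigma> then 1 else 0)" if "y \<in> U" for y \<rho> \<sigma>
    using jac_inverse[OF C(2,1), of "bpt C y"] bU[OF that] by (simp add: N_def J_def)
  \<comment> \<open>The entries of the Jacobian matrix are first derivatives, so this is the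
    commutation of second derivatives.\<close>
  have dJ: "pd \<alpha> (J \<mu> \<sigma>) y0 = pd \<sigma> (J \<mu> \<alpha>) y0" for \<alpha> \<mu> \<sigma>
  proof -
    let ?f = "\<lambda>y. bcoord C' (bpt C y) \<mu>"
    have fs: "smooth_fun UNIV U ?f" unfolding U_def by (rule base_trans(2)[OF C])
    have J_eq: "J \<mu> \<beta> y = pd \<beta> ?f y" if "y \<in> U" for \<beta> y using bU[OF that] by (simp add: J_def jac_def)
    have "pd \<alpha> (J \<mu> \<sigma>) y0 = pd \<alpha> (pd \<sigma> ?f) y0" by (rule pd_cong[OF finite oU y0U UNIV_I J_eq])
    also have "\<dots> = pd \<sigma> (pd \<alpha> ?f) y0" by (rule pd_commute[OF finite oU fs y0U]) simp_all
    also have "\<dots> = pd \<sigma> (J \<mu> \<alpha>) y0" by (rule pd_cong[OF finite oU y0U UNIV_I J_eq[symmetric]])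
    finally show ?thesis .
  qed
  have dD: "pd \<alpha> D y0 = (\<Sum>m\<in>UNIV. \<Sum>\<rho>\<in>UNIV. pd \<alpha> (J m \<rho>) y0 * N \<rho> m y0) * D y0" for \<alpha>
  proof -
    have u: "y0(\<alpha> := y0 \<alpha>) = y0" by simp
    have "((\<lambda>t. det (\<chi> i j. J i j (y0(\<alpha> := t)))) has_real_derivative
      (\<Sum>m\<in>UNIV. \<Sum>\<rho>\<in>UNIV. pd \<alpha> (J m \<rho>) y0 * N \<rho> m y0) * det (\<chi> i j. J i j (y0(\<alpha> := y0 \<alpha>)))) (at (y0 \<alpha>))"
    proof (rule det_has_derivative)
      show "((\<lambda>t. J i j (y0(\<alpha> := t))) has_real_derivative pd \<alpha> (J i j) y0) (at (y0 \<alpha>))" for i j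
        by (rule smooth_has_pd[OF Js y0U UNIV_I])
      show "(\<Sum>i\<in>UNIV. N \<rho> i y0 * J i \<sigma> (y0(\<alpha> := y0 \<alpha>))) = (if \<rho> = \<sigma> then 1 else 0)" for \<rho> \<sigma>
        unfolding u by (rule NJ[OF y0U])
    qed
    moreover have "D = (\<lambda>y. det (\<chi> i j. J i j y))" by (simp add: D_def J_def jdet_def)
    ultimately show ?thesis unfolding u by (simp add: pd_def DERIV_imp_deriv)
  qed
  \<comment> \<open>Derivative of an inverse matrix: the identity \<open>NJ\<close> is
    differentiated and multiplied by \<open>N\<close> from the right.\<close>
  have dN: "pd \<alpha> (N \<rho> \<tau>) y0 = - (\<Sum>\<mu>\<in>UNIV. \<Sum>\<sigma>\<in>UNIV. N \<rho> \<mu> y0 * pd \<alpha> (J \<mu> \<sigma>) y0 * N \<sigma> \<tau> y0)" for \<alpha> \<rho> \<tau>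
  proof -
    have e: "(\<Sum>\<mu>\<in>UNIV. N \<rho> \<mu> y0 * pd \<alpha> (J \<mu> \<sigma>) y0 + pd \<alpha> (N \<rho> \<mu>) y0 * J \<mu> \<sigma> y0) = 0" for \<sigma>
    proof -
      have "pd \<alpha> (\<lambda>y. \<Sum>\<mu>\<in>UNIV. N \<rho> \<mu> y * J \<mu> \<sigma> y) y0 = pd \<alpha> (\<lambda>y. if \<rho> = \<sigma> then 1 else 0) y0"
        by (rule pd_cong[OF finite oU y0U UNIV_I NJ])
      also have "\<dots> = 0" by (simp add: pd_const)
      finally have "pd \<alpha> (\<lambda>y. \<Sum>\<mu>\<in>UNIV. N \<rho> \<mu> y * J \<mu> \<sigma> y) y0 = 0" .
      moreover have "pd \<alpha> (\<lambda>y. \<Sum>\<mu>\<in>UNIV. N \<rho> \<mu> y * J \<mu> \<sigma> y) y0 = (\<Sum>\<mu>\<in>UNIV. pd \<alpha> (\<lambda>y. N \<rho> \<mu> y * J \<mu> \<sigma> y) y0)"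
        by (rule smooth_pd_sum[OF finite oU smooth_mult[OF finite oU Ns Js] y0U UNIV_I])
      ultimately show ?thesis by (simp add: smooth_pd_mult[OF Ns Js y0U])
    qed
    have "pd \<alpha> (N \<rho> \<tau>) y0 = (\<Sum>\<mu>\<in>UNIV. pd \<alpha> (N \<rho> \<mu>) y0 * (if \<mu> = \<tau> then 1 else 0))"
      by (rule sum_mult_unit[symmetric])
    also have "\<dots> = (\<Sum>\<mu>\<in>UNIV. pd \<alpha> (N \<rho> \<mu>) y0 * (\<Sum>\<sigma>\<in>UNIV. J \<mu> \<sigma> y0 * N \<sigma> \<tau> y0))"
      by (simp only: JN[OF y0U])
    also have "\<dots> = (\<Sum>\<sigma>\<in>UNIV. (\<Sum>\<mu>\<in>UNIV. pd \<alpha> (N \<rho> \<mu>) y0 * J \<mu> \<sigma> y0) * N \<sigma> \<tau> y0)"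
      by (rule sum_matrix_assoc[symmetric])
    also have "\<dots> = (\<Sum>\<sigma>\<in>UNIV. - (\<Sum>\<mu>\<in>UNIV. N \<rho> \<mu> y0 * pd \<alpha> (J \<mu> \<sigma>) y0) * N \<sigma> \<tau> y0)"
    proof (rule sum.cong[OF refl])
      fix \<sigma>
      have "(\<Sum>\<mu>\<in>UNIV. pd \<alpha> (N \<rho> \<mu>) y0 * J \<mu> \<sigma> y0) = - (\<Sum>\<mu>\<in>UNIV. N \<rho> \<mu> y0 * pd \<alpha> (J \<mu> \<sigma>) y0)"
        using e[of \<sigma>] by (simp add: sum.distrib)
      then show "(\<Sum>\<mu>\<in>UNIV. pd \<alpha> (N \<rho> \<mu>) y0 * J \<mu> \<sigma> y0) * N \<sigma> \<tau> y0 =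
          - (\<Sum>\<mu>\<in>UNIV. N \<rho> \<mu> y0 * pd \<alpha> (J \<mu> \<sigma>) y0) * N \<sigma> \<tau> y0" by (simp only:)
    qed
    also have "\<dots> = - (\<Sum>\<mu>\<in>UNIV. \<Sum>\<sigma>\<in>UNIV. N \<rho> \<mu> y0 * pd \<alpha> (J \<mu> \<sigma>) y0 * N \<sigma> \<tau> y0)"
      by (simp add: sum_distrib_right sum_negf) (rule sum.swap)
    finally show ?thesis .
  qed
  \<comment> \<open>Differentiating the determinant and the inverse matrix leaves two triple sums.
    By \<open>dJ\<close> they differ only by exchanging the roles of \<open>\<rho>\<close> and
    \<open>\<sigma>\<close>, so they cancel.\<close>
  define T where "T = (\<lambda>\<rho> \<mu> \<sigma>. pd \<rho> (J \<mu> \<sigma>) y0 * N \<sigma> \<mu> y0 * N \<rho> \<kappa> y0)"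
  have "(\<Sum>\<rho>\<in>UNIV. pd \<rho> (\<lambda>y. cofac C C' (bpt C y) \<rho> \<kappa>) y0) = (\<Sum>\<rho>\<in>UNIV. pd \<rho> (\<lambda>y. D y * N \<rho> \<kappa> y) y0)"
    by (simp add: cofac_def D_def N_def)
  also have "\<dots> = (\<Sum>\<rho>\<in>UNIV. D y0 * pd \<rho> (N \<rho> \<kappa>) y0 + pd \<rho> D y0 * N \<rho> \<kappa> y0)"
    by (simp add: smooth_pd_mult[OF Ds Ns y0U])
  also have "\<dots> = D y0 * ((\<Sum>\<rho>\<in>UNIV. \<Sum>\<mu>\<in>UNIV. \<Sum>\<sigma>\<in>UNIV. T \<rho> \<mu> \<sigma>) -
      (\<Sum>\<rho>\<in>UNIV. \<Sum>\<mu>\<in>UNIV. \<Sum>\<sigma>\<in>UNIV. N \<rho> \<mu> y0 * pd \<rho> (J \<mu> \<sigma>) y0 * N \<sigma> \<kappa> y0))"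
    unfolding dD dN T_def
    by (simp add: sum.distrib sum_subtractf sum_negf right_diff_distrib sum_distrib_left sum_distrib_right mult_ac)
  also have "(\<Sum>\<rho>\<in>UNIV. \<Sum>\<mu>\<in>UNIV. \<Sum>\<sigma>\<in>UNIV. N \<rho> \<mu> y0 * pd \<rho> (J \<mu> \<sigma>) y0 * N \<sigma> \<kappa> y0) =
      (\<Sum>\<rho>\<in>UNIV. \<Sum>\<mu>\<in>UNIV. \<Sum>\<sigma>\<in>UNIV. T \<sigma> \<mu> \<rho>)"
    unfolding T_def by (intro sum.cong refl) (simp add: dJ mult_ac)
  also have "\<dots> = (\<Sum>\<rho>\<in>UNIV. \<Sum>\<mu>\<in>UNIV. \<Sum>\<sigma>\<in>UNIV. T \<rho> \<mu> \<sigma>)"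
  proof -
    have "(\<Sum>\<rho>\<in>UNIV. \<Sum>\<mu>\<in>UNIV. \<Sum>\<sigma>\<in>UNIV. T \<sigma> \<mu> \<rho>) = (\<Sum>\<rho>\<in>UNIV. \<Sum>\<sigma>\<in>UNIV. \<Sum>\<mu>\<in>UNIV. T \<sigma> \<mu> \<rho>)"
      by (rule sum.cong[OF refl sum.swap])
    also have "\<dots> = (\<Sum>\<sigma>\<in>UNIV. \<Sum>\<rho>\<in>UNIV. \<Sum>\<mu>\<in>UNIV. T \<sigma> \<mu> \<rho>)" by (rule sum.swap)
    also have "\<dots> = (\<Sum>\<sigma>\<in>UNIV. \<Sum>\<mu>\<in>UNIV. \<Sum>\<rho>\<in>UNIV. T \<sigma> \<mu> \<rho>)" by (rule sum.cong[OF refl sum.swap])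
    finally show ?thesis .
  qed
  finally show ?thesis by simp
qed

text \<open>In the product rule, the terms that differentiate \<open>cofac\<close> sum to zero by
  \<open>piola\<close>. In the others the chain rule produces the Jacobian matrix, which cancels
  against its inverse inside \<open>cofac\<close> and leaves the determinant.\<close>

lemma divergence_covariant:
  assumes C: "adapted B C" "adapted B C'" and N: "N \<subseteq> bdom C \<inter> bdom C'" and x: "x \<in> N"
    and oN: "open (bcoord C ` N)" "open (bcoord C' ` N)"
    and b': "\<And>\<kappa>. smooth_fun UNIV (bcoord C' ` N) (\<lambda>y. b' (bpt C' y) \<kappa>)"
    and b: "\<And>x \<rho>. x \<in> N \<Longrightarrow> b x \<rho> = (\<Sum>\<kappa>\<in>UNIV. cofac C C' x \<rho> \<kappa> * b' x \<kappa>)"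
  shows "(\<Sum>\<rho>\<in>UNIV. pd \<rho> (\<lambda>y. b (bpt C y) \<rho>) (bcoord C x)) =
    jdet C C' x * (\<Sum>\<kappa>\<in>UNIV. pd \<kappa> (\<lambda>y. b' (bpt C' y) \<kappa>) (bcoord C' x))"
proof -
  define U where "U = bcoord C ` N"
  define U' where "U' = bcoord C' ` N"
  have oU: "open_in UNIV U" "open_in UNIV U'" using oN by (simp_all add: U_def U'_def)
  have xb: "x \<in> bdom C" "x \<in> bdom C'" using x N by auto
  have bU: "bpt C y \<in> N \<and> bpt C y \<in> bdom C \<and> bpt C y \<in> bdom C'" if "y \<in> U" for y
  proof -
    obtain x where x: "x \<in> N" "y = bcoord C x" using \<open>y \<in> U\<close> by (auto simp: U_def)
    have "x \<in> bdom C" "x \<in> bdom C'" using x(1) N by auto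
    then show ?thesis using x bpt_bcoord[OF C(1)] by simp
  qed
  have y0: "bcoord C x \<in> U" using x by (simp add: U_def)
  have UO: "U \<subseteq> bcoord C ` (bdom C \<inter> bdom C')" using N by (auto simp: U_def)
  define \<psi> where "\<psi> = (\<lambda>y. bcoord C' (bpt C y))"
  define h where "h = (\<lambda>\<kappa> y. b' (bpt C' y) \<kappa>)"
  have hs: "smooth_fun UNIV U' (h \<kappa>)" for \<kappa> unfolding h_def U'_def by (rule b')
  have \<psi>s: "smooth_fun UNIV U (\<lambda>y. \<psi> y j)" for j
    unfolding \<psi>_def by (rule smooth_subset[OF base_trans(2)[OF C] UO])
  have \<psi>U: "\<psi> y \<in> U'" if "y \<in> U" for y using bU[OF that] by (simp add: \<psi>_def U'_def)
  have \<psi>0: "\<psi> (bcoord C x) = bcoord C' x" by (simp add: \<psi>_def bpt_bcoord[OF C(1) xb(1)])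
  have h\<psi>: "smooth_fun UNIV U (\<lambda>y. h \<kappa> (\<psi> y))" for \<kappa>
    by (rule smooth_compose[OF finite oU(2) hs \<psi>U finite oU(1) \<psi>s])
  define c where "c = (\<lambda>\<rho> \<kappa> y. cofac C C' (bpt C y) \<rho> \<kappa>)"
  have cs: "smooth_fun UNIV U (c \<rho> \<kappa>)" for \<rho> \<kappa>
    unfolding c_def by (rule smooth_subset[OF cofac_smooth(2)[OF C] UO])
  have c0: "c \<rho> \<kappa> (bcoord C x) = jdet C C' x * jac C' C x \<rho> \<kappa>" for \<rho> \<kappa>
    by (simp add: c_def cofac_def bpt_bcoord[OF C(1) xb(1)])
  have dh: "pd \<rho> (\<lambda>y. h \<kappa> (\<psi> y)) (bcoord C x) = (\<Sum>\<mu>\<in>UNIV. pd \<mu> (h \<kappa>) (bcoord C' x) * jac C C' x \<mu> \<rho>)" for \<rho> \<kappa>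
    using smooth_pd_compose[OF finite oU(2) hs \<psi>U finite oU(1) y0 UNIV_I \<psi>s, of \<rho> \<kappa>]
    unfolding \<psi>0 unfolding jac_def \<psi>_def .
  have "pd \<rho> (\<lambda>y. b (bpt C y) \<rho>) (bcoord C x) =
      (\<Sum>\<kappa>\<in>UNIV. c \<rho> \<kappa> (bcoord C x) * pd \<rho> (\<lambda>y. h \<kappa> (\<psi> y)) (bcoord C x) + pd \<rho> (c \<rho> \<kappa>) (bcoord C x) * h \<kappa> (\<psi> (bcoord C x)))" for \<rho>
  proof -
    have "pd \<rho> (\<lambda>y. b (bpt C y) \<rho>) (bcoord C x) = pd \<rho> (\<lambda>y. \<Sum>\<kappa>\<in>UNIV. c \<rho> \<kappa> y * h \<kappa> (\<psi> y)) (bcoord C x)"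
    proof (rule pd_cong[OF finite oU(1) y0 UNIV_I])
      fix y assume "y \<in> U"
      then show "b (bpt C y) \<rho> = (\<Sum>\<kappa>\<in>UNIV. c \<rho> \<kappa> y * h \<kappa> (\<psi> y))"
        using bU b bpt_bcoord[OF C(2)] by (simp add: c_def h_def \<psi>_def)
    qed
    also have "\<dots> = (\<Sum>\<kappa>\<in>UNIV. pd \<rho> (\<lambda>y. c \<rho> \<kappa> y * h \<kappa> (\<psi> y)) (bcoord C x))"
      by (rule smooth_pd_sum[OF finite oU(1) smooth_mult[OF finite oU(1) cs h\<psi>] y0 UNIV_I])
    finally show ?thesis by (simp add: smooth_pd_mult[OF cs h\<psi> y0])
  qed
  then have "(\<Sum>\<rho>\<in>UNIV. pd \<rho> (\<lambda>y. b (bpt C y) \<rho>) (bcoord C x)) =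
      (\<Sum>\<rho>\<in>UNIV. \<Sum>\<kappa>\<in>UNIV. c \<rho> \<kappa> (bcoord C x) * pd \<rho> (\<lambda>y. h \<kappa> (\<psi> y)) (bcoord C x)) +
      (\<Sum>\<rho>\<in>UNIV. \<Sum>\<kappa>\<in>UNIV. pd \<rho> (c \<rho> \<kappa>) (bcoord C x) * h \<kappa> (\<psi> (bcoord C x)))"
    by (simp add: sum.distrib)
  also have "(\<Sum>\<rho>\<in>UNIV. \<Sum>\<kappa>\<in>UNIV. pd \<rho> (c \<rho> \<kappa>) (bcoord C x) * h \<kappa> (\<psi> (bcoord C x))) =
      (\<Sum>\<kappa>\<in>UNIV. (\<Sum>\<rho>\<in>UNIV. pd \<rho> (c \<rho> \<kappa>) (bcoord C x)) * h \<kappa> (\<psi> (bcoord C x)))"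
    by (subst sum.swap) (simp add: sum_distrib_right)
  also have "\<dots> = 0"
    using piola[OF C, of "bcoord C x"] xb by (simp add: c_def)
  also have "(\<Sum>\<rho>\<in>UNIV. \<Sum>\<kappa>\<in>UNIV. c \<rho> \<kappa> (bcoord C x) * pd \<rho> (\<lambda>y. h \<kappa> (\<psi> y)) (bcoord C x)) =
      jdet C C' x * (\<Sum>\<kappa>\<in>UNIV. pd \<kappa> (h \<kappa>) (bcoord C' x))"
  proof -
    have "(\<Sum>\<rho>\<in>UNIV. c \<rho> \<kappa> (bcoord C x) * pd \<rho> (\<lambda>y. h \<kappa> (\<psi> y)) (bcoord C x)) =
        jdet C C' x * pd \<kappa> (h \<kappa>) (bcoord C' x)" for \<kappa>
    proof -
      have "(\<Sum>\<rho>\<in>UNIV. c \<rho> \<kappa> (bcoord C x) * pd \<rho> (\<lambda>y. h \<kappa> (\<psi> y)) (bcoord C x)) =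
          jdet C C' x * (\<Sum>\<rho>\<in>UNIV. (\<Sum>\<mu>\<in>UNIV. pd \<mu> (h \<kappa>) (bcoord C' x) * jac C C' x \<mu> \<rho>) * jac C' C x \<rho> \<kappa>)"
        unfolding dh c0 by (simp add: sum_distrib_left mult_ac)
      also have "(\<Sum>\<rho>\<in>UNIV. (\<Sum>\<mu>\<in>UNIV. pd \<mu> (h \<kappa>) (bcoord C' x) * jac C C' x \<mu> \<rho>) * jac C' C x \<rho> \<kappa>) =
          (\<Sum>\<mu>\<in>UNIV. pd \<mu> (h \<kappa>) (bcoord C' x) * (\<Sum>\<rho>\<in>UNIV. jac C C' x \<mu> \<rho> * jac C' C x \<rho> \<kappa>))"
        by (rule sum_matrix_assoc)
      also have "\<dots> = pd \<kappa> (h \<kappa>) (bcoord C' x)"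
        unfolding jac_inverse[OF C(2,1) xb(2,1)] by (rule sum_mult_unit)
      finally show ?thesis .
    qed
    then show ?thesis by (subst sum.swap) (simp add: sum_distrib_left)
  qed
  finally show ?thesis by (simp add: h_def)
qed

end

section \<open>Prolongation of vertical vector fields\<close>

text \<open>The index type \<open>'n option\<close> adjoins one parameter, in the slot
  \<open>None\<close>, to the base coordinates. Commuting a base derivative with the parameter
  derivative then becomes an instance of \<open>pd_commute\<close>.\<close>

lemma pd_Some: "pd (Some \<kappa>) f (case_option t y) = pd \<kappa> (\<lambda>y. f (case_option t y)) y"
proof -
  have "(case_option t y)(Some \<kappa> := s) = case_option t (y(\<kappa> := s))" for s
    by (auto simp: fun_eq_iff split: option.split)
  then show ?thesis by (simp add: pd_def)
qed

lemma upd_None: "(case_option t y)(None := s) = case_option s y"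
  by (auto simp: fun_eq_iff split: option.split)

lemma left_J1_velocity: "velocity B (\<lambda>t. left (\<gamma> t)) t C i = velocity B \<gamma> t C (Inl i)"
  by (simp add: velocity_def)

lemma smooth_real_zero: "smooth_real T (\<lambda>_. 0)"
proof -
  have "(deriv ^^ r) (\<lambda>_ :: real. 0 :: real) = (\<lambda>_. 0)" for r by (induction r) auto
  then show ?thesis by (simp add: smooth_real_def)
qed

context coord_bundle begin

lemma left_jet1:
  assumes s: "smooth_section B S N s" and x: "x \<in> N"
  shows "left (jet1 B s x) = s x"
proof (rule prod_eqI)
  show "snd (left (jet1 B s x)) = snd (s x)"
  proof (intro ext)
    fix C i show "snd (left (jet1 B s x)) C i = snd (s x) C i"
      using pt_zero[OF smooth_sectionD(2)[OF s x], of C i] by (simp add: jet1_def)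
  qed
qed (simp add: jet1_def)

lemma left_J1: "z \<in> J1 B S \<Longrightarrow> left z \<in> S"
  using left_jet1 smooth_sectionD(2) by (fastforce simp: J1_def)

lemma J1_coord_eq:
  assumes z: "z \<in> J1 B S" and ar: "around B C (fst z)" "around B C' (fst z)"
  shows "snd z C' (Inr (i, \<kappa>)) = (\<Sum>\<rho>\<in>UNIV. jac C' C (proj B (fst z)) \<rho> \<kappa> *
      (pd (Inl \<rho>) (tr C C' i) (jcoord B C (left z)) +
       (\<Sum>j\<in>K. pd (Inr j) (tr C C' i) (jcoord B C (left z)) * snd z C (Inr (j, \<rho>)))))"
proof -
  obtain s x N where s: "z = jet1 B s x" "smooth_section B S N s" "x \<in> N" using z by (auto simp: J1_def)
  have f: "fst z = fst (s x)" by (simp add: s jet1_def)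
  have p: "proj B (fst z) = x" using sectionD(4)[OF smooth_sectionD(1)[OF s(2)] s(3)] by (simp add: f)
  have l: "left z = s x" unfolding s(1) by (rule left_jet1[OF s(2,3)])
  show ?thesis unfolding p l unfolding s(1) by (rule jet1_trans[OF s(2,3) ar[unfolded f]])
qed

lemma left_tangent:
  assumes X: "X \<in> vertical_tangent B (J1 B S) z"
  shows "(\<lambda>C i. X C (Inl i)) \<in> vertical_tangent B S (left z)"
proof -
  obtain \<gamma> \<epsilon> where g: "X = velocity B \<gamma> 0" "\<epsilon> > 0" "vertical_curve B (J1 B S) (proj B (fst z)) {-\<epsilon><..<\<epsilon>} \<gamma>" "\<gamma> 0 = z"
    using X by (auto simp: vertical_tangent_def)
  have "vertical_curve B S (proj B (fst z)) {-\<epsilon><..<\<epsilon>} (\<lambda>t. left (\<gamma> t))"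
    using g(3) left_J1 by (auto simp: vertical_curve_def fibre_def)
  moreover have "(\<lambda>C i. X C (Inl i)) = velocity B (\<lambda>t. left (\<gamma> t)) 0"
    by (intro ext) (simp add: g(1) left_J1_velocity)
  ultimately show ?thesis using g unfolding vertical_tangent_def by force
qed

text \<open>Being the prolongation of a vertical field \<open>V\<close> along \<open>s\<close> does
  not depend on the chart. The field is replaced by the family with coordinates
  \<open>u + t * v\<close> in \<open>C\<close>: \<open>V\<close> is its derivative in the parameter
  and \<open>X\<close> that of its first jet, so in \<open>C'\<close> the claim is that parameter
  and base derivatives commute.\<close>

lemma tangent_field:
  assumes s: "smooth_section B S N s" and x: "x \<in> N" and C: "adapted B C" "adapted B C'"
    and sC: "\<And>y. y \<in> N \<Longrightarrow> fst (s y) \<in> fdom C" "\<And>y. y \<in> N \<Longrightarrow> fst (s y) \<in> fdom C'"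
    and V: "\<And>y. y \<in> N \<Longrightarrow> V y \<in> vertical_tangent B S (s y)"
    and Vs: "\<And>j. smooth_fun UNIV (bcoord C ` N) (\<lambda>y. V (bpt C y) C j)"
    and X: "X \<in> vertical_tangent B (J1 B S) (jet1 B s x)"
    and X0: "\<And>j. j \<in> K \<Longrightarrow> X C (Inl j) = V x C j"
    and X1: "\<And>j \<rho>. j \<in> K \<Longrightarrow> X C (Inr (j, \<rho>)) = pd \<rho> (\<lambda>y. V (bpt C y) C j) (bcoord C x)"
  shows "smooth_fun UNIV (bcoord C' ` N) (\<lambda>y. V (bpt C' y) C' i)"
    "X C' (Inl i) = V x C' i"
    "X C' (Inr (i, \<kappa>)) = pd \<kappa> (\<lambda>y. V (bpt C' y) C' i) (bcoord C' x)"
proof -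
  have NC: "{x \<in> N. fst (s x) \<in> fdom C} = N" "{x \<in> N. fst (s x) \<in> fdom C'} = N" using sC by auto
  define U where "U = bcoord C ` N"
  define U' where "U' = bcoord C' ` N"
  note nb = smooth_section_around[OF s C(1), unfolded NC, folded U_def]
  note nb' = smooth_section_around[OF s C(2), unfolded NC, folded U'_def]
  have oU: "open_in UNIV U" and oU': "open_in UNIV U'" using nb(1) nb'(1) by simp_all
  have ar: "around B C (fst (s y))" "around B C' (fst (s y))" if "y \<in> N" for y
    using sC[OF that] C by (simp_all add: around_def)
  have xb: "x \<in> bdom C" "x \<in> bdom C'" using nb(3)[OF x sC(1)[OF x]] nb'(3)[OF x sC(2)[OF x]] by auto
  have bx: "bpt C (bcoord C x) = x" "bpt C' (bcoord C' x) = x" using bpt_bcoord C xb by auto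
  define \<psi> where "\<psi> = (\<lambda>y. bcoord C (bpt C' y))"
  have U'O: "U' \<subseteq> bcoord C' ` (bdom C' \<inter> bdom C)"
    using nb(3) nb'(3) sC by (auto simp: U'_def)
  have \<psi>s: "smooth_fun UNIV U' (\<lambda>y. \<psi> y j)" for j
    unfolding \<psi>_def by (rule smooth_subset[OF base_trans(2)[OF C(2,1)] U'O])
  have \<psi>U: "\<psi> y \<in> U" if "y \<in> U'" for y using nb'(2)[OF that] by (simp add: \<psi>_def U_def)
  have b\<psi>: "bpt C (\<psi> y) = bpt C' y" if "y \<in> U'" for y
    unfolding \<psi>_def using nb'(2)[OF that] nb(3) sC by (intro bpt_bcoord[OF C(1)]) blast
  define u where "u = (\<lambda>j y. snd (s (bpt C y)) C j)"
  define v where "v = (\<lambda>j y. V (bpt C y) C j)"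
  have us: "smooth_fun UNIV U (u j)" for j
    using smooth_sectionD(3)[OF s C(1), of j] unfolding NC(1) u_def U_def .
  have vs: "smooth_fun UNIV U (v j)" for j using Vs unfolding v_def U_def .
  have uvs: "smooth_fun UNIV U (\<lambda>y. u j y + t * v j y)" for j t
    by (intro smooth_add[OF finite oU] smooth_cmult[OF finite oU] us vs)
  have u\<psi>: "smooth_fun UNIV U' (\<lambda>y. u j (\<psi> y))" for j
    by (rule smooth_compose[OF finite oU us \<psi>U finite oU' \<psi>s])
  have v\<psi>: "smooth_fun UNIV U' (\<lambda>y. v j (\<psi> y))" for j
    by (rule smooth_compose[OF finite oU vs \<psi>U finite oU' \<psi>s])
  have js: "jcoord B C (s (bpt C' y)) = case_sum (\<psi> y) (\<lambda>j. u j (\<psi> y))" if "y \<in> U'" for y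
    using nb'(2)[OF that] b\<psi>[OF that] by (simp add: jcoord_def u_def \<psi>_def)
  have VC': "V (bpt C' y) C' i = (\<Sum>j\<in>K. pd (Inr j) (tr C C' i) (case_sum (\<psi> y) (\<lambda>j. u j (\<psi> y))) * v j (\<psi> y))"
    if y: "y \<in> U'" for y
  proof -
    have yN: "bpt C' y \<in> N" using nb'(2)[OF y] by blast
    show ?thesis
      using tangent_trans[OF V[OF yN] ar[OF yN], of i] by (simp add: js[OF y] v_def b\<psi>[OF y])
  qed
  have JO: "case_sum (\<psi> y) (\<lambda>j. u j (\<psi> y)) \<in> overlap B K emb C C'" if y: "y \<in> U'" for y
  proof -
    have yN: "bpt C' y \<in> N" using nb'(2)[OF y] by blast
    show ?thesis using jcoord_overlap[OF smooth_sectionD(2)[OF s yN] ar[OF yN]] by (simp add: js[OF y])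
  qed
  have Js: "smooth_fun UNIV U' (\<lambda>y. case_sum (\<psi> y) (\<lambda>j. u j (\<psi> y)) q)" for q
    by (cases q) (simp_all add: \<psi>s u\<psi>)
  have "smooth_fun UNIV U' (\<lambda>y. \<Sum>j\<in>K. pd (Inr j) (tr C C' i) (case_sum (\<psi> y) (\<lambda>j. u j (\<psi> y))) * v j (\<psi> y))"
  proof (intro smooth_sum[OF finite oU'] smooth_mult[OF finite oU'] v\<psi>)
    fix j assume "j \<in> K"
    then have "Inr j \<in> bidx K" by simp
    show "smooth_fun UNIV U' (\<lambda>y. pd (Inr j) (tr C C' i) (case_sum (\<psi> y) (\<lambda>j. u j (\<psi> y))))"
      by (rule smooth_compose[OF finite_bK overlap_open[OF C] smooth_pd[OF tr_smooth[OF C] \<open>Inr j \<in> bidx K\<close>] JO finite oU' Js])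
  qed
  then show "smooth_fun UNIV (bcoord C' ` N) (\<lambda>y. V (bpt C' y) C' i)"
    unfolding U'_def[symmetric] by (rule smooth_cong[OF finite oU']) (simp add: VC')
  have sx: "left (jet1 B s x) = s x" by (rule left_jet1[OF s x])
  have Xl: "(\<lambda>C i. X C (Inl i)) \<in> vertical_tangent B S (s x)" using left_tangent[OF X] by (simp add: sx)
  have "(\<lambda>C i. X C (Inl i)) = V x"
  proof (rule tangent_eqI[OF Xl V[OF x] ar(1)[OF x]])
    show "(\<lambda>i. X C (Inl i)) = V x C"
    proof
      fix j show "X C (Inl j) = V x C j"
        using X0[of j] tangent_coord[OF Xl ar(1)[OF x]] tangent_coord[OF V[OF x] ar(1)[OF x]]
        by (cases "j \<in> K") (auto simp: coord_space_def)
    qed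
  qed
  then have X0': "X C i = V x C j" if "i = Inl j" for C j i using that by (metis (mono_tags))
  then show "X C' (Inl i) = V x C' i" by simp
  interpret J1: coord_bundle B "J1 B S" "K <+> K \<times> UNIV" "\<lambda>a. Inl (emb a)" by (rule J1_coord_bundle)
  define y0 where "y0 = bcoord C' x"
  have y0: "y0 \<in> U'" using x by (simp add: y0_def U'_def)
  have \<psi>0: "\<psi> y0 = bcoord C x" by (simp add: \<psi>_def y0_def bx)
  \<comment> \<open>Coordinates in \<open>C\<close> of the section displaced along \<open>V\<close>,
    as a function of the parameter \<open>p None\<close> and of base coordinates in
    \<open>C'\<close>.\<close>
  define G where "G = (\<lambda>p :: 'n option \<Rightarrow> real. let y = (\<lambda>n. p (Some n)) in
    case_sum (\<psi> y) (\<lambda>j. u j (\<psi> y) + p None * v j (\<psi> y)))"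
  have Gc: "G (case_option t y) = case_sum (\<psi> y) (\<lambda>j. u j (\<psi> y) + t * v j (\<psi> y))" for t y
    by (simp add: G_def)
  define R where "R = {p :: 'n option \<Rightarrow> real. (\<lambda>n. p (Some n)) \<in> U'}"
  have oR: "open_in UNIV R"
  proof -
    have "open {p \<in> (UNIV :: ('n option \<Rightarrow> real) set). (\<lambda>n. p (Some n)) \<in> U'}"
      by (rule open_preimage_smooth[OF open_UNIV smooth_coord nb'(1)])
    then show ?thesis by (simp add: R_def)
  qed
  have cR: "smooth_fun UNIV R (\<lambda>p. g (\<lambda>n. p (Some n)))" if "smooth_fun UNIV U' g" for g :: "('n \<Rightarrow> real) \<Rightarrow> real"
  proof -
    define r where "r = (\<lambda>(p :: 'n option \<Rightarrow> real) n. p (Some n))"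
    have "smooth_fun UNIV R (\<lambda>p. g (r p))"
      by (rule smooth_compose[OF finite oU' that _ finite oR]) (auto simp: r_def R_def smooth_coord)
    then show ?thesis by (simp add: r_def)
  qed
  have GR: "smooth_fun UNIV R (\<lambda>p. G p q)" for q
  proof (cases q)
    case (Inl n)
    then show ?thesis using cR[OF \<psi>s[of n]] by (simp add: G_def Let_def)
  next
    case (Inr j)
    have "smooth_fun UNIV R (\<lambda>p. u j (\<psi> (\<lambda>n. p (Some n))) + p None * v j (\<psi> (\<lambda>n. p (Some n))))"
      by (intro smooth_add[OF finite oR] smooth_mult[OF finite oR] smooth_coord cR[OF u\<psi>] cR[OF v\<psi>])
    then show ?thesis by (simp add: G_def Inr Let_def)
  qed
  \<comment> \<open>The displaced point may leave the chart overlap, so the parameter is restricted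
    to the open set where it does not.\<close>
  define Q where "Q = {p \<in> R. G p \<in> overlap B K emb C C'}"
  have Gco: "G p \<in> coord_space (bidx K)" if p: "p \<in> R" for p
  proof -
    define y where "y = (\<lambda>n. p (Some n))"
    have y: "y \<in> U'" using p by (simp add: R_def y_def)
    have yN: "bpt C' y \<in> N" using nb'(2)[OF y] by blast
    have "u j (\<psi> y) = 0 \<and> v j (\<psi> y) = 0" if "j \<notin> K" for j
      using pt_coord[OF smooth_sectionD(2)[OF s yN] ar(1)[OF yN]] tangent_coord[OF V[OF yN] ar(1)[OF yN]] that
      by (simp add: u_def v_def b\<psi>[OF y] coord_space_def)
    then show ?thesis
      unfolding G_def Let_def y_def[symmetric] by (intro case_sum_coord_space) (simp add: coord_space_def)
  qed
  have oQ: "open_in UNIV Q"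
    unfolding Q_def by (rule open_in_preimage[OF oR GR overlap_open[OF C] Gco])
  have GQ: "smooth_fun UNIV Q (\<lambda>p. G p q)" for q by (rule smooth_subset[OF GR]) (auto simp: Q_def)
  have GO: "G p \<in> overlap B K emb C C'" if "p \<in> Q" for p using that by (simp add: Q_def)
  define H where "H = (\<lambda>p. tr C C' i (G p))"
  have Hs: "smooth_fun UNIV Q H"
    unfolding H_def by (rule smooth_compose[OF finite_bK overlap_open[OF C] tr_smooth[OF C] GO finite oQ GQ])
  have in0: "case_option 0 y \<in> Q" if "y \<in> U'" for y
    using JO[OF that] that by (simp add: Q_def R_def Gc)
  have pdH: "pd o' H p = (\<Sum>n\<in>UNIV. pd (Inl n) (tr C C' i) (G p) * pd o' (\<lambda>p. G p (Inl n)) p) +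
      (\<Sum>j\<in>K. pd (Inr j) (tr C C' i) (G p) * pd o' (\<lambda>p. G p (Inr j)) p)" if "p \<in> Q" for o' p
  proof -
    have "pd o' H p = (\<Sum>q\<in>bidx K. pd q (tr C C' i) (G p) * pd o' (\<lambda>p. G p q) p)"
      unfolding H_def
      by (rule smooth_pd_compose[OF finite_bK overlap_open[OF C] tr_smooth[OF C] GO finite oQ that UNIV_I GQ])
    then show ?thesis by (simp only: sum_bidx[OF finite_K])
  qed
  have dNone: "pd None H (case_option 0 y) = V (bpt C' y) C' i" if y: "y \<in> U'" for y
  proof -
    have a: "pd None (\<lambda>p. G p (Inl n)) (case_option 0 y) = 0" for n
      by (simp add: pd_def upd_None Gc)
    have b: "pd None (\<lambda>p. G p (Inr j)) (case_option 0 y) = v j (\<psi> y)" for j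
      unfolding pd_def upd_None Gc by (rule DERIV_imp_deriv) (auto intro!: derivative_eq_intros)
    show ?thesis unfolding pdH[OF in0[OF y]] a b VC'[OF y] by (simp add: Gc)
  qed
  have dSome: "pd (Some \<kappa>) H (case_option t y0) = (\<Sum>\<rho>\<in>UNIV. jac C' C x \<rho> \<kappa> *
      (pd (Inl \<rho>) (tr C C' i) (G (case_option t y0)) +
       (\<Sum>j\<in>K. pd (Inr j) (tr C C' i) (G (case_option t y0)) * (pd \<rho> (u j) (bcoord C x) + t * pd \<rho> (v j) (bcoord C x)))))"
    if t: "case_option t y0 \<in> Q" for t
  proof -
    have a: "pd (Some \<kappa>) (\<lambda>p. G p (Inl n)) (case_option t y0) = jac C' C x n \<kappa>" for n
      unfolding pd_Some Gc by (simp add: jac_def \<psi>_def y0_def)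
    have b: "pd (Some \<kappa>) (\<lambda>p. G p (Inr j)) (case_option t y0) =
        (\<Sum>\<rho>\<in>UNIV. (pd \<rho> (u j) (bcoord C x) + t * pd \<rho> (v j) (bcoord C x)) * jac C' C x \<rho> \<kappa>)" for j
    proof -
      have "pd (Some \<kappa>) (\<lambda>p. G p (Inr j)) (case_option t y0) = pd \<kappa> (\<lambda>y. u j (\<psi> y) + t * v j (\<psi> y)) y0"
        unfolding pd_Some Gc by simp
      also have "\<dots> = (\<Sum>\<rho>\<in>UNIV. pd \<rho> (\<lambda>y. u j y + t * v j y) (\<psi> y0) * pd \<kappa> (\<lambda>y. \<psi> y \<rho>) y0)"
        by (rule smooth_pd_compose[OF finite oU uvs \<psi>U finite oU' y0 UNIV_I \<psi>s])
      also have "\<dots> = (\<Sum>\<rho>\<in>UNIV. (pd \<rho> (u j) (bcoord C x) + t * pd \<rho> (v j) (bcoord C x)) * jac C' C x \<rho> \<kappa>)"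
      proof (rule sum.cong[OF refl])
        fix \<rho>
        have "pd \<rho> (\<lambda>y. u j y + t * v j y) (\<psi> y0) = pd \<rho> (u j) (\<psi> y0) + pd \<rho> (\<lambda>y. t * v j y) (\<psi> y0)"
          by (rule smooth_pd_add[OF us smooth_cmult[OF finite oU vs] \<psi>U[OF y0] UNIV_I])
        also have "pd \<rho> (\<lambda>y. t * v j y) (\<psi> y0) = t * pd \<rho> (v j) (\<psi> y0)"
          by (rule smooth_pd_cmult[OF vs \<psi>U[OF y0] UNIV_I])
        finally have e: "pd \<rho> (\<lambda>y. u j y + t * v j y) (\<psi> y0) = pd \<rho> (u j) (\<psi> y0) + t * pd \<rho> (v j) (\<psi> y0)" .
        show "pd \<rho> (\<lambda>y. u j y + t * v j y) (\<psi> y0) * pd \<kappa> (\<lambda>y. \<psi> y \<rho>) y0 =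
            (pd \<rho> (u j) (bcoord C x) + t * pd \<rho> (v j) (bcoord C x)) * jac C' C x \<rho> \<kappa>"
          unfolding e unfolding \<psi>0 unfolding jac_def \<psi>_def y0_def by (rule refl)
      qed
      finally show ?thesis .
    qed
    have "(\<Sum>j\<in>K. pd (Inr j) (tr C C' i) (G (case_option t y0)) *
        (\<Sum>\<rho>\<in>UNIV. (pd \<rho> (u j) (bcoord C x) + t * pd \<rho> (v j) (bcoord C x)) * jac C' C x \<rho> \<kappa>)) =
      (\<Sum>\<rho>\<in>UNIV. (\<Sum>j\<in>K. pd (Inr j) (tr C C' i) (G (case_option t y0)) *
        (pd \<rho> (u j) (bcoord C x) + t * pd \<rho> (v j) (bcoord C x))) * jac C' C x \<rho> \<kappa>)"
      by (rule sum_matrix_assoc[symmetric])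
    then show ?thesis
      unfolding pdH[OF t] a b by (simp add: distrib_left sum.distrib mult.commute)
  qed
  let ?z = "jet1 B s x"
  have z: "?z \<in> J1 B S" unfolding J1_def using s x by blast
  have fz: "fst ?z = fst (s x)" by (simp add: jet1_def)
  have arz: "around B C (fst ?z)" "around B C' (fst ?z)" using ar[OF x] by (simp_all add: fz)
  have pz: "proj B (fst ?z) = x" using sectionD(4)[OF smooth_sectionD(1)[OF s] x] by (simp add: fz)
  \<comment> \<open>A line in first-jet coordinates with velocity \<open>X\<close>. By
    \<open>X0\<close> and \<open>X1\<close> its points have, in \<open>C\<close>, the values and
    base derivatives of the displaced family at \<open>x\<close>.\<close>
  obtain \<gamma> \<epsilon> where g: "\<epsilon> > 0" "vertical_curve B (J1 B S) (proj B (fst ?z)) {-\<epsilon><..<\<epsilon>} \<gamma>" "\<gamma> 0 = ?z"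
    "\<And>t. t \<in> {-\<epsilon><..<\<epsilon>} \<Longrightarrow> fst (\<gamma> t) \<in> fdom C \<and> snd (\<gamma> t) C = (\<lambda>i. snd ?z C i + t * X C i)"
    "velocity B \<gamma> 0 C = X C"
    by (rule J1.tangent_curve[OF z arz(1) J1.tangent_coord[OF X arz(1)]]) blast
  have "velocity B \<gamma> 0 \<in> vertical_tangent B (J1 B S) ?z" unfolding vertical_tangent_def using g by blast
  then have Xg: "X = velocity B \<gamma> 0" using J1.tangent_eqI[OF X _ arz(1)] g(5) by simp
  have op: "open {t \<in> {-\<epsilon><..<\<epsilon>}. fst (\<gamma> t) \<in> fdom C'}" by (rule vertical_curve_open[OF g(2) C(2)])
  have t0: "0 \<in> {t \<in> {-\<epsilon><..<\<epsilon>}. fst (\<gamma> t) \<in> fdom C'}" using g arz by (simp add: around_def)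
  have "\<forall>\<^sub>F t in nhds 0. snd (\<gamma> t) C' (Inr (i, \<kappa>)) = pd (Some \<kappa>) H (case_option t y0)"
    using eventually_nhds_in_open[OF op t0]
  proof eventually_elim
    case (elim t)
    then have t: "t \<in> {-\<epsilon><..<\<epsilon>}" "fst (\<gamma> t) \<in> fdom C'" by auto
    note gt = g(4)[OF t(1)] and gi = vertical_curve_in[OF g(2) t(1)]
    have a: "around B C (fst (\<gamma> t))" "around B C' (fst (\<gamma> t))" using gt t C by (auto simp: around_def)
    have zl: "snd ?z C (Inl j) = u j (bcoord C x)" for j using arz by (simp add: jet1_def u_def bx)
    have jl: "jcoord B C (left (\<gamma> t)) = G (case_option t y0)"
      using gi gt zl X0' by (simp add: jcoord_left jcoord_def Gc \<psi>0 pz v_def bx fun_eq_iff split: sum.split)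
    have GO': "G (case_option t y0) \<in> overlap B K emb C C'"
      unfolding jl[symmetric] using left_J1 gi a by (intro jcoord_overlap) simp_all
    then have tQ: "case_option t y0 \<in> Q" using y0 by (simp add: Q_def R_def)
    have z1: "snd (\<gamma> t) C (Inr (j, \<rho>)) = pd \<rho> (u j) (bcoord C x) + t * pd \<rho> (v j) (bcoord C x)" if "j \<in> K" for j \<rho>
      using gt X1[OF that] arz by (simp add: jet1_def u_def v_def)
    have px: "proj B (fst (\<gamma> t)) = x" using gi pz by simp
    have "snd (\<gamma> t) C' (Inr (i, \<kappa>)) = (\<Sum>\<rho>\<in>UNIV. jac C' C x \<rho> \<kappa> *
      (pd (Inl \<rho>) (tr C C' i) (G (case_option t y0)) +
       (\<Sum>j\<in>K. pd (Inr j) (tr C C' i) (G (case_option t y0)) * snd (\<gamma> t) C (Inr (j, \<rho>)))))"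
      using J1_coord_eq[OF conjunct1[OF gi] a, of i \<kappa>] unfolding jl px .
    also have "\<dots> = pd (Some \<kappa>) H (case_option t y0)"
      unfolding dSome[OF tQ] using z1 by (intro sum.cong arg_cong2[where f = "(*)"] arg_cong2[where f = "(+)"] refl) simp
    finally show ?case .
  qed
  moreover have "((\<lambda>t. pd (Some \<kappa>) H (case_option t y0)) has_real_derivative pd None (pd (Some \<kappa>) H) (case_option 0 y0)) (at 0)"
  proof -
    have "((\<lambda>t. pd (Some \<kappa>) H ((case_option 0 y0)(None := t))) has_real_derivative
        pd None (pd (Some \<kappa>) H) (case_option 0 y0)) (at ((case_option 0 y0) None))"
      by (rule smooth_has_pd[OF smooth_pd[OF Hs UNIV_I] in0[OF y0] UNIV_I])
    then show ?thesis by (simp add: upd_None)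
  qed
  ultimately have "velocity B \<gamma> 0 C' (Inr (i, \<kappa>)) = pd None (pd (Some \<kappa>) H) (case_option 0 y0)"
    by (rule velocity_eqI) (use arz g(3) in simp)
  then have "X C' (Inr (i, \<kappa>)) = pd None (pd (Some \<kappa>) H) (case_option 0 y0)" by (simp add: Xg)
  \<comment> \<open>The commutation that proves the lemma: after it, the inner derivative is
    \<open>V\<close> in \<open>C'\<close> by \<open>dNone\<close>.\<close>
  also have "\<dots> = pd (Some \<kappa>) (pd None H) (case_option 0 y0)"
    by (rule pd_commute[OF finite oQ Hs in0[OF y0]]) simp_all
  also have "\<dots> = pd \<kappa> (\<lambda>y. pd None H (case_option 0 y)) y0" by (rule pd_Some)
  also have "\<dots> = pd \<kappa> (\<lambda>y. V (bpt C' y) C' i) y0" by (rule pd_cong[OF finite oU' y0 UNIV_I dNone])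
  finally show "X C' (Inr (i, \<kappa>)) = pd \<kappa> (\<lambda>y. V (bpt C' y) C' i) (bcoord C' x)" by (simp add: y0_def)
qed

end

text \<open>The inclusion of (k+1)-jets into first jets of k-jets, in the coordinates of one
  chart.\<close>

definition jlift :: "nat \<Rightarrow> (('n, 'm) jidx \<Rightarrow> real) \<Rightarrow> ('n, 'm) jidx + ('n, 'm) jidx \<times> 'n \<Rightarrow> real" where
  "jlift k u = case_sum (\<lambda>i. if size (fst i) \<le> k then u i else 0)
     (\<lambda>(i, \<rho>). if size (fst i) \<le> k then u (add_mset \<rho> (fst i), snd i) else 0)"

text \<open>Every slot copies one fixed coordinate or is constantly zero, so smoothness and
  differentiation pass through \<open>jlift\<close> trivially.\<close>

lemma jlift_coord: "(\<exists>i. \<forall>u. jlift k u q = u i) \<or> (\<forall>u. jlift k u q = 0)"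
proof (cases q)
  case (Inl i)
  have "(\<forall>u. jlift k u q = u i) \<or> (\<forall>u. jlift k u q = 0)" by (simp add: Inl jlift_def)
  then show ?thesis by blast
next
  case (Inr p)
  have "(\<forall>u. jlift k u q = u (add_mset (snd p) (fst (fst p)), snd (fst p))) \<or> (\<forall>u. jlift k u q = 0)"
    by (simp add: Inr jlift_def case_prod_unfold)
  then show ?thesis by blast
qed

context fibred begin

lemma jet1_jet_lift:
  assumes f: "local_section B N f" and x: "x \<in> N"
  shows "jet1 B (jet B k f) x = (f x, \<lambda>C. jlift k (snd (jet B (Suc k) f x) C))"
proof (rule prod_eqI)
  show "snd (jet1 B (jet B k f) x) = snd (f x, \<lambda>C. jlift k (snd (jet B (Suc k) f x) C))"
  proof (intro ext)
    fix C and q :: "('n, 'm) jidx + ('n, 'm) jidx \<times> 'n"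
    show "snd (jet1 B (jet B k f) x) C q = snd (f x, \<lambda>C. jlift k (snd (jet B (Suc k) f x) C)) C q"
    proof (cases "around B C (f x)")
      case True
      show ?thesis
      proof (cases q)
        case (Inl i)
        then show ?thesis using jet1_jet(1)[OF f x True, of k i] by (cases i) (simp add: jlift_def snd_jet)
      next
        case (Inr p)
        obtain I a \<rho> where p: "p = ((I, a), \<rho>)" by (cases p) auto
        show ?thesis using jet1_jet(2)[OF f x True, of k I a \<rho>] by (simp add: jlift_def Inr p)
      qed
    next
      case False
      then show ?thesis by (cases q) (auto simp: jet1_def jlift_def snd_jet split: prod.split)
    qed
  qed
qed (simp add: jet1_def)

text \<open>The inclusion of jets acts linearly on coordinates, so it sends curves to curves and
  acts on velocities by the same formula.\<close>

lemma jet_tangent_lift: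
  assumes f: "local_section B N f" and x: "x \<in> N"
    and v: "v \<in> vertical_tangent B (Jet B (Suc k)) (jet B (Suc k) f x)"
  shows "(\<lambda>C. jlift k (v C)) \<in> vertical_tangent B (J1 B (Jet B k)) (jet1 B (jet B k f) x)"
proof -
  let ?z = "jet B (Suc k) f x"
  obtain \<gamma> \<epsilon> where g: "v = velocity B \<gamma> 0" "\<epsilon> > 0" "vertical_curve B (Jet B (Suc k)) (proj B (fst ?z)) {-\<epsilon><..<\<epsilon>} \<gamma>" "\<gamma> 0 = ?z"
    using v by (auto simp: vertical_tangent_def)
  define \<delta> where "\<delta> = (\<lambda>t. (fst (\<gamma> t), \<lambda>C. jlift k (snd (\<gamma> t) C)))"
  have "vertical_curve B (J1 B (Jet B k)) (proj B (fst ?z)) {-\<epsilon><..<\<epsilon>} \<delta>"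
    unfolding vertical_curve_def
  proof (intro conjI ballI allI impI)
    fix t assume t: "t \<in> {-\<epsilon><..<\<epsilon>}"
    have gt: "\<gamma> t \<in> Jet B (Suc k)" "proj B (fst (\<gamma> t)) = proj B (fst ?z)" using vertical_curve_in[OF g(3) t] by auto
    obtain h N' y where h: "\<gamma> t = jet B (Suc k) h y" "local_section B N' h" "y \<in> N'" by (rule Jet_cases[OF gt(1)])
    have "\<delta> t = jet1 B (jet B k h) y" by (simp add: jet1_jet_lift[OF h(2,3)] \<delta>_def h(1))
    moreover have "jet1 B (jet B k h) y \<in> J1 B (Jet B k)"
      unfolding J1_def using jet_smooth_section[OF h(2)] h(3) by blast
    ultimately have "\<delta> t \<in> J1 B (Jet B k)" by (simp only:)
    moreover have "fst (\<delta> t) = fst (\<gamma> t)" by (simp add: \<delta>_def)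
    ultimately show "\<delta> t \<in> fibre B (J1 B (Jet B k)) (proj B (fst ?z))"
      using gt(2) by (simp add: fibre_def)
  next
    fix C assume C: "adapted B C"
    show "open {t \<in> {-\<epsilon><..<\<epsilon>}. fst (\<delta> t) \<in> fdom C}" using vertical_curve_open[OF g(3) C] by (simp add: \<delta>_def)
    fix q
    have sm: "smooth_real {t \<in> {-\<epsilon><..<\<epsilon>}. fst (\<gamma> t) \<in> fdom C} (\<lambda>t. snd (\<gamma> t) C i)" for i
      using g(3) C unfolding vertical_curve_def by blast
    show "smooth_real {t \<in> {-\<epsilon><..<\<epsilon>}. fst (\<delta> t) \<in> fdom C} (\<lambda>t. snd (\<delta> t) C q)"
      using jlift_coord[of k q]
    proof (elim disjE exE)
      fix i assume i: "\<forall>u. jlift k u q = u i"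
      show ?thesis unfolding \<delta>_def fst_conv snd_conv i[rule_format] by (rule sm)
    next
      assume 0: "\<forall>u. jlift k u q = 0"
      show ?thesis unfolding \<delta>_def fst_conv snd_conv 0[rule_format] by (rule smooth_real_zero)
    qed
  qed
  moreover have "(\<lambda>C. jlift k (v C)) = velocity B \<delta> 0"
  proof (intro ext)
    fix C and q :: "('n, 'm) jidx + ('n, 'm) jidx \<times> 'n"
    show "jlift k (v C) q = velocity B \<delta> 0 C q"
      by (cases q) (auto simp: g(1) velocity_def \<delta>_def jlift_def split: prod.split)
  qed
  moreover have "\<delta> 0 = jet1 B (jet B k f) x" by (simp add: jet1_jet_lift[OF f x] \<delta>_def g(4))
  moreover have "fst (jet1 B (jet B k f) x) = fst ?z" by (simp add: jet1_def)
  ultimately show ?thesis using g(2) unfolding vertical_tangent_def by force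
qed

end

section \<open>Currents\<close>

text \<open>The body of \<open>current\<close> as a linear function of the coordinates in one chart,
  so that it can be applied to tangent vectors as well as to points.\<close>

definition cur :: "nat \<Rightarrow> (('n::finite, 'm) p1idx \<Rightarrow> real) \<Rightarrow> ('n, 'm) jidx \<Rightarrow> real" where
  "cur k y = (\<lambda>(I, a). if size I \<le> k then
     (if size I \<ge> 1 then symmetrised (\<lambda>i. y (Inl (Inr i))) (I, a) else 0) +
     (if size I < k then \<Sum>\<rho>\<in>UNIV. y (Inr (Inr (I, \<rho>, a), \<rho>)) else 0)
     else 0)"

lemma current_cur: "current k w C = cur k (snd w C)"
  by (simp add: current_def cur_def)

lemma cur_outside: "size I > k \<Longrightarrow> cur k y (I, a) = 0"
  by (simp add: cur_def)

lemma cur_coord_space: "cur k y \<in> coord_space (jidx k)"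
  by (auto simp: coord_space_def cur_outside)

lemma smooth_cur:
  assumes "finite K" "open_in K U"
  shows "smooth_fun K U (\<lambda>y. cur k y i)"
proof -
  obtain I a where i: "i = (I, a)" by (cases i)
  show ?thesis
    unfolding i cur_def symmetrised_def prod.case
    by (intro smooth_if smooth_add[OF assms] smooth_divide[OF assms] smooth_sum[OF assms] smooth_coord smooth_const)
qed

lemma cur_DERIV:
  assumes "\<And>q. ((\<lambda>t. y t q) has_real_derivative y' q) (at t)"
  shows "((\<lambda>t. cur k (y t) i) has_real_derivative cur k y' i) (at t)"
proof -
  obtain I a where i: "i = (I, a)" by (cases i)
  have 1: "((\<lambda>t. symmetrised (\<lambda>i. y t (Inl (Inr i))) (I, a)) has_real_derivative
      symmetrised (\<lambda>i. y' (Inl (Inr i))) (I, a)) (at t)"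
    unfolding symmetrised_def prod.case by (intro DERIV_cdivide DERIV_sum assms)
  have 2: "((\<lambda>t. \<Sum>\<rho>\<in>UNIV. y t (Inr (Inr (I, \<rho>, a), \<rho>))) has_real_derivative
      (\<Sum>\<rho>\<in>UNIV. y' (Inr (Inr (I, \<rho>, a), \<rho>)))) (at t)"
    by (intro DERIV_sum assms)
  show ?thesis
    unfolding i cur_def prod.case using 1 2
    by (auto intro: DERIV_add[OF 1 2] DERIV_add[OF 1 DERIV_const[of 0]] simp: add.commute)
qed

text \<open>Within each class of lists with the same multiset the second factor is constant, so
  averaging the first factor over the class leaves the sum unchanged.\<close>

lemma sum_symmetrised:
  fixes p :: "'n::finite multiset \<times> 'n \<times> 'm \<Rightarrow> real"
  shows "(\<Sum>\<mu>s | length \<mu>s = l. symmetrised p (mset \<mu>s, a) * g (mset \<mu>s)) =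
    (\<Sum>\<mu>s | length \<mu>s = l. p (mset (butlast \<mu>s), last \<mu>s, a) * g (mset \<mu>s))"
proof -
  have "(\<Sum>\<mu>s | length \<mu>s = l. symmetrised p (mset \<mu>s, a) * g (mset \<mu>s)) =
      (\<Sum>I | size I = l. orderings I * (symmetrised p (I, a) * g I))"
    by (rule sum_lists_mset)
  also have "\<dots> = (\<Sum>I | size I = l. \<Sum>\<mu>s\<in>permutations_of_multiset I. p (mset (butlast \<mu>s), last \<mu>s, a) * g I)"
  proof (rule sum.cong[OF refl])
    fix I :: "'n multiset"
    show "orderings I * (symmetrised p (I, a) * g I) =
        (\<Sum>\<mu>s\<in>permutations_of_multiset I. p (mset (butlast \<mu>s), last \<mu>s, a) * g I)"
      using orderings_pos[of I] by (simp add: symmetrised_def sum_distrib_right)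
  qed
  also have "\<dots> = (\<Sum>I\<in>mset ` {\<mu>s. length \<mu>s = l}. \<Sum>\<mu>s\<in>{\<mu>s \<in> {\<mu>s. length \<mu>s = l}. mset \<mu>s = I}.
      p (mset (butlast \<mu>s), last \<mu>s, a) * g (mset \<mu>s))"
    unfolding mset_lists
  proof (rule sum.cong[OF refl])
    fix I :: "'n multiset" assume "I \<in> {I. size I = l}"
    then have "{\<mu>s \<in> {\<mu>s. length \<mu>s = l}. mset \<mu>s = I} = permutations_of_multiset I"
      by (auto simp: permutations_of_multiset_def)
    then show "(\<Sum>\<mu>s\<in>permutations_of_multiset I. p (mset (butlast \<mu>s), last \<mu>s, a) * g I) =
      (\<Sum>\<mu>s\<in>{\<mu>s \<in> {\<mu>s. length \<mu>s = l}. mset \<mu>s = I}. p (mset (butlast \<mu>s), last \<mu>s, a) * g (mset \<mu>s))"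
      by (simp add: permutations_of_multiset_def)
  qed
  also have "\<dots> = (\<Sum>\<mu>s | length \<mu>s = l. p (mset (butlast \<mu>s), last \<mu>s, a) * g (mset \<mu>s))"
    by (rule sum.image_gen[OF finite_lists_length, symmetric])
  finally show ?thesis .
qed

lemma sum_lists_snoc:
  fixes F :: "'n::finite list \<Rightarrow> real"
  shows "(\<Sum>\<mu>s | length \<mu>s = Suc l. F \<mu>s) = (\<Sum>\<mu>s | length \<mu>s = l. \<Sum>\<rho>\<in>UNIV. F (\<mu>s @ [\<rho>]))"
proof -
  have im: "(\<lambda>(\<mu>s, \<rho>). \<mu>s @ [\<rho>]) ` ({\<mu>s :: 'n list. length \<mu>s = l} \<times> UNIV) = {\<mu>s. length \<mu>s = Suc l}"
  proof (intro equalityI subsetI)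
    fix \<mu>s :: "'n list" assume "\<mu>s \<in> {\<mu>s. length \<mu>s = Suc l}"
    then have "\<mu>s \<noteq> []" "length (butlast \<mu>s) = l" by auto
    then have "\<mu>s = butlast \<mu>s @ [last \<mu>s]" "length (butlast \<mu>s) = l" by simp_all
    then show "\<mu>s \<in> (\<lambda>(\<mu>s, \<rho>). \<mu>s @ [\<rho>]) ` ({\<mu>s. length \<mu>s = l} \<times> UNIV)"
      by (intro image_eqI[of _ _ "(butlast \<mu>s, last \<mu>s)"]) auto
  qed auto
  have inj: "inj_on (\<lambda>(\<mu>s, \<rho>). \<mu>s @ [\<rho>]) ({\<mu>s :: 'n list. length \<mu>s = l} \<times> UNIV)"
    by (auto simp: inj_on_def)
  show ?thesis
    unfolding im[symmetric] sum.reindex[OF inj] by (simp add: sum.cartesian_product case_prod_unfold)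
qed

text \<open>The right-hand side is what the product rule gives for the divergence of momenta paired
  with a field whose jet is \<open>v\<close>. The symmetrised part is shifted from order
  \<open>l + 1\<close> to order \<open>l\<close>: the last entry of each list becomes the divergence
  index \<open>\<rho>\<close>.\<close>

lemma contract_cur:
  fixes v :: "('n::finite, 'm::finite) jidx \<Rightarrow> real"
  shows "contract k (cur k y) v = (\<Sum>l<k. \<Sum>\<mu>s | length \<mu>s = l. \<Sum>a\<in>UNIV. \<Sum>\<rho>\<in>UNIV.
     y (Inr (Inr (mset \<mu>s, \<rho>, a), \<rho>)) * v (mset \<mu>s, a) +
     y (Inl (Inr (mset \<mu>s, \<rho>, a))) * v (add_mset \<rho> (mset \<mu>s), a))"
proof -
  let ?p = "\<lambda>i. y (Inl (Inr i))"
  define S where "S = (\<lambda>l. \<Sum>\<mu>s | length \<mu>s = l. \<Sum>a\<in>UNIV.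
     (if l \<ge> 1 then symmetrised ?p (mset \<mu>s, a) else 0) * v (mset \<mu>s, a))"
  define D where "D = (\<lambda>l. \<Sum>\<mu>s | length \<mu>s = l. \<Sum>a\<in>UNIV.
     (if l < k then \<Sum>\<rho>\<in>UNIV. y (Inr (Inr (mset \<mu>s, \<rho>, a), \<rho>)) else 0) * v (mset \<mu>s, a))"
  have "contract k (cur k y) v = (\<Sum>l\<le>k. S l + D l)"
    unfolding contract_def S_def D_def sum.distrib[symmetric]
    by (intro sum.cong refl) (auto simp: cur_def distrib_right)
  also have "\<dots> = (\<Sum>l\<le>k. S l) + (\<Sum>l\<le>k. D l)" by (rule sum.distrib)
  also have "(\<Sum>l\<le>k. D l) = (\<Sum>l<k. D l)"
    by (rule sum.mono_neutral_right) (auto simp: D_def)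
  also have "(\<Sum>l\<le>k. S l) = (\<Sum>l<k. S (Suc l))"
    by (subst sum.atMost_shift) (simp add: S_def)
  also have "(\<Sum>l<k. S (Suc l)) + (\<Sum>l<k. D l) = (\<Sum>l<k. D l + S (Suc l))"
    by (simp add: sum.distrib)
  also have "\<dots> = (\<Sum>l<k. \<Sum>\<mu>s | length \<mu>s = l. \<Sum>a\<in>UNIV. \<Sum>\<rho>\<in>UNIV.
     y (Inr (Inr (mset \<mu>s, \<rho>, a), \<rho>)) * v (mset \<mu>s, a) +
     y (Inl (Inr (mset \<mu>s, \<rho>, a))) * v (add_mset \<rho> (mset \<mu>s), a))"
  proof (rule sum.cong[OF refl])
    fix l assume l: "l \<in> {..<k}"
    have "S (Suc l) = (\<Sum>a\<in>UNIV. \<Sum>\<mu>s | length \<mu>s = Suc l. symmetrised ?p (mset \<mu>s, a) * v (mset \<mu>s, a))"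
      unfolding S_def by (subst sum.swap) simp
    also have "\<dots> = (\<Sum>a\<in>UNIV. \<Sum>\<mu>s | length \<mu>s = l. \<Sum>\<rho>\<in>UNIV. ?p (mset \<mu>s, \<rho>, a) * v (add_mset \<rho> (mset \<mu>s), a))"
    proof (rule sum.cong[OF refl])
      fix a
      show "(\<Sum>\<mu>s | length \<mu>s = Suc l. symmetrised ?p (mset \<mu>s, a) * v (mset \<mu>s, a)) =
          (\<Sum>\<mu>s | length \<mu>s = l. \<Sum>\<rho>\<in>UNIV. ?p (mset \<mu>s, \<rho>, a) * v (add_mset \<rho> (mset \<mu>s), a))"
        unfolding sum_symmetrised[where g = "\<lambda>I. v (I, a)"] sum_lists_snoc by simp
    qed
    also have "\<dots> = (\<Sum>\<mu>s | length \<mu>s = l. \<Sum>a\<in>UNIV. \<Sum>\<rho>\<in>UNIV. ?p (mset \<mu>s, \<rho>, a) * v (add_mset \<rho> (mset \<mu>s), a))"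
      by (rule sum.swap)
    finally have S: "S (Suc l) = \<dots>" .
    have D: "D l = (\<Sum>\<mu>s | length \<mu>s = l. \<Sum>a\<in>UNIV. \<Sum>\<rho>\<in>UNIV. y (Inr (Inr (mset \<mu>s, \<rho>, a), \<rho>)) * v (mset \<mu>s, a))"
      using l by (simp add: D_def sum_distrib_right)
    show "D l + S (Suc l) = (\<Sum>\<mu>s | length \<mu>s = l. \<Sum>a\<in>UNIV. \<Sum>\<rho>\<in>UNIV.
     y (Inr (Inr (mset \<mu>s, \<rho>, a), \<rho>)) * v (mset \<mu>s, a) +
     y (Inl (Inr (mset \<mu>s, \<rho>, a))) * v (add_mset \<rho> (mset \<mu>s), a))"
      unfolding S D by (simp add: sum.distrib)
  qed
  finally show ?thesis .
qed

lemma sum_jidx: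
  fixes h :: "('n::finite, 'm::finite) jidx \<Rightarrow> real"
  assumes "k \<ge> 1"
  shows "(\<Sum>i\<in>jidx (k - 1). orderings (fst i) * h i) = (\<Sum>l<k. \<Sum>\<mu>s | length \<mu>s = l. \<Sum>a\<in>UNIV. h (mset \<mu>s, a))"
proof -
  have "{..<k} = {..k - 1}" using assms by auto
  then show ?thesis using contract_eq[of "k - 1" h "\<lambda>_. 1"] by (simp add: contract_def)
qed

section \<open>Holonomic first jets of the phase bundle\<close>

definition pj :: "(('n, 'm) p1idx \<Rightarrow> real) \<Rightarrow> ('n, 'm) jidx + ('n, 'm) jidx \<times> 'n \<Rightarrow> real" where
  "pj y = case_sum (\<lambda>i. y (Inl (Inl i))) (\<lambda>(i, \<rho>). y (Inr (Inl i, \<rho>)))"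

lemma snd_projJ1: "snd (projJ1 w) C = pj (snd w C)" and fst_projJ1 [simp]: "fst (projJ1 w) = fst w"
  by (simp_all add: projJ1_def pj_def)

text \<open>The coordinates \<open>y\<close> of a first jet of the phase bundle lie over the k-jet
  with coordinates \<open>u\<close>. The condition is linear, so straight lines respect it.\<close>

definition hol :: "nat \<Rightarrow> (('n, 'm) jidx \<Rightarrow> real) \<Rightarrow> (('n, 'm) p1idx \<Rightarrow> real) \<Rightarrow> bool" where
  "hol k u y \<longleftrightarrow> u \<in> coord_space (jidx k) \<and> pj y = jlift (k - 1) u"

lemma jlift_linear: "jlift k (\<lambda>i. u i + t * v i) = (\<lambda>q. jlift k u q + t * jlift k v q)"
  by (auto simp: jlift_def fun_eq_iff split: sum.split)

lemma pj_linear: "pj (\<lambda>i. y i + t * w i) = (\<lambda>q. pj y q + t * pj w q)"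
  by (auto simp: pj_def fun_eq_iff split: sum.split)

lemma hol_line:
  assumes "hol k u y" "hol k v w"
  shows "hol k (\<lambda>i. u i + t * v i) (\<lambda>i. y i + t * w i)"
  using assms by (auto simp: hol_def pj_linear jlift_linear coord_space_def)

text \<open>Lower orders are copied unchanged, and since \<open>k\<close> is positive a multi-index
  of order \<open>k\<close> arises from one of order \<open>k - 1\<close> by adding an index, so its
  coordinate occurs in a derivative slot.\<close>

lemma jlift_inj:
  fixes u v :: "('n, 'm) jidx \<Rightarrow> real"
  assumes u: "u \<in> coord_space (jidx k)" "v \<in> coord_space (jidx k)" and e: "jlift (k - 1) u = jlift (k - 1) v" and k: "k \<ge> 1"
  shows "u = v"
proof
  fix i :: "('n, 'm) jidx"
  obtain I a where i: "i = (I, a)" by (cases i)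
  consider "size I \<le> k - 1" | "size I = k" | "size I > k" by linarith
  then show "u i = v i"
  proof cases
    case 1
    then show ?thesis using fun_cong[OF e, of "Inl i"] i by (simp add: jlift_def)
  next
    case 2
    then obtain \<rho> I' where I: "I = add_mset \<rho> I'" using k by (metis multiset_cases not_one_le_zero size_empty)
    then have "size I' \<le> k - 1" using 2 by simp
    then show ?thesis using fun_cong[OF e, of "Inr ((I', a), \<rho>)"] i I by (simp add: jlift_def)
  next
    case 3
    then show ?thesis using u i by (simp add: coord_space_def)
  qed
qed

text \<open>Assembles holonomic coordinates from a k-jet \<open>u\<close>, momenta \<open>p\<close>
  and derivatives \<open>q\<close> of the momenta, which may all be chosen independently.\<close>

definition mkw :: "nat \<Rightarrow> (('n, 'm) jidx \<Rightarrow> real) \<Rightarrow> ('n multiset \<times> 'n \<times> 'm \<Rightarrow> real)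
    \<Rightarrow> (('n multiset \<times> 'n \<times> 'm) \<times> 'n \<Rightarrow> real) \<Rightarrow> ('n, 'm) p1idx \<Rightarrow> real" where
  "mkw k u p q = case_sum (case_sum (\<lambda>i. jlift (k - 1) u (Inl i)) p)
     (\<lambda>(r, \<rho>). case r of Inl i \<Rightarrow> jlift (k - 1) u (Inr (i, \<rho>)) | Inr i \<Rightarrow> q (i, \<rho>))"

lemma pj_mkw: "pj (mkw k u p q) = jlift (k - 1) u"
  by (auto simp: pj_def mkw_def fun_eq_iff split: sum.split)

lemma mkw_simps [simp]: "mkw k u p q (Inl (Inr i)) = p i" "mkw k u p q (Inr (Inr i, \<rho>)) = q (i, \<rho>)"
  "mkw k u p q (Inl (Inl j)) = jlift (k - 1) u (Inl j)" "mkw k u p q (Inr (Inl j, \<rho>)) = jlift (k - 1) u (Inr (j, \<rho>))"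
  by (simp_all add: mkw_def)

lemma p1idx_cases:
  fixes r :: "('n, 'm) p1idx"
  obtains i where "r = Inl (Inl i)" | i where "r = Inl (Inr i)"
    | i \<rho> where "r = Inr (Inl i, \<rho>)" | i \<rho> where "r = Inr (Inr i, \<rho>)"
proof (cases r)
  case (Inl s)
  then show ?thesis using that(1,2) by (cases s) auto
next
  case (Inr t)
  then show ?thesis using that(3,4) by (cases t; cases "fst t") auto
qed

lemma mkw_coord_space:
  fixes p :: "'n multiset \<times> 'n \<times> 'm \<Rightarrow> real" and q :: "('n multiset \<times> 'n \<times> 'm) \<times> 'n \<Rightarrow> real"
  assumes "\<And>I \<rho> a. size I \<ge> k \<Longrightarrow> p (I, \<rho>, a) = 0" "\<And>I \<rho> a \<kappa>. size I \<ge> k \<Longrightarrow> q ((I, \<rho>, a), \<kappa>) = 0"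
  shows "mkw k u p q \<in> coord_space (pidx k <+> pidx k \<times> UNIV)"
  unfolding coord_space_def
proof (intro CollectI allI impI)
  fix r :: "('n, 'm) p1idx"
  assume r: "r \<notin> pidx k <+> pidx k \<times> UNIV"
  show "mkw k u p q r = 0"
  proof (cases r rule: p1idx_cases)
    case (1 i)
    then show ?thesis using r by (cases i) (auto simp: jlift_def)
  next
    case (2 i)
    obtain I \<rho> a where i: "i = (I, \<rho>, a)" by (cases i) auto
    have "size I \<ge> k" using r 2 i by (auto simp: not_less)
    then show ?thesis using assms(1) 2 i by simp
  next
    case (3 i \<rho>)
    then show ?thesis using r by (cases i) (auto simp: jlift_def)
  next
    case (4 i \<rho>)
    obtain I \<sigma> a where i: "i = (I, \<sigma>, a)" by (cases i) auto
    have "size I \<ge> k" using r 4 i by (auto simp: not_less)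
    then show ?thesis using assms(2) 4 i by simp
  qed
qed

lemma (in fibred) jet1_cong:
  assumes s: "smooth_section B S N s" and x: "x \<in> N" and e: "\<And>y. y \<in> N \<Longrightarrow> s y = s' y"
  shows "jet1 B s x = jet1 B s' x"
proof -
  have "pd \<rho> (\<lambda>y. snd (s (bpt C y)) C i) (bcoord C x) = pd \<rho> (\<lambda>y. snd (s' (bpt C y)) C i) (bcoord C x)"
    if C: "around B C (fst (s x))" for C i \<rho>
  proof (rule pd_cong[OF finite _ _ UNIV_I])
    let ?U = "bcoord C ` {y \<in> N. (fst \<circ> s) y \<in> fdom C}"
    have Ca: "adapted B C" using C by (simp add: around_def)
    show "open_in UNIV ?U" using section_chart(1)[OF smooth_sectionD(1)[OF s] Ca] by simp
    show "bcoord C x \<in> ?U" using x C by (simp add: around_def)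
    fix y assume "y \<in> ?U"
    then have "bpt C y \<in> N" using section_coord(1)[OF smooth_sectionD(1)[OF s] Ca] by blast
    then show "snd (s (bpt C y)) C i = snd (s' (bpt C y)) C i" using e by simp
  qed
  then show ?thesis using e[OF x] by (auto simp: jet1_def fun_eq_iff split: sum.split)
qed

text \<open>The interpretations below are \<open>J\<close> for k-jets, \<open>J'\<close> for the
  (k-1)-jets over which momenta live, \<open>JJ\<close> for first jets of the latter,
  \<open>Q\<close> for the phase bundle and \<open>Q1\<close> for its first jets.\<close>

locale phase = fibred B
  for B :: "('x, 'e, 'n::finite, 'm::finite) fbundle" +
  fixes k :: nat
  assumes k: "k \<ge> 1"
begin

sublocale J: coord_bundle B "Jet B k" "jidx k" "\<lambda>a. ({#}, a)" by (rule Jet_coord_bundle)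
sublocale J': coord_bundle B "Jet B (k - 1)" "jidx (k - 1)" "\<lambda>a. ({#}, a)" by (rule Jet_coord_bundle)
sublocale JJ: coord_bundle B "J1 B (Jet B (k - 1))" "jidx (k - 1) <+> jidx (k - 1) \<times> UNIV" "\<lambda>a. Inl ({#}, a)"
  by (rule J'.J1_coord_bundle)
sublocale Q: coord_bundle B "Phase B k" "pidx k" "\<lambda>a. Inl ({#}, a)" by (rule Phase_coord_bundle[OF k])
sublocale Q1: coord_bundle B "J1 B (Phase B k)" "pidx k <+> pidx k \<times> UNIV" "\<lambda>a. Inl (Inl ({#}, a))"
  by (rule Q.J1_coord_bundle)

lemma Suc_k: "Suc (k - 1) = k"
  using k by simp

lemma J1Phase_J1: "J1Phase B k = J1 B (Phase B k)"
  by (simp add: J1Phase_def J1_def)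

lemma left_section:
  assumes s: "smooth_section B (Phase B k) N \<sigma>"
  shows "smooth_section B (Jet B (k - 1)) N (\<lambda>x. left (\<sigma> x))" "projJ1 (jet1 B \<sigma> x) = jet1 B (\<lambda>x. left (\<sigma> x)) x"
proof -
  have f: "fst \<circ> (\<lambda>x. left (\<sigma> x)) = fst \<circ> \<sigma>" by (simp add: fun_eq_iff)
  show "smooth_section B (Jet B (k - 1)) N (\<lambda>x. left (\<sigma> x))"
    unfolding smooth_section_def f
  proof (intro conjI ballI allI impI)
    show "local_section B N (fst \<circ> \<sigma>)" by (rule smooth_sectionD(1)[OF s])
    show "left (\<sigma> x) \<in> Jet B (k - 1)" if "x \<in> N" for x
      by (rule PhaseD(1)[OF smooth_sectionD(2)[OF s that]])
    show "smooth_fun UNIV (bcoord C ` {x \<in> N. fst (left (\<sigma> x)) \<in> fdom C}) (\<lambda>y. snd (left (\<sigma> (bpt C y))) C i)"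
      if "adapted B C" for C i
      unfolding left_left by (rule smooth_sectionD(3)[OF s that])
  qed
  show "projJ1 (jet1 B \<sigma> x) = jet1 B (\<lambda>x. left (\<sigma> x)) x"
    by (auto simp: projJ1_def jet1_def fun_eq_iff split: sum.split)
qed

lemma projJ1_J1:
  assumes "w \<in> J1 B (Phase B k)"
  shows "projJ1 w \<in> J1 B (Jet B (k - 1))"
proof -
  obtain \<sigma> x N where s: "w = jet1 B \<sigma> x" "smooth_section B (Phase B k) N \<sigma>" "x \<in> N" using assms by (auto simp: J1_def)
  show ?thesis unfolding s(1) left_section(2)[OF s(2)] J1_def using left_section(1)[OF s(2)] s(3) by blast
qed

lemma jet1_lift:
  assumes "local_section B N f" "x \<in> N"
  shows "jet1 B (jet B (k - 1) f) x = (f x, \<lambda>C. jlift (k - 1) (snd (jet B k f x) C))"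
  using jet1_jet_lift[OF assms, of "k - 1"] unfolding Suc_k .

text \<open>Trades the existence of a common section for a coordinate condition in every
  chart.\<close>

lemma holonomic_iff:
  "holonomic B k z w \<longleftrightarrow> z \<in> Jet B k \<and> w = (fst z, \<lambda>C. jlift (k - 1) (snd z C))"
proof
  assume "holonomic B k z w"
  then obtain f N x where f: "local_section B N f" "x \<in> N" "z = jet B k f x" "w = jet1 B (jet B (k - 1) f) x"
    by (auto simp: holonomic_def)
  then show "z \<in> Jet B k \<and> w = (fst z, \<lambda>C. jlift (k - 1) (snd z C))"
    unfolding f(3,4) jet1_lift[OF f(1,2)] by (auto simp: Jet_def)
next
  assume z: "z \<in> Jet B k \<and> w = (fst z, \<lambda>C. jlift (k - 1) (snd z C))"
  then obtain f N x where f: "z = jet B k f x" "local_section B N f" "x \<in> N" using Jet_cases by metis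
  then show "holonomic B k z w"
  proof -
    have "w = jet1 B (jet B (k - 1) f) x" using z unfolding jet1_lift[OF f(2,3)] f(1) fst_jet by blast
    then show ?thesis unfolding holonomic_def using f by blast
  qed
qed

lemma holonomic_unique:
  assumes "holonomic B k z w" "holonomic B k z' w"
  shows "z = z'"
proof -
  have z: "z \<in> Jet B k" "z' \<in> Jet B k" "fst z = fst z'" and e: "\<And>C. jlift (k - 1) (snd z C) = jlift (k - 1) (snd z' C)"
    using assms by (auto simp: holonomic_iff fun_eq_iff)
  obtain C where C: "around B C (fst z)" using chart_ex[OF J.pt_tspace[OF z(1)]] by blast
  show ?thesis
    using J.pt_eqI[OF z C] jlift_inj[OF _ _ e k] J.pt_coord[OF z(1) C] J.pt_coord[OF z(2), of C] C z(3) by simp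
qed

lemma kjet_eq: "holonomic B k z (projJ1 w) \<Longrightarrow> kjet B k w = z"
  unfolding kjet_def using holonomic_unique by (intro the_equality) auto

lemma HolPhaseD:
  assumes "w \<in> HolPhase B k"
  shows "w \<in> J1 B (Phase B k)" "kjet B k w \<in> Jet B k" "fst (kjet B k w) = fst w"
    "pj (snd w C) = jlift (k - 1) (snd (kjet B k w) C)"
    "around B C (fst w) \<Longrightarrow> hol k (snd (kjet B k w) C) (snd w C)" "fst w \<in> tspace B"
proof -
  obtain z where z: "holonomic B k z (projJ1 w)" and w: "w \<in> J1 B (Phase B k)"
    using assms by (auto simp: HolPhase_def J1Phase_J1)
  have kz: "kjet B k w = z" by (rule kjet_eq[OF z])
  show "w \<in> J1 B (Phase B k)" by (rule w)
  have zi: "z \<in> Jet B k" "projJ1 w = (fst z, \<lambda>C. jlift (k - 1) (snd z C))" using z by (auto simp: holonomic_iff)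
  show zJ: "kjet B k w \<in> Jet B k" using zi by (simp add: kz)
  show fz: "fst (kjet B k w) = fst w" using arg_cong[OF zi(2), of fst] by (simp add: kz)
  show p: "pj (snd w C) = jlift (k - 1) (snd (kjet B k w) C)" for C
    using arg_cong[OF zi(2), of "\<lambda>z. snd z C"] by (simp add: kz snd_projJ1)
  show "hol k (snd (kjet B k w) C) (snd w C)" if "around B C (fst w)"
    using p J.pt_coord[OF zJ, of C] fz that by (simp add: hol_def)
  show "fst w \<in> tspace B" by (rule Q1.pt_tspace[OF w])
qed

text \<open>Holonomy can be tested in a single chart: the lift of the k-jet with coordinates
  \<open>u\<close> and the projection of \<open>w\<close> are first jets with the same coordinates
  in \<open>C\<close>, so they coincide.\<close>

lemma HolPhase_intro:
  assumes w: "w \<in> J1 B (Phase B k)" and C: "around B C (fst w)" and h: "hol k u (snd w C)"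
  shows "w \<in> HolPhase B k" "snd (kjet B k w) C = u"
proof -
  have u: "u \<in> coord_space (jidx k)" "pj (snd w C) = jlift (k - 1) u" using h by (auto simp: hol_def)
  have "u ({#}, a) = fcoord C (fst w) a" for a
    using fun_cong[OF u(2), of "Inl ({#}, a)"] Q1.pt_emb[OF w C, of a] by (simp add: pj_def jlift_def)
  then obtain z where z: "z \<in> Jet B k" "fst z = fst w" "snd z C = u" using J.pt_ex[OF C u(1)] by blast
  obtain f N x where f: "z = jet B k f x" "local_section B N f" "x \<in> N" by (rule Jet_cases[OF z(1)])
  define w0 where "w0 = jet1 B (jet B (k - 1) f) x"
  have hz: "holonomic B k z w0" unfolding holonomic_def w0_def using f by blast
  have w0e: "w0 = (fst z, \<lambda>C. jlift (k - 1) (snd z C))" using hz by (simp add: holonomic_iff)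
  have w0: "w0 \<in> J1 B (Jet B (k - 1))" unfolding w0_def J1_def using jet_smooth_section[OF f(2)] f(3) by blast
  have "projJ1 w = w0"
    by (rule JJ.pt_eqI[OF projJ1_J1[OF w] w0, of C]) (use z C u in \<open>simp_all add: w0e snd_projJ1\<close>)
  then have hw: "holonomic B k z (projJ1 w)" using hz by simp
  then show "w \<in> HolPhase B k" using w unfolding HolPhase_def J1Phase_J1 by blast
  show "snd (kjet B k w) C = u" using kjet_eq[OF hw] z by simp
qed

lemma phase_section:
  assumes f: "local_section B N f" and C: "adapted B C" and fC: "\<And>x. x \<in> N \<Longrightarrow> f x \<in> fdom C"
    and p: "\<And>i. smooth_fun UNIV (bcoord C ` N) (\<lambda>y. p y i)"
    and p0: "\<And>y I \<rho> a. size I \<ge> k \<Longrightarrow> p y (I, \<rho>, a) = 0"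
  obtains \<sigma> where "smooth_section B (Phase B k) N \<sigma>" "\<And>x. x \<in> N \<Longrightarrow> left (\<sigma> x) = jet B (k - 1) f x"
    "\<And>x i. x \<in> N \<Longrightarrow> snd (\<sigma> x) C (Inr i) = p (bcoord C x) i"
proof -
  have NC: "{x \<in> N. f x \<in> fdom C} = N" using fC by auto
  define u where "u = (\<lambda>y. case_sum (\<lambda>i. snd (jet B (k - 1) f (bpt C y)) C i) (p y))"
  note js = jet_smooth_section[OF f, of "k - 1"]
  have us: "smooth_fun UNIV (bcoord C ` N) (\<lambda>y. u y q)" for q
  proof (cases q)
    case (Inl i)
    then show ?thesis using smooth_sectionD(3)[OF js C, of i] NC by (simp add: u_def)
  next
    case (Inr i)
    then show ?thesis using p by (simp add: u_def)
  qed
  have ux: "u (bcoord C x) = case_sum (snd (jet B (k - 1) f x) C) (p (bcoord C x))" if "x \<in> N" for x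
    using bpt_bcoord[OF C section_bdom[OF f C that fC[OF that]]] by (simp add: u_def)
  have ar: "around B C (fst (jet B (k - 1) f x))" if "x \<in> N" for x using C fC[OF that] by (simp add: around_def)
  have jx: "jet B (k - 1) f x \<in> Jet B (k - 1)" if "x \<in> N" for x by (rule smooth_sectionD(2)[OF js that])
  have uK: "u (bcoord C x) \<in> coord_space (pidx k)" if x: "x \<in> N" for x
    unfolding ux[OF x] coord_space_def
  proof (intro CollectI allI impI)
    fix q :: "('n, 'm) pidx" assume q: "q \<notin> pidx k"
    show "case_sum (snd (jet B (k - 1) f x) C) (p (bcoord C x)) q = 0"
    proof (cases q)
      case (Inl i)
      then have "i \<notin> jidx (k - 1)" using q by simp
      then have "snd (jet B (k - 1) f x) C i = 0"
        using J'.pt_coord[OF jx[OF x] ar[OF x]] unfolding coord_space_def by blast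
      then show ?thesis by (simp add: Inl)
    next
      case (Inr i)
      obtain I \<rho> a where "i = (I, \<rho>, a)" by (cases i) auto
      then show ?thesis using q Inr p0[of I] by simp
    qed
  qed
  have ue: "u (bcoord C x) (Inl ({#}, a)) = fcoord C (f x) a" if "x \<in> N" for x a
    using J'.pt_emb[OF jx[OF that] ar[OF that], of a] by (simp add: ux[OF that])
  obtain \<sigma> where s: "smooth_section B (Phase B k) N \<sigma>" "fst \<circ> \<sigma> = f" "\<And>x. x \<in> N \<Longrightarrow> snd (\<sigma> x) C = u (bcoord C x)"
    by (rule Q.section_ex[OF f C fC us uK ue]) (assumption | rule that)+
  have fs: "fst (\<sigma> x) = f x" for x using s(2) by (metis comp_apply)
  have "left (\<sigma> x) = jet B (k - 1) f x" if x: "x \<in> N" for x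
  proof (rule J'.pt_eqI[OF PhaseD(1)[OF smooth_sectionD(2)[OF s(1) x]] jx[OF x]])
    show "fst (left (\<sigma> x)) = fst (jet B (k - 1) f x)" by (simp add: fs)
    show "around B C (fst (left (\<sigma> x)))" using ar[OF x] by (simp add: fs)
    show "snd (left (\<sigma> x)) C = snd (jet B (k - 1) f x) C" using s(3)[OF x] ux[OF x] by (simp add: fun_eq_iff)
  qed
  moreover have "snd (\<sigma> x) C (Inr i) = p (bcoord C x) i" if "x \<in> N" for x i
    using s(3)[OF that] ux[OF that] by simp
  ultimately show ?thesis using that s(1) by blast
qed

text \<open>A first jet that is holonomic at one point is represented by a section over an actual
  prolongation of some \<open>f\<close>, holonomic on a whole neighbourhood. \<open>N\<close> is
  small enough for both charts to be usable along \<open>f\<close>.\<close>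

lemma HolPhase_rep:
  assumes w: "w \<in> HolPhase B k" and ar: "around B C (fst w)" "around B C' (fst w)"
  obtains f N \<sigma> where "local_section B N f" "proj B (fst w) \<in> N" "smooth_section B (Phase B k) N \<sigma>"
    "\<And>y. y \<in> N \<Longrightarrow> left (\<sigma> y) = jet B (k - 1) f y" "w = jet1 B \<sigma> (proj B (fst w))"
    "kjet B k w = jet B k f (proj B (fst w))" "\<And>y. y \<in> N \<Longrightarrow> f y \<in> fdom C \<and> f y \<in> fdom C'"
proof -
  have C: "adapted B C" "adapted B C'" "fst w \<in> fdom C" "fst w \<in> fdom C'" using ar by (auto simp: around_def)
  note wD = HolPhaseD[OF w]
  obtain f N0 x where f0: "kjet B k w = jet B k f x" "local_section B N0 f" "x \<in> N0" by (rule Jet_cases[OF wD(2)])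
  have fx: "f x = fst w" using wD(3) f0(1) by simp
  have xp: "proj B (fst w) = x" using sectionD(4)[OF f0(2,3)] fx by simp
  define N1 where "N1 = {y \<in> N0. f y \<in> fdom C}"
  have N1: "local_section B N1 f"
    unfolding N1_def by (rule local_section_subset[OF f0(2) section_preimage_open[OF f0(2) C(1)]]) auto
  define N where "N = {y \<in> N1. f y \<in> fdom C'}"
  have f: "local_section B N f"
    unfolding N_def by (rule local_section_subset[OF N1 section_preimage_open[OF N1 C(2)]]) auto
  have xN: "x \<in> N" using f0(3) fx C by (simp add: N_def N1_def)
  have fC: "f y \<in> fdom C \<and> f y \<in> fdom C'" if "y \<in> N" for y using that by (simp add: N_def N1_def)
  have NC: "{x \<in> N. f x \<in> fdom C} = N" using fC by auto
  define x0 where "x0 = bcoord C x"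
  have oN: "open (bcoord C ` N)" using section_chart(1)[OF f C(1)] NC by simp
  \<comment> \<open>Momenta affine in the base coordinates, with the values and first derivatives
    prescribed by \<open>w\<close>.\<close>
  define p where "p = (\<lambda>y i. snd w C (Inl (Inr i)) + (\<Sum>\<tau>\<in>UNIV. snd w C (Inr (Inr i, \<tau>)) * (y \<tau> - x0 \<tau>)))"
  have wc: "snd w C \<in> coord_space (pidx k <+> pidx k \<times> UNIV)" by (rule Q1.pt_coord[OF wD(1) ar(1)])
  obtain \<sigma> where s: "smooth_section B (Phase B k) N \<sigma>" "\<And>x. x \<in> N \<Longrightarrow> left (\<sigma> x) = jet B (k - 1) f x"
    "\<And>x i. x \<in> N \<Longrightarrow> snd (\<sigma> x) C (Inr i) = p (bcoord C x) i"
  proof (rule phase_section[OF f C(1)])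
    show "f x \<in> fdom C" if "x \<in> N" for x using fC[OF that] by blast
    show "smooth_fun UNIV (bcoord C ` N) (\<lambda>y. p y i)" for i unfolding p_def by (rule smooth_affine[OF oN])
    fix y and I :: "'n multiset" and \<rho> :: 'n and a :: 'm assume "size I \<ge> k"
    then have "Inl (Inr (I, \<rho>, a)) \<notin> (pidx k <+> pidx k \<times> UNIV :: ('n, 'm) p1idx set)"
      "Inr (Inr (I, \<rho>, a), \<tau>) \<notin> (pidx k <+> pidx k \<times> UNIV :: ('n, 'm) p1idx set)" for \<tau> by auto
    then have "snd w C (Inl (Inr (I, \<rho>, a))) = 0" "snd w C (Inr (Inr (I, \<rho>, a), \<tau>)) = 0" for \<tau>
      using wc unfolding coord_space_def by auto
    then show "p y (I, \<rho>, a) = 0" by (simp add: p_def)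
  qed blast
  have fs: "fst (\<sigma> y) = f y" if "y \<in> N" for y using arg_cong[OF s(2)[OF that], of fst] by simp
  have arx: "around B C (fst (\<sigma> x))" using ar fs[OF xN] fx by simp
  have "w = jet1 B \<sigma> x"
  proof (rule Q1.pt_eqI[OF wD(1) _ _ ar(1)])
    show "jet1 B \<sigma> x \<in> J1 B (Phase B k)" unfolding J1_def using s(1) xN by blast
    show "fst w = fst (jet1 B \<sigma> x)" using fs[OF xN] fx by (simp add: jet1_def)
    have oN': "open_in UNIV (bcoord C ` N)" using oN by simp
    have bN: "bpt C y \<in> N \<and> bcoord C (bpt C y) = y" if "y \<in> bcoord C ` N" for y
      using section_coord(1)[OF f C(1), of y] that NC by simp
    have xI: "x0 \<in> bcoord C ` N" using xN by (simp add: x0_def)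
    have pjw: "pj (snd (jet1 B \<sigma> x) C) = pj (snd w C)"
    proof -
      have "pj (snd (jet1 B \<sigma> x) C) = snd (jet1 B (\<lambda>x. left (\<sigma> x)) x) C"
        unfolding snd_projJ1[symmetric] left_section(2)[OF s(1)] ..
      also have "jet1 B (\<lambda>x. left (\<sigma> x)) x = jet1 B (jet B (k - 1) f) x"
        by (rule jet1_cong[OF left_section(1)[OF s(1)] xN s(2)])
      also have "snd \<dots> C = jlift (k - 1) (snd (kjet B k w) C)"
        unfolding jet1_lift[OF f xN] f0(1) by simp
      also have "\<dots> = pj (snd w C)" by (rule wD(4)[symmetric])
      finally show ?thesis .
    qed
    show "snd w C = snd (jet1 B \<sigma> x) C"
    proof
      fix r :: "('n, 'm) p1idx"
      show "snd w C r = snd (jet1 B \<sigma> x) C r"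
      proof (cases r rule: p1idx_cases)
        case (1 i)
        then show ?thesis using fun_cong[OF pjw, of "Inl i"] by (simp add: pj_def)
      next
        case (2 i)
        then show ?thesis using arx s(3)[OF xN] by (simp add: jet1_def p_def x0_def)
      next
        case (3 i \<rho>)
        then show ?thesis using fun_cong[OF pjw, of "Inr (i, \<rho>)"] by (simp add: pj_def)
      next
        case (4 i \<rho>)
        have "pd \<rho> (\<lambda>y. snd (\<sigma> (bpt C y)) C (Inr i)) x0 = pd \<rho> (\<lambda>y. p y i) x0"
          by (rule pd_cong[OF finite oN' xI UNIV_I]) (use s(3) bN in metis)
        also have "\<dots> = snd w C (Inr (Inr i, \<rho>))" unfolding p_def by (rule pd_affine)
        finally show ?thesis using arx 4 by (simp add: jet1_def x0_def)
      qed
    qed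
  qed
  then show ?thesis using that[of N f \<sigma>] f xN s(1,2) f0(1) fC xp by simp
qed

subsection \<open>Currents as divergences\<close>

text \<open>At \<open>x\<close> the field \<open>V\<close> has the components of \<open>v\<close>
  below order \<open>k\<close>, and its first derivatives supply those of the next order. The
  product rule therefore produces the right-hand side of \<open>contract_cur\<close>.\<close>

lemma momentum_divergence:
  assumes s: "smooth_section B (Phase B k) N \<sigma>" and x: "x \<in> N" and D: "adapted B D"
    and sD: "\<And>y. y \<in> N \<Longrightarrow> fst (\<sigma> y) \<in> fdom D"
    and Vs: "\<And>i. smooth_fun UNIV (bcoord D ` N) (\<lambda>y. V (bpt D y) D i)"
    and V0: "\<And>i. i \<in> jidx (k - 1) \<Longrightarrow> V x D i = v i"
    and V1: "\<And>I a \<kappa>. size I \<le> k - 1 \<Longrightarrow> pd \<kappa> (\<lambda>y. V (bpt D y) D (I, a)) (bcoord D x) = v (add_mset \<kappa> I, a)"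
  shows "smooth_fun UNIV (bcoord D ` N) (\<lambda>y. momentum_value k (\<sigma> (bpt D y)) (V (bpt D y)) D \<rho>)"
    "(\<Sum>\<rho>\<in>UNIV. pd \<rho> (\<lambda>y. momentum_value k (\<sigma> (bpt D y)) (V (bpt D y)) D \<rho>) (bcoord D x)) =
       contract k (current k (jet1 B \<sigma> x) D) v"
proof -
  have ND: "{x \<in> N. fst (\<sigma> x) \<in> fdom D} = N" using sD by auto
  note nb = Q.smooth_section_around[OF s D, unfolded ND]
  define U where "U = bcoord D ` N"
  have oU: "open_in UNIV U" using nb(1) by (simp add: U_def)
  define P where "P = (\<lambda>i y. snd (\<sigma> (bpt D y)) D (Inr i))"
  have Ps: "smooth_fun UNIV U (P i)" for i
    using smooth_sectionD(3)[OF s D, of "Inr i"] unfolding ND P_def U_def .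
  define W where "W = (\<lambda>i y. V (bpt D y) D i)"
  have Ws: "smooth_fun UNIV U (W i)" for i using Vs unfolding W_def U_def .
  have ar: "around B D (fst (\<sigma> x))" using sD[OF x] D by (simp add: around_def)
  have bx: "bpt D (bcoord D x) = x" by (rule bpt_bcoord[OF D nb(3)[OF x sD[OF x]]])
  define x0 where "x0 = bcoord D x"
  have x0: "x0 \<in> U" using x by (simp add: U_def x0_def)
  have mom: "momentum_value k (\<sigma> (bpt D y)) (V (bpt D y)) D \<rho> =
      (\<Sum>i\<in>jidx (k - 1). orderings (fst i) * (P (fst i, \<rho>, snd i) y * W i y))" for y \<rho>
    unfolding momentum_value_eq[OF k] P_def W_def by (rule refl)
  have PW: "smooth_fun UNIV U (\<lambda>y. P j y * W i y)" for i j by (rule smooth_mult[OF finite oU Ps Ws])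
  show "smooth_fun UNIV (bcoord D ` N) (\<lambda>y. momentum_value k (\<sigma> (bpt D y)) (V (bpt D y)) D \<rho>)"
    unfolding mom U_def[symmetric] by (intro smooth_lincomb[OF finite oU] PW)
  let ?w = "snd (jet1 B \<sigma> x) D"
  have P0: "P i x0 = ?w (Inl (Inr i))" for i using ar by (simp add: P_def x0_def bx jet1_def)
  have P1: "pd \<rho> (P i) x0 = ?w (Inr (Inr i, \<rho>))" for i \<rho> using ar by (simp add: P_def x0_def jet1_def)
  have dm: "pd \<rho> (\<lambda>y. momentum_value k (\<sigma> (bpt D y)) (V (bpt D y)) D \<rho>) x0 =
      (\<Sum>i\<in>jidx (k - 1). orderings (fst i) * (?w (Inr (Inr (fst i, \<rho>, snd i), \<rho>)) * v i +
        ?w (Inl (Inr (fst i, \<rho>, snd i))) * v (add_mset \<rho> (fst i), snd i)))" for \<rho>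
  proof -
    have "pd \<rho> (\<lambda>y. momentum_value k (\<sigma> (bpt D y)) (V (bpt D y)) D \<rho>) x0 =
        (\<Sum>i\<in>jidx (k - 1). pd \<rho> (\<lambda>y. orderings (fst i) * (P (fst i, \<rho>, snd i) y * W i y)) x0)"
      unfolding mom by (rule smooth_pd_sum[OF finite oU smooth_cmult[OF finite oU PW] x0 UNIV_I])
    also have "\<dots> = (\<Sum>i\<in>jidx (k - 1). orderings (fst i) * (?w (Inr (Inr (fst i, \<rho>, snd i), \<rho>)) * v i +
        ?w (Inl (Inr (fst i, \<rho>, snd i))) * v (add_mset \<rho> (fst i), snd i)))"
    proof (rule sum.cong[OF refl])
      fix i :: "('n, 'm) jidx" assume i: "i \<in> jidx (k - 1)"
      obtain I a where Ia: "i = (I, a)" by (cases i)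
      have sI: "size I \<le> k - 1" using i Ia by simp
      have W0: "W i x0 = v i" using V0[OF i] by (simp add: W_def x0_def bx)
      have W1: "pd \<rho> (W i) x0 = v (add_mset \<rho> I, a)" using V1[OF sI] by (simp add: W_def x0_def Ia)
      show "pd \<rho> (\<lambda>y. orderings (fst i) * (P (fst i, \<rho>, snd i) y * W i y)) x0 =
        orderings (fst i) * (?w (Inr (Inr (fst i, \<rho>, snd i), \<rho>)) * v i +
        ?w (Inl (Inr (fst i, \<rho>, snd i))) * v (add_mset \<rho> (fst i), snd i))"
        unfolding smooth_pd_cmult[OF PW x0 UNIV_I] smooth_pd_mult[OF Ps Ws x0 UNIV_I] P0 P1 W0 W1
        by (simp add: Ia)
    qed
    finally show ?thesis .
  qed
  have "(\<Sum>\<rho>\<in>UNIV. pd \<rho> (\<lambda>y. momentum_value k (\<sigma> (bpt D y)) (V (bpt D y)) D \<rho>) x0) =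
      (\<Sum>i\<in>jidx (k - 1). orderings (fst i) * (\<Sum>\<rho>\<in>UNIV. ?w (Inr (Inr (fst i, \<rho>, snd i), \<rho>)) * v i +
        ?w (Inl (Inr (fst i, \<rho>, snd i))) * v (add_mset \<rho> (fst i), snd i)))"
    unfolding dm by (subst sum.swap) (simp only: sum_distrib_left)
  also have "\<dots> = contract k (cur k ?w) v"
    unfolding sum_jidx[OF k] contract_cur by simp
  finally show "(\<Sum>\<rho>\<in>UNIV. pd \<rho> (\<lambda>y. momentum_value k (\<sigma> (bpt D y)) (V (bpt D y)) D \<rho>) (bcoord D x)) =
       contract k (current k (jet1 B \<sigma> x) D) v"
    by (simp add: x0_def current_cur)
qed

text \<open>Both contractions are divergences of the same (n-1)-form, the pairing of a momentum
  section with a vertical field extending \<open>v\<close>; \<open>divergence_covariant\<close>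
  supplies the determinant.\<close>

lemma current_covariant:
  assumes w: "w \<in> HolPhase B k" and ar: "around B C (fst w)" "around B C' (fst w)"
    and v: "v \<in> vertical_tangent B (Jet B k) (kjet B k w)"
  shows "contract k (current k w C) (v C) = jdet C C' (proj B (fst w)) * contract k (current k w C') (v C')"
proof -
  define x where "x = proj B (fst w)"
  have C: "adapted B C" "adapted B C'" using ar by (auto simp: around_def)
  obtain f N \<sigma> where f: "local_section B N f" "x \<in> N" "smooth_section B (Phase B k) N \<sigma>"
    "\<And>y. y \<in> N \<Longrightarrow> left (\<sigma> y) = jet B (k - 1) f y" "w = jet1 B \<sigma> x"
    "kjet B k w = jet B k f x" "\<And>y. y \<in> N \<Longrightarrow> f y \<in> fdom C \<and> f y \<in> fdom C'"
    unfolding x_def by (rule HolPhase_rep[OF w ar]) blast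
  have fs: "fst (\<sigma> y) = f y" if "y \<in> N" for y using arg_cong[OF f(4)[OF that], of fst] by simp
  have NC: "{x \<in> N. f x \<in> fdom C} = N" using f(7) by auto
  have NC': "{x \<in> N. f x \<in> fdom C'} = N" using f(7) by auto
  define U where "U = bcoord C ` N"
  have U: "open U" "open (bcoord C' ` N)"
    using section_chart(1)[OF f(1) C(1)] section_chart(1)[OF f(1) C(2)] by (simp_all add: U_def NC NC')
  have oU: "open_in UNIV U" using U by simp
  have bU: "bpt C y \<in> N \<and> bcoord C (bpt C y) = y" if "y \<in> U" for y
    using section_coord(1)[OF f(1) C(1), of y] that by (simp add: U_def NC)
  have x0: "bcoord C x \<in> U" using f(2) by (simp add: U_def)
  have bx: "bpt C (bcoord C x) = x" using section_coord(2)[OF f(1) C(1) f(2)] f(7)[OF f(2)] by simp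
  \<comment> \<open>Taylor polynomials whose derivatives up to order \<open>k\<close> at
    \<open>x\<close> are the components of \<open>v\<close>. Their derivatives up to order
    \<open>k - 1\<close> serve as the components of the field \<open>V\<close>, so first derivatives
    of \<open>V\<close> reach order \<open>k\<close>.\<close>
  define \<tau> where "\<tau> = (\<lambda>a. taylor k (bcoord C x) (\<lambda>J. v C (J, a)))"
  have \<tau>s: "smooth_fun UNIV U (\<tau> a)" for a unfolding \<tau>_def by (rule smooth_taylor[OF U(1)])
  define j where "j = jet B (k - 1) f"
  note js = jet_smooth_section[OF f(1), of "k - 1", folded j_def]
  have jx: "j y \<in> Jet B (k - 1)" "fst (j y) = f y" if "y \<in> N" for y
    using smooth_sectionD(2)[OF js that] by (simp_all add: j_def)
  define V0 where "V0 = (\<lambda>y (I, a). if size I \<le> k - 1 then pdm I (\<tau> a) y else 0)"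
  have V0K: "V0 y \<in> coord_space (jidx (k - 1))" for y by (auto simp: V0_def coord_space_def)
  have "\<exists>X\<in>vertical_tangent B (Jet B (k - 1)) (j y). X C = V0 (bcoord C y)" if y: "y \<in> N" for y
    using f(7)[OF y] C jx[OF y] by (intro J'.tangent_ex[OF jx(1)[OF y] _ V0K]) (simp add: around_def)
  then obtain V where V: "\<And>y. y \<in> N \<Longrightarrow> V y \<in> vertical_tangent B (Jet B (k - 1)) (j y)"
    "\<And>y. y \<in> N \<Longrightarrow> V y C = V0 (bcoord C y)" by metis
  have VU: "V (bpt C y) C i = V0 y i" if "y \<in> U" for y i using V(2) bU[OF that] by simp
  have V0s: "smooth_fun UNIV U (\<lambda>y. V0 y i)" for i
  proof -
    obtain I a where i: "i = (I, a)" by (cases i)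
    show ?thesis unfolding V0_def i prod.case by (intro smooth_if smooth_pdm[OF \<tau>s] smooth_const) simp
  qed
  have Vs: "smooth_fun UNIV (bcoord C ` N) (\<lambda>y. V (bpt C y) C i)" for i
    unfolding U_def[symmetric] by (rule smooth_cong[OF finite oU V0s]) (simp add: VU)
  define X where "X = (\<lambda>C. jlift (k - 1) (v C))"
  have X: "X \<in> vertical_tangent B (J1 B (Jet B (k - 1))) (jet1 B j x)"
    unfolding X_def j_def
    using jet_tangent_lift[OF f(1,2), of v "k - 1"] v f(6) unfolding Suc_k by simp
  have X0: "X C (Inl i) = V x C i" if "i \<in> jidx (k - 1)" for i
  proof -
    obtain I a where i: "i = (I, a)" by (cases i)
    then have "size I \<le> k - 1" using that by simp
    moreover from this have "size I \<le> k" by simp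
    ultimately show ?thesis using pdm_taylor[of I k "bcoord C x" "\<lambda>J. v C (J, a)"]
      by (simp add: X_def jlift_def V(2)[OF f(2)] V0_def i \<tau>_def)
  qed
  have X1: "X C (Inr (i, \<rho>)) = pd \<rho> (\<lambda>y. V (bpt C y) C i) (bcoord C x)" if "i \<in> jidx (k - 1)" for i \<rho>
  proof -
    obtain I a where i: "i = (I, a)" by (cases i)
    then have sI: "size I \<le> k - 1" using that by simp
    then have sI': "size (add_mset \<rho> I) \<le> k" using k by simp
    have "pd \<rho> (\<lambda>y. V (bpt C y) C i) (bcoord C x) = pd \<rho> (pdm I (\<tau> a)) (bcoord C x)"
      by (rule pd_cong[OF finite oU x0 UNIV_I]) (use sI in \<open>simp add: VU V0_def i\<close>)
    also have "\<dots> = pdm (add_mset \<rho> I) (\<tau> a) (bcoord C x)"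
      by (rule pdm_add_mset[OF finite oU \<tau>s UNIV_I _ x0, symmetric]) simp
    also have "\<dots> = v C (add_mset \<rho> I, a)" unfolding \<tau>_def by (rule pdm_taylor[OF sI'])
    finally show ?thesis using sI by (simp add: X_def jlift_def i)
  qed
  \<comment> \<open>\<open>V\<close> is built from polynomials in \<open>C\<close> only;
    \<open>tangent_field\<close> shows that the lift of \<open>v\<close> is its prolongation in
    every other chart over \<open>N\<close>.\<close>
  have tf: "smooth_fun UNIV (bcoord D ` N) (\<lambda>y. V (bpt D y) D i)"
    "X D (Inl i) = V x D i" "X D (Inr (i, \<kappa>)) = pd \<kappa> (\<lambda>y. V (bpt D y) D i) (bcoord D x)"
    if D: "adapted B D" and fD: "\<And>y. y \<in> N \<Longrightarrow> f y \<in> fdom D" for D i \<kappa>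
  proof -
    have a: "fst (j y) \<in> fdom C" "fst (j y) \<in> fdom D" if "y \<in> N" for y
      using f(7)[OF that] fD[OF that] jx(2)[OF that] by simp_all
    note t = J'.tangent_field[OF js f(2) C(1) D a V(1) Vs X X0 X1]
    show "smooth_fun UNIV (bcoord D ` N) (\<lambda>y. V (bpt D y) D i)"
      "X D (Inl i) = V x D i" "X D (Inr (i, \<kappa>)) = pd \<kappa> (\<lambda>y. V (bpt D y) D i) (bcoord D x)"
      using t by blast+
  qed
  have md: "smooth_fun UNIV (bcoord D ` N) (\<lambda>y. momentum_value k (\<sigma> (bpt D y)) (V (bpt D y)) D \<rho>)"
    "(\<Sum>\<rho>\<in>UNIV. pd \<rho> (\<lambda>y. momentum_value k (\<sigma> (bpt D y)) (V (bpt D y)) D \<rho>) (bcoord D x)) =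
       contract k (current k w D) (v D)"
    if D: "adapted B D" and fD: "\<And>y. y \<in> N \<Longrightarrow> f y \<in> fdom D" for D \<rho>
  proof -
    note t = tf[OF D fD]
    have sD: "fst (\<sigma> y) \<in> fdom D" if "y \<in> N" for y using fs[OF that] fD[OF that] by simp
    have a0: "V x D i = v D i" if "i \<in> jidx (k - 1)" for i
    proof -
      have "X D (Inl i) = v D i" using that by (cases i) (simp add: X_def jlift_def)
      then show ?thesis using t(2)[of i] by simp
    qed
    have a1: "pd \<kappa> (\<lambda>y. V (bpt D y) D (I, a)) (bcoord D x) = v D (add_mset \<kappa> I, a)" if "size I \<le> k - 1" for I a \<kappa>
    proof -
      have "X D (Inr ((I, a), \<kappa>)) = v D (add_mset \<kappa> I, a)" using that by (simp add: X_def jlift_def)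
      then show ?thesis using t(3)[of "(I, a)" \<kappa>] by simp
    qed
    note m = momentum_divergence[where V = V and v = "v D", OF f(3,2) D sD t(1) a0 a1]
    show "smooth_fun UNIV (bcoord D ` N) (\<lambda>y. momentum_value k (\<sigma> (bpt D y)) (V (bpt D y)) D \<rho>)"
      using m(1) by blast
    show "(\<Sum>\<rho>\<in>UNIV. pd \<rho> (\<lambda>y. momentum_value k (\<sigma> (bpt D y)) (V (bpt D y)) D \<rho>) (bcoord D x)) =
       contract k (current k w D) (v D)"
      using m(2) unfolding f(5) by blast
  qed
  have fC: "f y \<in> fdom C" "f y \<in> fdom C'" if "y \<in> N" for y using f(7)[OF that] by auto
  have Nb: "N \<subseteq> bdom C \<inter> bdom C'"
    using section_bdom[OF f(1) C(1)] section_bdom[OF f(1) C(2)] fC by blast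
  have "(\<Sum>\<rho>\<in>UNIV. pd \<rho> (\<lambda>y. momentum_value k (\<sigma> (bpt C y)) (V (bpt C y)) C \<rho>) (bcoord C x)) =
    jdet C C' x * (\<Sum>\<kappa>\<in>UNIV. pd \<kappa> (\<lambda>y. momentum_value k (\<sigma> (bpt C' y)) (V (bpt C' y)) C' \<kappa>) (bcoord C' x))"
  proof (rule divergence_covariant[where b = "\<lambda>y \<rho>. momentum_value k (\<sigma> y) (V y) C \<rho>"
        and b' = "\<lambda>y \<rho>. momentum_value k (\<sigma> y) (V y) C' \<rho>", OF C Nb f(2) U[unfolded U_def] md(1)[OF C(2) fC(2)]])
    fix y \<rho> assume y: "y \<in> N"
    have "V y \<in> vertical_tangent B (Jet B (k - 1)) (left (\<sigma> y))" using V(1)[OF y] f(4)[OF y] by (simp add: j_def)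
    note ct = PhaseD(4)[OF smooth_sectionD(2)[OF f(3) y] this]
    have a: "around B C (fst (\<sigma> y))" "around B C' (fst (\<sigma> y))"
      using fC[OF y] fs[OF y] C by (simp_all add: around_def)
    have py: "proj B (fst (\<sigma> y)) = y" using fs[OF y] sectionD(4)[OF f(1) y] by simp
    show "momentum_value k (\<sigma> y) (V y) C \<rho> =
      (\<Sum>\<kappa>\<in>UNIV. cofac C C' y \<rho> \<kappa> * momentum_value k (\<sigma> y) (V y) C' \<kappa>)"
      using ct a unfolding cotop_form_cofac py by blast
  qed
  moreover have "(\<Sum>\<rho>\<in>UNIV. pd \<rho> (\<lambda>y. momentum_value k (\<sigma> (bpt C y)) (V (bpt C y)) C \<rho>) (bcoord C x)) =
      contract k (current k w C) (v C)"
    by (rule md(2)[OF C(1)]) (rule fC(1))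
  moreover have "(\<Sum>\<rho>\<in>UNIV. pd \<rho> (\<lambda>y. momentum_value k (\<sigma> (bpt C' y)) (V (bpt C' y)) C' \<rho>) (bcoord C' x)) =
      contract k (current k w C') (v C')"
    by (rule md(2)[OF C(2)]) (rule fC(2))
  ultimately show ?thesis unfolding x_def by (simp only:)
qed

subsection \<open>Degeneracy leaves\<close>

text \<open>The holonomic constraints are linear in coordinates, so a line whose direction satisfies
  them stays in \<open>HolPhase\<close>.\<close>

lemma HolPhase_tangent:
  assumes w: "w \<in> HolPhase B k" and C: "around B C (fst w)"
    and y: "y \<in> coord_space (pidx k <+> pidx k \<times> UNIV)" and h: "hol k u y"
  shows "\<exists>Y\<in>vertical_tangent B (HolPhase B k) w. Y C = y"
proof -
  note wD = HolPhaseD[OF w]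
  obtain \<gamma> \<epsilon> where g: "\<epsilon> > 0" "vertical_curve B (J1 B (Phase B k)) (proj B (fst w)) {-\<epsilon><..<\<epsilon>} \<gamma>" "\<gamma> 0 = w"
    "\<And>t. t \<in> {-\<epsilon><..<\<epsilon>} \<Longrightarrow> fst (\<gamma> t) \<in> fdom C \<and> snd (\<gamma> t) C = (\<lambda>i. snd w C i + t * y i)"
    "velocity B \<gamma> 0 C = y"
    by (rule Q1.tangent_curve[OF wD(1) C y]) blast
  have "vertical_curve B (HolPhase B k) (proj B (fst w)) {-\<epsilon><..<\<epsilon>} \<gamma>"
  proof (rule vertical_curve_codomain[OF g(2)])
    fix t assume t: "t \<in> {-\<epsilon><..<\<epsilon>}"
    have "hol k (\<lambda>i. snd (kjet B k w) C i + t * u i) (snd (\<gamma> t) C)"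
      using hol_line[OF wD(5)[OF C] h] g(4)[OF t] by simp
    then show "\<gamma> t \<in> HolPhase B k"
      using HolPhase_intro(1)[of "\<gamma> t" C] vertical_curve_in[OF g(2) t] g(4)[OF t] C by (simp add: around_def)
  qed
  then show ?thesis
    using g unfolding vertical_tangent_def by (intro bexI[of _ "velocity B \<gamma> 0"]) auto
qed

lemma HolPhase_J1: "HolPhase B k \<subseteq> J1 B (Phase B k)"
  using HolPhaseD(1) by blast

text \<open>Two test vectors turn the vanishing of \<open>omega_tilde\<close> into vanishing sums of
  squares. \<open>Y\<close>, purely in the momentum directions, detects the jet components of
  \<open>X\<close>; \<open>Z\<close>, purely in the jet directions, detects its currents.\<close>

lemma degeneracyD:
  assumes X: "X \<in> degeneracy B k w" and C: "around B C (fst w)"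
  shows "pj (X C) = (\<lambda>_. 0)" "cur k (X C) = (\<lambda>_. 0)"
proof -
  have Xt: "X \<in> vertical_tangent B (HolPhase B k) w"
    and X0: "\<And>Y. Y \<in> vertical_tangent B (HolPhase B k) w \<Longrightarrow> omega_tilde k X Y C = 0"
    using X C by (auto simp: degeneracy_def)
  have Xt1: "X \<in> vertical_tangent B (J1 B (Phase B k)) w" using Xt vertical_tangent_mono[OF HolPhase_J1] by blast
  have w: "w \<in> HolPhase B k"
  proof -
    obtain \<gamma> \<epsilon> where "\<epsilon> > 0" "vertical_curve B (HolPhase B k) (proj B (fst w)) {-\<epsilon><..<\<epsilon>} \<gamma>" "\<gamma> 0 = w"
      using Xt by (auto simp: vertical_tangent_def)
    then show ?thesis using vertical_curve_in[of B "HolPhase B k" _ _ \<gamma> 0] by auto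
  qed
  have XK: "X C \<in> coord_space (pidx k <+> pidx k \<times> UNIV)" by (rule Q1.tangent_coord[OF Xt1 C])
  \<comment> \<open>Over the zero k-jet the momentum slots are free. They copy the components of
    \<open>X\<close> they are paired with, which makes the form minus a sum of squares; the guard
    keeps the vector in the coordinate space.\<close>
  define p where "p = (\<lambda>(I :: 'n multiset, \<rho> :: 'n, a :: 'm). if size I < k then X C (Inr (Inl (I, a), \<rho>)) else 0)"
  define q where "q = (\<lambda>((I :: 'n multiset, \<rho> :: 'n, a :: 'm), \<kappa> :: 'n). if size I < k then X C (Inl (Inl (I, a))) else 0)"
  have "\<exists>Y\<in>vertical_tangent B (HolPhase B k) w. Y C = mkw k (\<lambda>_. 0) p q"
    by (rule HolPhase_tangent[OF w C mkw_coord_space, where u = "\<lambda>_. 0"])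
      (auto simp: p_def q_def hol_def pj_mkw coord_space_def)
  then obtain Y where Y: "Y \<in> vertical_tangent B (HolPhase B k) w" "Y C = mkw k (\<lambda>_. 0) p q" by blast
  have j0: "jlift (k - 1) (\<lambda>_. 0) = (\<lambda>_ :: ('n, 'm) jidx + ('n, 'm) jidx \<times> 'n. 0)"
    by (auto simp: jlift_def fun_eq_iff split: sum.split)
  define T where "T = (\<lambda>(\<mu>s :: 'n list) (a :: 'm) \<rho>. X C (Inl (Inl (mset \<mu>s, a))) * X C (Inl (Inl (mset \<mu>s, a))) +
      X C (Inr (Inl (mset \<mu>s, a), \<rho>)) * X C (Inr (Inl (mset \<mu>s, a), \<rho>)))"
  have T0: "T \<mu>s a \<rho> \<ge> 0" for \<mu>s a \<rho> by (simp add: T_def)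
  have "omega_tilde k X Y C = (\<Sum>l<k. \<Sum>\<mu>s | length \<mu>s = l. \<Sum>a\<in>UNIV. \<Sum>\<rho>\<in>UNIV. - T \<mu>s a \<rho>)"
    unfolding omega_tilde_def Let_def Y(2)
    by (intro sum.cong refl) (simp add: T_def j0[simplified] p_def q_def)
  then have s0: "(\<Sum>l<k. \<Sum>\<mu>s | length \<mu>s = l. \<Sum>a\<in>UNIV. \<Sum>\<rho>\<in>UNIV. T \<mu>s a \<rho>) = 0"
    using X0[OF Y(1)] by (simp add: sum_negf)
  have Tz: "T \<mu>s a \<rho> = 0" if "length \<mu>s < k" for \<mu>s a \<rho>
  proof -
    have "(\<Sum>\<mu>s' | length \<mu>s' = length \<mu>s. \<Sum>a\<in>UNIV. \<Sum>\<rho>\<in>UNIV. T \<mu>s' a \<rho>) = 0"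
      by (rule sum_nonneg_0[OF _ _ s0]) (use that T0 in \<open>auto intro!: sum_nonneg\<close>)
    then have "(\<Sum>a\<in>UNIV. \<Sum>\<rho>\<in>UNIV. T \<mu>s a \<rho>) = 0"
      by (rule sum_nonneg_0[OF finite_lists_length _, rotated]) (use T0 in \<open>auto intro!: sum_nonneg\<close>)
    then have "(\<Sum>\<rho>\<in>UNIV. T \<mu>s a \<rho>) = 0"
      by (rule sum_nonneg_0[OF finite _, rotated]) (use T0 in \<open>auto intro!: sum_nonneg\<close>)
    then show ?thesis by (rule sum_nonneg_0[OF finite _, rotated]) (use T0 in auto)
  qed
  have z: "X C (Inl (Inl (I, a))) = 0" "X C (Inr (Inl (I, a), \<rho>)) = 0" if "size I < k" for I a \<rho>
  proof -
    obtain \<mu>s where I: "I = mset \<mu>s" by (metis ex_mset)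
    have "T \<mu>s a \<rho> = 0" using Tz that I by simp
    then show "X C (Inl (Inl (I, a))) = 0" "X C (Inr (Inl (I, a), \<rho>)) = 0"
      unfolding T_def I by (simp_all add: sum_squares_eq_zero_iff)
  qed
  show pj0: "pj (X C) = (\<lambda>_. 0)"
  proof
    fix r :: "('n, 'm) jidx + ('n, 'm) jidx \<times> 'n"
    have n: "X C (Inl (Inl (I, a))) = 0" "X C (Inr (Inl (I, a), \<rho>)) = 0" if "\<not> size I < k" for I a \<rho>
    proof -
      have "Inl (Inl (I, a)) \<notin> (pidx k <+> pidx k \<times> UNIV :: ('n, 'm) p1idx set)"
        "Inr (Inl (I, a), \<rho>) \<notin> (pidx k <+> pidx k \<times> UNIV :: ('n, 'm) p1idx set)" using that k by auto
      then show "X C (Inl (Inl (I, a))) = 0" "X C (Inr (Inl (I, a), \<rho>)) = 0"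
        using XK unfolding coord_space_def by blast+
    qed
    have zz: "X C (Inl (Inl (I, a))) = 0" "X C (Inr (Inl (I, a), \<rho>)) = 0" for I a \<rho>
      using z n by blast+
    show "pj (X C) r = 0" using zz by (auto simp: pj_def split: sum.split)
  qed
  \<comment> \<open>The k-jet part of the second test vector is chosen as the currents of
    \<open>X\<close>; by \<open>contract_cur\<close> the form then becomes the contraction of the
    currents with themselves.\<close>
  define c where "c = cur k (X C)"
  have "\<exists>Z\<in>vertical_tangent B (HolPhase B k) w. Z C = mkw k c (\<lambda>_. 0) (\<lambda>_. 0)"
    by (rule HolPhase_tangent[OF w C mkw_coord_space, where u = c])
      (auto simp: hol_def pj_mkw c_def cur_coord_space)
  then obtain Z where Z: "Z \<in> vertical_tangent B (HolPhase B k) w" "Z C = mkw k c (\<lambda>_. 0) (\<lambda>_. 0)" by blast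
  have "omega_tilde k X Z C = contract k c c"
    unfolding omega_tilde_def Let_def Z(2) contract_cur[of k "X C" c, folded c_def]
  proof (intro sum.cong refl)
    fix l \<mu>s a \<rho> assume "l \<in> {..<k}" "\<mu>s \<in> {\<mu>s :: 'n list. length \<mu>s = l}"
    then have "length \<mu>s \<le> k - 1" by auto
    then show "X C (Inr (Inr (mset \<mu>s, \<rho>, a), \<rho>)) * mkw k c (\<lambda>_. 0) (\<lambda>_. 0) (Inl (Inl (mset \<mu>s, a))) -
        mkw k c (\<lambda>_. 0) (\<lambda>_. 0) (Inr (Inr (mset \<mu>s, \<rho>, a), \<rho>)) * X C (Inl (Inl (mset \<mu>s, a))) +
        (X C (Inl (Inr (mset \<mu>s, \<rho>, a))) * mkw k c (\<lambda>_. 0) (\<lambda>_. 0) (Inr (Inl (mset \<mu>s, a), \<rho>)) -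
         mkw k c (\<lambda>_. 0) (\<lambda>_. 0) (Inl (Inr (mset \<mu>s, \<rho>, a))) * X C (Inr (Inl (mset \<mu>s, a), \<rho>))) =
        X C (Inr (Inr (mset \<mu>s, \<rho>, a), \<rho>)) * c (mset \<mu>s, a) +
        X C (Inl (Inr (mset \<mu>s, \<rho>, a))) * c (add_mset \<rho> (mset \<mu>s), a)"
      by (simp add: jlift_def)
  qed
  then have s: "(\<Sum>i\<in>jidx k. orderings (fst i) * (c i * c i)) = 0"
    using X0[OF Z(1)] by (simp add: contract_eq)
  have ci: "c i = 0" if i: "i \<in> jidx k" for i
  proof -
    have "orderings (fst i) * (c i * c i) = 0" by (rule sum_nonneg_0[OF finite_jidx _ s i]) simp
    then show ?thesis using orderings_pos[of "fst i"] by simp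
  qed
  show "cur k (X C) = (\<lambda>_. 0)"
  proof
    fix i show "cur k (X C) i = 0"
      using ci[of i] cur_coord_space[of k "X C"] unfolding coord_space_def c_def by (cases "i \<in> jidx k") blast+
  qed
qed

text \<open>By \<open>degeneracyD\<close> jet coordinates and currents have zero derivative along
  the joining curve. A single chart need not contain the whole curve a priori, so constancy of the
  underlying point has to precede the comparison of coordinates.\<close>

lemma same_leaf_invariant:
  assumes l: "(w, w') \<in> same_leaf B k"
  shows "w \<in> HolPhase B k" "w' \<in> HolPhase B k" "fst w' = fst w" "kjet B k w' = kjet B k w"
    "around B C (fst w) \<Longrightarrow> current k w' C = current k w C"
proof -
  obtain \<gamma> \<epsilon> where g: "\<epsilon> > 0" "vertical_curve B (HolPhase B k) (proj B (fst w)) {-\<epsilon><..<1+\<epsilon>} \<gamma>"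
    "\<gamma> 0 = w" "\<gamma> 1 = w'" "\<And>t. t \<in> {0..1} \<Longrightarrow> velocity B \<gamma> t \<in> degeneracy B k (\<gamma> t)"
    using l by (auto simp: same_leaf_def)
  show w: "w \<in> HolPhase B k" and w': "w' \<in> HolPhase B k" using l by (auto simp: same_leaf_def)
  have sub: "{0..1} \<subseteq> {-\<epsilon><..<1+\<epsilon>}" using g(1) by auto
  have gin: "\<gamma> t \<in> HolPhase B k" "proj B (fst (\<gamma> t)) = proj B (fst w)" if "t \<in> {0..1}" for t
    using vertical_curve_in[OF g(2)] sub that by blast+
  have DV: "((\<lambda>s. snd (\<gamma> s) C i) has_real_derivative velocity B \<gamma> t C i) (at t)"
    if "t \<in> {0..1}" "around B C (fst (\<gamma> t))" for t C i
    using vertical_curve_DERIV[OF g(2) _ that(2)] sub that(1) by blast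
  have pjD: "((\<lambda>s. pj (snd (\<gamma> s) C) r) has_real_derivative 0) (at t)"
    if t: "t \<in> {0..1}" "around B C (fst (\<gamma> t))" for t C r
  proof -
    have "((\<lambda>s. pj (snd (\<gamma> s) C) r) has_real_derivative pj (velocity B \<gamma> t C) r) (at t)"
      using DV[OF t] by (cases r) (auto simp: pj_def split: prod.split)
    then show ?thesis using degeneracyD(1)[OF g(5)[OF t(1)] t(2)] by simp
  qed
  \<comment> \<open>Near each time the curve stays in one chart, where the order-zero coordinates
    are constant; connectedness of the unit interval then gives \<open>const\<close>.\<close>
  have loc: "\<forall>\<^sub>F s in at t within {0..1}. fst (\<gamma> t) = fst (\<gamma> s)" if t: "t \<in> {0..1}" for t
  proof -
    obtain C where C: "around B C (fst (\<gamma> t))"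
      using chart_ex[OF HolPhaseD(6)[OF gin(1)[OF t]]] by blast
    have Ca: "adapted B C" using C by (simp add: around_def)
    let ?T = "{s \<in> {-\<epsilon><..<1+\<epsilon>}. fst (\<gamma> s) \<in> fdom C}"
    have "open ?T" "t \<in> ?T" using vertical_curve_open[OF g(2) Ca] t sub C by (auto simp: around_def)
    then obtain d where d: "d > 0" "ball t d \<subseteq> ?T" using open_contains_ball by blast
    define S where "S = ball t d \<inter> {0..1}"
    have arS: "around B C (fst (\<gamma> s))" "s \<in> {0..1}" if "s \<in> S" for s
      using that d(2) Ca by (auto simp: S_def around_def)
    have "convex S" unfolding S_def by (intro convex_Int convex_ball convex_real_interval)
    have "fst (\<gamma> t) = fst (\<gamma> s)" if s: "s \<in> S" for s
    proof -
      have tS: "t \<in> S" using d(1) t by (simp add: S_def)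
      have e: "snd (\<gamma> s) C (Inl (Inl ({#}, a))) = snd (\<gamma> t) C (Inl (Inl ({#}, a)))" for a
      proof -
        have "((\<lambda>s. pj (snd (\<gamma> s) C) (Inl ({#}, a))) has_real_derivative 0) (at r within S)" if "r \<in> S" for r
          by (rule has_field_derivative_at_within[OF pjD[OF arS(2)[OF that] arS(1)[OF that]]])
        from has_field_derivative_zero_constant[OF \<open>convex S\<close> this]
        obtain c where "\<forall>s\<in>S. pj (snd (\<gamma> s) C) (Inl ({#}, a)) = c" by blast
        then have "pj (snd (\<gamma> s) C) (Inl ({#}, a)) = pj (snd (\<gamma> t) C) (Inl ({#}, a))" using s tS by simp
        then show ?thesis by (simp add: pj_def)
      qed
      have em: "snd (\<gamma> r) C (Inl (Inl ({#}, a))) = fcoord C (fst (\<gamma> r)) a" if "r \<in> S" for r a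
        by (rule Q1.pt_emb[OF HolPhaseD(1)[OF gin(1)[OF arS(2)[OF that]]] arS(1)[OF that]])
      have "tcoord B C (fst (\<gamma> t)) = tcoord B C (fst (\<gamma> s))"
        using e em[OF s] em[OF tS] gin(2)[OF t] gin(2)[OF arS(2)[OF s]]
        by (simp add: tcoord_def fun_eq_iff split: sum.split)
      then show ?thesis using tcoord_inj[OF Ca] arS(1)[OF s] C by (simp add: around_def)
    qed
    then show ?thesis
      unfolding eventually_at using d(1) by (intro exI[of _ d]) (auto simp: S_def dist_commute)
  qed
  have const: "fst (\<gamma> t) = fst w" if "t \<in> {0..1}" for t
    using connected_local_const[of "{0..1}" 0 t "\<lambda>t. fst (\<gamma> t)"] loc that g(3) by auto
  show fw: "fst w' = fst w" using const[of 1] g(4) by simp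
  have eqI: "F 1 = F 0" if "\<And>t. t \<in> {0..1} \<Longrightarrow> (F has_real_derivative 0) (at t)" for F :: "real \<Rightarrow> real"
  proof -
    have "\<exists>c. \<forall>s\<in>{0..1}. F s = c"
      by (rule has_field_derivative_zero_constant[OF convex_real_interval(5)])
        (rule has_field_derivative_at_within[OF that])
    then show ?thesis by force
  qed
  obtain C0 where C0: "around B C0 (fst w)" using chart_ex[OF HolPhaseD(6)[OF w]] by blast
  have "pj (snd w' C0) r = pj (snd w C0) r" for r
    using eqI[OF pjD[of _ C0 r]] const C0 g(3,4) by simp
  then have "jlift (k - 1) (snd (kjet B k w') C0) = jlift (k - 1) (snd (kjet B k w) C0)"
    using HolPhaseD(4)[OF w] HolPhaseD(4)[OF w'] by (metis ext)
  then have "snd (kjet B k w') C0 = snd (kjet B k w) C0"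
    using HolPhaseD(5)[OF w C0] HolPhaseD(5)[OF w', of C0] C0 fw k by (intro jlift_inj) (simp_all add: hol_def)
  then show "kjet B k w' = kjet B k w"
    using J.pt_eqI[OF HolPhaseD(2)[OF w'] HolPhaseD(2)[OF w], of C0] HolPhaseD(3)[OF w] HolPhaseD(3)[OF w'] C0 fw by simp
  show "current k w' C = current k w C" if C: "around B C (fst w)"
  proof
    fix i
    have "((\<lambda>s. cur k (snd (\<gamma> s) C) i) has_real_derivative 0) (at t)" if t: "t \<in> {0..1}" for t
    proof -
      have a: "around B C (fst (\<gamma> t))" using C const[OF t] by simp
      show ?thesis using cur_DERIV[where y = "\<lambda>s. snd (\<gamma> s) C" and k = k and i = i, OF DV[OF t a]] degeneracyD(2)[OF g(5)[OF t] a] by simp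
    qed
    from eqI[OF this] show "current k w' C i = current k w C i" using g(3,4) by (simp add: current_cur)
  qed
qed

lemma same_leaf_refl:
  assumes w: "w \<in> HolPhase B k"
  shows "(w, w) \<in> same_leaf B k"
proof -
  have sm: "smooth_real T (\<lambda>_. c)" for T c
  proof -
    have "(deriv ^^ r) (\<lambda>_ :: real. c) = (\<lambda>_. if r = 0 then c else 0)" for r by (induction r) auto
    then show ?thesis by (simp add: smooth_real_def)
  qed
  have c: "vertical_curve B (HolPhase B k) (proj B (fst w)) T (\<lambda>_. w)" if "open T" for T
    unfolding vertical_curve_def
  proof (intro conjI ballI allI impI sm)
    show "w \<in> fibre B (HolPhase B k) (proj B (fst w))" using w by (simp add: fibre_def)
    show "open {t \<in> T. fst w \<in> fdom C}" for C using that by (cases "fst w \<in> fdom C") simp_all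
  qed
  have v0: "velocity B (\<lambda>_. w) t = (\<lambda>_ _. 0)" for t by (simp add: velocity_def fun_eq_iff)
  have "velocity B (\<lambda>_. w) 0 \<in> vertical_tangent B (HolPhase B k) w"
    unfolding vertical_tangent_def using c[of "{-1<..<1}"] by (intro CollectI exI[of _ "\<lambda>_. w"] exI[of _ 1]) simp
  then have "(\<lambda>_ _. 0) \<in> degeneracy B k w"
    unfolding degeneracy_def v0 by (simp add: omega_tilde_def)
  then show ?thesis
    unfolding same_leaf_def using w c[of "{-1<..<1+1}"] v0
    by (intro CollectI case_prodI conjI exI[of _ "\<lambda>_. w"] exI[of _ 1]) simp_all
qed

text \<open>\<open>inf_coords\<close> evaluates an arbitrarily chosen representative; this is the
  same formula at a given representative.\<close>

definition iota :: "('x, 'e, 'n, 'm, ('n, 'm) p1idx) pt \<Rightarrow> ('x, 'e, 'n, 'm, ('n, 'm) iidx) pt" where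
  "iota w = (fst w, \<lambda>C. if around B C (fst w) then case_sum (snd (kjet B k w) C) (current k w C) else (\<lambda>_. 0))"

lemma inf_coords_iota:
  assumes w: "w \<in> HolPhase B k"
  shows "inf_coords B k (same_leaf B k `` {w}) = iota w"
proof -
  define w' where "w' = (SOME w'. w' \<in> same_leaf B k `` {w})"
  have "w' \<in> same_leaf B k `` {w}"
    unfolding w'_def by (rule someI[of _ w]) (use same_leaf_refl[OF w] in simp)
  then have l: "(w, w') \<in> same_leaf B k" by simp
  note i = same_leaf_invariant[OF l]
  have "inf_coords B k (same_leaf B k `` {w}) = iota w'"
    by (simp add: inf_coords_def iota_def w'_def Let_def)
  also have "\<dots> = iota w"
    unfolding iota_def i(3) i(4) using i(5) by (simp cong: if_cong)
  finally show ?thesis .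
qed

lemma inf_coords_InfPhase: "inf_coords B k ` InfPhase B k = iota ` HolPhase B k"
  unfolding InfPhase_def quotient_def using inf_coords_iota by (force simp: image_iff)

end

context coord_bundle begin

lemma jcoord_inj:
  assumes z: "z \<in> S" "z' \<in> S" and C: "around B C (fst z)" "around B C (fst z')"
    and e: "jcoord B C z = jcoord B C z'"
  shows "z = z'"
proof (rule pt_eqI[OF z _ C(1)])
  have "tcoord B C (fst z) = tcoord B C (fst z')"
    unfolding tcoord_pt[OF z(1) C(1), symmetric] tcoord_pt[OF z(2) C(2), symmetric] e by (rule refl)
  then show "fst z = fst z'" using C by (intro tcoord_inj[of C]) (auto simp: around_def)
  show "snd z C = snd z' C"
  proof
    fix i show "snd z C i = snd z' C i" using fun_cong[OF e, of "Inr i"] by (simp add: jcoord_def)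
  qed
qed

lemma jcoord_image:
  assumes C: "adapted B C"
  shows "jcoord B C ` {z \<in> S. fst z \<in> fdom C} = overlap B K emb C C"
proof (intro equalityI subsetI)
  fix y assume "y \<in> jcoord B C ` {z \<in> S. fst z \<in> fdom C}"
  then obtain z where "z \<in> S" "around B C (fst z)" "y = jcoord B C z" using C by (auto simp: around_def)
  then show "y \<in> overlap B K emb C C" using jcoord_overlap by simp
next
  fix y assume "y \<in> overlap B K emb C C"
  then obtain z where "z \<in> S" "fst z \<in> fdom C" "jcoord B C z = y" by (rule overlap_pt[OF _ C])
  then show "y \<in> jcoord B C ` {z \<in> S. fst z \<in> fdom C}" by blast
qed

end

section \<open>The infinitesimal phase bundle\<close>

lemma contract_unit:
  assumes "i \<in> jidx k"
  shows "contract k j (\<lambda>q. if q = i then 1 else 0) = orderings (fst i) * j i"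
proof -
  have "contract k j (\<lambda>q. if q = i then 1 else 0) = (\<Sum>q\<in>jidx k. if q = i then orderings (fst i) * j i else 0)"
    unfolding contract_eq by (rule sum.cong) auto
  then show ?thesis using assms by (simp add: sum.delta[OF finite_jidx])
qed

lemma contract_unit_eq:
  assumes "i \<in> jidx k" "contract k j (\<lambda>q. if q = i then 1 else 0) = contract k j' (\<lambda>q. if q = i then 1 else 0)"
  shows "j i = j' i"
  using assms orderings_pos[of "fst i"] by (simp add: contract_unit)

lemma unit_coord_space: "i \<in> K \<Longrightarrow> (\<lambda>q. if q = i then 1 else 0) \<in> coord_space K"
  by (auto simp: coord_space_def)

lemma case_sum_Plus_coord_space:
  "case_sum u v \<in> coord_space (K <+> K') \<longleftrightarrow> u \<in> coord_space K \<and> v \<in> coord_space K'"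
  by (force simp: coord_space_def split: sum.split)

lemma Plus_coord_space:
  assumes "y \<in> coord_space (K <+> K')"
  shows "(\<lambda>i. y (Inl i)) \<in> coord_space K" "(\<lambda>i. y (Inr i)) \<in> coord_space K'"
  using assms by (auto simp: coord_space_def)

text \<open>Chooses momenta for given currents: those of order at least one become totally symmetric
  momenta with zero divergence. The order-zero current has no momentum of its own and is stored as
  one diagonal derivative, where \<open>undefined\<close> merely names a fixed direction.\<close>

definition inf_lift :: "nat \<Rightarrow> (('n, 'm) iidx \<Rightarrow> real) \<Rightarrow> ('n, 'm) p1idx \<Rightarrow> real" where
  "inf_lift k u = mkw k (\<lambda>i. u (Inl i)) (\<lambda>(I, \<rho>, a). if size I < k then u (Inr (add_mset \<rho> I, a)) else 0)
     (\<lambda>((I, \<rho>, a), \<kappa>). if I = {#} \<and> \<rho> = undefined \<and> \<kappa> = undefined then u (Inr ({#}, a)) else 0)"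

text \<open>Reads off the k-jet and the currents. A top-order jet coordinate is taken from a
  derivative slot, with an arbitrary choice of the index split off.\<close>

definition inf_proj :: "nat \<Rightarrow> (('n::finite, 'm) p1idx \<Rightarrow> real) \<Rightarrow> ('n, 'm) iidx \<Rightarrow> real" where
  "inf_proj k v = case_sum (\<lambda>(I, a). if size I \<le> k - 1 then v (Inl (Inl (I, a)))
     else if size I = k then let \<rho> = SOME \<rho>. \<rho> \<in># I in v (Inr (Inl (I - {#\<rho>#}, a), \<rho>)) else 0) (cur k v)"

lemma smooth_jlift: "smooth_fun K U (\<lambda>u. jlift k (\<lambda>i. u (g i)) r)"
  using jlift_coord[of k r] by (elim disjE exE) (simp_all add: smooth_coord smooth_const)

lemma smooth_inf_lift: "smooth_fun K U (\<lambda>u. inf_lift k u r)"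
proof (cases r rule: p1idx_cases)
  case (1 i)
  then show ?thesis by (simp only: inf_lift_def mkw_simps smooth_jlift)
next
  case (2 i)
  obtain I \<rho> a where "i = (I, \<rho>, a)" by (cases i) auto
  then show ?thesis using 2
    unfolding inf_lift_def by (simp only: mkw_simps prod.case) (intro smooth_if smooth_coord smooth_const)
next
  case (3 i \<rho>)
  then show ?thesis by (simp only: inf_lift_def mkw_simps smooth_jlift)
next
  case (4 i \<kappa>)
  obtain I \<rho> a where "i = (I, \<rho>, a)" by (cases i) auto
  then show ?thesis using 4
    unfolding inf_lift_def by (simp only: mkw_simps prod.case) (intro smooth_if smooth_coord smooth_const)
qed

lemma smooth_inf_proj:
  assumes "finite K" "open_in K U"
  shows "smooth_fun K U (\<lambda>v. inf_proj k v r)"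
proof (cases r)
  case (Inl i)
  obtain I a where "i = (I, a)" by (cases i)
  then show ?thesis using Inl
    unfolding inf_proj_def Let_def by (simp only: sum.case prod.case) (intro smooth_if smooth_coord smooth_const)
next
  case (Inr i)
  then show ?thesis using smooth_cur[OF assms] by (simp add: inf_proj_def)
qed

lemma inf_lift_coord_space:
  assumes "k \<ge> 1"
  shows "inf_lift k u \<in> coord_space (pidx k <+> pidx k \<times> UNIV)"
  unfolding inf_lift_def by (rule mkw_coord_space) (use assms in auto)

lemma cur_inf_lift:
  fixes u :: "('n::finite, 'm) iidx \<Rightarrow> real"
  assumes k: "k \<ge> 1" and u: "u \<in> coord_space (jidx k <+> jidx k)"
  shows "cur k (inf_lift k u) = (\<lambda>i. u (Inr i))"
proof
  fix i :: "('n, 'm) jidx"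
  obtain I a where i: "i = (I, a)" by (cases i)
  have s: "symmetrised (\<lambda>i. inf_lift k u (Inl (Inr i))) (I, a) = u (Inr (I, a))" if I: "size I \<le> k" "size I \<ge> 1"
  proof -
    have "inf_lift k u (Inl (Inr (mset (butlast \<mu>s), last \<mu>s, a))) = u (Inr (I, a))"
      if "\<mu>s \<in> permutations_of_multiset I" for \<mu>s
    proof -
      have m: "mset \<mu>s = I" using that by (simp add: permutations_of_multiset_def)
      then have n: "\<mu>s \<noteq> []" "length \<mu>s = size I" using I(2) by auto
      show ?thesis using add_mset_last_butlast[OF m n(1)] n I by (simp add: inf_lift_def)
    qed
    then show ?thesis using orderings_pos[of I] by (simp add: symmetrised_def)
  qed
  have d: "(\<Sum>\<rho>\<in>UNIV. inf_lift k u (Inr (Inr (I, \<rho>, a), \<rho>))) = (if I = {#} then u (Inr ({#}, a)) else 0)"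
    by (simp add: inf_lift_def)
  have out: "u (Inr (I, a)) = 0" if "size I > k"
  proof -
    have "Inr (I, a) \<notin> (jidx k <+> jidx k :: ('n, 'm) iidx set)" using that by auto
    then show ?thesis using u unfolding coord_space_def by blast
  qed
  have n: "size I \<ge> 1" if "I \<noteq> {#}" using that by (simp add: Suc_le_eq nonempty_has_size)
  consider "I = {#}" | "I \<noteq> {#}" "size I < k" | "I \<noteq> {#}" "size I = k" | "size I > k"
    using linorder_less_linear[of "size I" k] by blast
  then show "cur k (inf_lift k u) i = u (Inr i)"
  proof cases
    case 1
    then show ?thesis using k d unfolding i cur_def by simp
  next
    case 2
    then show ?thesis using s n d unfolding i cur_def by simp
  next
    case 3
    then show ?thesis using s n unfolding i cur_def by simp
  next
    case 4
    then show ?thesis using out unfolding i cur_def by simp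
  qed
qed

lemma hol_inf_lift:
  assumes "u \<in> coord_space (jidx k <+> jidx k)"
  shows "hol k (\<lambda>i. u (Inl i)) (inf_lift k u)"
  using Plus_coord_space(1)[OF assms] by (simp add: hol_def inf_lift_def pj_mkw)

lemma inf_proj_hol:
  fixes u :: "('n::finite, 'm) jidx \<Rightarrow> real"
  assumes h: "hol k u v" and k: "k \<ge> 1"
  shows "inf_proj k v = case_sum u (cur k v)"
proof
  fix r :: "('n, 'm) iidx"
  have uc: "u \<in> coord_space (jidx k)" and e: "\<And>q. pj v q = jlift (k - 1) u q" using h by (simp_all add: hol_def)
  show "inf_proj k v r = case_sum u (cur k v) r"
  proof (cases r)
    case (Inl i)
    obtain I a where i: "i = (I, a)" by (cases i)
    consider "size I \<le> k - 1" | "size I = k" | "size I > k" by linarith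
    then show ?thesis
    proof cases
      case 1
      then show ?thesis using e[of "Inl (I, a)"] Inl i by (simp add: inf_proj_def pj_def jlift_def)
    next
      case 2
      have nle: "\<not> size I \<le> k - 1" using 2 k by linarith
      define \<rho> where "\<rho> = (SOME \<rho>. \<rho> \<in># I)"
      have "I \<noteq> {#}" using 2 k by auto
      then obtain \<rho>' where "\<rho>' \<in># I" by (rule multiset_nonemptyE)
      then have "\<rho> \<in># I" unfolding \<rho>_def by (rule someI)
      then obtain I' where I: "I = add_mset \<rho> I'" by (metis multi_member_split)
      have "inf_proj k v r = v (Inr (Inl (I - {#\<rho>#}, a), \<rho>))"
        using nle unfolding inf_proj_def \<rho>_def Let_def Inl i by (simp add: 2)
      also have "\<dots> = u (I, a)"
        using e[of "Inr ((I', a), \<rho>)"] 2 I by (simp add: pj_def jlift_def)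
      finally show ?thesis using Inl i by simp
    next
      case 3
      then show ?thesis using uc Inl i by (auto simp: inf_proj_def coord_space_def)
    qed
  qed (simp add: inf_proj_def)
qed

context phase begin

text \<open>By covariance the contractions with every vertical vector agree in \<open>C'\<close>; a
  vector that is a unit vector in \<open>C'\<close> isolates one component.\<close>

lemma current_eq_chart:
  assumes w: "w \<in> HolPhase B k" "w' \<in> HolPhase B k" "kjet B k w = kjet B k w'"
    and C: "around B C (fst w)" "around B C' (fst w)" and e: "current k w C = current k w' C"
  shows "current k w C' = current k w' C'"
proof
  fix i
  have fw: "fst w' = fst w" using HolPhaseD(3)[OF w(1)] HolPhaseD(3)[OF w(2)] w(3) by simp
  show "current k w C' i = current k w' C' i"
  proof (cases "i \<in> jidx k")
    case True
    obtain v where v: "v \<in> vertical_tangent B (Jet B k) (kjet B k w)" "v C' = (\<lambda>q. if q = i then 1 else 0)"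
      using J.tangent_ex[OF HolPhaseD(2)[OF w(1)] _ unit_coord_space[OF True], of C'] C HolPhaseD(3)[OF w(1)] by auto
    have "contract k (current k w C') (v C') = contract k (current k w' C') (v C')"
      using current_covariant[OF w(1) C(2,1) v(1)] current_covariant[OF w(2), of C' C v] v(1) C w(3) fw e by simp
    then show ?thesis unfolding v(2) by (rule contract_unit_eq[OF True])
  next
    case False
    then have "cur k y i = 0" for y using cur_coord_space[of k y] unfolding coord_space_def by blast
    then show ?thesis by (simp add: current_cur)
  qed
qed

lemma iota_simps [simp]: "fst (iota w) = fst w"
  "around B C (fst w) \<Longrightarrow> snd (iota w) C = case_sum (snd (kjet B k w) C) (current k w C)"
  by (simp_all add: iota_def)

lemma iota_eqI:
  assumes w: "w \<in> HolPhase B k" "w' \<in> HolPhase B k" "kjet B k w = kjet B k w'"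
    and C: "around B C (fst w)" and e: "current k w C = current k w' C"
  shows "iota w = iota w'"
proof -
  have fw: "fst w = fst w'" using HolPhaseD(3)[OF w(1)] HolPhaseD(3)[OF w(2)] w(3) by simp
  have "current k w C' = current k w' C'" if "around B C' (fst w')" for C'
    by (rule current_eq_chart[OF w C _ e]) (use that fw in simp)
  then show ?thesis unfolding iota_def fw w(3) by (simp cong: if_cong)
qed

lemma left_iota:
  assumes w: "w \<in> HolPhase B k"
  shows "left (iota w) = kjet B k w"
proof (rule prod_eqI)
  show "snd (left (iota w)) = snd (kjet B k w)"
  proof (intro ext)
    fix C i
    show "snd (left (iota w)) C i = snd (kjet B k w) C i"
      using J.pt_zero[OF HolPhaseD(2)[OF w], of C i] HolPhaseD(3)[OF w]
      by (cases "around B C (fst w)") (simp_all add: left_def iota_def)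
  qed
qed (simp add: left_def HolPhaseD(3)[OF w])

lemma HolPhase_inf_lift:
  assumes C: "around B C e" and u: "u \<in> coord_space (jidx k <+> jidx k)" and e: "\<And>a. u (Inl ({#}, a)) = fcoord C e a"
  obtains w where "w \<in> HolPhase B k" "fst w = e" "snd w C = inf_lift k u"
    "snd (kjet B k w) C = (\<lambda>i. u (Inl i))" "current k w C = (\<lambda>i. u (Inr i))"
proof -
  have "\<exists>w\<in>J1 B (Phase B k). fst w = e \<and> snd w C = inf_lift k u"
    by (rule Q1.pt_ex[OF C inf_lift_coord_space[OF k]]) (simp add: inf_lift_def jlift_def e)
  then obtain w where w: "w \<in> J1 B (Phase B k)" "fst w = e" "snd w C = inf_lift k u" by blast
  have "hol k (\<lambda>i. u (Inl i)) (snd w C)" unfolding w(3) by (rule hol_inf_lift[OF u])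
  note h = HolPhase_intro[OF w(1) _ this]
  show ?thesis
    using that[OF h(1) w(2,3) h(2)] C w(2) cur_inf_lift[OF k u] by (simp add: current_cur w(3))
qed

text \<open>\<open>transfer\<close> from first jets of the phase bundle, with
  \<open>inf_lift\<close> as lift and \<open>inf_proj\<close> as its left inverse.\<close>

lemma InfPhase_coord_bundle: "coord_bundle B (iota ` HolPhase B k) (jidx k <+> jidx k) (\<lambda>a. Inl ({#}, a))"
proof (rule Q1.transfer[where E = "inf_lift k" and P = "inf_proj k"])
  show "finite (jidx k <+> jidx k :: ('n, 'm) iidx set)" by (simp add: finite_jidx)
  fix z' :: "('x, 'e, 'n, 'm, ('n, 'm) iidx) pt" and C assume z: "z' \<in> iota ` HolPhase B k"
  then obtain w where w: "w \<in> HolPhase B k" "z' = iota w" by blast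
  show "fst z' \<in> tspace B" using w HolPhaseD(6) by simp
  show "snd z' C i = 0" if "\<not> around B C (fst z')" for i using w that by (simp add: iota_def)
  have J: "kjet B k w \<in> Jet B k" "fst (kjet B k w) = fst w" using HolPhaseD(2,3)[OF w(1)] by auto
  assume C: "around B C (fst z')"
  then have C': "around B C (fst w)" "around B C (fst (kjet B k w))" using w J by simp_all
  show zK: "snd z' C \<in> coord_space (jidx k <+> jidx k)"
    using J.pt_coord[OF J(1) C'(2)] C' cur_coord_space[of k] by (simp add: w(2) case_sum_Plus_coord_space current_cur)
  show ze: "snd z' C (Inl ({#}, a)) = fcoord C (fst z') a" for a
    using J.pt_emb[OF J(1) C'(2), of a] C' J(2) by (simp add: w(2))
  \<comment> \<open>\<open>w'\<close> is a standard representative, lifted in \<open>C\<close>, and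
    may differ from \<open>w\<close>. Sharing the k-jet and, in \<open>C\<close>, the currents with
    \<open>w\<close>, it has the same image under \<open>iota\<close>, hence the right coordinates
    in every chart.\<close>
  obtain w' where w': "w' \<in> HolPhase B k" "fst w' = fst z'" "snd w' C = inf_lift k (snd z' C)"
    "snd (kjet B k w') C = (\<lambda>i. snd z' C (Inl i))" "current k w' C = (\<lambda>i. snd z' C (Inr i))"
    by (rule HolPhase_inf_lift[OF C zK ze])
  have cw: "around B C (fst w')" using C w'(2) by simp
  have "kjet B k w' = kjet B k w"
    by (rule J.pt_eqI[OF HolPhaseD(2)[OF w'(1)] J(1), of C]) (use HolPhaseD(3)[OF w'(1)] J w'(2,4) C' w(2) cw in simp_all)
  then have ww: "iota w' = z'"
    unfolding w(2) by (rule iota_eqI[OF w'(1) w(1) _ cw]) (use w'(5) w(2) C' in simp)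
  have "snd z' C' = inf_proj k (snd w' C')" if "around B C' (fst z')" for C'
  proof -
    have a: "around B C' (fst w')" using that w'(2) by simp
    show ?thesis unfolding ww[symmetric] iota_simps(2)[OF a] inf_proj_hol[OF HolPhaseD(5)[OF w'(1) a] k] current_cur ..
  qed
  then show "\<exists>z\<in>J1 B (Phase B k). fst z = fst z' \<and> snd z C = inf_lift k (snd z' C) \<and>
      (\<forall>C'. around B C' (fst z') \<longrightarrow> snd z' C' = inf_proj k (snd z C'))"
    by (intro bexI[OF _ HolPhaseD(1)[OF w'(1)]] conjI allI impI w'(2,3))
next
  fix C e and u :: "('n, 'm) iidx \<Rightarrow> real"
  assume C: "around B C e" and u: "u \<in> coord_space (jidx k <+> jidx k)" "\<And>a. u (Inl ({#}, a)) = fcoord C e a"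
  obtain w where w: "w \<in> HolPhase B k" "fst w = e" "snd w C = inf_lift k u"
    "snd (kjet B k w) C = (\<lambda>i. u (Inl i))" "current k w C = (\<lambda>i. u (Inr i))"
    by (rule HolPhase_inf_lift[OF C u])
  have "snd (iota w) C = u" using w C by (auto simp: fun_eq_iff split: sum.split)
  then show "\<exists>z\<in>iota ` HolPhase B k. fst z = e \<and> snd z C = u"
    by (intro bexI[OF _ imageI[OF w(1)]] conjI) (simp_all add: w(2))
next
  show "smooth_fun (jidx k <+> jidx k) (coord_space (jidx k <+> jidx k)) (\<lambda>u. inf_lift k u i)" for i :: "('n, 'm) p1idx"
    by (rule smooth_inf_lift)
  show "smooth_fun (pidx k <+> pidx k \<times> UNIV) (coord_space (pidx k <+> pidx k \<times> UNIV)) (\<lambda>v. inf_proj k v i)" for i :: "('n, 'm) iidx"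
    by (rule smooth_inf_proj[OF Q1.finite_K open_in_coord_space])
  show "inf_lift k u \<in> coord_space (pidx k <+> pidx k \<times> UNIV)" for u :: "('n, 'm) iidx \<Rightarrow> real"
    by (rule inf_lift_coord_space[OF k])
qed (auto simp: inf_lift_def jlift_def)

sublocale P: coord_bundle B "iota ` HolPhase B k" "jidx k <+> jidx k" "\<lambda>a. Inl ({#}, a)"
  by (rule InfPhase_coord_bundle)

end

section \<open>The graph of the differential of a Lagrangian\<close>

lemma theta_line: "theta k (\<lambda>i. y i + t * X i) Y = theta k y Y + t * contract k (\<lambda>i. X (Inr i)) (\<lambda>i. Y (Inl i))"
  unfolding theta_def contract_eq sum_distrib_left sum.distrib[symmetric]
  by (rule sum.cong[OF refl]) (simp add: algebra_simps)

lemma omega_eq: "omega k y X Y =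
    contract k (\<lambda>i. X (Inr i)) (\<lambda>i. Y (Inl i)) - contract k (\<lambda>i. Y (Inr i)) (\<lambda>i. X (Inl i))"
proof -
  have "((\<lambda>t. theta k (\<lambda>i. y i + t * X i) Y) has_real_derivative
      contract k (\<lambda>i. X (Inr i)) (\<lambda>i. Y (Inl i))) (at 0)" for X Y
    unfolding theta_line by (auto intro!: derivative_eq_intros)
  from DERIV_imp_deriv[OF this] show ?thesis by (simp add: omega_def ext_deriv_def)
qed

locale lagrangian = phase B k
  for B :: "('x, 'e, 'n::finite, 'm::finite) fbundle" and k +
  fixes L :: "('x, 'e, 'n, 'm) density"
  assumes L: "lagrangian_density B k L"
begin

abbreviation chart_dom :: "('x, 'e, 'n, 'm) fchart \<Rightarrow> ('n + ('n, 'm) jidx \<Rightarrow> real) set" where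
  "chart_dom C \<equiv> overlap B (jidx k) (\<lambda>a. ({#}, a)) C C"

abbreviation "lag \<equiv> lagr_fun B k L"

abbreviation "\<D> \<equiv> inf_coords B k ` delta_graph B k L"

text \<open>The symmetric coefficients, set to zero above order \<open>k\<close> so that they can be
  compared with currents as functions on all indices.\<close>

definition dlag :: "('x, 'e, 'n, 'm) fchart \<Rightarrow> ('n, 'm) jidx \<Rightarrow> ('n + ('n, 'm) jidx \<Rightarrow> real) \<Rightarrow> real" where
  "dlag C i y = (if i \<in> jidx k then pd (Inr i) (lag C) y / orderings (fst i) else 0)"

lemma smooth_lag:
  assumes C: "adapted B C"
  shows "smooth_fun (bidx (jidx k)) (chart_dom C) (lag C)"
  unfolding J.jcoord_image[OF C, symmetric] bidx_def using L C unfolding lagrangian_density_def by blast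

lemma smooth_dlag:
  assumes C: "adapted B C"
  shows "smooth_fun (bidx (jidx k)) (chart_dom C) (dlag C i)"
  unfolding dlag_def
  by (intro smooth_if smooth_divide[OF J.finite_bK overlap_open[OF C C]] smooth_pd[OF smooth_lag[OF C]] smooth_const) simp

lemma dlag_coord_space: "(\<lambda>i. dlag C i y) \<in> coord_space (jidx k)"
  by (simp add: coord_space_def dlag_def)

lemma dL_dphi_dlag: "i \<in> jidx k \<Longrightarrow> dL_dphi B k L C z i = dlag C i (jcoord B C z)"
  by (cases i) (simp add: dL_dphi_def dlag_def)

lemma fibre_deriv_dlag: "fibre_deriv B k L z v C = contract k (\<lambda>i. dlag C i (jcoord B C z)) (v C)"
  unfolding fibre_deriv_def contract_eq
proof (rule sum.cong[OF refl])
  fix i :: "('n, 'm) jidx" assume "i \<in> jidx k"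
  then show "pd (Inr i) (lag C) (jcoord B C z) * v C i = orderings (fst i) * (dlag C i (jcoord B C z) * v C i)"
    using orderings_pos[of "fst i"] by (simp add: dlag_def)
qed

lemma lag_jcoord:
  assumes z: "z \<in> Jet B k" and C: "around B C (fst z)"
  shows "lag C (jcoord B C z) = L z C"
proof -
  have "inj_on (jcoord B C) {z \<in> Jet B k. fst z \<in> fdom C}"
    by (rule inj_onI, rule J.jcoord_inj[of _ _ C]) (use C in \<open>auto simp: around_def\<close>)
  then have "inv_into {z \<in> Jet B k. fst z \<in> fdom C} (jcoord B C) (jcoord B C z) = z"
    by (rule inv_into_f_f) (use z C in \<open>simp add: around_def\<close>)
  then show ?thesis by (simp add: lagr_fun_def)
qed

lemma L_DERIV:
  assumes c: "vertical_curve B (Jet B k) x T \<gamma>" and T: "open T" "t \<in> T" and C: "around B C (fst (\<gamma> t))"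
  shows "((\<lambda>s. L (\<gamma> s) C) has_real_derivative fibre_deriv B k L (\<gamma> t) (velocity B \<gamma> t) C) (at t)"
proof -
  have Ca: "adapted B C" using C by (simp add: around_def)
  have op: "open {t\<in>T. fst (\<gamma> t) \<in> fdom C}" using vertical_curve_open[OF c Ca] .
  have tT: "t \<in> {t\<in>T. fst (\<gamma> t) \<in> fdom C}" using C T by (simp add: around_def)
  have ev: "\<forall>\<^sub>F s in nhds t. lag C (jcoord B C (\<gamma> s)) = L (\<gamma> s) C"
    using eventually_nhds_in_open[OF op tT]
  proof eventually_elim
    case (elim s)
    then show ?case using vertical_curve_in[OF c, of s] Ca by (intro lag_jcoord) (auto simp: around_def)
  qed
  have "((\<lambda>s. lag C (jcoord B C (\<gamma> s))) has_real_derivative fibre_deriv B k L (\<gamma> t) (velocity B \<gamma> t) C) (at t)"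
    unfolding fibre_deriv_def by (rule J.curve_chain[OF c T C C smooth_lag[OF Ca]])
  then show ?thesis using DERIV_cong_ev[OF refl ev refl] by simp
qed

text \<open>\<open>L\<close> is a density, and the Jacobian determinant depends only on the base
  point, so it is constant along a vertical curve and passes through the derivative.\<close>

lemma fibre_deriv_covariant:
  assumes v: "v \<in> vertical_tangent B (Jet B k) z" and C: "around B C (fst z)" "around B C' (fst z)"
  shows "fibre_deriv B k L z v C = jdet C C' (proj B (fst z)) * fibre_deriv B k L z v C'"
proof -
  obtain \<gamma> \<epsilon> where g: "v = velocity B \<gamma> 0" "\<epsilon> > 0"
    "vertical_curve B (Jet B k) (proj B (fst z)) {-\<epsilon><..<\<epsilon>} \<gamma>" "\<gamma> 0 = z"
    using v by (auto simp: vertical_tangent_def)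
  let ?T = "{-\<epsilon><..<\<epsilon>}"
  have z0: "0 \<in> ?T" "open ?T" using g(2) by auto
  have Ca: "adapted B C" "adapted B C'" using C by (auto simp: around_def)
  have op: "open ({t\<in>?T. fst (\<gamma> t) \<in> fdom C} \<inter> {t\<in>?T. fst (\<gamma> t) \<in> fdom C'})"
    by (rule open_Int[OF vertical_curve_open[OF g(3) Ca(1)] vertical_curve_open[OF g(3) Ca(2)]])
  have tT: "0 \<in> {t\<in>?T. fst (\<gamma> t) \<in> fdom C} \<inter> {t\<in>?T. fst (\<gamma> t) \<in> fdom C'}"
    using C z0 g(4) by (simp add: around_def)
  have ev: "\<forall>\<^sub>F s in nhds 0. L (\<gamma> s) C = jdet C C' (proj B (fst z)) * L (\<gamma> s) C'"
    using eventually_nhds_in_open[OF op tT]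
  proof eventually_elim
    case (elim s)
    then have s: "\<gamma> s \<in> Jet B k" "proj B (fst (\<gamma> s)) = proj B (fst z)" "around B C (fst (\<gamma> s))" "around B C' (fst (\<gamma> s))"
      using vertical_curve_in[OF g(3), of s] Ca by (auto simp: around_def)
    have "top_form B (fst (\<gamma> s)) (L (\<gamma> s))" using L s(1) unfolding lagrangian_density_def by blast
    then show ?case using s(3,4) unfolding s(2)[symmetric] top_form_def by blast
  qed
  have a: "around B C (fst (\<gamma> 0))" "around B C' (fst (\<gamma> 0))" using C g(4) by simp_all
  note d = L_DERIV[OF g(3) z0(2,1) a(1)] L_DERIV[OF g(3) z0(2,1) a(2)]
  have "((\<lambda>s. L (\<gamma> s) C) has_real_derivative jdet C C' (proj B (fst z)) * fibre_deriv B k L (\<gamma> 0) (velocity B \<gamma> 0) C') (at 0)"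
    using DERIV_cmult[OF d(2)] DERIV_cong_ev[OF refl ev refl] by simp
  from DERIV_unique[OF d(1) this] show ?thesis by (simp add: g(1,4))
qed

text \<open>Membership is a condition in all charts, but the contraction with the currents and the
  fibre derivative acquire the same determinant under a change of chart. Hence one chart decides,
  and there unit vectors give equality of components.\<close>

lemma delta_graph_iff:
  assumes w: "w \<in> HolPhase B k" and C: "around B C (fst w)"
  shows "same_leaf B k `` {w} \<in> delta_graph B k L \<longleftrightarrow> current k w C = (\<lambda>i. dlag C i (jcoord B C (kjet B k w)))"
proof
  have kw: "kjet B k w \<in> Jet B k" "fst (kjet B k w) = fst w" using HolPhaseD(2,3)[OF w] by auto
  have q: "same_leaf B k `` {w} \<in> InfPhase B k" unfolding InfPhase_def using w by (rule quotientI)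
  have iff: "same_leaf B k `` {w} \<in> delta_graph B k L \<longleftrightarrow> (\<forall>v\<in>vertical_tangent B (Jet B k) (kjet B k w).
      \<forall>C. around B C (fst w) \<longrightarrow> contract k (current k w C) (v C) = fibre_deriv B k L (kjet B k w) v C)"
    using q by (simp add: delta_graph_def Let_def inf_coords_iota[OF w] left_iota[OF w] cong: conj_cong)
  {
    assume "same_leaf B k `` {w} \<in> delta_graph B k L"
    then have e: "contract k (current k w C) (v C) = fibre_deriv B k L (kjet B k w) v C"
      if "v \<in> vertical_tangent B (Jet B k) (kjet B k w)" for v using that C iff by blast
    show "current k w C = (\<lambda>i. dlag C i (jcoord B C (kjet B k w)))"
    proof
      fix i
      show "current k w C i = dlag C i (jcoord B C (kjet B k w))"
      proof (cases "i \<in> jidx k")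
        case True
        obtain v where v: "v \<in> vertical_tangent B (Jet B k) (kjet B k w)" "v C = (\<lambda>q. if q = i then 1 else 0)"
          using J.tangent_ex[OF kw(1) _ unit_coord_space[OF True], of C] C kw by auto
        have "contract k (current k w C) (v C) = contract k (\<lambda>i. dlag C i (jcoord B C (kjet B k w))) (v C)"
          using e[OF v(1)] by (simp only: fibre_deriv_dlag)
        from contract_unit_eq[OF True this[unfolded v(2)]] show ?thesis .
      next
        case False
        then have "cur k y i = 0" for y using cur_coord_space[of k y] unfolding coord_space_def by blast
        then show ?thesis using False by (simp add: current_cur dlag_def)
      qed
    qed
  }
  assume e: "current k w C = (\<lambda>i. dlag C i (jcoord B C (kjet B k w)))"
  have "contract k (current k w C') (v C') = fibre_deriv B k L (kjet B k w) v C'"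
    if v: "v \<in> vertical_tangent B (Jet B k) (kjet B k w)" and C': "around B C' (fst w)" for v C'
  proof -
    have "contract k (current k w C') (v C') = jdet C' C (proj B (fst w)) * fibre_deriv B k L (kjet B k w) v C"
      unfolding current_covariant[OF w C' C v] e fibre_deriv_dlag by (rule refl)
    also have "\<dots> = fibre_deriv B k L (kjet B k w) v C'"
      using fibre_deriv_covariant[OF v, of C' C] C C' kw(2) by simp
    finally show ?thesis .
  qed
  then show "same_leaf B k `` {w} \<in> delta_graph B k L" using iff by blast
qed

lemma graph_subset: "\<D> \<subseteq> iota ` HolPhase B k"
  unfolding inf_coords_InfPhase[symmetric] by (intro image_mono) (auto simp: delta_graph_def)

lemma graph_iff:
  assumes z: "z \<in> iota ` HolPhase B k" and C: "around B C (fst z)"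
  shows "z \<in> \<D> \<longleftrightarrow> (\<lambda>i. snd z C (Inr i)) = (\<lambda>i. dlag C i (jcoord B C (left z)))"
proof
  assume "z \<in> \<D>"
  then obtain c where c: "c \<in> delta_graph B k L" "z = inf_coords B k c" by blast
  then have "c \<in> HolPhase B k // same_leaf B k" by (simp add: delta_graph_def InfPhase_def)
  then obtain w where w: "w \<in> HolPhase B k" "c = same_leaf B k `` {w}" by (rule quotientE)
  have zw: "z = iota w" using c(2) w inf_coords_iota by simp
  have "current k w C = (\<lambda>i. dlag C i (jcoord B C (kjet B k w)))"
    using delta_graph_iff[OF w(1), of C] c(1) w(2) C zw by simp
  then show "(\<lambda>i. snd z C (Inr i)) = (\<lambda>i. dlag C i (jcoord B C (left z)))"
    using C by (simp add: zw left_iota[OF w(1)])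
next
  assume e: "(\<lambda>i. snd z C (Inr i)) = (\<lambda>i. dlag C i (jcoord B C (left z)))"
  obtain w where w: "w \<in> HolPhase B k" "z = iota w" using z by blast
  have "current k w C = (\<lambda>i. dlag C i (jcoord B C (kjet B k w)))"
    using e C by (simp add: w(2) left_iota[OF w(1)])
  then have "same_leaf B k `` {w} \<in> delta_graph B k L" using delta_graph_iff[OF w(1), of C] C w(2) by simp
  then show "z \<in> \<D>" using inf_coords_iota[OF w(1)] w(2) by (metis imageI)
qed

lemma left_InfPhase: "z \<in> iota ` HolPhase B k \<Longrightarrow> left z \<in> Jet B k"
  using left_iota HolPhaseD(2) by auto

lemma left_curve:
  assumes "vertical_curve B (iota ` HolPhase B k) x T \<gamma>"
  shows "vertical_curve B (Jet B k) x T (\<lambda>t. left (\<gamma> t))"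
  using assms left_InfPhase unfolding vertical_curve_def fibre_def by auto

lemma generating: "generating_formula B k L \<D>"
  unfolding generating_formula_def
proof (intro allI impI)
  fix x \<gamma> \<epsilon> C
  assume a: "\<epsilon> > 0 \<and> vertical_curve B \<D> x {-\<epsilon><..<\<epsilon>} \<gamma> \<and> around B C (fst (\<gamma> 0))"
  let ?T = "{-\<epsilon><..<\<epsilon>}"
  have T: "open ?T" "0 \<in> ?T" using a by auto
  have c: "vertical_curve B \<D> x ?T \<gamma>" and C: "around B C (fst (\<gamma> 0))" using a by auto
  have zD: "\<gamma> 0 \<in> \<D>" using vertical_curve_in[OF c T(2)] by blast
  have zP: "\<gamma> 0 \<in> iota ` HolPhase B k" by (rule subsetD[OF graph_subset zD])
  have cP: "vertical_curve B (iota ` HolPhase B k) x ?T \<gamma>"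
    by (rule vertical_curve_codomain[OF c subsetD[OF graph_subset]]) (use vertical_curve_in[OF c] in blast)
  have C': "around B C (fst (left (\<gamma> 0)))" using C by simp
  have "((\<lambda>s. L (left (\<gamma> s)) C) has_real_derivative
      contract k (\<lambda>i. snd (\<gamma> 0) C (Inr i)) (velocity B (\<lambda>t. left (\<gamma> t)) 0 C)) (at 0)"
    using L_DERIV[OF left_curve[OF cP] T C'] unfolding fibre_deriv_dlag graph_iff[OF zP C, THEN iffD1, OF zD] .
  moreover have "velocity B (\<lambda>t. left (\<gamma> t)) 0 C = (\<lambda>i. velocity B \<gamma> 0 C (Inl i))"
    by (rule ext) (rule left_J1_velocity)
  ultimately show "((\<lambda>t. L (left (\<gamma> t)) C) has_real_derivative theta k (snd (\<gamma> 0) C) (velocity B \<gamma> 0 C)) (at 0)"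
    by (simp add: theta_def)
qed

subsection \<open>Tangent spaces of the graph\<close>

definition hess :: "('x, 'e, 'n, 'm) fchart \<Rightarrow> ('n + ('n, 'm) jidx \<Rightarrow> real) \<Rightarrow> ('n, 'm) jidx \<Rightarrow> ('n, 'm) jidx \<Rightarrow> real" where
  "hess C y i j = pd (Inr j) (dlag C i) y"

text \<open>\<open>dlag C i\<close> carries the factor \<open>1 / orderings (fst i)\<close>, so
  \<open>hess\<close> alone need not be symmetric. The weights of \<open>contract\<close> restore
  the plain second derivatives, which commute.\<close>

lemma hess_symmetric:
  assumes C: "adapted B C" and y: "y \<in> chart_dom C" and ij: "i \<in> jidx k" "j \<in> jidx k"
  shows "orderings (fst i) * hess C y i j = orderings (fst j) * hess C y j i"
proof -
  have *: "orderings (fst i) * hess C y i j = pd (Inr j) (pd (Inr i) (lag C)) y" if ij: "i \<in> jidx k" "j \<in> jidx k" for i j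
  proof -
    have "dlag C i = (\<lambda>y. 1 / orderings (fst i) * pd (Inr i) (lag C) y)" using ij by (auto simp: dlag_def)
    then have "hess C y i j = 1 / orderings (fst i) * pd (Inr j) (pd (Inr i) (lag C)) y"
      unfolding hess_def
      using smooth_pd_cmult[OF smooth_pd[OF smooth_lag[OF C]] y, of "Inr i" "Inr j" "1 / orderings (fst i)"] ij by simp
    then show ?thesis using orderings_pos[of "fst i"] by simp
  qed
  show ?thesis
    unfolding *[OF ij] *[OF ij(2,1)]
    by (rule pd_commute[OF J.finite_bK overlap_open[OF C C] smooth_lag[OF C] y]) (use ij in simp_all)
qed

lemma hess_outside: "i \<notin> jidx k \<Longrightarrow> hess C y i j = 0"
proof -
  assume "i \<notin> jidx k"
  then have "dlag C i = (\<lambda>_. 0)" by (auto simp: dlag_def)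
  then show ?thesis by (simp add: hess_def pd_const)
qed

lemma left_chart_dom:
  assumes "z \<in> iota ` HolPhase B k" "around B C (fst z)"
  shows "jcoord B C (left z) \<in> chart_dom C"
  using J.jcoord_overlap[OF left_InfPhase[OF assms(1)], of C C] assms(2) by simp

lemma graph_tangentD:
  assumes X: "X \<in> vertical_tangent B \<D> z" and C: "around B C (fst z)"
  shows "X C (Inr i) = (\<Sum>j\<in>jidx k. hess C (jcoord B C (left z)) i j * X C (Inl j))"
proof -
  have Ca: "adapted B C" using C by (simp add: around_def)
  obtain \<gamma> \<epsilon> where g: "X = velocity B \<gamma> 0" "\<epsilon> > 0" "vertical_curve B \<D> (proj B (fst z)) {-\<epsilon><..<\<epsilon>} \<gamma>" "\<gamma> 0 = z"
    using X by (auto simp: vertical_tangent_def)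
  let ?T = "{-\<epsilon><..<\<epsilon>}"
  have T: "open ?T" "0 \<in> ?T" using g(2) by auto
  have gD: "\<gamma> s \<in> \<D>" if "s \<in> ?T" for s using vertical_curve_in[OF g(3) that] by blast
  have cP: "vertical_curve B (iota ` HolPhase B k) (proj B (fst z)) ?T \<gamma>"
    by (rule vertical_curve_codomain[OF g(3) subsetD[OF graph_subset gD]])
  have op: "open {t\<in>?T. fst (\<gamma> t) \<in> fdom C}" using vertical_curve_open[OF g(3) Ca] .
  have tT: "0 \<in> {t\<in>?T. fst (\<gamma> t) \<in> fdom C}" using C T g(4) by (simp add: around_def)
  have ev: "\<forall>\<^sub>F s in nhds 0. snd (\<gamma> s) C (Inr i) = dlag C i (jcoord B C (left (\<gamma> s)))"
    using eventually_nhds_in_open[OF op tT]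
  proof eventually_elim
    case (elim s)
    then have s: "\<gamma> s \<in> \<D>" "around B C (fst (\<gamma> s))" using gD Ca by (auto simp: around_def)
    from fun_cong[OF graph_iff[OF subsetD[OF graph_subset s(1)] s(2), THEN iffD1, OF s(1)], of i] show ?case .
  qed
  have C0: "around B C (fst (\<gamma> 0))" "around B C (fst (left (\<gamma> 0)))" using C g(4) by simp_all
  have d: "((\<lambda>s. dlag C i (jcoord B C (left (\<gamma> s)))) has_real_derivative
      (\<Sum>j\<in>jidx k. pd (Inr j) (dlag C i) (jcoord B C (left (\<gamma> 0))) * velocity B (\<lambda>t. left (\<gamma> t)) 0 C j)) (at 0)"
    by (rule J.curve_chain[OF left_curve[OF cP] T C0(2) C0(2) smooth_dlag[OF Ca]])
  from velocity_eqI[OF ev d C0(1)]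
  show ?thesis unfolding g(1) hess_def left_J1_velocity g(4) .
qed

text \<open>A straight line in the jet coordinates is lifted into the graph by
  \<open>\<Psi>\<close>. Its velocity \<open>Y\<close> has the jet part of \<open>X\<close>, and by
  \<open>graph_tangentD\<close> a tangent vector of the graph is determined by its jet part, so
  \<open>Y\<close> is \<open>X\<close>.\<close>

lemma graph_tangentI:
  assumes z: "z \<in> \<D>" and C: "around B C (fst z)" and X: "X \<in> vertical_tangent B (iota ` HolPhase B k) z"
    and e: "\<And>i. X C (Inr i) = (\<Sum>j\<in>jidx k. hess C (jcoord B C (left z)) i j * X C (Inl j))"
  shows "X \<in> vertical_tangent B \<D> z"
proof -
  have Ca: "adapted B C" "fst z \<in> fdom C" using C by (simp_all add: around_def)
  have zP: "z \<in> iota ` HolPhase B k" by (rule subsetD[OF graph_subset z])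
  define x where "x = proj B (fst z)"
  define V where "V = {u \<in> coord_space (jidx k). case_sum (bcoord C x) u \<in> chart_dom C}"
  have s: "smooth_fun (jidx k) (coord_space (jidx k)) (\<lambda>u. case_sum (bcoord C x) u q)" for q :: "'n + ('n, 'm) jidx"
    by (cases q) (simp_all add: smooth_const smooth_coord)
  have oV: "open_in (jidx k) V" unfolding V_def
    by (rule open_in_preimage[OF open_in_coord_space s overlap_open[OF Ca(1) Ca(1)] case_sum_coord_space])
  have sV: "smooth_fun (jidx k) V (\<lambda>u. case_sum (bcoord C x) u q)" for q
    by (rule smooth_subset[OF s]) (auto simp: V_def)
  define \<Psi> where "\<Psi> = (\<lambda>u. case_sum u (\<lambda>i. dlag C i (case_sum (bcoord C x) u)))"
  have \<Psi>s: "smooth_fun (jidx k) V (\<lambda>u. \<Psi> u q)" for q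
  proof (cases q)
    case (Inr i)
    have "smooth_fun (jidx k) V (\<lambda>u. dlag C i (case_sum (bcoord C x) u))"
      by (rule smooth_compose[OF J.finite_bK overlap_open[OF Ca(1) Ca(1)] smooth_dlag[OF Ca(1)] _ J.finite_K oV sV])
        (simp add: V_def)
    then show ?thesis by (simp add: \<Psi>_def Inr)
  qed (simp add: \<Psi>_def smooth_coord)
  define a where "a = (\<lambda>i. snd z C (Inl i))"
  define b where "b = (\<lambda>i. X C (Inl i))"
  have ac: "a \<in> coord_space (jidx k)" unfolding a_def by (rule Plus_coord_space(1)[OF P.pt_coord[OF zP C]])
  have bc: "b \<in> coord_space (jidx k)" unfolding b_def by (rule Plus_coord_space(1)[OF P.tangent_coord[OF X C]])
  have jz: "jcoord B C (left z) = case_sum (bcoord C x) a"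
    by (auto simp: jcoord_def a_def x_def fun_eq_iff split: sum.split)
  have aV: "a \<in> V" using ac left_chart_dom[OF zP C] by (simp add: V_def jz)
  have \<Psi>V: "case_sum (bcoord C x) (\<Psi> u) \<in> overlap B (jidx k <+> jidx k) (\<lambda>a. Inl ({#}, a)) C C" if "u \<in> V" for u
    using that dlag_coord_space[of C]
    by (auto simp: overlap_def V_def \<Psi>_def intro!: case_sum_coord_space simp: case_sum_Plus_coord_space)
  let ?l = "\<lambda>t i. a i + t * b i"
  obtain \<gamma> where g: "vertical_curve B (iota ` HolPhase B k) x {t. ?l t \<in> V} \<gamma>"
    "\<And>t. ?l t \<in> V \<Longrightarrow> fst (\<gamma> t) \<in> fdom C \<and> snd (\<gamma> t) C = \<Psi> (?l t)"
    by (rule P.curve_ex[OF Ca(1) _ J.finite_K oV \<Psi>s ac bc \<Psi>V]) (simp_all add: x_def fdom_proj[OF Ca])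
  have "open {t. ?l t \<in> V}" by (rule smooth_real_line(1)[OF J.finite_K oV smooth_const ac bc])
  moreover have "0 \<in> {t. ?l t \<in> V}" using aV by simp
  ultimately obtain \<epsilon> where e0: "\<epsilon> > 0" "ball 0 \<epsilon> \<subseteq> {t. ?l t \<in> V}" using open_contains_ball by blast
  have ev: "{-\<epsilon><..<\<epsilon>} \<subseteq> {t. ?l t \<in> V}" using e0(2) by (auto simp: ball_def dist_real_def subset_iff)
  have lV: "?l t \<in> V" if "t \<in> {-\<epsilon><..<\<epsilon>}" for t using ev that by blast
  have gP: "vertical_curve B (iota ` HolPhase B k) x {-\<epsilon><..<\<epsilon>} \<gamma>"
    by (rule vertical_curve_subset[OF g(1) _ ev]) simp
  have gin: "\<gamma> t \<in> iota ` HolPhase B k" "proj B (fst (\<gamma> t)) = x" "around B C (fst (\<gamma> t))" if "t \<in> {-\<epsilon><..<\<epsilon>}" for t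
    using vertical_curve_in[OF gP that] g(2)[OF lV[OF that]] Ca(1) by (auto simp: around_def)
  have gD: "vertical_curve B \<D> x {-\<epsilon><..<\<epsilon>} \<gamma>"
  proof (rule vertical_curve_codomain[OF gP])
    fix t assume t: "t \<in> {-\<epsilon><..<\<epsilon>}"
    have "snd (\<gamma> t) C = \<Psi> (?l t)" using g(2)[OF lV[OF t]] by blast
    moreover have "jcoord B C (left (\<gamma> t)) = case_sum (bcoord C x) (?l t)"
      using g(2)[OF lV[OF t]] gin(2)[OF t] by (auto simp: jcoord_def \<Psi>_def fun_eq_iff split: sum.split)
    ultimately show "\<gamma> t \<in> \<D>" by (subst graph_iff[OF gin(1,3)[OF t]]) (simp add: \<Psi>_def)
  qed
  have z0: "0 \<in> {-\<epsilon><..<\<epsilon>}" using e0(1) by simp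
  have zi: "(\<lambda>i. snd z C (Inr i)) = (\<lambda>i. dlag C i (case_sum (bcoord C x) a))"
    using graph_iff[OF zP C] z unfolding jz by blast
  have "jcoord B C (\<gamma> 0) = jcoord B C z"
    using g(2)[OF lV[OF z0]] gin(2)[OF z0] fun_cong[OF zi]
    by (auto simp: jcoord_def \<Psi>_def x_def a_def fun_eq_iff split: sum.split)
  then have g0: "\<gamma> 0 = z" by (rule P.jcoord_inj[OF gin(1)[OF z0] zP gin(3)[OF z0] C])
  define Y where "Y = velocity B \<gamma> 0"
  have Y: "Y \<in> vertical_tangent B \<D> z"
    unfolding vertical_tangent_def Y_def using e0(1) gD g0 x_def by blast
  have YI: "Y C (Inl i) = b i" for i
    unfolding Y_def
  proof (rule velocity_eqI)
    have "\<forall>\<^sub>F s in nhds 0. s \<in> {-\<epsilon><..<\<epsilon>}" by (rule eventually_nhds_in_open[OF _ z0]) simp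
    then show "\<forall>\<^sub>F s in nhds 0. snd (\<gamma> s) C (Inl i) = a i + s * b i"
      by eventually_elim (use g(2)[OF lV] in \<open>simp add: \<Psi>_def\<close>)
    show "((\<lambda>s. a i + s * b i) has_real_derivative b i) (at 0)" by (auto intro!: derivative_eq_intros)
    show "around B C (fst (\<gamma> 0))" using gin(3)[OF z0] .
  qed
  have "Y C = X C"
  proof
    fix q show "Y C q = X C q"
    proof (cases q)
      case (Inl i)
      then show ?thesis using YI by (simp add: b_def)
    next
      case (Inr i)
      then show ?thesis using graph_tangentD[OF Y C, of i] e[of i] YI by (simp add: b_def)
    qed
  qed
  then have "Y = X" using P.tangent_eqI[OF _ X C, of Y] Y vertical_tangent_mono[OF graph_subset] by blast
  then show ?thesis using Y by simp
qed

text \<open>The tangent space is the graph of a map that is symmetric for the pairing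
  \<open>contract\<close>, which makes it isotropic; it projects onto all jet directions, which
  gives maximality without counting dimensions.\<close>

lemma graph_maximal_isotropic:
  assumes z: "z \<in> \<D>"
  shows "maximal_isotropic B k (vertical_tangent B (iota ` HolPhase B k) z) z (vertical_tangent B \<D> z)"
proof -
  let ?V = "vertical_tangent B (iota ` HolPhase B k) z" and ?W = "vertical_tangent B \<D> z"
  have zP: "z \<in> iota ` HolPhase B k" by (rule subsetD[OF graph_subset z])
  obtain C where C: "around B C (fst z)" using chart_ex[OF P.pt_tspace[OF zP]] by blast
  have WV: "?W \<subseteq> ?V" by (rule vertical_tangent_mono[OF graph_subset])
  define h where "h = (\<lambda>C. hess C (jcoord B C (left z)))"
  have tD: "X C (Inr i) = (\<Sum>j\<in>jidx k. h C i j * X C (Inl j))" if "X \<in> ?W" "around B C (fst z)" for X C i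
    unfolding h_def by (rule graph_tangentD[OF that])
  have tI: "X \<in> ?W" if "X \<in> ?V" "\<And>i. X C (Inr i) = (\<Sum>j\<in>jidx k. h C i j * X C (Inl j))" for X
    by (rule graph_tangentI[OF z C that(1)]) (rule that(2)[unfolded h_def])
  have hs: "orderings (fst i) * h C i j = orderings (fst j) * h C j i"
    if "around B C (fst z)" "i \<in> jidx k" "j \<in> jidx k" for C i j
    unfolding h_def using that by (intro hess_symmetric left_chart_dom[OF zP]) (simp_all add: around_def)
  have con: "contract k (\<lambda>i. \<Sum>j\<in>jidx k. h C i j * u j) v = (\<Sum>i\<in>jidx k. \<Sum>j\<in>jidx k. orderings (fst i) * h C i j * u j * v i)"
    for C u v unfolding contract_eq by (simp add: sum_distrib_left sum_distrib_right mult.assoc)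
  have sym: "contract k (\<lambda>i. \<Sum>j\<in>jidx k. h C i j * u j) v = contract k (\<lambda>i. \<Sum>j\<in>jidx k. h C i j * v j) u"
    if "around B C (fst z)" for C u v
    unfolding con
  proof (subst sum.swap, intro sum.cong refl)
    fix i j :: "('n, 'm) jidx" assume ij: "i \<in> jidx k" "j \<in> jidx k"
    have "orderings (fst j) * h C j i * u i * v j = (orderings (fst j) * h C j i) * (v j * u i)" by simp
    also have "\<dots> = (orderings (fst i) * h C i j) * (v j * u i)" unfolding hs[OF that ij] ..
    finally show "orderings (fst j) * h C j i * u i * v j = orderings (fst i) * h C i j * v j * u i" by simp
  qed
  have lin: "(\<lambda>C i. s * X C i + t * Y C i) \<in> ?W" if X: "X \<in> ?W" and Y: "Y \<in> ?W" for X Y s t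
  proof (rule tI)
    show "(\<lambda>C i. s * X C i + t * Y C i) \<in> ?V"
      by (rule P.tangent_linear[OF subsetD[OF WV X] subsetD[OF WV Y]])
    fix i
    show "s * X C (Inr i) + t * Y C (Inr i) = (\<Sum>j\<in>jidx k. h C i j * (s * X C (Inl j) + t * Y C (Inl j)))"
      unfolding tD[OF X C] tD[OF Y C] by (simp add: sum.distrib sum_distrib_left algebra_simps)
  qed
  have ex: "\<exists>Y\<in>?W. (\<lambda>i. Y C (Inl i)) = u" if u: "u \<in> coord_space (jidx k)" for u
  proof -
    have "(\<lambda>i. \<Sum>j\<in>jidx k. h C i j * u j) \<in> coord_space (jidx k)"
      by (simp add: coord_space_def h_def hess_outside)
    then obtain Y where Y: "Y \<in> ?V" "Y C = case_sum u (\<lambda>i. \<Sum>j\<in>jidx k. h C i j * u j)"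
      using P.tangent_ex[OF zP C] u case_sum_Plus_coord_space by blast
    have "Y \<in> ?W" by (rule tI[OF Y(1)]) (simp add: Y(2))
    then show ?thesis using Y(2) by (intro bexI[of _ Y]) auto
  qed
  have zero: "(\<lambda>_ _. 0) \<in> ?W"
  proof -
    obtain Y where "Y \<in> ?W" using ex[of "\<lambda>_. 0"] by (auto simp: coord_space_def)
    from lin[OF this this, of 0 0] show ?thesis by simp
  qed
  have iso: "isotropic B k z ?W"
    unfolding isotropic_def
  proof (intro conjI ballI allI impI zero lin)
    fix X Y C assume X: "X \<in> ?W" and Y: "Y \<in> ?W" and C: "around B C (fst z)"
    show "omega k (snd z C) (X C) (Y C) = 0"
      unfolding omega_eq tD[OF X C] tD[OF Y C] using sym[OF C] by simp
  qed
  \<comment> \<open>Isotropy of \<open>W'\<close> makes \<open>X\<close> orthogonal to all of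
    \<open>?W\<close>. Pairing \<open>X\<close> with the vectors over unit jet directions recovers
    its current components one by one.\<close>
  have "X \<in> ?W" if W': "?W \<subseteq> W'" "W' \<subseteq> ?V" "isotropic B k z W'" and X: "X \<in> W'" for W' X
  proof (rule tI)
    show XV: "X \<in> ?V" using X W'(2) by blast
    fix i
    show "X C (Inr i) = (\<Sum>j\<in>jidx k. h C i j * X C (Inl j))"
    proof (cases "i \<in> jidx k")
      case True
      obtain Y where Y: "Y \<in> ?W" "(\<lambda>i. Y C (Inl i)) = (\<lambda>q. if q = i then 1 else 0)"
        using ex[OF unit_coord_space[OF True]] by blast
      have "omega k (snd z C) (X C) (Y C) = 0"
        using W'(1,3) X Y(1) C unfolding isotropic_def by blast
      then have "contract k (\<lambda>i. X C (Inr i)) (\<lambda>i. Y C (Inl i)) = contract k (\<lambda>i. \<Sum>j\<in>jidx k. h C i j * X C (Inl j)) (\<lambda>i. Y C (Inl i))"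
        unfolding omega_eq tD[OF Y(1) C] using sym[OF C] by simp
      from contract_unit_eq[OF True this[unfolded Y(2)]] show ?thesis .
    next
      case False
      have "X C (Inr i) = 0"
        using Plus_coord_space(2)[OF P.tangent_coord[OF XV C]] False unfolding coord_space_def by blast
      then show ?thesis using False by (simp add: h_def hess_outside)
    qed
  qed
  then show ?thesis unfolding maximal_isotropic_def using WV iso by blast
qed

text \<open>One slice chart serves for the whole chart domain: subtracting the derivative of the
  Lagrangian from the currents flattens the graph to the locus where the currents vanish.\<close>

lemma graph_embedded:
  assumes C: "adapted B C"
  shows "embedded_submanifold (jidx k <+> jidx k)
    {snd z C | z. z \<in> fibre B (iota ` HolPhase B k) x \<and> fst z \<in> fdom C}
    {snd z C | z. z \<in> fibre B \<D> x \<and> fst z \<in> fdom C}" (is "embedded_submanifold ?K ?A ?S")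
proof (cases "x \<in> bdom C")
  case False
  then have e: "?S = {}" using fdom_proj[OF C] by (auto simp: fibre_def)
  show ?thesis unfolding e by (simp add: embedded_submanifold_def)
next
  case True
  define b where "b = (\<lambda>y :: ('n, 'm) iidx \<Rightarrow> real. case_sum (bcoord C x) (\<lambda>i. y (Inl i)))"
  define V where "V = {y \<in> coord_space ?K. b y \<in> chart_dom C}"
  have jl: "jcoord B C (left z) = b (snd z C)" if "proj B (fst z) = x" for z :: "('x, 'e, 'n, 'm, ('n, 'm) iidx) pt"
    using that by (auto simp: jcoord_def b_def fun_eq_iff split: sum.split)
  have A: "?A = V"
  proof (intro equalityI subsetI)
    fix y assume "y \<in> ?A"
    then obtain z where z: "z \<in> iota ` HolPhase B k" "proj B (fst z) = x" "fst z \<in> fdom C" "y = snd z C"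
      unfolding fibre_def by blast
    have ar: "around B C (fst z)" using z C by (simp add: around_def)
    show "y \<in> V" using P.pt_coord[OF z(1) ar] left_chart_dom[OF z(1) ar] by (simp add: V_def z(4) jl[OF z(2)])
  next
    fix y assume y: "y \<in> V"
    then have "b y \<in> chart_dom C" by (simp add: V_def)
    then obtain z0 where z0: "z0 \<in> Jet B k" "fst z0 \<in> fdom C" "snd z0 C = (\<lambda>i. b y (Inr i))"
      "bcoord C (proj B (fst z0)) = (\<lambda>n. b y (Inl n))"
      by (rule J.overlap_pt[OF _ C])
    have ar: "around B C (fst z0)" using z0 C by (simp add: around_def)
    have px: "proj B (fst z0) = x"
      using bcoord_inj[OF C fdom_proj[OF C z0(2)] True] z0(4) by (simp add: b_def)
    have "\<exists>z\<in>iota ` HolPhase B k. fst z = fst z0 \<and> snd z C = y"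
    proof (rule P.pt_ex[OF ar])
      show "y \<in> coord_space ?K" using y by (simp add: V_def)
      show "y (Inl ({#}, a)) = fcoord C (fst z0) a" for a
        using J.pt_emb[OF z0(1) ar, of a] z0(3) by (simp add: b_def)
    qed
    then obtain z where z: "z \<in> iota ` HolPhase B k" "fst z = fst z0" "snd z C = y" by blast
    have "z \<in> fibre B (iota ` HolPhase B k) x \<and> fst z \<in> fdom C" using z px z0(2) by (simp add: fibre_def)
    then show "y \<in> ?A" using z(3) by blast
  qed
  define d where "d = (\<lambda>y i. dlag C i (b y))"
  have S: "?S = {y \<in> V. (\<lambda>i. y (Inr i)) = d y}"
  proof (intro equalityI subsetI)
    fix y assume "y \<in> ?S"
    then obtain z where z: "z \<in> \<D>" "proj B (fst z) = x" "fst z \<in> fdom C" "y = snd z C" unfolding fibre_def by blast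
    have zP: "z \<in> iota ` HolPhase B k" by (rule subsetD[OF graph_subset z(1)])
    have ar: "around B C (fst z)" using z C by (simp add: around_def)
    have "y \<in> ?A" using zP z(2-4) unfolding fibre_def by blast
    moreover have "(\<lambda>i. y (Inr i)) = d y"
      using graph_iff[OF zP ar] z(1) unfolding jl[OF z(2)] z(4) d_def by blast
    ultimately show "y \<in> {y \<in> V. (\<lambda>i. y (Inr i)) = d y}" unfolding A by blast
  next
    fix y assume "y \<in> {y \<in> V. (\<lambda>i. y (Inr i)) = d y}"
    then have y: "y \<in> ?A" "(\<lambda>i. y (Inr i)) = d y" unfolding A by blast+
    then obtain z where z: "z \<in> iota ` HolPhase B k" "proj B (fst z) = x" "fst z \<in> fdom C" "y = snd z C"
      unfolding fibre_def by blast
    have ar: "around B C (fst z)" using z C by (simp add: around_def)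
    have "z \<in> \<D>" using graph_iff[OF z(1) ar] y(2) unfolding jl[OF z(2)] z(4) d_def by blast
    then show "y \<in> ?S" using z(2-4) unfolding fibre_def by blast
  qed
  have fin: "finite ?K" by (rule P.finite_K)
  have bs: "smooth_fun ?K (coord_space ?K) (\<lambda>y. b y q)" for q
    by (cases q) (simp_all add: b_def smooth_const smooth_coord)
  have bc: "b y \<in> coord_space (bidx (jidx k))" if "y \<in> coord_space ?K" for y
    unfolding b_def by (rule case_sum_coord_space[OF Plus_coord_space(1)[OF that]])
  have oV: "open_in ?K V"
    unfolding V_def by (rule open_in_preimage[OF open_in_coord_space bs overlap_open[OF C C] bc])
  have VK: "V \<subseteq> coord_space ?K" by (auto simp: V_def)
  have ds: "smooth_fun ?K V (\<lambda>y. d y i)" for i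
    unfolding d_def
    by (rule smooth_compose[OF J.finite_bK overlap_open[OF C C] smooth_dlag[OF C] _ fin oV smooth_subset[OF bs VK]])
      (simp add: V_def)
  have dK: "d y \<in> coord_space (jidx k)" for y unfolding d_def by (rule dlag_coord_space)
  \<comment> \<open>A shear in the current directions. Since \<open>d\<close> depends on the jet
    coordinates only, which \<open>h\<close> leaves fixed, \<open>h 1\<close> and
    \<open>h (-1)\<close> are inverse to each other.\<close>
  define h where "h = (\<lambda>s y. case_sum (\<lambda>i. y (Inl i)) (\<lambda>i. y (Inr i) + s * d y i) :: ('n, 'm) iidx \<Rightarrow> real)"
  have bh: "b (h s y) = b y" "d (h s y) = d y" for s y by (simp_all add: b_def h_def d_def)
  have hV: "h s y \<in> V" if "y \<in> V" for s y
  proof -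
    have yK: "y \<in> coord_space ?K" using that by (simp add: V_def)
    have "(\<lambda>i. y (Inr i) + s * d y i) \<in> coord_space (jidx k)"
      using Plus_coord_space(2)[OF yK] dK[of y] by (simp add: coord_space_def)
    then have "h s y \<in> coord_space ?K"
      unfolding h_def case_sum_Plus_coord_space using Plus_coord_space(1)[OF yK] by blast
    then show ?thesis using that by (simp add: V_def bh)
  qed
  have hh: "h s (h (- s) y) = y" for s y
  proof -
    have "h s (h (- s) y) = case_sum (\<lambda>i. h (- s) y (Inl i)) (\<lambda>i. h (- s) y (Inr i) + s * d (h (- s) y) i)"
      unfolding h_def ..
    then show ?thesis unfolding bh by (auto simp: h_def fun_eq_iff split: sum.split)
  qed
  have hh': "h 1 (h (-1) y) = y" "h (-1) (h 1 y) = y" for y using hh[of 1 y] hh[of "-1" y] by simp_all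
  have hs: "smooth_fun ?K V (\<lambda>y. h s y q)" for s q
  proof (cases q)
    case (Inr i)
    have "smooth_fun ?K V (\<lambda>y. y (Inr i) + s * d y i)"
      by (rule smooth_add[OF fin oV smooth_coord smooth_cmult[OF fin oV ds]])
    then show ?thesis by (simp add: h_def Inr)
  qed (simp add: h_def smooth_coord)
  have bij: "bij_betw (h (-1)) V V"
    by (rule bij_betw_byWitness[where f' = "h 1"]) (use hh' hV in auto)
  have inv: "inv_into V (h (-1)) y = h 1 y" if "y \<in> V" for y
    using inv_into_f_f[OF bij_betw_imp_inj_on[OF bij] hV[OF that, of 1]] unfolding hh'(2) .
  have diff: "diffeo ?K V V (h (-1))"
    unfolding diffeo_def
  proof (intro conjI allI bij hs)
    show "smooth_fun ?K V (\<lambda>y. inv_into V (h (-1)) y i)" for i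
      by (rule smooth_cong[OF fin oV hs[of 1 i]]) (simp add: inv)
  qed
  have img: "h (-1) ` (?S \<inter> V) = {y \<in> V. \<forall>i\<in>?K - Inl ` jidx k. y i = 0}"
    unfolding S
  proof (intro equalityI subsetI)
    fix y' assume "y' \<in> h (-1) ` ({y \<in> V. (\<lambda>i. y (Inr i)) = d y} \<inter> V)"
    then obtain y where y: "y \<in> V" "(\<lambda>i. y (Inr i)) = d y" "y' = h (-1) y" by blast
    have "y' i = 0" if "i \<in> ?K - Inl ` jidx k" for i
    proof -
      obtain j where "i = Inr j" using \<open>i \<in> ?K - Inl ` jidx k\<close> by blast
      then show ?thesis using fun_cong[OF y(2), of j] by (simp add: y(3) h_def)
    qed
    then show "y' \<in> {y \<in> V. \<forall>i\<in>?K - Inl ` jidx k. y i = 0}" using hV[OF y(1)] y(3) by blast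
  next
    fix y assume y: "y \<in> {y \<in> V. \<forall>i\<in>?K - Inl ` jidx k. y i = 0}"
    have yz: "y (Inr i) = 0" for i
    proof (cases "i \<in> jidx k")
      case True
      then have "Inr i \<in> ?K - Inl ` jidx k" by blast
      then show ?thesis using y by blast
    next
      case False
      have "y \<in> coord_space ?K" using y VK by blast
      then show ?thesis using Plus_coord_space(2)[of y] False unfolding coord_space_def by blast
    qed
    have "(\<lambda>i. h 1 y (Inr i)) = d (h 1 y)" unfolding bh by (simp add: h_def yz)
    then show "y \<in> h (-1) ` ({y \<in> V. (\<lambda>i. y (Inr i)) = d y} \<inter> V)"
      using hV[of y 1] y hh'(2)[of y] by (intro image_eqI[of _ _ "h 1 y"]) auto
  qed
  show ?thesis
    unfolding embedded_submanifold_def A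
  proof (intro conjI ballI)
    show "?S \<subseteq> V" unfolding S by blast
    fix s assume "s \<in> ?S"
    then have "s \<in> V" unfolding S by blast
    moreover have "Inl ` jidx k \<subseteq> ?K" by blast
    ultimately show "\<exists>U V' h J. s \<in> U \<and> U \<subseteq> V \<and> J \<subseteq> ?K \<and> open_in ?K U \<and> open_in ?K V' \<and> diffeo ?K U V' h \<and>
        h ` (?S \<inter> U) = {y \<in> V'. \<forall>i\<in>?K - J. y i = 0}"
      using oV diff img by (intro exI[of _ V] exI[of _ "h (-1)"] exI[of _ "Inl ` jidx k"] conjI) (assumption | rule subset_refl)+
  qed
qed

lemma lagrangian_submanifold: "lagrangian_submanifold_at B k (iota ` HolPhase B k) \<D> x"
  unfolding lagrangian_submanifold_at_def
  using graph_embedded graph_maximal_isotropic by (simp add: fibre_def)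

end

section \<open>The Euler--Lagrange equations\<close>

lemma pds_add:
  assumes "finite I" "open_in I U" "smooth_fun I U f" "smooth_fun I U g" "set \<mu>s \<subseteq> I" "y \<in> U"
  shows "pds \<mu>s (\<lambda>y. f y + g y) y = pds \<mu>s f y + pds \<mu>s g y"
proof -
  have s: "smooth_fun I U (if b then f else g)" for b using assms(3,4) by simp
  show ?thesis
    using pds_lincomb[where f = "\<lambda>b. if b then f else g" and c = "\<lambda>_. 1" and J = UNIV, OF assms(1,2) s assms(5,6)]
    by (simp add: UNIV_bool add.commute)
qed

text \<open>Each term of the average splits a last index off some ordering of the same multiset.
  Putting that index back gives the multiset of \<open>\<mu>s\<close>, so the derivative can be
  indexed by the term itself.\<close>

lemma pds_symmetrised:
  fixes p :: "'n::finite multiset \<times> 'n \<times> 'm \<Rightarrow> ('n \<Rightarrow> real) \<Rightarrow> real"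
  assumes U: "open U" "y \<in> U" and p: "\<And>i. smooth_fun UNIV U (p i)" and n: "\<mu>s \<noteq> []"
  shows "pds \<mu>s (\<lambda>z. symmetrised (\<lambda>i. p i z) (mset \<mu>s, a)) y =
    symmetrised (\<lambda>(I, \<rho>, a). pdm (add_mset \<rho> I) (p (I, \<rho>, a)) y) (mset \<mu>s, a)"
proof -
  have oU: "open_in UNIV U" using U(1) by simp
  let ?M = "permutations_of_multiset (mset \<mu>s)" and ?c = "orderings (mset \<mu>s)"
  let ?i = "\<lambda>\<nu>s. (mset (butlast \<nu>s), last \<nu>s, a)"
  have e: "symmetrised q (mset \<mu>s, a) = (\<Sum>\<nu>s\<in>?M. 1 / ?c * q (?i \<nu>s))" for q :: "'n multiset \<times> 'n \<times> 'm \<Rightarrow> real"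
    by (simp add: symmetrised_def sum_divide_distrib)
  have "pds \<mu>s (\<lambda>z. symmetrised (\<lambda>i. p i z) (mset \<mu>s, a)) y = (\<Sum>\<nu>s\<in>?M. 1 / ?c * pds \<mu>s (p (?i \<nu>s)) y)"
    unfolding e by (rule pds_lincomb[OF finite oU p subset_UNIV U(2)])
  also have "\<dots> = (\<Sum>\<nu>s\<in>?M. 1 / ?c * (case ?i \<nu>s of (I, \<rho>, a) \<Rightarrow> pdm (add_mset \<rho> I) (p (I, \<rho>, a)) y))"
  proof (rule sum.cong[OF refl])
    fix \<nu>s assume "\<nu>s \<in> ?M"
    then have m: "mset \<nu>s = mset \<mu>s" by (simp add: permutations_of_multiset_def)
    then have "\<nu>s \<noteq> []" using n by auto
    from add_mset_last_butlast[OF m this] show "1 / ?c * pds \<mu>s (p (?i \<nu>s)) y =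
        1 / ?c * (case ?i \<nu>s of (I, \<rho>, a) \<Rightarrow> pdm (add_mset \<rho> I) (p (I, \<rho>, a)) y)"
      using pdm_eq[OF finite oU p subset_UNIV U(2), of \<mu>s "?i \<nu>s"] by simp
  qed
  also have "\<dots> = symmetrised (\<lambda>(I, \<rho>, a). pdm (add_mset \<rho> I) (p (I, \<rho>, a)) y) (mset \<mu>s, a)"
    unfolding e ..
  finally show ?thesis .
qed

lemma sum_pds_symmetrised:
  fixes p :: "'n::finite multiset \<times> 'n \<times> 'm \<Rightarrow> ('n \<Rightarrow> real) \<Rightarrow> real"
  assumes U: "open U" "y \<in> U" and p: "\<And>i. smooth_fun UNIV U (p i)"
  shows "(\<Sum>\<mu>s | length \<mu>s = Suc l. pds \<mu>s (\<lambda>z. symmetrised (\<lambda>i. p i z) (mset \<mu>s, a)) y) =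
    (\<Sum>\<mu>s | length \<mu>s = l. pds \<mu>s (\<lambda>z. \<Sum>\<rho>\<in>UNIV. pd \<rho> (p (mset \<mu>s, \<rho>, a)) z) y)"
proof -
  have oU: "open_in UNIV U" using U(1) by simp
  define P where "P = (\<lambda>(I, \<rho>, a). pdm (add_mset \<rho> I) (p (I, \<rho>, a)) y)"
  have "(\<Sum>\<mu>s | length \<mu>s = Suc l. pds \<mu>s (\<lambda>z. symmetrised (\<lambda>i. p i z) (mset \<mu>s, a)) y) =
      (\<Sum>\<mu>s | length \<mu>s = Suc l. symmetrised P (mset \<mu>s, a) * 1)"
    unfolding P_def by (intro sum.cong refl, subst pds_symmetrised[OF U p]) auto
  also have "\<dots> = (\<Sum>\<mu>s | length \<mu>s = l. \<Sum>\<rho>\<in>UNIV. P (mset \<mu>s, \<rho>, a))"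
    unfolding sum_symmetrised[where g = "\<lambda>_. 1"] sum_lists_snoc by simp
  also have "\<dots> = (\<Sum>\<mu>s | length \<mu>s = l. pds \<mu>s (\<lambda>z. \<Sum>\<rho>\<in>UNIV. pd \<rho> (p (mset \<mu>s, \<rho>, a)) z) y)"
  proof (rule sum.cong[OF refl])
    fix \<mu>s :: "'n list"
    have "pds \<mu>s (\<lambda>z. \<Sum>\<rho>\<in>UNIV. 1 * pd \<rho> (p (mset \<mu>s, \<rho>, a)) z) y =
        (\<Sum>\<rho>\<in>UNIV. 1 * pds \<mu>s (pd \<rho> (p (mset \<mu>s, \<rho>, a))) y)"
      by (rule pds_lincomb[OF finite oU smooth_pd[OF p UNIV_I] subset_UNIV U(2)])
    also have "\<dots> = (\<Sum>\<rho>\<in>UNIV. P (mset \<mu>s, \<rho>, a))"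
    proof (rule sum.cong[OF refl])
      fix \<rho>
      have "pdm (mset (\<mu>s @ [\<rho>])) (p (mset \<mu>s, \<rho>, a)) y = pds (\<mu>s @ [\<rho>]) (p (mset \<mu>s, \<rho>, a)) y"
        by (rule pdm_eq[OF finite oU p subset_UNIV U(2)])
      then show "1 * pds \<mu>s (pd \<rho> (p (mset \<mu>s, \<rho>, a))) y = P (mset \<mu>s, \<rho>, a)"
        by (simp add: P_def pds_append)
    qed
    finally show "(\<Sum>\<rho>\<in>UNIV. P (mset \<mu>s, \<rho>, a)) = pds \<mu>s (\<lambda>z. \<Sum>\<rho>\<in>UNIV. pd \<rho> (p (mset \<mu>s, \<rho>, a)) z) y"
      by simp
  qed
  finally show ?thesis .
qed

text \<open>The Euler--Lagrange operator annihilates currents: the symmetrised part of order \<open>l + 1\<close>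
  cancels against the divergence part of order \<open>l\<close>.\<close>

lemma euler_operator_current:
  fixes p :: "'n::finite multiset \<times> 'n \<times> 'm \<Rightarrow> ('n \<Rightarrow> real) \<Rightarrow> real"
  assumes U: "open U" "y \<in> U" and p: "\<And>i. smooth_fun UNIV U (p i)"
    and j: "\<And>I z. size I \<le> k \<Longrightarrow> z \<in> U \<Longrightarrow> j I z =
      (if size I \<ge> 1 then symmetrised (\<lambda>i. p i z) (I, a) else 0) +
      (if size I < k then \<Sum>\<rho>\<in>UNIV. pd \<rho> (p (I, \<rho>, a)) z else 0)"
  shows "(\<Sum>l\<le>k. (- 1) ^ l * (\<Sum>\<mu>s | length \<mu>s = l. pds \<mu>s (j (mset \<mu>s)) y)) = 0"
proof -
  have oU: "open_in UNIV U" using U(1) by simp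
  define A where "A = (\<lambda>l. \<Sum>\<mu>s | length \<mu>s = l. pds \<mu>s (\<lambda>z. \<Sum>\<rho>\<in>UNIV. pd \<rho> (p (mset \<mu>s, \<rho>, a)) z) y)"
  define S where "S = (\<lambda>l. \<Sum>\<mu>s | length \<mu>s = l. pds \<mu>s (\<lambda>z. symmetrised (\<lambda>i. p i z) (mset \<mu>s, a)) y)"
  have SA: "S (Suc l) = A l" for l unfolding S_def A_def by (rule sum_pds_symmetrised[OF U p])
  have s1: "smooth_fun UNIV U (\<lambda>z. symmetrised (\<lambda>i. p i z) (I, a))" for I
    unfolding symmetrised_def prod.case by (intro smooth_divide[OF finite oU] smooth_sum[OF finite oU] p)
  have s2: "smooth_fun UNIV U (\<lambda>z. \<Sum>\<rho>\<in>UNIV. pd \<rho> (p (I, \<rho>, a)) z)" for I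
    by (intro smooth_sum[OF finite oU] smooth_pd[OF p UNIV_I])
  have p0: "pds \<mu>s (\<lambda>_. 0) y = 0" for \<mu>s
    using pds_lincomb[where J = "{} :: nat set" and f = "\<lambda>_ _. 0" and c = "\<lambda>_. 0",
        OF finite oU smooth_const subset_UNIV U(2)] by simp
  \<comment> \<open>Order 0 lacks the symmetrised part and order \<open>k\<close> the divergence
    part, so after shifting the former by one both sums run over \<open>l < k\<close> with opposite
    signs.\<close>
  have T: "(\<Sum>\<mu>s | length \<mu>s = l. pds \<mu>s (j (mset \<mu>s)) y) = (if l \<ge> 1 then S l else 0) + (if l < k then A l else 0)"
    if l: "l \<le> k" for l
  proof -
    have "pds \<mu>s (j (mset \<mu>s)) y = (if l \<ge> 1 then pds \<mu>s (\<lambda>z. symmetrised (\<lambda>i. p i z) (mset \<mu>s, a)) y else 0) +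
        (if l < k then pds \<mu>s (\<lambda>z. \<Sum>\<rho>\<in>UNIV. pd \<rho> (p (mset \<mu>s, \<rho>, a)) z) y else 0)"
      if m: "length \<mu>s = l" for \<mu>s
    proof -
      let ?f = "\<lambda>z. if l \<ge> 1 then symmetrised (\<lambda>i. p i z) (mset \<mu>s, a) else 0"
      let ?g = "\<lambda>z. if l < k then \<Sum>\<rho>\<in>UNIV. pd \<rho> (p (mset \<mu>s, \<rho>, a)) z else 0"
      have "pds \<mu>s (j (mset \<mu>s)) y = pds \<mu>s (\<lambda>z. ?f z + ?g z) y"
        by (rule pds_cong[OF finite oU subset_UNIV _ U(2)]) (subst j, use l m in auto)
      also have "\<dots> = pds \<mu>s ?f y + pds \<mu>s ?g y"
        by (rule pds_add[OF finite oU _ _ subset_UNIV U(2)]) (intro smooth_if s1 s2 smooth_const)+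
      finally show ?thesis using p0 by simp
    qed
    then have "(\<Sum>\<mu>s | length \<mu>s = l. pds \<mu>s (j (mset \<mu>s)) y) = (\<Sum>\<mu>s | length \<mu>s = l.
        (if l \<ge> 1 then pds \<mu>s (\<lambda>z. symmetrised (\<lambda>i. p i z) (mset \<mu>s, a)) y else 0) +
        (if l < k then pds \<mu>s (\<lambda>z. \<Sum>\<rho>\<in>UNIV. pd \<rho> (p (mset \<mu>s, \<rho>, a)) z) y else 0))"
      by (intro sum.cong refl) blast
    then show ?thesis by (simp add: sum.distrib S_def A_def)
  qed
  have "(\<Sum>l\<le>k. (- 1) ^ l * (\<Sum>\<mu>s | length \<mu>s = l. pds \<mu>s (j (mset \<mu>s)) y)) =
      (\<Sum>l\<le>k. (- 1) ^ l * (if l \<ge> 1 then S l else 0)) + (\<Sum>l\<le>k. (- 1) ^ l * (if l < k then A l else 0))"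
    unfolding sum.distrib[symmetric] by (intro sum.cong refl, subst T) (simp_all add: distrib_left)
  also have "(\<Sum>l\<le>k. (- 1) ^ l * (if l < k then A l else 0)) = (\<Sum>l<k. (- 1) ^ l * A l)"
    by (rule sum.mono_neutral_cong_right) auto
  also have "(\<Sum>l\<le>k. (- 1) ^ l * (if l \<ge> 1 then S l else 0)) = (\<Sum>l<k. (- 1) ^ Suc l * A l)"
    by (subst sum.atMost_shift) (simp add: SA)
  finally show ?thesis by (simp add: sum.distrib[symmetric])
qed

context phase begin

lemma jet1_HolPhase:
  assumes f: "local_section B N f" and s: "smooth_section B (Phase B k) N' \<sigma>" and x: "x \<in> N'" "x \<in> N"
    and l: "\<And>y. y \<in> N' \<Longrightarrow> left (\<sigma> y) = jet B (k - 1) f y"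
  shows "jet1 B \<sigma> x \<in> HolPhase B k" "kjet B k (jet1 B \<sigma> x) = jet B k f x"
proof -
  have "projJ1 (jet1 B \<sigma> x) = jet1 B (jet B (k - 1) f) x"
    unfolding left_section(2)[OF s] by (rule jet1_cong[OF left_section(1)[OF s] x(1) l])
  then have h: "holonomic B k (jet B k f x) (projJ1 (jet1 B \<sigma> x))"
    unfolding holonomic_def using f x(2) by blast
  have "jet1 B \<sigma> x \<in> J1Phase B k" unfolding J1Phase_def using s x(1) by blast
  then show "jet1 B \<sigma> x \<in> HolPhase B k" unfolding HolPhase_def using h by blast
  show "kjet B k (jet1 B \<sigma> x) = jet B k f x" by (rule kjet_eq[OF h])
qed

lemma current_jet1:
  assumes C: "around B C (fst (\<sigma> x))" and U: "open U" "bcoord C x \<in> U" "bpt C (bcoord C x) = x"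
    and p: "\<And>y i. y \<in> U \<Longrightarrow> snd (\<sigma> (bpt C y)) C (Inr i) = p i y" and I: "size I \<le> k"
  shows "current k (jet1 B \<sigma> x) C (I, a) =
    (if size I \<ge> 1 then symmetrised (\<lambda>i. p i (bcoord C x)) (I, a) else 0) +
    (if size I < k then \<Sum>\<rho>\<in>UNIV. pd \<rho> (p (I, \<rho>, a)) (bcoord C x) else 0)"
proof -
  have oU: "open_in UNIV U" using U(1) by simp
  have "pd \<rho> (\<lambda>y. snd (\<sigma> (bpt C y)) C (Inr i)) (bcoord C x) = pd \<rho> (p i) (bcoord C x)" for \<rho> i
    by (rule pd_cong[OF finite oU U(2) UNIV_I p])
  moreover have "snd (\<sigma> x) C (Inr i) = p i (bcoord C x)" for i using p[OF U(2)] U(3) by simp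
  ultimately show ?thesis using C I by (simp add: current_def jet1_def)
qed

end

context lagrangian begin

section \<open>Derivatives of the Lagrangian along a section\<close>

definition momenta :: "('x, 'e, 'n, 'm) fchart \<Rightarrow> ('x \<Rightarrow> 'e) \<Rightarrow> ('n, 'm) jidx \<Rightarrow> ('n \<Rightarrow> real) \<Rightarrow> real" where
  "momenta C f i y = dlag C i (jcoord B C (jet B k f (bpt C y)))"

lemma smooth_momenta:
  assumes f: "local_section B N f" and C: "adapted B C" and fC: "\<And>y. y \<in> N \<Longrightarrow> f y \<in> fdom C"
  shows "smooth_fun UNIV (bcoord C ` N) (momenta C f i)"
proof -
  have NC: "{x \<in> N. f x \<in> fdom C} = N" using fC by auto
  let ?U = "bcoord C ` N"
  have U: "open ?U" using section_chart(1)[OF f C] by (simp only: NC)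
  have oU: "open_in UNIV ?U" using U by simp
  have bU: "bpt C y \<in> N \<and> bcoord C (bpt C y) = y" if "y \<in> ?U" for y
    using section_coord(1)[OF f C, of y] that unfolding NC by blast
  note js = jet_smooth_section[OF f, of k]
  have jx: "jet B k f y \<in> Jet B k" if "y \<in> N" for y by (rule smooth_sectionD(2)[OF js that])
  define g where "g = (\<lambda>y. jcoord B C (jet B k f (bpt C y)))"
  have "smooth_fun UNIV ?U (\<lambda>y. dlag C i (g y))"
  proof (rule smooth_compose[OF J.finite_bK overlap_open[OF C C] smooth_dlag[OF C] _ finite oU])
    show "g y \<in> chart_dom C" if "y \<in> ?U" for y
      unfolding g_def using bU[OF that] jx fC C by (intro J.jcoord_overlap) (simp_all add: around_def)
    show "smooth_fun UNIV ?U (\<lambda>y. g y q)" for q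
    proof (cases q)
      case (Inl n)
      have "y n = g y q" if "y \<in> ?U" for y
        using bU[OF that] sectionD(4)[OF f, of "bpt C y"] by (simp add: g_def jcoord_def Inl)
      from smooth_cong[OF finite oU smooth_coord this] show ?thesis .
    next
      case (Inr i)
      have "smooth_fun UNIV ?U (\<lambda>y. snd (jet B k f (bpt C y)) C i)"
        using smooth_sectionD(3)[OF js C, of i] by (simp add: NC)
      then show ?thesis by (simp add: g_def jcoord_def Inr)
    qed
  qed
  then show ?thesis by (simp add: g_def momenta_def[abs_def])
qed

lemma euler_lagrange_momenta:
  "euler_lagrange B k L N f \<longleftrightarrow> (\<forall>x\<in>N. \<forall>C a. around B C (f x) \<longrightarrow>
     (\<Sum>l\<le>k. (- 1) ^ l * (\<Sum>\<mu>s | length \<mu>s = l. pds \<mu>s (momenta C f (mset \<mu>s, a)) (bcoord C x))) = 0)"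
proof -
  have "(\<Sum>l\<le>k. (- 1) ^ l * (\<Sum>\<mu>s | length \<mu>s = l.
        pds \<mu>s (\<lambda>y. dL_dphi B k L C (jet B k f (bpt C y)) (mset \<mu>s, a)) (bcoord C x))) =
      (\<Sum>l\<le>k. (- 1) ^ l * (\<Sum>\<mu>s | length \<mu>s = l. pds \<mu>s (momenta C f (mset \<mu>s, a)) (bcoord C x)))" for C a x
  proof (intro sum.cong refl arg_cong2[where f = "(*)"])
    fix l and \<mu>s :: "'n list" assume "l \<in> {..k}" "\<mu>s \<in> {\<mu>s. length \<mu>s = l}"
    then have "(\<lambda>y. dL_dphi B k L C (jet B k f (bpt C y)) (mset \<mu>s, a)) = momenta C f (mset \<mu>s, a)"
      by (simp add: dL_dphi_dlag momenta_def[abs_def])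
    then show "pds \<mu>s (\<lambda>y. dL_dphi B k L C (jet B k f (bpt C y)) (mset \<mu>s, a)) (bcoord C x) =
      pds \<mu>s (momenta C f (mset \<mu>s, a)) (bcoord C x)" by simp
  qed
  then show ?thesis by (simp only: euler_lagrange_def)
qed

text \<open>Lying in the graph says, on a neighbourhood and in any chart around \<open>f x\<close>,
  that the derivatives of the Lagrangian along \<open>f\<close> are the currents of
  \<open>\<sigma>\<close>; \<open>euler_operator_current\<close> then applies.\<close>

lemma solution_imp_euler_lagrange:
  assumes f: "local_section B N f" and s: "smooth_section B (Phase B k) N' \<sigma>" "x \<in> N'" "N' \<subseteq> N"
    and l: "\<And>y. y \<in> N' \<Longrightarrow> left (\<sigma> y) = jet B (k - 1) f y"
    and d: "\<And>y. y \<in> N' \<Longrightarrow> same_leaf B k `` {jet1 B \<sigma> y} \<in> delta_graph B k L"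
    and C: "around B C (f x)"
  shows "(\<Sum>l\<le>k. (- 1) ^ l * (\<Sum>\<mu>s | length \<mu>s = l. pds \<mu>s (momenta C f (mset \<mu>s, a)) (bcoord C x))) = 0"
proof -
  have Ca: "adapted B C" "f x \<in> fdom C" using C by (auto simp: around_def)
  have fs: "fst (\<sigma> y) = f y" if "y \<in> N'" for y using arg_cong[OF l[OF that], of fst] by simp
  define U where "U = bcoord C ` {y \<in> N'. fst (\<sigma> y) \<in> fdom C}"
  note nb = Q.smooth_section_around[OF s(1) Ca(1), folded U_def]
  have x0: "bcoord C x \<in> U" using s(2) Ca(2) fs[OF s(2)] by (simp add: U_def)
  define p where "p = (\<lambda>i y. snd (\<sigma> (bpt C y)) C (Inr i))"
  have ps: "smooth_fun UNIV U (p i)" for i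
    using smooth_sectionD(3)[OF s(1) Ca(1), of "Inr i"] unfolding p_def U_def .
  show ?thesis
  proof (rule euler_operator_current[OF nb(1) x0 ps])
    fix I :: "'n multiset" and z assume I: "size I \<le> k" and z: "z \<in> U"
    note n = nb(2)[OF z]
    let ?y = "bpt C z"
    have y: "?y \<in> N'" "bcoord C ?y = z" using n by blast+
    have ar: "around B C (fst (\<sigma> ?y))" using n Ca(1) by (simp add: around_def)
    have h: "jet1 B \<sigma> ?y \<in> HolPhase B k" "kjet B k (jet1 B \<sigma> ?y) = jet B k f ?y"
      by (rule jet1_HolPhase[OF f s(1) y(1) subsetD[OF s(3) y(1)] l], assumption)+
    have "around B C (fst (jet1 B \<sigma> ?y))" using ar by (simp add: jet1_def)
    from delta_graph_iff[OF h(1) this] d[OF y(1)]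
    have "current k (jet1 B \<sigma> ?y) C = (\<lambda>i. dlag C i (jcoord B C (jet B k f ?y)))" unfolding h(2) by blast
    then have "momenta C f (I, a) z = current k (jet1 B \<sigma> ?y) C (I, a)" by (simp add: momenta_def)
    also have "\<dots> = (if size I \<ge> 1 then symmetrised (\<lambda>i. p i (bcoord C ?y)) (I, a) else 0) +
        (if size I < k then \<Sum>\<rho>\<in>UNIV. pd \<rho> (p (I, \<rho>, a)) (bcoord C ?y) else 0)"
      by (rule current_jet1[where \<sigma> = \<sigma> and x = ?y, OF ar nb(1)]) (use y z I in \<open>simp_all add: p_def\<close>)
    finally show "momenta C f (I, a) z = (if size I \<ge> 1 then symmetrised (\<lambda>i. p i z) (I, a) else 0) +
        (if size I < k then \<Sum>\<rho>\<in>UNIV. pd \<rho> (p (I, \<rho>, a)) z else 0)" unfolding y(2) .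
  qed
qed

text \<open>\<open>res m a I\<close> is the totally symmetric solution \<open>p\<close> of the current equations at the multi-indices \<open>I\<close>
  of order \<open>k - m\<close>, found by descending recursion from the top order.\<close>

primrec res :: "(('n, 'm) jidx \<Rightarrow> ('n \<Rightarrow> real) \<Rightarrow> real) \<Rightarrow> nat \<Rightarrow> 'm \<Rightarrow> 'n multiset \<Rightarrow> ('n \<Rightarrow> real) \<Rightarrow> real" where
  "res j 0 a I = j (I, a)"
| "res j (Suc m) a I = (\<lambda>y. j (I, a) y - (\<Sum>\<rho>\<in>UNIV. pd \<rho> (res j m a (add_mset \<rho> I)) y))"

lemma smooth_res:
  assumes "open U" "\<And>i. smooth_fun UNIV U (j i)"
  shows "smooth_fun UNIV U (res j m a I)"
proof (induction m arbitrary: I)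
  case (Suc m)
  have oU: "open_in UNIV U" using assms(1) by simp
  show ?case unfolding res.simps
    by (intro smooth_diff[OF finite oU assms(2)] smooth_sum[OF finite oU] smooth_pd[OF Suc UNIV_I])
qed (simp add: assms(2))

text \<open>The value depends on \<open>\<rho>\<close> only through
  \<open>add_mset \<rho> I\<close>, so these momenta are symmetric in all indices. That multi-index
  has order \<open>size I + 1\<close>, which fixes the recursion depth.\<close>

definition res_momentum ::
    "(('n, 'm) jidx \<Rightarrow> ('n \<Rightarrow> real) \<Rightarrow> real) \<Rightarrow> 'n multiset \<times> 'n \<times> 'm \<Rightarrow> ('n \<Rightarrow> real) \<Rightarrow> real" where
  "res_momentum j = (\<lambda>(I, \<rho>, a) y. if size I < k then res j (k - Suc (size I)) a (add_mset \<rho> I) y else 0)"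

text \<open>The symmetrised part at \<open>I\<close> is \<open>res\<close> itself and the divergence
  part is \<open>j\<close> minus \<open>res\<close>, so the sum is \<open>j\<close>. At order 0 the
  symmetrised part is absent, and \<open>res j k a {#}\<close> remains as a defect.\<close>

lemma res_momentum_current:
  assumes I: "size I \<le> k"
  shows "(if size I \<ge> 1 then symmetrised (\<lambda>i. res_momentum j i y) (I, a) else 0) +
      (if size I < k then \<Sum>\<rho>\<in>UNIV. pd \<rho> (res_momentum j (I, \<rho>, a)) y else 0) =
    j (I, a) y - (if I = {#} then res j k a {#} y else 0)"
proof -
  have sy: "symmetrised (\<lambda>i. res_momentum j i y) (I, a) = res j (k - size I) a I y" if "size I \<ge> 1"
  proof -
    have "res_momentum j (mset (butlast \<mu>s), last \<mu>s, a) y = res j (k - size I) a I y"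
      if m: "\<mu>s \<in> permutations_of_multiset I" for \<mu>s
    proof -
      have m: "mset \<mu>s = I" using m by (simp add: permutations_of_multiset_def)
      then have n: "\<mu>s \<noteq> []" "length \<mu>s = size I" using \<open>size I \<ge> 1\<close> by auto
      show ?thesis using add_mset_last_butlast[OF m n(1)] n I \<open>size I \<ge> 1\<close> by (simp add: res_momentum_def)
    qed
    then show ?thesis using orderings_pos[of I] by (simp add: symmetrised_def)
  qed
  have dv: "(\<Sum>\<rho>\<in>UNIV. pd \<rho> (res_momentum j (I, \<rho>, a)) y) = j (I, a) y - res j (k - size I) a I y" if "size I < k"
  proof -
    have e: "k - size I = Suc (k - Suc (size I))" using that by simp
    have "res_momentum j (I, \<rho>, a) = res j (k - Suc (size I)) a (add_mset \<rho> I)" for \<rho>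
      using that by (simp add: res_momentum_def fun_eq_iff)
    then show ?thesis unfolding e by simp
  qed
  have n: "size I \<ge> 1" if "I \<noteq> {#}" using that by (simp add: Suc_le_eq nonempty_has_size)
  consider "I = {#}" | "I \<noteq> {#}" "size I < k" | "I \<noteq> {#}" "size I = k"
    using I le_neq_implies_less by blast
  then show ?thesis
  proof cases
    case 1
    then show ?thesis using k dv by simp
  next
    case 2
    then show ?thesis using sy dv n by simp
  next
    case 3
    then show ?thesis using sy n by simp
  qed
qed

text \<open>Correcting \<open>j\<close> by its defect at order 0 leaves genuine currents, which the
  Euler operator annihilates; at order 0 the operator is the identity, so its value on
  \<open>j\<close> is the defect.\<close>

lemma res_euler:
  assumes U: "open U" "y \<in> U" and j: "\<And>i. smooth_fun UNIV U (j i)"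
  shows "(\<Sum>l\<le>k. (- 1) ^ l * (\<Sum>\<mu>s | length \<mu>s = l. pds \<mu>s (j (mset \<mu>s, a)) y)) = res j k a {#} y"
proof -
  have oU: "open_in UNIV U" using U(1) by simp
  define j' where "j' = (\<lambda>I y. j (I, a) y - (if I = {#} then res j k a {#} y else 0))"
  have ps: "smooth_fun UNIV U (res_momentum j i)" for i
  proof -
    obtain I \<rho> a where i: "i = (I, \<rho>, a)" by (cases i) auto
    show ?thesis unfolding i res_momentum_def prod.case by (intro smooth_if smooth_res[OF U(1) j] smooth_const)
  qed
  have "(\<Sum>l\<le>k. (- 1) ^ l * (\<Sum>\<mu>s | length \<mu>s = l. pds \<mu>s (j' (mset \<mu>s)) y)) = 0"
    by (rule euler_operator_current[where p = "res_momentum j" and a = a, OF U ps]) (simp only: j'_def res_momentum_current)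
  moreover have "(\<Sum>l\<le>k. (- 1) ^ l * (\<Sum>\<mu>s | length \<mu>s = l. pds \<mu>s (j' (mset \<mu>s)) y)) =
      (\<Sum>l\<le>k. (- 1) ^ l * (\<Sum>\<mu>s | length \<mu>s = l. pds \<mu>s (j (mset \<mu>s, a)) y) - (if l = 0 then res j k a {#} y else 0))"
  proof (rule sum.cong[OF refl])
    fix l
    show "(- 1) ^ l * (\<Sum>\<mu>s | length \<mu>s = l. pds \<mu>s (j' (mset \<mu>s)) y) =
      (- 1) ^ l * (\<Sum>\<mu>s | length \<mu>s = l. pds \<mu>s (j (mset \<mu>s, a)) y) - (if l = 0 then res j k a {#} y else 0)"
    proof (cases "l = 0")
      case True
      then show ?thesis by (simp add: j'_def)
    next
      case False
      then have "j' (mset \<mu>s) = j (mset \<mu>s, a)" if "length \<mu>s = l" for \<mu>s using that by (auto simp: j'_def)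
      then have "(\<Sum>\<mu>s | length \<mu>s = l. pds \<mu>s (j' (mset \<mu>s)) y) = (\<Sum>\<mu>s | length \<mu>s = l. pds \<mu>s (j (mset \<mu>s, a)) y)"
        by (intro sum.cong refl) simp
      then show ?thesis using False by simp
    qed
  qed
  ultimately show ?thesis by (simp add: sum_subtractf)
qed

lemma euler_lagrange_imp_solution:
  assumes f: "local_section B N f" and el: "euler_lagrange B k L N f" and x: "x \<in> N"
  shows "\<exists>N' \<sigma>. x \<in> N' \<and> N' \<subseteq> N \<and> smooth_section B (Phase B k) N' \<sigma> \<and>
    (\<forall>y\<in>N'. left (\<sigma> y) = jet B (k - 1) f y) \<and> (\<forall>y\<in>N'. same_leaf B k `` {jet1 B \<sigma> y} \<in> delta_graph B k L)"
proof -
  obtain C where C: "around B C (f x)" using chart_ex[OF sectionD(3)[OF f x]] by blast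
  have Ca: "adapted B C" "f x \<in> fdom C" using C by (auto simp: around_def)
  define N' where "N' = {y \<in> N. f y \<in> fdom C}"
  have N': "N' \<subseteq> N" "x \<in> N'" using x Ca by (auto simp: N'_def)
  have f': "local_section B N' f"
    unfolding N'_def by (rule local_section_subset[OF f section_preimage_open[OF f Ca(1)]]) auto
  have fC: "f y \<in> fdom C" if "y \<in> N'" for y using that by (simp add: N'_def)
  have NC: "{x \<in> N'. f x \<in> fdom C} = N'" using fC by auto
  define U where "U = bcoord C ` N'"
  have U: "open U" using section_chart(1)[OF f' Ca(1)] by (simp only: NC U_def)
  have bU: "bpt C y \<in> N' \<and> bcoord C (bpt C y) = y" if "y \<in> U" for y
    using section_coord(1)[OF f' Ca(1), of y] that unfolding NC U_def by blast
  define j where "j = momenta C f"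
  have js: "smooth_fun UNIV U (j i)" for i unfolding j_def U_def by (rule smooth_momenta[OF f' Ca(1) fC])
  \<comment> \<open>The equation holds at all points over \<open>U\<close>, so the defect vanishes
    identically there, and the recursive momenta have exactly the prescribed currents.\<close>
  have r0: "res j k a {#} y = 0" if y: "y \<in> U" for y a
  proof -
    have b: "bpt C y \<in> N" "around B C (f (bpt C y))" "bcoord C (bpt C y) = y"
      using bU[OF y] fC N'(1) Ca(1) by (auto simp: around_def)
    have "(\<Sum>l\<le>k. (- 1) ^ l * (\<Sum>\<mu>s | length \<mu>s = l. pds \<mu>s (j (mset \<mu>s, a)) (bcoord C (bpt C y)))) = 0"
      using el b(1,2) unfolding euler_lagrange_momenta j_def by blast
    moreover have "(\<Sum>l\<le>k. (- 1) ^ l * (\<Sum>\<mu>s | length \<mu>s = l. pds \<mu>s (j (mset \<mu>s, a)) y)) = res j k a {#} y"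
      by (rule res_euler[OF U y js])
    ultimately show ?thesis unfolding b(3) by (simp only:)
  qed
  have ps: "smooth_fun UNIV U (\<lambda>y. res_momentum j i y)" for i
  proof -
    obtain I \<rho> a where i: "i = (I, \<rho>, a)" by (cases i) auto
    show ?thesis unfolding i res_momentum_def prod.case by (intro smooth_if smooth_res[OF U js] smooth_const)
  qed
  obtain \<sigma> where s: "smooth_section B (Phase B k) N' \<sigma>" "\<And>x. x \<in> N' \<Longrightarrow> left (\<sigma> x) = jet B (k - 1) f x"
    "\<And>x i. x \<in> N' \<Longrightarrow> snd (\<sigma> x) C (Inr i) = res_momentum j i (bcoord C x)"
  proof (rule phase_section[where p = "\<lambda>y i. res_momentum j i y", OF f' Ca(1)])
    show "smooth_fun UNIV (bcoord C ` N') (\<lambda>y. res_momentum j i y)" for i using ps[of i] unfolding U_def .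
    show "res_momentum j (I, \<rho>, a) y = 0" if "size I \<ge> k" for y I \<rho> a using that by (simp add: res_momentum_def)
  qed (rule fC, assumption, blast)
  have "same_leaf B k `` {jet1 B \<sigma> y} \<in> delta_graph B k L" if y: "y \<in> N'" for y
  proof -
    have h: "jet1 B \<sigma> y \<in> HolPhase B k" "kjet B k (jet1 B \<sigma> y) = jet B k f y"
      by (rule jet1_HolPhase[OF f' s(1) y y s(2)], assumption)+
    have yU: "bcoord C y \<in> U" using y by (simp add: U_def)
    have bx: "bpt C (bcoord C y) = y" by (rule section_coord(2)[OF f' Ca(1) y fC[OF y]])
    have fs: "fst (\<sigma> y) = f y" using arg_cong[OF s(2)[OF y], of fst] by simp
    have ar: "around B C (fst (\<sigma> y))" using fC[OF y] Ca(1) fs by (simp add: around_def)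
    have ar': "around B C (fst (jet1 B \<sigma> y))" using ar by (simp add: jet1_def)
    have sp: "snd (\<sigma> (bpt C z)) C (Inr i) = res_momentum j i z" if "z \<in> U" for z i
      using s(3)[of "bpt C z" i] bU[OF that] by simp
    have "current k (jet1 B \<sigma> y) C i = dlag C i (jcoord B C (jet B k f y))" for i
    proof (cases i)
      case (Pair I a)
      show ?thesis
      proof (cases "size I \<le> k")
        case True
        have "current k (jet1 B \<sigma> y) C (I, a) =
            (if size I \<ge> 1 then symmetrised (\<lambda>i. res_momentum j i (bcoord C y)) (I, a) else 0) +
            (if size I < k then \<Sum>\<rho>\<in>UNIV. pd \<rho> (res_momentum j (I, \<rho>, a)) (bcoord C y) else 0)"
          by (rule current_jet1[where \<sigma> = \<sigma> and x = y, OF ar U yU bx sp True])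
        then have "current k (jet1 B \<sigma> y) C (I, a) = j (I, a) (bcoord C y)"
          unfolding res_momentum_current[OF True] using r0[OF yU] by simp
        then show ?thesis by (simp add: j_def momenta_def bx Pair)
      next
        case False
        then show ?thesis by (simp add: current_cur cur_outside dlag_def Pair)
      qed
    qed
    then show ?thesis unfolding delta_graph_iff[OF h(1) ar'] h(2) by blast
  qed
  with N' s(1,2) show ?thesis by (intro exI[of _ N'] exI[of _ \<sigma>] conjI ballI) assumption+
qed

end

theorem corollary2:
  fixes B :: "('x, 'e, 'n::finite, 'm::finite) fbundle"
    and F :: "'f set" and AF :: "('f, 'm) chart set"
    and k :: nat and L :: "('x, 'e, 'n, 'm) density"
  assumes "smooth_fibre_bundle B F AF"
    and "k \<ge> 1"
    and "lagrangian_density B k L"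
  shows "(\<forall>x\<in>bspace B. lagrangian_submanifold_at B k
            (inf_coords B k ` InfPhase B k) (inf_coords B k ` delta_graph B k L) x) \<and>
         generating_formula B k L (inf_coords B k ` delta_graph B k L) \<and>
         (\<forall>N f. local_section B N f \<longrightarrow>
            (euler_lagrange B k L N f \<longleftrightarrow>
              (\<forall>x\<in>N. \<exists>N' \<sigma>. x \<in> N' \<and> N' \<subseteq> N \<and> smooth_section B (Phase B k) N' \<sigma> \<and>
                 (\<forall>y\<in>N'. left (\<sigma> y) = jet B (k - 1) f y) \<and>
                 (\<forall>y\<in>N'. same_leaf B k `` {jet1 B \<sigma> y} \<in> delta_graph B k L))))"
proof -
  interpret lagrangian B k L
    using smooth_fibre_bundle_fibred[OF assms(1)] assms(2,3)
    by (intro lagrangian.intro phase.intro phase_axioms.intro lagrangian_axioms.intro)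
  show ?thesis
  proof (intro conjI ballI allI impI)
    show "lagrangian_submanifold_at B k (inf_coords B k ` InfPhase B k) \<D> x" for x
      unfolding inf_coords_InfPhase by (rule lagrangian_submanifold)
    show "generating_formula B k L \<D>" by (rule generating)
    fix N f assume f: "local_section B N f"
    let ?P = "\<lambda>x N' \<sigma>. x \<in> N' \<and> N' \<subseteq> N \<and> smooth_section B (Phase B k) N' \<sigma> \<and>
      (\<forall>y\<in>N'. left (\<sigma> y) = jet B (k - 1) f y) \<and> (\<forall>y\<in>N'. same_leaf B k `` {jet1 B \<sigma> y} \<in> delta_graph B k L)"
    show "euler_lagrange B k L N f \<longleftrightarrow> (\<forall>x\<in>N. \<exists>N' \<sigma>. ?P x N' \<sigma>)"
    proof
      assume el: "euler_lagrange B k L N f"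
      show "\<forall>x\<in>N. \<exists>N' \<sigma>. ?P x N' \<sigma>" by (rule ballI) (rule euler_lagrange_imp_solution[OF f el])
    next
      assume h: "\<forall>x\<in>N. \<exists>N' \<sigma>. ?P x N' \<sigma>"
      show "euler_lagrange B k L N f"
        unfolding euler_lagrange_momenta
      proof (intro ballI allI impI)
        fix x C a assume x: "x \<in> N" and C: "around B C (f x)"
        obtain N' \<sigma> where p: "?P x N' \<sigma>" using bspec[OF h x] by (elim exE) (rule that)
        show "(\<Sum>l\<le>k. (- 1) ^ l * (\<Sum>\<mu>s | length \<mu>s = l. pds \<mu>s (momenta C f (mset \<mu>s, a)) (bcoord C x))) = 0"
          using p by (elim conjE) (rule solution_imp_euler_lagrange[OF f _ _ _ _ _ C]; (assumption | erule bspec, assumption))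
      qed
    qed
  qed
qed

end
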